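(* Let $D \subset \mathbb{P}^n$ be a smooth divisor in the projective space $\mathbb{P}^n$ over $\mathbb{C}$, defined by a homogeneous polynomial $f$. Then $D$ is Torelli if and only if $f$ is not of Sebastiani--Thom type.
   Context: $\mathbb{P}^n$ denotes the $n$-dimensional projective space over $\mathbb{C}$. Sebastiani--Thom type: a homogeneous polynomial $f$ of degree $k$ in $n+1$ variables is of Sebastiani--Thom type if, for a choice of homogeneous coordinates $(x_0,\dots,x_n)$ of $\mathbb{P}^n$ (that is, after an invertible linear change of variables) and some integer $l$ with $0 \le l \le n-1$, it can be represented as a sum $f(x_0,\dots,x_n) = f_1(x_0,\dots,x_l) + f_2(x_{l+1},\dots,x_n)$. Logarithmic vector fields: for a divisor $D$ in $\mathbb{P}^n$, the sheaf $\mathcal{T}_{\mathbb{P}^n}(-\log D)$ of logarithmic vector fields along $D$ is the subsheaf of the tangent sheaf $\mathcal{T}_{\mathbb{P}^n}$ whose sections are the vector fields tangent to $D$, i.e. the vector fields $\theta$ such that $\theta(h) \in (h)$ for a local defining equation $h$ of $D$. Torelli: a smooth divisor $D$ in $\mathbb{P}^n$ is Torelli if the isomorphism class of $\mathcal{T}_{\mathbb{P}^n}(-\log D)$ as an $\mathcal{O}_{\mathbb{P}^n}$-module determines $D$ uniquely; that is, whenever $D'$ is a smooth divisor in $\mathbb{P}^n$ with $\mathcal{T}_{\mathbb{P}^n}(-\log D') \cong \mathcal{T}_{\mathbb{P}^n}(-\log D)$ as $\mathcal{O}_{\mathbb{P}^n}$-modules, one has $D' = D$.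
   Formalization: The statement is proved for n ≥ 2 and nonzero divisors (degree ≥ 1): on the projective line it fails, e.g. x⁴+x²y²+y⁴ is not of Sebastiani–Thom type, yet its four points are not Torelli; it also fails for the zero divisor. *)

theory Defs
  imports
    Complex_Main
    "HOL-Library.FuncSet"
    "HOL-Library.Poly_Mapping"
    "Jordan_Normal_Form.Matrix"
    "Jordan_Normal_Form.Missing_VectorSpace"
begin

section \<open>Polynomials\<close>

text \<open>A polynomial is a finitely supported map from exponent vectors to coefficients; the variable
  \<open>x\<^sub>i\<close> has index \<open>i\<close>, and polynomials in \<open>n + 1\<close> variables use the indices \<open>0, \<dots>, n\<close>.\<close>

type_synonym cpoly = "(nat \<Rightarrow>\<^sub>0 nat) \<Rightarrow>\<^sub>0 complex"

definition poly_vars :: "cpoly \<Rightarrow> nat set" where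
  "poly_vars f = (\<Union>m\<in>Poly_Mapping.keys f. Poly_Mapping.keys m)"

definition poly_eval :: "cpoly \<Rightarrow> complex vec \<Rightarrow> complex" where
  "poly_eval f v =
    (\<Sum>m\<in>Poly_Mapping.keys f.
      Poly_Mapping.lookup f m * (\<Prod>i\<in>Poly_Mapping.keys m. v $ i ^ Poly_Mapping.lookup m i))"

definition poly_partial :: "nat \<Rightarrow> cpoly \<Rightarrow> cpoly" where
  "poly_partial i f =
    (\<Sum>m\<in>Poly_Mapping.keys f.
      Poly_Mapping.single (m - Poly_Mapping.single i 1)
        (of_nat (Poly_Mapping.lookup m i) * Poly_Mapping.lookup f m))"

definition homogeneous :: "nat \<Rightarrow> nat \<Rightarrow> cpoly \<Rightarrow> bool" where
  "homogeneous n k f \<longleftrightarrow>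
    poly_vars f \<subseteq> {..n} \<and>
    (\<forall>m\<in>Poly_Mapping.keys f. (\<Sum>i\<in>Poly_Mapping.keys m. Poly_Mapping.lookup m i) = k)"

text \<open>The vector \<open>A *\<^sub>v v\<close> consists of the new homogeneous coordinates of the point with
  coordinates \<open>v\<close>. Equality of polynomials is expressed by equality of their values.\<close>

definition sebastiani_thom :: "nat \<Rightarrow> cpoly \<Rightarrow> bool" where
  "sebastiani_thom n f \<longleftrightarrow>
    (\<exists>A \<in> carrier_mat (Suc n) (Suc n). invertible_mat A \<and>
      (\<exists>l f1 f2. l < n \<and> poly_vars f1 \<subseteq> {0..l} \<and> poly_vars f2 \<subseteq> {Suc l..n} \<and>
        (\<forall>v \<in> carrier_vec (Suc n).
          poly_eval f v = poly_eval f1 (A *\<^sub>v v) + poly_eval f2 (A *\<^sub>v v))))"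


section \<open>Projective space and its structure sheaf\<close>

text \<open>A point is the set of all its homogeneous coordinate vectors.\<close>

type_synonym ppoint = "complex vec set"

definition proj_point :: "complex vec \<Rightarrow> ppoint" where
  "proj_point v = {c \<cdot>\<^sub>v v | c. c \<noteq> 0}"

definition proj_space :: "nat \<Rightarrow> ppoint set" where
  "proj_space n = proj_point ` (carrier_vec (Suc n) - {0\<^sub>v (Suc n)})"

definition proj_zeros :: "nat \<Rightarrow> cpoly \<Rightarrow> ppoint set" where
  "proj_zeros n f = {p \<in> proj_space n. \<forall>v\<in>p. poly_eval f v = 0}"

definition zariski_open :: "nat \<Rightarrow> ppoint set \<Rightarrow> bool" where
  "zariski_open n U \<longleftrightarrow>
    (\<exists>F. (\<forall>f\<in>F. \<exists>k. homogeneous n k f) \<and> U = proj_space n - (\<Inter>f\<in>F. proj_zeros n f))"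

definition opens_in :: "nat \<Rightarrow> ppoint set \<Rightarrow> ppoint set set" where
  "opens_in n U = {V. zariski_open n V \<and> V \<subseteq> U}"

text \<open>Functions on \<open>U\<close> are extensional, so that equality in \<open>regular n U\<close> is equality on \<open>U\<close>.\<close>

definition regular :: "nat \<Rightarrow> ppoint set \<Rightarrow> (ppoint \<Rightarrow> complex) set" where
  "regular n U = {s \<in> extensional U.
    \<forall>p\<in>U. \<exists>W\<in>opens_in n U. p \<in> W \<and>
      (\<exists>d g h. homogeneous n d g \<and> homogeneous n d h \<and>
        (\<forall>q\<in>W. \<forall>v\<in>q. poly_eval h v \<noteq> 0 \<and> s q = poly_eval g v / poly_eval h v))}"

definition structure_ring :: "nat \<Rightarrow> ppoint set \<Rightarrow> (ppoint \<Rightarrow> complex) ring" where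
  "structure_ring n U =
    \<lparr>carrier = regular n U,
     mult = (\<lambda>s t. \<lambda>p\<in>U. s p * t p), one = (\<lambda>p\<in>U. 1),
     zero = (\<lambda>p\<in>U. 0), add = (\<lambda>s t. \<lambda>p\<in>U. s p + t p)\<rparr>"


section \<open>Smooth divisors\<close>

text \<open>Jacobian criterion: the gradient of \<open>f\<close> vanishes at no zero of \<open>f\<close>.\<close>

definition nonsingular :: "nat \<Rightarrow> cpoly \<Rightarrow> bool" where
  "nonsingular n f \<longleftrightarrow>
    (\<forall>v \<in> carrier_vec (Suc n) - {0\<^sub>v (Suc n)}.
      poly_eval f v = 0 \<longrightarrow> (\<exists>i\<le>n. poly_eval (poly_partial i f) v \<noteq> 0))"

text \<open>A smooth divisor is reduced, so it is identified with the set of its points. The degree is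
  positive, which excludes the zero divisor.\<close>

definition smooth_divisor_of :: "nat \<Rightarrow> ppoint set \<Rightarrow> cpoly \<Rightarrow> bool" where
  "smooth_divisor_of n D f \<longleftrightarrow>
    (\<exists>k\<ge>1. homogeneous n k f) \<and> nonsingular n f \<and> D = proj_zeros n f"

definition smooth_divisor :: "nat \<Rightarrow> ppoint set \<Rightarrow> bool" where
  "smooth_divisor n D \<longleftrightarrow> (\<exists>f. smooth_divisor_of n D f)"

text \<open>\<open>h\<close> generates over \<open>V\<close> the ideal sheaf of the reduced divisor \<open>D\<close>.\<close>

definition local_equation ::
    "nat \<Rightarrow> ppoint set \<Rightarrow> ppoint set \<Rightarrow> (ppoint \<Rightarrow> complex) \<Rightarrow> bool" where
  "local_equation n D V h \<longleftrightarrow> h \<in> regular n V \<and>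
    (\<forall>W\<in>opens_in n V. \<forall>g\<in>regular n W.
      (\<forall>p\<in>W \<inter> D. g p = 0) \<longleftrightarrow> (\<exists>a\<in>regular n W. g = (\<lambda>p\<in>W. a p * h p)))"


section \<open>Vector fields\<close>

text \<open>A vector field on \<open>U\<close> is a \<open>\<complex>\<close>-linear derivation of the sheaf of rings \<open>\<O>\<^bsub>U\<^esub>\<close>, that is, a
  family of derivations of the rings \<open>\<O>(V)\<close> for the open subsets \<open>V\<close> of \<open>U\<close>, compatible with
  restriction.\<close>

type_synonym vfield = "ppoint set \<Rightarrow> (ppoint \<Rightarrow> complex) \<Rightarrow> (ppoint \<Rightarrow> complex)"

definition tangent_sections :: "nat \<Rightarrow> ppoint set \<Rightarrow> vfield set" where
  "tangent_sections n U = {\<theta> \<in> (\<Pi>\<^sub>E V\<in>opens_in n U. regular n V \<rightarrow>\<^sub>E regular n V).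
    (\<forall>V\<in>opens_in n U. \<forall>s\<in>regular n V. \<forall>t\<in>regular n V.
      \<theta> V (\<lambda>p\<in>V. s p + t p) = (\<lambda>p\<in>V. \<theta> V s p + \<theta> V t p) \<and>
      \<theta> V (\<lambda>p\<in>V. s p * t p) = (\<lambda>p\<in>V. s p * \<theta> V t p + t p * \<theta> V s p)) \<and>
    (\<forall>V\<in>opens_in n U. \<forall>s\<in>regular n V. \<forall>c.
      \<theta> V (\<lambda>p\<in>V. c * s p) = (\<lambda>p\<in>V. c * \<theta> V s p)) \<and>
    (\<forall>V\<in>opens_in n U. \<forall>W\<in>opens_in n V. \<forall>s\<in>regular n V.
      \<theta> W (restrict s W) = restrict (\<theta> V s) W)}"

definition vfield_restrict :: "nat \<Rightarrow> ppoint set \<Rightarrow> vfield \<Rightarrow> vfield" where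
  "vfield_restrict n W \<theta> = restrict \<theta> (opens_in n W)"

definition log_sections :: "nat \<Rightarrow> ppoint set \<Rightarrow> ppoint set \<Rightarrow> vfield set" where
  "log_sections n D U = {\<theta> \<in> tangent_sections n U.
    \<forall>V\<in>opens_in n U. \<forall>h. local_equation n D V h \<longrightarrow>
      (\<exists>a\<in>regular n V. \<theta> V h = (\<lambda>p\<in>V. a p * h p))}"

text \<open>The module of sections over \<open>U\<close> of the sheaf of vector fields logarithmic along \<open>D\<close>;
  multiplication and unit of the record play no role in a module.\<close>

definition log_module ::
    "nat \<Rightarrow> ppoint set \<Rightarrow> ppoint set \<Rightarrow> (ppoint \<Rightarrow> complex, vfield) module" where
  "log_module n D U =
    \<lparr>carrier = log_sections n D U, mult = undefined, one = undefined,
     zero = (\<lambda>V\<in>opens_in n U. \<lambda>s\<in>regular n V. \<lambda>p\<in>V. 0),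
     add = (\<lambda>\<theta> \<eta>. \<lambda>V\<in>opens_in n U. \<lambda>s\<in>regular n V. \<lambda>p\<in>V. \<theta> V s p + \<eta> V s p),
     smult = (\<lambda>a \<theta>. \<lambda>V\<in>opens_in n U. \<lambda>s\<in>regular n V. \<lambda>p\<in>V. a p * \<theta> V s p)\<rparr>"

text \<open>Isomorphism, as sheaves of modules over the structure sheaf, of the logarithmic sheaves of
  \<open>D\<close> and \<open>D'\<close>.\<close>

definition log_sheaf_iso :: "nat \<Rightarrow> ppoint set \<Rightarrow> ppoint set \<Rightarrow> bool" where
  "log_sheaf_iso n D D' \<longleftrightarrow> (\<exists>\<phi>.
    (\<forall>U. zariski_open n U \<longrightarrow>
      \<phi> U \<in> module_hom (structure_ring n U) (log_module n D U) (log_module n D' U) \<and>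
      bij_betw (\<phi> U) (log_sections n D U) (log_sections n D' U)) \<and>
    (\<forall>U. zariski_open n U \<longrightarrow> (\<forall>W\<in>opens_in n U. \<forall>\<theta>\<in>log_sections n D U.
      \<phi> W (vfield_restrict n W \<theta>) = vfield_restrict n W (\<phi> U \<theta>))))"

definition torelli :: "nat \<Rightarrow> ppoint set \<Rightarrow> bool" where
  "torelli n D \<longleftrightarrow>
    (\<forall>D'. smooth_divisor n D' \<and> log_sheaf_iso n D' D \<longrightarrow> D' = D)"

end

theory Submission
 imports Defs
  "HOL-Computational_Algebra.Fundamental_Theorem_Algebra"
  "HOL-Analysis.Continuum_Not_Denumerable"
  "HOL-Library.Indicator_Function"
  "Jordan_Normal_Form.Jordan_Normal_Form_Existence"
begin

text \<open>
 Why the theorem holds. On the cone over an open set \<open>U\<close>, a vector field on \<open>U\<close> is a vector function \<open>a\<close> that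
 is homogeneous of degree one, acting by directional derivatives, and \<open>a\<close> is determined up to multiples of the
 Euler field \<open>v\<close>. The field is tangent to \<open>D = V(f)\<close> iff \<open>\<nabla>f \<bullet> a\<close> is a multiple of \<open>f\<close>; since
 \<open>\<nabla>f(v) \<bullet> v = k f(v)\<close>, exactly one representative satisfies \<open>\<nabla>f \<bullet> a = 0\<close> (\<open>bij_fields\<close>). So the logarithmic
 sheaf is the kernel of \<open>\<nabla>f\<close> on the vector functions of degree one, and only the gradient of \<open>f\<close> matters.

 If \<open>f(x) = f(Ex) + f((1 - E)x)\<close> for a projection \<open>E \<noteq> 0, 1\<close>, which is a coordinate-free form of Sebastiani--Thom
 type, then \<open>g(x) = f(Ex) + 2 f((1 - E)x)\<close> has a gradient that differs from \<open>\<nabla>f\<close> by an invertible constant matrix.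
 The two kernels are isomorphic, while the zero sets differ (\<open>splits_not_torelli\<close>). Degree one is treated apart,
 because there one summand can vanish.

 Conversely, let \<open>\<Phi>\<close> be an isomorphism of the logarithmic sheaves of \<open>V(f)\<close> and \<open>V(g)\<close>. As the partial derivatives
 of \<open>f\<close> have no common zero, the kernel of \<open>\<nabla>f\<close> is generated over each chart \<open>x\<^sub>i \<noteq> 0\<close> by an explicit frame, so \<open>\<Phi>\<close>
 is given there by a matrix of rational functions. The matrices of two charts differ by a multiple of \<open>\<nabla>f\<close>. On
 three charts, available since \<open>n \<ge> 2\<close>, these multiples form a cocycle, and it splits for degree reasons; this is
 the vanishing of a first cohomology group of a line bundle, carried out on monomials. Hence \<open>\<Phi>\<close> is given by a
 constant matrix \<open>A\<close>, and \<open>A \<nabla>g = c \<nabla>f\<close> with a constant \<open>c \<noteq> 0\<close> (\<open>gradients_linearly_related\<close>).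

 Symmetry of second derivatives now says that the transpose \<open>U\<close> of \<open>A\<close> is self-adjoint for the Hessian form of \<open>g\<close>
 at every point. In a Jordan basis of \<open>U\<close>, generalized eigenspaces of distinct eigenvalues are orthogonal for
 all these forms, so two distinct eigenvalues give a splitting of \<open>g\<close>. If \<open>U\<close> has one eigenvalue and is not scalar,
 some vector is isotropic for all Hessian forms, and then \<open>V(g)\<close> is singular at this vector when the degree is at
 least three. So \<open>U\<close> is scalar and \<open>V(f) = V(g)\<close> by Euler's identity (\<open>zeros_determined_by_sheaf\<close>). Forms of degree at
 most two are always of Sebastiani--Thom type, by the same eigenvalue argument for a matrix of rank one.
\<close>

section \<open>Polynomials and their values\<close>

abbreviation lkp :: "('a \<Rightarrow>\<^sub>0 'b::zero) \<Rightarrow> 'a \<Rightarrow> 'b" where "lkp \<equiv> Poly_Mapping.lookup"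
abbreviation supp :: "('a \<Rightarrow>\<^sub>0 'b::zero) \<Rightarrow> 'a set" where "supp \<equiv> Poly_Mapping.keys"
abbreviation mono1 :: "nat \<Rightarrow> (nat \<Rightarrow>\<^sub>0 nat)" where "mono1 i \<equiv> Poly_Mapping.single i (Suc 0)"
abbreviation Const :: "complex \<Rightarrow> cpoly" where "Const c \<equiv> Poly_Mapping.single 0 c"
abbreviation Var :: "nat \<Rightarrow> cpoly" where "Var i \<equiv> Poly_Mapping.single (mono1 i) 1"
abbreviation ev :: "cpoly \<Rightarrow> complex vec \<Rightarrow> complex" where "ev \<equiv> poly_eval"
abbreviation zvec :: "nat \<Rightarrow> complex vec" where "zvec n \<equiv> 0\<^sub>v (Suc n)"
abbreviation carr :: "nat \<Rightarrow> complex vec set" where "carr n \<equiv> carrier_vec (Suc n)"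

definition mon :: "(nat \<Rightarrow>\<^sub>0 nat) \<Rightarrow> complex vec \<Rightarrow> complex" where
 "mon m v = (\<Prod>i\<in>supp m. v $ i ^ lkp m i)"

definition mdeg :: "(nat \<Rightarrow>\<^sub>0 nat) \<Rightarrow> nat" where
 "mdeg m = (\<Sum>i\<in>supp m. lkp m i)"

lemma mon_superset:
 assumes "finite A" "supp m \<subseteq> A"
 shows "mon m v = (\<Prod>i\<in>A. v $ i ^ lkp m i)"
 unfolding mon_def using assms
 by (intro prod.mono_neutral_left) (auto simp: in_keys_iff)

lemma mdeg_superset:
 assumes "finite A" "supp m \<subseteq> A"
 shows "mdeg m = (\<Sum>i\<in>A. lkp m i)"
 unfolding mdeg_def using assms
 by (intro sum.mono_neutral_left) (auto simp: in_keys_iff)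

lemma mon_add: "mon (m + m') v = mon m v * mon m' v"
proof -
 let ?A = "supp m \<union> supp m'"
 have "supp (m + m') \<subseteq> ?A" by (rule Poly_Mapping.keys_add)
 then show ?thesis
  by (simp add: mon_superset[of ?A] lookup_add power_add prod.distrib)
qed

lemma mdeg_add: "mdeg (m + m') = mdeg m + mdeg m'"
proof -
 let ?A = "supp m \<union> supp m'"
 have "supp (m + m') \<subseteq> ?A" by (rule Poly_Mapping.keys_add)
 then show ?thesis
  by (simp add: mdeg_superset[of ?A] lookup_add sum.distrib)
qed

lemma mon_0 [simp]: "mon 0 v = 1" by (simp add: mon_def)
lemma mdeg_0 [simp]: "mdeg 0 = 0" by (simp add: mdeg_def)
lemma mon_mono1 [simp]: "mon (mono1 i) v = v $ i" by (simp add: mon_def)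
lemma mdeg_mono1 [simp]: "mdeg (mono1 i) = 1" by (simp add: mdeg_def)

lemma mdeg_eq_0_iff: "mdeg m = 0 \<longleftrightarrow> m = 0"
 by (auto simp: mdeg_def in_keys_iff intro!: poly_mapping_eqI)

lemma split_off_variable:
 assumes "lkp m i \<noteq> 0"
 shows "m = mono1 i + (m - mono1 i)"
 using assms by (intro poly_mapping_eqI) (auto simp: lookup_add lookup_minus lookup_single when_def)

lemma supp_add_nat: "supp ((m::nat \<Rightarrow>\<^sub>0 nat) + m') = supp m \<union> supp m'"
 by (auto simp: in_keys_iff lookup_add)

lemma monomial_induct [consumes 1, case_names zero var]:
 assumes "supp m \<subseteq> A"
  and "P 0"
  and "\<And>i m. i \<in> A \<Longrightarrow> supp m \<subseteq> A \<Longrightarrow> P m \<Longrightarrow> P (mono1 i + m)"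
 shows "P m"
 using assms(1)
proof (induction "mdeg m" arbitrary: m)
 case 0
 then show ?case using assms(2) by (simp add: mdeg_eq_0_iff)
next
 case (Suc d)
 then have "m \<noteq> 0" by auto
 then obtain i where i: "lkp m i \<noteq> 0" using poly_mapping_eqI[of m 0] by auto
 define m' where "m' = m - mono1 i"
 have m: "m = mono1 i + m'" unfolding m'_def by (rule split_off_variable[OF i])
 have "supp m' \<subseteq> A" "i \<in> A" using Suc.prems by (auto simp: m supp_add_nat)
 moreover have "mdeg m' = d" using Suc(2) by (simp add: m mdeg_add)
 ultimately show ?case unfolding m using Suc(1) assms(3) by blast
qed

lemma poly_eval_superset:
 assumes "finite A" "supp p \<subseteq> A"
 shows "ev p v = (\<Sum>m\<in>A. lkp p m * mon m v)"
 unfolding poly_eval_def mon_def[symmetric] using assms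
 by (intro sum.mono_neutral_left) (auto simp: in_keys_iff)

lemma poly_eval_mon: "ev p v = (\<Sum>m\<in>supp p. lkp p m * mon m v)"
 by (rule poly_eval_superset) auto

lemma poly_eval_0 [simp]: "ev 0 v = 0" by (simp add: poly_eval_mon)

lemma poly_eval_add [simp]: "ev (p + q) v = ev p v + ev q v"
proof -
 let ?A = "supp p \<union> supp q"
 have "supp (p + q) \<subseteq> ?A" by (rule Poly_Mapping.keys_add)
 then show ?thesis
  by (simp add: poly_eval_superset[of ?A] lookup_add sum.distrib algebra_simps)
qed

lemma poly_eval_sum [simp]: "ev (sum f A) v = (\<Sum>a\<in>A. ev (f a) v)"
 by (induction A rule: infinite_finite_induct) auto

lemma poly_eval_single [simp]: "ev (Poly_Mapping.single m c) v = c * mon m v"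
 by (cases "c = 0") (auto simp: poly_eval_mon)

lemma cpoly_expand: "p = (\<Sum>m\<in>supp p. Poly_Mapping.single m (lkp p m))"
 by (rule poly_mapping_eqI)
  (auto simp: lookup_sum lookup_single when_def in_keys_iff)

lemma poly_eval_mult [simp]: "ev (p * q) v = ev p v * ev q v"
proof -
 have "p * q = (\<Sum>m\<in>supp p. \<Sum>m'\<in>supp q. Poly_Mapping.single (m + m') (lkp p m * lkp q m'))"
  by (subst cpoly_expand[of p], subst cpoly_expand[of q]) (simp add: sum_product mult_single)
 then show ?thesis
  by (simp add: poly_eval_mon[of p] poly_eval_mon[of q] sum_product mon_add algebra_simps)
qed

lemma poly_eval_uminus [simp]: "ev (- p) v = - ev p v"
proof -
 have "ev (- p) v + ev p v = ev (- p + p) v" by (simp only: poly_eval_add)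
 then show ?thesis by (simp add: eq_neg_iff_add_eq_0)
qed

lemma poly_eval_diff [simp]: "ev (p - q) v = ev p v - ev q v"
 using poly_eval_add[of p "- q" v] by simp

lemma poly_eval_1 [simp]: "ev 1 v = 1"
 using poly_eval_single[of 0 1 v] by (simp del: poly_eval_single) 

lemma poly_eval_power [simp]: "ev (p ^ k) v = ev p v ^ k"
 by (induction k) auto

lemma poly_eval_prod [simp]: "ev (prod f A) v = (\<Prod>a\<in>A. ev (f a) v)"
 by (induction A rule: infinite_finite_induct) auto

definition polys :: "nat \<Rightarrow> cpoly set" where
 "polys n = {p. poly_vars p \<subseteq> {..n}}"

lemma polys_iff: "p \<in> polys n \<longleftrightarrow> (\<forall>m\<in>supp p. supp m \<subseteq> {..n})"
 by (auto simp: polys_def poly_vars_def)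

lemma polys_0 [simp]: "0 \<in> polys n" by (simp add: polys_iff)
lemma polys_single: "supp m \<subseteq> {..n} \<Longrightarrow> Poly_Mapping.single m c \<in> polys n"
 by (auto simp: polys_iff split: if_splits)
lemma polys_Const [simp]: "Const c \<in> polys n" by (simp add: polys_single)
lemma polys_1 [simp]: "1 \<in> polys n" using polys_Const[of 1 n] by (simp del: polys_Const)
lemma polys_Var [simp]: "i \<le> n \<Longrightarrow> Var i \<in> polys n" by (simp add: polys_single)
lemma polys_add [intro]: "p \<in> polys n \<Longrightarrow> q \<in> polys n \<Longrightarrow> p + q \<in> polys n"
 using Poly_Mapping.keys_add[of p q] by (fastforce simp: polys_iff)
lemma polys_mult [intro]: "p \<in> polys n \<Longrightarrow> q \<in> polys n \<Longrightarrow> p * q \<in> polys n"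
 using keys_mult[of p q] by (fastforce simp: polys_iff supp_add_nat)
lemma polys_sum [intro]: "(\<And>a. a \<in> A \<Longrightarrow> f a \<in> polys n) \<Longrightarrow> sum f A \<in> polys n"
 by (induction A rule: infinite_finite_induct) auto
lemma polys_uminus [intro]: "p \<in> polys n \<Longrightarrow> - p \<in> polys n"
 by (auto simp: polys_iff)
lemma polys_diff [intro]: "p \<in> polys n \<Longrightarrow> q \<in> polys n \<Longrightarrow> p - q \<in> polys n"
 using polys_add[of p n "- q"] by (auto)
lemma polys_power [intro]: "p \<in> polys n \<Longrightarrow> p ^ k \<in> polys n"
 by (induction k) auto

text \<open>Polynomials in \<open>n + 1\<close> variables form the algebra generated by the variables, which is how most closure
 properties below are proved.\<close>

lemma polys_induct [consumes 1, case_names Const Var add mult]: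
 assumes "p \<in> polys n"
  and C: "\<And>c. P (Const c)"
  and V: "\<And>i. i \<le> n \<Longrightarrow> P (Var i)"
  and A: "\<And>p q. p \<in> polys n \<Longrightarrow> q \<in> polys n \<Longrightarrow> P p \<Longrightarrow> P q \<Longrightarrow> P (p + q)"
  and M: "\<And>p q. p \<in> polys n \<Longrightarrow> q \<in> polys n \<Longrightarrow> P p \<Longrightarrow> P q \<Longrightarrow> P (p * q)"
 shows "P p"
proof -
 have single: "P (Poly_Mapping.single m c)" if "supp m \<subseteq> {..n}" for m c
  using that
 proof (induction m rule: monomial_induct)
  case zero then show ?case by (rule C)
 next
  case (var i m)
  have "Poly_Mapping.single (mono1 i + m) c = Var i * Poly_Mapping.single m c"
   by (simp add: mult_single)
  then show ?case using M[of "Var i" "Poly_Mapping.single m c"] V var by (auto simp: polys_single)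
 qed
 have "P (\<Sum>m\<in>B. Poly_Mapping.single m (lkp p m))" if "finite B" "B \<subseteq> supp p" for B
  using that
 proof (induction B)
  case empty then show ?case using C[of 0] by simp
 next
  case (insert m B)
  have s: "supp m' \<subseteq> {..n}" if "m' \<in> supp p" for m' using assms(1) that by (auto simp: polys_iff)
  show ?case
   using insert single s A[of "Poly_Mapping.single m (lkp p m)" "\<Sum>m\<in>B. Poly_Mapping.single m (lkp p m)"]
   by (auto intro!: polys_single polys_sum)
 qed
 from this[of "supp p"] show ?thesis using cpoly_expand[of p] by simp
qed

lemma homogeneous_iff: "homogeneous n k p \<longleftrightarrow> (\<forall>m\<in>supp p. supp m \<subseteq> {..n} \<and> mdeg m = k)"
 by (auto simp: homogeneous_def poly_vars_def mdeg_def)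

lemma homogeneous_polys: "homogeneous n k p \<Longrightarrow> p \<in> polys n"
 by (auto simp: homogeneous_iff polys_iff)
lemma homogeneous_0 [simp]: "homogeneous n k 0" by (simp add: homogeneous_iff)
lemma homogeneous_Const [simp]: "homogeneous n 0 (Const c)" by (simp add: homogeneous_iff)
lemma homogeneous_1 [simp]: "homogeneous n 0 1" by (simp add: homogeneous_iff)
lemma homogeneous_Var [simp]: "i \<le> n \<Longrightarrow> homogeneous n 1 (Var i)" by (simp add: homogeneous_iff)
lemma homogeneous_single: "supp m \<subseteq> {..n} \<Longrightarrow> mdeg m = k \<Longrightarrow> homogeneous n k (Poly_Mapping.single m c)"
 by (auto simp: homogeneous_iff split: if_splits)
lemma homogeneous_add: "homogeneous n k p \<Longrightarrow> homogeneous n k q \<Longrightarrow> homogeneous n k (p + q)"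
 using Poly_Mapping.keys_add[of p q] by (fastforce simp: homogeneous_iff)
lemma homogeneous_uminus: "homogeneous n k p \<Longrightarrow> homogeneous n k (- p)"
 by (auto simp: homogeneous_iff)
lemma homogeneous_diff: "homogeneous n k p \<Longrightarrow> homogeneous n k q \<Longrightarrow> homogeneous n k (p - q)"
 using homogeneous_add[of n k p "- q"] homogeneous_uminus by auto
lemma homogeneous_sum: "(\<And>a. a \<in> A \<Longrightarrow> homogeneous n k (f a)) \<Longrightarrow> homogeneous n k (sum f A)"
 by (induction A rule: infinite_finite_induct) (auto intro: homogeneous_add)
lemma homogeneous_mult:
 "homogeneous n k p \<Longrightarrow> homogeneous n l q \<Longrightarrow> homogeneous n (k + l) (p * q)"
 using keys_mult[of p q] by (fastforce simp: homogeneous_iff supp_add_nat mdeg_add)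
lemma homogeneous_power: "homogeneous n k p \<Longrightarrow> homogeneous n (k * l) (p ^ l)"
 by (induction l) (auto intro: homogeneous_mult)
lemma homogeneous_Const_mult: "homogeneous n k p \<Longrightarrow> homogeneous n k (Const c * p)"
 using homogeneous_mult[of n 0 "Const c" k p] by simp

definition hcomp :: "nat \<Rightarrow> cpoly \<Rightarrow> cpoly" where
 "hcomp d p = (\<Sum>m\<in>{m\<in>supp p. mdeg m = d}. Poly_Mapping.single m (lkp p m))"

lemma lookup_hcomp: "lkp (hcomp d p) m = (if mdeg m = d then lkp p m else 0)"
 by (auto simp: hcomp_def lookup_sum lookup_single when_def in_keys_iff)

lemma hcomp_add: "hcomp d (p + q) = hcomp d p + hcomp d q"
 by (rule poly_mapping_eqI) (simp add: lookup_hcomp lookup_add)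
lemma hcomp_0 [simp]: "hcomp d 0 = 0"
 by (rule poly_mapping_eqI) (simp add: lookup_hcomp)
lemma hcomp_sum: "hcomp d (sum f A) = (\<Sum>a\<in>A. hcomp d (f a))"
 by (induction A rule: infinite_finite_induct) (auto simp: hcomp_add)

lemma hcomp_single: "hcomp d (Poly_Mapping.single m c) = (if mdeg m = d then Poly_Mapping.single m c else 0)"
 by (rule poly_mapping_eqI) (auto simp: lookup_hcomp lookup_single when_def)

lemma homogeneous_hcomp: "p \<in> polys n \<Longrightarrow> homogeneous n d (hcomp d p)"
 by (auto simp: homogeneous_iff polys_iff in_keys_iff lookup_hcomp split: if_splits)

lemma hcomp_homogeneous: "homogeneous n k p \<Longrightarrow> hcomp d p = (if d = k then p else 0)"
 by (rule poly_mapping_eqI) (auto simp: lookup_hcomp homogeneous_iff in_keys_iff)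

lemma hcomp_mult_homogeneous:
 assumes "homogeneous n k q"
 shows "hcomp (d + k) (p * q) = hcomp d p * q"
proof -
 have "hcomp (d + k) (Poly_Mapping.single m c * q) = hcomp d (Poly_Mapping.single m c) * q" for m c
 proof -
  have "Poly_Mapping.single m c * q = (\<Sum>m'\<in>supp q. Poly_Mapping.single (m + m') (c * lkp q m'))"
   by (subst cpoly_expand[of q]) (simp add: sum_distrib_left mult_single)
  moreover from this have "hcomp (d + k) (Poly_Mapping.single m c * q) =
    (\<Sum>m'\<in>supp q. if mdeg m = d then Poly_Mapping.single (m + m') (c * lkp q m') else 0)"
   using assms by (auto simp: hcomp_sum hcomp_single mdeg_add homogeneous_iff intro!: sum.cong)
  ultimately show ?thesis by (simp add: hcomp_single)
 qed
 then show ?thesis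
  by (subst (1 2) cpoly_expand[of p]) (simp add: hcomp_sum sum_distrib_right)
qed

lemma mon_smult: "supp m \<subseteq> {..n} \<Longrightarrow> v \<in> carr n \<Longrightarrow> mon m (t \<cdot>\<^sub>v v) = t ^ mdeg m * mon m v"
 by (induction m rule: monomial_induct) (auto simp: mon_add mdeg_add)

lemma homogeneous_eval:
 assumes "homogeneous n k p" "v \<in> carr n"
 shows "ev p (t \<cdot>\<^sub>v v) = t ^ k * ev p v"
proof -
 have "lkp p m * mon m (t \<cdot>\<^sub>v v) = t ^ k * (lkp p m * mon m v)" if "m \<in> supp p" for m
  using assms that by (subst mon_smult[of _ n]) (auto simp: homogeneous_iff)
 then show ?thesis unfolding poly_eval_mon sum_distrib_left by (rule sum.cong[OF refl])
qed

section \<open>Partial derivatives\<close>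

lemma lookup_poly_partial:
 "lkp (poly_partial i p) m = of_nat (lkp m i + 1) * lkp p (mono1 i + m)"
proof -
 have eq: "(m' - mono1 i = m \<and> lkp m' i \<noteq> 0) \<longleftrightarrow> m' = mono1 i + m" for m'
  using split_off_variable[of m' i] by (auto simp: lookup_add)
 have "lkp (poly_partial i p) m = (\<Sum>m'\<in>supp p. (of_nat (lkp m' i) * lkp p m') when m' - mono1 i = m)"
  by (simp add: poly_partial_def lookup_sum lookup_single)
 also have "\<dots> = (\<Sum>m'\<in>supp p. if m' = mono1 i + m then of_nat (lkp m' i) * lkp p m' else 0)"
  by (rule sum.cong[OF refl]) (simp only: when_def eq[symmetric], simp)
 also have "\<dots> = of_nat (lkp m i + 1) * lkp p (mono1 i + m)"
  by (auto simp: in_keys_iff lookup_add)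
 finally show ?thesis .
qed

lemma poly_partial_add: "poly_partial i (p + q) = poly_partial i p + poly_partial i q"
 by (rule poly_mapping_eqI) (simp add: lookup_poly_partial lookup_add algebra_simps)
lemma poly_partial_0 [simp]: "poly_partial i 0 = 0"
 by (rule poly_mapping_eqI) (simp add: lookup_poly_partial)
lemma poly_partial_sum: "poly_partial i (sum f A) = (\<Sum>a\<in>A. poly_partial i (f a))"
 by (induction A rule: infinite_finite_induct) (auto simp: poly_partial_add)

lemma poly_partial_commute: "poly_partial i (poly_partial j p) = poly_partial j (poly_partial i p)"
 by (rule poly_mapping_eqI) (simp add: lookup_poly_partial lookup_add lookup_single when_def ac_simps)

lemma homogeneous_poly_partial:
 assumes "homogeneous n k p"
 shows "homogeneous n (k - 1) (poly_partial i p)"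
 unfolding homogeneous_iff
proof
 fix m assume "m \<in> supp (poly_partial i p)"
 then have "mono1 i + m \<in> supp p" by (auto simp: in_keys_iff lookup_poly_partial)
 then have "supp (mono1 i + m) \<subseteq> {..n}" "mdeg (mono1 i + m) = k"
  using assms by (auto simp: homogeneous_iff)
 then show "supp m \<subseteq> {..n} \<and> mdeg m = k - 1"
  by (auto simp: supp_add_nat mdeg_add)
qed

lemma polys_partial: "p \<in> polys n \<Longrightarrow> poly_partial i p \<in> polys n"
 unfolding polys_iff
proof
 fix m assume *: "\<forall>m\<in>supp p. supp m \<subseteq> {..n}" "m \<in> supp (poly_partial i p)"
 then have "mono1 i + m \<in> supp p" by (auto simp: in_keys_iff lookup_poly_partial)
 then have "supp (mono1 i + m) \<subseteq> {..n}" using * by blast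
 then show "supp m \<subseteq> {..n}" by (simp add: supp_add_nat)
qed

lemma poly_partial_Var_mult:
 "poly_partial i (Var j * p) = (if i = j then p else 0) + Var j * poly_partial i p"
proof -
 have s: "poly_partial i (Var j * Poly_Mapping.single m c) =
   (if i = j then Poly_Mapping.single m c else 0) + Var j * poly_partial i (Poly_Mapping.single m c)" for m c
 proof -
  have ps: "poly_partial i (Poly_Mapping.single m c) = Poly_Mapping.single (m - mono1 i) (of_nat (lkp m i) * c)" for m c
   by (cases "c = 0") (auto simp: poly_partial_def)
  show ?thesis
  proof (cases "lkp m i = 0")
   case True
   then show ?thesis by (auto simp: mult_single ps lookup_add lookup_single when_def)
  next
   case False
   have "mono1 j + m - mono1 i = mono1 j + (m - mono1 i)"
    using False by (intro poly_mapping_eqI) (auto simp: lookup_add lookup_minus lookup_single when_def)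
   moreover have "mono1 i + (m - mono1 i) = m" using split_off_variable[OF False] by simp
   ultimately show ?thesis
    by (auto simp: mult_single ps lookup_add lookup_single when_def single_add[symmetric] algebra_simps)
  qed
 qed
 have "poly_partial i (Var j * p) = (\<Sum>m\<in>supp p. poly_partial i (Var j * Poly_Mapping.single m (lkp p m)))"
  by (subst cpoly_expand[of p]) (simp only: sum_distrib_left poly_partial_sum)
 also have "\<dots> = (\<Sum>m\<in>supp p. (if i = j then Poly_Mapping.single m (lkp p m) else 0)
   + Var j * poly_partial i (Poly_Mapping.single m (lkp p m)))"
  by (simp only: s)
 also have "\<dots> = (if i = j then (\<Sum>m\<in>supp p. Poly_Mapping.single m (lkp p m)) else 0)
   + Var j * poly_partial i (\<Sum>m\<in>supp p. Poly_Mapping.single m (lkp p m))"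
  by (simp only: sum.distrib sum_distrib_left poly_partial_sum) simp
 finally show ?thesis by (simp only: cpoly_expand[symmetric])
qed

text \<open>This identifies the formal partial derivatives with analytic ones. Afterwards identities between
 gradients are obtained from uniqueness of derivatives along lines.\<close>

lemma poly_eval_has_derivative_line:
 assumes "p \<in> polys n" "v \<in> carr n" "w \<in> carr n"
 shows "((\<lambda>t. ev p (v + t \<cdot>\<^sub>v w)) has_field_derivative
   (\<Sum>i\<le>n. w $ i * ev (poly_partial i p) (v + x \<cdot>\<^sub>v w))) (at x)"
proof -
 have s: "((\<lambda>t. ev (Poly_Mapping.single m c) (v + t \<cdot>\<^sub>v w)) has_field_derivative
   (\<Sum>i\<le>n. w $ i * ev (poly_partial i (Poly_Mapping.single m c)) (v + x \<cdot>\<^sub>v w))) (at x)"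
  if "supp m \<subseteq> {..n}" for m c
  using that
 proof (induction m rule: monomial_induct)
  case zero
  have "poly_partial i (Poly_Mapping.single 0 c) = 0" for i
  proof -
   have "mono1 i + m \<noteq> 0" for m
   proof
    assume "mono1 i + m = 0"
    then have "lkp (mono1 i + m) i = 0" by (simp only: lookup_zero)
    then show False by (simp add: lookup_add)
   qed
   then show ?thesis
    by (intro poly_mapping_eqI) (auto simp: lookup_poly_partial lookup_single when_def)
  qed
  then show ?case by simp
 next
  case (var j m)
  have eq: "Poly_Mapping.single (mono1 j + m) c = Var j * Poly_Mapping.single m c"
   by (simp add: mult_single)
  have j: "j \<le> n" using var by simp
  have "((\<lambda>t. (v + t \<cdot>\<^sub>v w) $ j * ev (Poly_Mapping.single m c) (v + t \<cdot>\<^sub>v w)) has_field_derivative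
    (w $ j * ev (Poly_Mapping.single m c) (v + x \<cdot>\<^sub>v w)
    + (\<Sum>i\<le>n. w $ i * ev (poly_partial i (Poly_Mapping.single m c)) (v + x \<cdot>\<^sub>v w)) * (v + x \<cdot>\<^sub>v w) $ j)) (at x)"
  proof (rule DERIV_mult[OF _ var.IH])
   have "((\<lambda>t. v $ j + t * w $ j) has_field_derivative w $ j) (at x)"
    by (auto intro!: derivative_eq_intros)
   then show "((\<lambda>t. (v + t \<cdot>\<^sub>v w) $ j) has_field_derivative w $ j) (at x)"
    using j assms by simp
  qed
  moreover have "(\<Sum>i\<le>n. w $ i * ev (poly_partial i (Var j * Poly_Mapping.single m c)) u)
    = w $ j * ev (Poly_Mapping.single m c) u
    + (\<Sum>i\<le>n. w $ i * ev (poly_partial i (Poly_Mapping.single m c)) u) * u $ j" for u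
  proof -
   have "(\<Sum>i\<le>n. w $ i * ev (poly_partial i (Var j * Poly_Mapping.single m c)) u) =
    (\<Sum>i\<le>n. (if i = j then w $ j * ev (Poly_Mapping.single m c) u else 0)
     + w $ i * ev (poly_partial i (Poly_Mapping.single m c)) u * u $ j)"
    unfolding poly_partial_Var_mult by (rule sum.cong[OF refl]) (auto simp: algebra_simps)
   then show ?thesis using j by (simp add: sum.distrib sum_distrib_right)
  qed
  ultimately show ?case unfolding eq by (simp only: poly_eval_mult) simp
 qed
 have "((\<lambda>t. \<Sum>m\<in>supp p. ev (Poly_Mapping.single m (lkp p m)) (v + t \<cdot>\<^sub>v w)) has_field_derivative
   (\<Sum>m\<in>supp p. \<Sum>i\<le>n. w $ i * ev (poly_partial i (Poly_Mapping.single m (lkp p m))) (v + x \<cdot>\<^sub>v w))) (at x)"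
  using assms(1) by (intro DERIV_sum s) (auto simp: polys_iff)
 moreover have "(\<Sum>m\<in>supp p. \<Sum>i\<le>n. w $ i * ev (poly_partial i (Poly_Mapping.single m (lkp p m))) u)
   = (\<Sum>i\<le>n. w $ i * ev (poly_partial i p) u)" for u
  by (subst (3) cpoly_expand[of p], subst sum.swap) (simp add: poly_partial_sum sum_distrib_left)
 moreover have "(\<Sum>m\<in>supp p. ev (Poly_Mapping.single m (lkp p m)) u) = ev p u" for u
  by (subst (3) cpoly_expand[of p]) simp
 ultimately show ?thesis by simp
qed

section \<open>Polynomial functions\<close>

text \<open>The coefficient of a monomial is reached by induction: the value at the origin gives the constant term, and
 partial derivatives lower the degree.\<close>

lemma polys_eq_0I:
 assumes "p \<in> polys n" "\<And>v. v \<in> carr n \<Longrightarrow> ev p v = 0"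
 shows "p = 0"
proof -
 have "lkp p m = 0" if "supp m \<subseteq> {..n}" for m
  using that assms
 proof (induction m arbitrary: p rule: monomial_induct)
  case zero
  have "mon m (zvec n) = (if m = 0 then 1 else 0)" if "m \<in> supp p" for m
  proof -
   have "supp m \<subseteq> {..n}" using zero(1) that by (auto simp: polys_iff)
   then show ?thesis
   proof (induction m rule: monomial_induct)
    case (var i m)
    have "mono1 i + m \<noteq> 0"
    proof
     assume "mono1 i + m = 0"
     then have "lkp (mono1 i + m) i = 0" by (simp only: lookup_zero)
     then show False by (simp add: lookup_add)
    qed
    then show ?case using var by (simp add: mon_add del: One_nat_def)
   qed simp
  qed
  then have "ev p (zvec n) = (\<Sum>m\<in>supp p. if m = 0 then lkp p m else 0)"
   unfolding poly_eval_mon by (intro sum.cong) auto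
  also have "\<dots> = lkp p 0" by (auto simp: in_keys_iff)
  finally show ?case using zero(2) by simp
 next
  case (var i m)
  have "ev (poly_partial i p) v = 0" if v: "v \<in> carr n" for v
  proof -
   let ?w = "unit_vec (Suc n) i :: complex vec"
   have "((\<lambda>t. ev p (v + t \<cdot>\<^sub>v ?w)) has_field_derivative
    (\<Sum>j\<le>n. ?w $ j * ev (poly_partial j p) (v + 0 \<cdot>\<^sub>v ?w))) (at 0)"
    by (rule poly_eval_has_derivative_line) (use var v in auto)
   moreover have "(\<lambda>t. ev p (v + t \<cdot>\<^sub>v ?w)) = (\<lambda>t. 0)"
    using var.prems(2) v by (intro ext) auto
   ultimately have "(\<Sum>j\<le>n. ?w $ j * ev (poly_partial j p) (v + 0 \<cdot>\<^sub>v ?w)) = 0"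
    using DERIV_unique DERIV_const by metis
   moreover have "(\<Sum>j\<le>n. ?w $ j * ev (poly_partial j p) (v + 0 \<cdot>\<^sub>v ?w))
     = (\<Sum>j\<le>n. if j = i then ev (poly_partial j p) (v + 0 \<cdot>\<^sub>v ?w) else 0)"
    by (rule sum.cong[OF refl]) (use var in \<open>auto simp: unit_vec_def\<close>)
   moreover have "v + 0 \<cdot>\<^sub>v ?w = v" using v by (intro eq_vecI) auto
   ultimately show ?thesis using var by simp
  qed
  then have "lkp (poly_partial i p) m = 0"
   using var.IH polys_partial[OF var.prems(1)] by blast
  then show ?case by (simp add: lookup_poly_partial del: of_nat_Suc)
 qed
 moreover have "lkp p m = 0" if "\<not> supp m \<subseteq> {..n}" for m
  using assms(1) that by (auto simp: polys_iff in_keys_iff)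
 ultimately show ?thesis by (intro poly_mapping_eqI) (metis lookup_zero)
qed

lemma polys_eqI:
 assumes "p \<in> polys n" "q \<in> polys n" "\<And>v. v \<in> carr n \<Longrightarrow> ev p v = ev q v"
 shows "p = q"
 using polys_eq_0I[of "p - q" n] assms by auto

lemma polys_nonzeroE:
 assumes "p \<in> polys n" "p \<noteq> 0"
 obtains v where "v \<in> carr n" "ev p v \<noteq> 0"
 using polys_eq_0I assms by blast

text \<open>Working with functions that are given by polynomials avoids formal substitution.\<close>

definition polyfun :: "nat \<Rightarrow> (complex vec \<Rightarrow> complex) \<Rightarrow> bool" where
 "polyfun n F \<longleftrightarrow> (\<exists>p\<in>polys n. \<forall>v\<in>carr n. F v = ev p v)"

lemma polyfun_poly_eval [intro]: "p \<in> polys n \<Longrightarrow> polyfun n (ev p)"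
 by (auto simp: polyfun_def)
lemma polyfun_const [intro, simp]: "polyfun n (\<lambda>v. c)"
 unfolding polyfun_def by (rule bexI[of _ "Const c"]) auto
lemma polyfun_coord [intro]: "i \<le> n \<Longrightarrow> polyfun n (\<lambda>v. v $ i)"
 unfolding polyfun_def by (rule bexI[of _ "Var i"]) auto
lemma polyfun_add [intro]:
 assumes "polyfun n F" "polyfun n G" shows "polyfun n (\<lambda>v. F v + G v)"
 using assms unfolding polyfun_def by (metis polys_add poly_eval_add)
lemma polyfun_mult [intro]:
 assumes "polyfun n F" "polyfun n G" shows "polyfun n (\<lambda>v. F v * G v)"
 using assms unfolding polyfun_def by (metis polys_mult poly_eval_mult)
lemma polyfun_uminus [intro]:
 assumes "polyfun n F" shows "polyfun n (\<lambda>v. - F v)"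
 using assms unfolding polyfun_def by (metis polys_uminus poly_eval_uminus)
lemma polyfun_diff [intro]:
 assumes "polyfun n F" "polyfun n G" shows "polyfun n (\<lambda>v. F v - G v)"
 using assms unfolding polyfun_def by (metis polys_diff poly_eval_diff)
lemma polyfun_sum [intro]:
 assumes "\<And>a. a \<in> A \<Longrightarrow> polyfun n (F a)" shows "polyfun n (\<lambda>v. \<Sum>a\<in>A. F a v)"
 using assms by (induction A rule: infinite_finite_induct) auto
lemma polyfun_cong:
 assumes "\<And>v. v \<in> carr n \<Longrightarrow> F v = G v" shows "polyfun n F \<longleftrightarrow> polyfun n G"
 using assms by (auto simp: polyfun_def)

lemma polyfun_compose:
 assumes "polyfun n F" "\<And>i. i \<le> n \<Longrightarrow> polyfun m (\<lambda>v. \<sigma> v $ i)"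
  "\<And>v. v \<in> carr m \<Longrightarrow> \<sigma> v \<in> carr n"
 shows "polyfun m (\<lambda>v. F (\<sigma> v))"
proof -
 obtain p where p: "p \<in> polys n" "\<And>v. v \<in> carr n \<Longrightarrow> F v = ev p v"
  using assms(1) by (auto simp: polyfun_def)
 have "polyfun m (\<lambda>v. ev p (\<sigma> v))"
  using p(1) by (induction p rule: polys_induct) (auto intro: assms(2))
 then show ?thesis using polyfun_cong[of m "\<lambda>v. F (\<sigma> v)"] p(2) assms(3) by simp
qed

lemma polyfun_mult_eq_0:
 assumes "polyfun n F" "polyfun n G" "\<And>v. v \<in> carr n \<Longrightarrow> F v * G v = 0"
 shows "(\<forall>v\<in>carr n. F v = 0) \<or> (\<forall>v\<in>carr n. G v = 0)"
proof -
 obtain p q where pq: "p \<in> polys n" "q \<in> polys n" "\<And>v. v \<in> carr n \<Longrightarrow> F v = ev p v"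
   "\<And>v. v \<in> carr n \<Longrightarrow> G v = ev q v"
  using assms by (auto simp: polyfun_def)
 have "p * q = 0" using pq assms(3) by (intro polys_eq_0I[of _ n]) auto
 then have "p = 0 \<or> q = 0" by (rule divisors_zero)
 then show ?thesis using pq by auto
qed

section \<open>Restriction to lines and division\<close>

text \<open>A family of univariate polynomials that depends polynomially on a parameter, such as the restrictions of a
 polynomial to all lines of a given direction.\<close>

definition linefun :: "nat \<Rightarrow> (complex vec \<Rightarrow> complex poly) \<Rightarrow> bool" where
 "linefun n Q \<longleftrightarrow> (\<forall>i. polyfun n (\<lambda>v. coeff (Q v) i)) \<and> (\<exists>N. \<forall>v\<in>carr n. degree (Q v) \<le> N)"

lemma linefun_const [intro]: "linefun n (\<lambda>v. q)"
 by (auto simp: linefun_def)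

lemma linefun_add [intro]:
 assumes "linefun n P" "linefun n Q" shows "linefun n (\<lambda>v. P v + Q v)"
proof -
 obtain N M where "\<forall>v\<in>carr n. degree (P v) \<le> N" "\<forall>v\<in>carr n. degree (Q v) \<le> M"
  using assms by (auto simp: linefun_def)
 then have "\<forall>v\<in>carr n. degree (P v + Q v) \<le> max N M"
  by (auto intro!: degree_add_le simp: max.coboundedI1 max.coboundedI2)
 then show ?thesis using assms by (auto simp: linefun_def)
qed

lemma linefun_mult [intro]:
 assumes "linefun n P" "linefun n Q" shows "linefun n (\<lambda>v. P v * Q v)"
proof -
 obtain N M where "\<forall>v\<in>carr n. degree (P v) \<le> N" "\<forall>v\<in>carr n. degree (Q v) \<le> M"
  using assms by (auto simp: linefun_def)
 then have "\<forall>v\<in>carr n. degree (P v * Q v) \<le> N + M"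
  by (meson add_mono degree_mult_le order_trans)
 moreover have "polyfun n (\<lambda>v. coeff (P v * Q v) i)" for i
  unfolding coeff_mult using assms by (intro polyfun_sum polyfun_mult) (auto simp: linefun_def)
 ultimately show ?thesis by (auto simp: linefun_def)
qed

lemma linefun_uminus [intro]: "linefun n P \<Longrightarrow> linefun n (\<lambda>v. - P v)"
 by (auto simp: linefun_def)

lemma linefun_diff [intro]: "linefun n P \<Longrightarrow> linefun n Q \<Longrightarrow> linefun n (\<lambda>v. P v - Q v)"
 using linefun_add[of n P "\<lambda>v. - Q v"] by auto

lemma linefun_monom [intro]: "polyfun n F \<Longrightarrow> linefun n (\<lambda>v. monom (F v) k)"
proof -
 assume F: "polyfun n F"
 then have "polyfun n (\<lambda>v. coeff (monom (F v) k) i)" for i by (cases "k = i") auto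
 then show ?thesis by (auto simp: linefun_def intro!: exI[of _ k] degree_monom_le)
qed

lemma linefun_sum [intro]: "(\<And>a. a \<in> A \<Longrightarrow> linefun n (F a)) \<Longrightarrow> linefun n (\<lambda>v. \<Sum>a\<in>A. F a v)"
 by (induction A rule: infinite_finite_induct) auto

lemma linefun_coeff: "linefun n Q \<Longrightarrow> polyfun n (\<lambda>v. coeff (Q v) i)"
 by (auto simp: linefun_def)

lemma linefun_cong: "(\<And>v. v \<in> carr n \<Longrightarrow> P v = Q v) \<Longrightarrow> linefun n P \<longleftrightarrow> linefun n Q"
 unfolding linefun_def by (auto simp: polyfun_cong[of n "\<lambda>v. coeff (P v) _" "\<lambda>v. coeff (Q v) _"])

text \<open>Division with remainder by a divisor with constant leading coefficient involves no division by functions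
 of the parameter; the induction follows the division algorithm on the degree of the dividend.\<close>

lemma linefun_div:
 assumes "linefun n P" "linefun n Q" "c \<noteq> 0"
  and Q: "\<And>v. v \<in> carr n \<Longrightarrow> degree (Q v) = k \<and> coeff (Q v) k = c"
 shows "linefun n (\<lambda>v. P v div Q v)"
proof -
 have "linefun n (\<lambda>v. P v div Q v)" if "linefun n P" "\<And>v. v \<in> carr n \<Longrightarrow> degree (P v) < N" for N P
  using that
 proof (induction N arbitrary: P)
  case 0
  then have "P v div Q v = 0" if "v \<in> carr n" for v using that by blast
  then show ?case using linefun_cong[of n "\<lambda>v. P v div Q v" "\<lambda>v. 0"] by auto
 next
  case (Suc N)
  show ?case
  proof (cases "N < k")
   case True
   then have "P v div Q v = 0" if "v \<in> carr n" for v
    using that Suc.prems(2)[of v] Q[of v] by (intro div_poly_less) auto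
   then show ?thesis using linefun_cong[of n "\<lambda>v. P v div Q v" "\<lambda>v. 0"] by auto
  next
   case False
   define M where "M v = monom (coeff (P v) N / c) (N - k)" for v
   define P' where "P' v = P v - M v * Q v" for v
   have M: "linefun n M"
    unfolding M_def divide_inverse using Suc.prems(1) by (intro linefun_monom) (auto simp: linefun_def)
   have P': "linefun n P'"
    unfolding P'_def using M Suc.prems(1) assms(2) by auto
   have step: "P v div Q v = M v + P' v div Q v" if "v \<in> carr n" for v
   proof -
    have "Q v \<noteq> 0" using Q[OF that] \<open>c \<noteq> 0\<close> by auto
    moreover have "P v = P' v + M v * Q v" by (simp add: P'_def)
    ultimately show ?thesis by (metis div_mult_self1)
   qed
   have deg: "degree (P' v) < N \<or> P' v = 0 \<or> (N = 0 \<and> degree (P' v) = 0)" if "v \<in> carr n" for v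
   proof -
    have "degree (P v) \<le> N" using Suc.prems(2)[OF that] by simp
    moreover have "degree (M v * Q v) \<le> N"
    proof -
     have "degree (M v * Q v) \<le> degree (M v) + degree (Q v)" by (rule degree_mult_le)
     also have "\<dots> \<le> (N - k) + k" using Q[OF that] by (simp add: M_def degree_monom_le)
     finally show ?thesis using False by simp
    qed
    ultimately have le: "degree (P' v) \<le> N" unfolding P'_def by (rule degree_diff_le)
    have "coeff (M v * Q v) N = coeff (P v) N / c * coeff (Q v) (N - (N - k))"
     using False unfolding M_def by (simp add: coeff_monom_mult)
    also have "\<dots> = coeff (P v) N" using Q[OF that] False \<open>c \<noteq> 0\<close> by simp
    finally have "coeff (P' v) N = 0" by (simp add: P'_def)
    then show ?thesis using le
     by (metis leading_coeff_0_iff le_neq_implies_less)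
   qed
   have "linefun n (\<lambda>v. P' v div Q v)"
   proof (cases "N = 0")
    case True
    then have "P' v = 0" if "v \<in> carr n" for v
    proof -
     have k: "k = 0" using False True by simp
     have "degree (P v) = 0" using Suc.prems(2)[OF that] True by simp
     moreover have "degree (Q v) = 0" "coeff (Q v) 0 = c" using Q[OF that] k by auto
     ultimately obtain x where "P v = [:x:]" "Q v = [:c:]"
      by (metis degree_0_id)
     then show ?thesis unfolding P'_def M_def using True k \<open>c \<noteq> 0\<close> by (simp add: monom_0)
    qed
    then show ?thesis using linefun_cong[of n "\<lambda>v. P' v div Q v" "\<lambda>v. 0"] by auto
   next
    case False
    show ?thesis by (rule Suc.IH[OF P']) (use deg False in force)
   qed
   then have "linefun n (\<lambda>v. M v + P' v div Q v)" using M by auto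
   then show ?thesis using linefun_cong[of n "\<lambda>v. P v div Q v" "\<lambda>v. M v + P' v div Q v"] step by auto
  qed
 qed
 moreover obtain N where "\<forall>v\<in>carr n. degree (P v) \<le> N" using assms by (auto simp: linefun_def)
 ultimately show ?thesis using assms(1) by (meson le_imp_less_Suc)
qed

lemma monomial_line:
 assumes "supp m \<subseteq> {..n}" "w \<in> carr n"
 shows "\<exists>R. linefun n R \<and> (\<forall>v\<in>carr n. (\<forall>t. mon m (v + t \<cdot>\<^sub>v w) = poly (R v) t) \<and>
  degree (R v) \<le> mdeg m \<and> coeff (R v) (mdeg m) = mon m w)"
 using assms(1)
proof (induction m rule: monomial_induct)
 case zero
 show ?case by (rule exI[of _ "\<lambda>v. 1"]) auto
next
 case (var i m)
 then obtain R where R: "linefun n R" "\<And>v t. v \<in> carr n \<Longrightarrow> mon m (v + t \<cdot>\<^sub>v w) = poly (R v) t"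
  "\<And>v. v \<in> carr n \<Longrightarrow> degree (R v) \<le> mdeg m" "\<And>v. v \<in> carr n \<Longrightarrow> coeff (R v) (mdeg m) = mon m w"
  by auto
 have i: "i \<le> n" using var by simp
 have "linefun n (\<lambda>v. (monom (v $ i) 0 + monom (w $ i) 1) * R v)"
  using R(1) i by (intro linefun_mult linefun_add linefun_monom polyfun_coord polyfun_const)
 moreover have "mon (mono1 i + m) (v + t \<cdot>\<^sub>v w) = poly ((monom (v $ i) 0 + monom (w $ i) 1) * R v) t"
  if "v \<in> carr n" for v t
  using that i assms R(2) mon_mono1[of i "v + t \<cdot>\<^sub>v w"] by (simp add: mon_add poly_monom mult.commute)
 moreover have "degree ((monom (v $ i) 0 + monom (w $ i) 1) * R v) \<le> mdeg (mono1 i + m)"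
  if "v \<in> carr n" for v
 proof -
  have "degree (monom (v $ i) 0 + monom (w $ i) 1) \<le> 1"
   by (intro degree_add_le) (auto intro: order_trans[OF degree_monom_le])
  then show ?thesis using R(3)[OF that] degree_mult_le[of "monom (v $ i) 0 + monom (w $ i) 1" "R v"] mdeg_mono1[of i]
   by (simp add: mdeg_add)
 qed
 moreover have "coeff ((monom (v $ i) 0 + monom (w $ i) 1) * R v) (mdeg (mono1 i + m)) = mon (mono1 i + m) w"
  if "v \<in> carr n" for v
 proof -
  have "coeff (R v) (Suc (mdeg m)) = 0" using R(3)[OF that] by (intro coeff_eq_0) simp
  then show ?thesis using R(4)[OF that] mdeg_mono1[of i] mon_mono1[of i w]
   by (simp add: mon_add mdeg_add distrib_right coeff_monom_mult)
 qed
 ultimately show ?case by blast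
qed

text \<open>The leading coefficient along the direction \<open>w\<close> is the value at \<open>w\<close> of the top homogeneous component, so it does
 not depend on the line.\<close>

lemma poly_eval_line:
 assumes "p \<in> polys n" "w \<in> carr n" "\<And>m. m \<in> supp p \<Longrightarrow> mdeg m \<le> d"
 obtains Q where "linefun n Q" "\<And>v t. v \<in> carr n \<Longrightarrow> ev p (v + t \<cdot>\<^sub>v w) = poly (Q v) t"
  "\<And>v. v \<in> carr n \<Longrightarrow> degree (Q v) \<le> d"
  "\<And>v. v \<in> carr n \<Longrightarrow> coeff (Q v) d = ev (hcomp d p) w"
proof -
 have "\<forall>m\<in>supp p. \<exists>R. linefun n R \<and> (\<forall>v\<in>carr n. (\<forall>t. mon m (v + t \<cdot>\<^sub>v w) = poly (R v) t) \<and>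
  degree (R v) \<le> mdeg m \<and> coeff (R v) (mdeg m) = mon m w)"
  using assms by (intro ballI monomial_line) (auto simp: polys_iff)
 from bchoice[OF this] obtain R where R0: "\<forall>m\<in>supp p. linefun n (R m) \<and> (\<forall>v\<in>carr n.
  (\<forall>t. mon m (v + t \<cdot>\<^sub>v w) = poly (R m v) t) \<and>
  degree (R m v) \<le> mdeg m \<and> coeff (R m v) (mdeg m) = mon m w)" ..
 then have R: "\<And>m. m \<in> supp p \<Longrightarrow> linefun n (R m)"
  "\<And>m v t. m \<in> supp p \<Longrightarrow> v \<in> carr n \<Longrightarrow> mon m (v + t \<cdot>\<^sub>v w) = poly (R m v) t"
  "\<And>m v. m \<in> supp p \<Longrightarrow> v \<in> carr n \<Longrightarrow> degree (R m v) \<le> mdeg m"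
  "\<And>m v. m \<in> supp p \<Longrightarrow> v \<in> carr n \<Longrightarrow> coeff (R m v) (mdeg m) = mon m w"
  by auto
 define Q where "Q v = (\<Sum>m\<in>supp p. [:lkp p m:] * R m v)" for v
 show ?thesis
 proof (rule that)
  show "linefun n Q" unfolding Q_def by (intro linefun_sum linefun_mult linefun_const R(1))
  show "ev p (v + t \<cdot>\<^sub>v w) = poly (Q v) t" if "v \<in> carr n" for v t
   using R(2)[OF _ that] by (simp add: poly_eval_mon Q_def poly_sum)
  show "degree (Q v) \<le> d" if "v \<in> carr n" for v
   unfolding Q_def
  proof (rule degree_sum_le)
   fix m assume "m \<in> supp p"
   then show "degree ([:lkp p m:] * R m v) \<le> d"
    using R(3)[OF _ that] assms(3) by (auto intro: order_trans[OF degree_smult_le] order_trans)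
  qed simp
  show "coeff (Q v) d = ev (hcomp d p) w" if v: "v \<in> carr n" for v
  proof -
   have "coeff (R m v) d = (if mdeg m = d then mon m w else 0)" if "m \<in> supp p" for m
   proof (cases "mdeg m = d")
    case True then show ?thesis using R(4)[OF that v] by simp
   next
    case False
    then have "degree (R m v) < d" using R(3)[OF that v] assms(3)[OF that] by simp
    then show ?thesis using False by (simp add: coeff_eq_0)
   qed
   then have "coeff (Q v) d = (\<Sum>m\<in>supp p. if mdeg m = d then lkp p m * mon m w else 0)"
    by (auto simp: Q_def coeff_sum intro!: sum.cong)
   also have "\<dots> = (\<Sum>m\<in>{m\<in>supp p. mdeg m = d}. lkp p m * mon m w)"
    by (rule sum.inter_filter[symmetric]) simp
   also have "\<dots> = ev (hcomp d p) w" by (simp add: hcomp_def)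
   finally show ?thesis .
  qed
 qed
qed

lemma polyfun_line:
 assumes "polyfun n F" "w \<in> carr n"
 obtains Q where "linefun n Q" "\<And>v t. v \<in> carr n \<Longrightarrow> F (v + t \<cdot>\<^sub>v w) = poly (Q v) t"
proof -
 obtain p where p: "p \<in> polys n" "\<And>v. v \<in> carr n \<Longrightarrow> F v = ev p v"
  using assms(1) by (auto simp: polyfun_def)
 obtain d where "\<And>m. m \<in> supp p \<Longrightarrow> mdeg m \<le> d"
  using finite_nat_set_iff_bounded_le[of "mdeg ` supp p"] by auto
 from poly_eval_line[OF p(1) assms(2) this] show ?thesis
  using that p(2) assms(2) by (metis add_carrier_vec smult_carrier_vec)
qed

lemma polyfun_line_tendsto:
 assumes "polyfun n F" "v \<in> carr n" "w \<in> carr n"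
 shows "((\<lambda>t. F (v + t \<cdot>\<^sub>v w)) \<longlongrightarrow> F v) (at 0)"
proof -
 obtain Q where Q: "\<And>t. F (v + t \<cdot>\<^sub>v w) = poly (Q v) t"
  using polyfun_line[OF assms(1,3)] assms(2) by metis
 have "v + 0 \<cdot>\<^sub>v w = v" using assms by (intro eq_vecI) auto
 then have "F v = poly (Q v) 0" using Q[of 0] by simp
 then show ?thesis unfolding Q by (simp add: poly_isCont[unfolded isCont_def])
qed

text \<open>Boundedness of the quotient near a root of the divisor compares the multiplicities of this root.\<close>

lemma poly_dvdI_locally_bounded:
 fixes a b :: "complex poly"
 assumes "b \<noteq> 0" "\<And>t0. \<exists>C. eventually (\<lambda>t. norm (poly a t) \<le> C * norm (poly b t)) (at t0)"
 shows "b dvd a"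
 using assms
proof (induction "degree b" arbitrary: a b)
 case 0
 then show ?case by (metis is_unit_iff_degree unit_imp_dvd)
next
 case (Suc d)
 then have "\<not> constant (poly b)" using constant_degree by (metis nat.simps(3))
 then obtain z where z: "poly b z = 0" using fundamental_theorem_of_algebra by blast
 obtain b' where b': "b = [:-z, 1:] * b'" using z poly_eq_0_iff_dvd by (metis dvdE)
 have "poly a z = 0"
 proof -
  obtain C where C: "eventually (\<lambda>t. norm (poly a t) \<le> C * norm (poly b t)) (at z)"
   using Suc.prems(2) by blast
  have "((\<lambda>t. norm (poly a t)) \<longlongrightarrow> norm (poly a z)) (at z)"
   by (intro tendsto_norm) (simp add: poly_isCont[unfolded isCont_def])
  moreover have "((\<lambda>t. C * norm (poly b t)) \<longlongrightarrow> C * norm (poly b z)) (at z)"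
   by (intro tendsto_mult tendsto_norm tendsto_const) (simp add: poly_isCont[unfolded isCont_def])
  ultimately have "norm (poly a z) \<le> C * norm (poly b z)"
   by (intro tendsto_le[OF _ _ _ C]) auto
  then show ?thesis using z by simp
 qed
 then obtain a' where a': "a = [:-z, 1:] * a'" using poly_eq_0_iff_dvd by (metis dvdE)
 have ab: "poly a t = (t - z) * poly a' t" "poly b t = (t - z) * poly b' t" for t
  by (simp_all add: a' b' algebra_simps)
 have "b' \<noteq> 0" using b' Suc.prems by auto
 moreover have "degree b' = d" using Suc(2) \<open>b' \<noteq> 0\<close> unfolding b' by (subst (asm) degree_mult_eq) auto
 moreover have "\<exists>C. eventually (\<lambda>t. norm (poly a' t) \<le> C * norm (poly b' t)) (at t0)" for t0
 proof -
  obtain C where C: "eventually (\<lambda>t. norm (poly a t) \<le> C * norm (poly b t)) (at t0)"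
   using Suc.prems(2) by blast
  have "eventually (\<lambda>t. t \<noteq> z) (at t0)"
   by (rule eventually_neq_at_within)
  with C have "eventually (\<lambda>t. norm (poly a' t) \<le> C * norm (poly b' t)) (at t0)"
  proof eventually_elim
   case (elim t)
   then have "norm (t - z) * norm (poly a' t) \<le> norm (t - z) * (C * norm (poly b' t))"
    by (simp add: ab norm_mult ac_simps)
   then show ?case using elim by (simp add: mult_le_cancel_left)
  qed
  then show ?thesis ..
 qed
 ultimately have "b' dvd a'" using Suc(1)[of b' a'] by blast
 then show ?case unfolding a' b' by (rule mult_dvd_mono[OF dvd_refl])
qed

text \<open>A Riemann extension theorem for polynomials: a quotient that is locally bounded along lines is a polynomial.
 For a direction in which the divisor has constant leading coefficient, restriction to lines reduces the claim to
 one variable. The bound is required away from the origin only; lines through the origin are reached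
 by multiplying the remainder with a polynomial that vanishes on them.\<close>

lemma polyfun_dividesI:
 assumes "n \<ge> 1" "polyfun n P" "polyfun n Q" "u \<in> carr n" "Q u \<noteq> 0"
  and bounded: "\<And>v w. v \<in> carr n \<Longrightarrow> w \<in> carr n \<Longrightarrow> v \<noteq> zvec n \<Longrightarrow>
    \<exists>C. eventually (\<lambda>t. norm (P (v + t \<cdot>\<^sub>v w)) \<le> C * norm (Q (v + t \<cdot>\<^sub>v w))) (at 0)"
 obtains A where "polyfun n A" "\<And>v. v \<in> carr n \<Longrightarrow> P v = A v * Q v"
proof -
 obtain q where q: "q \<in> polys n" "\<And>v. v \<in> carr n \<Longrightarrow> Q v = ev q v"
  using assms(3) by (auto simp: polyfun_def)
 have "q \<noteq> 0" using q assms(4,5) by auto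
 define d where "d = Max (mdeg ` supp q)"
 have d: "mdeg m \<le> d" if "m \<in> supp q" for m using that by (auto simp: d_def)
 have "d \<in> mdeg ` supp q" unfolding d_def using \<open>q \<noteq> 0\<close>
  by (intro Max_in) (auto simp: poly_mapping_eq_iff in_keys_iff fun_eq_iff)
 then obtain m where "m \<in> supp q" "mdeg m = d" by auto
 then have "hcomp d q \<noteq> 0" by (auto simp: in_keys_iff lookup_hcomp poly_mapping_eq_iff fun_eq_iff)
 moreover have "Var 0 \<noteq> (0::cpoly)" by (metis single_zero inj_single lookup_single_eq lookup_zero zero_neq_one)
 ultimately have "hcomp d q * Var 0 \<noteq> 0" by simp
 moreover have "hcomp d q * Var 0 \<in> polys n"
  using homogeneous_hcomp[OF q(1)] homogeneous_polys by (intro polys_mult) auto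
 ultimately obtain w where w: "w \<in> carr n" "ev (hcomp d q * Var 0) w \<noteq> 0"
  using polys_nonzeroE by blast
 define c where "c = ev (hcomp d q) w"
 have c: "c \<noteq> 0" and w0: "w $ 0 \<noteq> 0" using w mon_mono1[of 0 w] by (auto simp: c_def)
 obtain Qu where Qu: "linefun n Qu" "\<And>v t. v \<in> carr n \<Longrightarrow> ev q (v + t \<cdot>\<^sub>v w) = poly (Qu v) t"
  "\<And>v. v \<in> carr n \<Longrightarrow> degree (Qu v) \<le> d"
  "\<And>v. v \<in> carr n \<Longrightarrow> coeff (Qu v) d = c"
  unfolding c_def using poly_eval_line[OF q(1) w(1) d] by metis
 obtain Pu where Pu: "linefun n Pu" "\<And>v t. v \<in> carr n \<Longrightarrow> P (v + t \<cdot>\<^sub>v w) = poly (Pu v) t"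
  using polyfun_line[OF assms(2) w(1)] by metis
 have degQ: "degree (Qu v) = d \<and> coeff (Qu v) d = c" if "v \<in> carr n" for v
  using Qu(3,4)[OF that] c by (metis le_antisym le_degree)
 have div: "linefun n (\<lambda>v. Pu v div Qu v)"
  by (rule linefun_div[OF Pu(1) Qu(1) c degQ])
 have md: "linefun n (\<lambda>v. Pu v mod Qu v)"
  unfolding minus_div_mult_eq_mod[symmetric] using div Pu(1) Qu(1) by auto
 \<comment> \<open>If Z v is non-zero, the line through v in the direction w misses the origin.\<close>
 define Z where "Z v = v $ 1 * w $ 0 - v $ 0 * w $ 1" for v :: "complex vec"
 have Z: "polyfun n Z" unfolding Z_def using \<open>n \<ge> 1\<close> by (auto intro!: polyfun_diff polyfun_mult)
 have dvd: "Qu v dvd Pu v" if v: "v \<in> carr n" "Z v \<noteq> 0" for v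
 proof (rule poly_dvdI_locally_bounded)
  show "Qu v \<noteq> 0" using degQ[OF v(1)] c by auto
  fix t0
  have *: "v + (t + t0) \<cdot>\<^sub>v w = (v + t0 \<cdot>\<^sub>v w) + t \<cdot>\<^sub>v w" for t
   using v w by (intro eq_vecI) (auto simp: algebra_simps)
  have "v + t0 \<cdot>\<^sub>v w \<noteq> zvec n"
  proof
   assume a: "v + t0 \<cdot>\<^sub>v w = zvec n"
   have "(v + t0 \<cdot>\<^sub>v w) $ 0 = 0" "(v + t0 \<cdot>\<^sub>v w) $ 1 = 0" unfolding a using \<open>n \<ge> 1\<close> by auto
   then have "v $ 0 = - t0 * w $ 0" "v $ 1 = - t0 * w $ 1"
    using v(1) w(1) \<open>n \<ge> 1\<close> by (auto simp: eq_neg_iff_add_eq_0)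
   then show False using v(2) by (simp add: Z_def)
  qed
  then obtain C where "eventually (\<lambda>t. norm (P ((v + t0 \<cdot>\<^sub>v w) + t \<cdot>\<^sub>v w)) \<le>
    C * norm (Q ((v + t0 \<cdot>\<^sub>v w) + t \<cdot>\<^sub>v w))) (at 0)"
   using bounded[of "v + t0 \<cdot>\<^sub>v w" w] v(1) w(1) by auto
  then have "eventually (\<lambda>t. norm (poly (Pu v) (t + t0)) \<le> C * norm (poly (Qu v) (t + t0))) (at 0)"
   unfolding *[symmetric] using Pu(2)[OF v(1)] Qu(2)[OF v(1)] q(2) v(1) w(1) by simp
  then have "eventually (\<lambda>t. norm (poly (Pu v) t) \<le> C * norm (poly (Qu v) t)) (at t0)"
   by (subst eventually_at_to_0)
  then show "\<exists>C. eventually (\<lambda>t. norm (poly (Pu v) t) \<le> C * norm (poly (Qu v) t)) (at t0)" ..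
 qed
 have zero: "Pu v mod Qu v = 0" if v: "v \<in> carr n" for v
 proof (rule poly_eqI)
  fix i
  have "(\<forall>v\<in>carr n. Z v = 0) \<or> (\<forall>v\<in>carr n. coeff (Pu v mod Qu v) i = 0)"
   by (rule polyfun_mult_eq_0[OF Z linefun_coeff[OF md]]) (use dvd in force)
  moreover have "Z (unit_vec (Suc n) 1) \<noteq> 0"
   using w0 \<open>n \<ge> 1\<close> by (simp add: Z_def unit_vec_def)
  ultimately show "coeff (Pu v mod Qu v) i = coeff 0 i"
   using v unit_vec_carrier[of "Suc n" 1] by (simp del: unit_vec_carrier) blast
 qed
 show ?thesis
 proof (rule that)
  show "polyfun n (\<lambda>v. coeff (Pu v div Qu v) 0)" using div by (rule linefun_coeff)
  fix v assume v: "v \<in> carr n"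
  have v0: "v + 0 \<cdot>\<^sub>v w = v" using v w by (intro eq_vecI) auto
  have "Pu v = (Pu v div Qu v) * Qu v" using zero[OF v] by (metis add_0_right div_mult_mod_eq)
  then have "poly (Pu v) 0 = poly (Pu v div Qu v) 0 * poly (Qu v) 0" by (metis poly_mult)
  then show "P v = coeff (Pu v div Qu v) 0 * Q v"
   using Pu(2)[OF v, of 0] Qu(2)[OF v, of 0] q(2)[OF v] v0 by (simp add: poly_0_coeff_0)
 qed
qed

section \<open>Equations of smooth hypersurfaces\<close>

lemma poly_coeff1_bound:
 fixes g :: "complex poly"
 assumes "\<And>z. poly g z = 0 \<Longrightarrow> \<rho> \<le> norm z" "\<rho> \<ge> 0"
 shows "norm (coeff g 1) * \<rho> \<le> degree g * norm (coeff g 0)"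
 using assms
proof (induction "degree g" arbitrary: g)
 case 0
 then have "coeff g 1 = 0" by (intro coeff_eq_0) simp
 then show ?case by simp
next
 case (Suc d)
 then have "\<not> constant (poly g)" using constant_degree by (metis nat.simps(3))
 then obtain z where z: "poly g z = 0" using fundamental_theorem_of_algebra by blast
 then obtain h where g: "g = [:-z, 1:] * h" using poly_eq_0_iff_dvd by (metis dvdE)
 have "h \<noteq> 0" using g Suc(2) by auto
 then have d: "degree h = d" "degree g = Suc d" using Suc(2) unfolding g by (auto simp: degree_mult_eq simp del: mult_pCons_left)
 have c: "coeff g 0 = - z * coeff h 0" "coeff g 1 = coeff h 0 - z * coeff h 1" by (simp_all add: g)
 have \<rho>: "\<rho> \<le> norm z" using Suc.prems z by blast
 have "norm (coeff h 1) * \<rho> \<le> degree h * norm (coeff h 0)"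
  using Suc.prems d(1) by (intro Suc(1)) (auto simp: g)
 then have IH: "norm z * (norm (coeff h 1) * \<rho>) \<le> norm z * (d * norm (coeff h 0))"
  unfolding d by (rule mult_left_mono) simp
 have "norm (coeff g 1) * \<rho> \<le> (norm (coeff h 0) + norm z * norm (coeff h 1)) * \<rho>"
  unfolding c norm_mult[symmetric] by (intro mult_right_mono norm_triangle_ineq4 Suc.prems)
 also have "\<dots> = norm (coeff h 0) * \<rho> + norm z * (norm (coeff h 1) * \<rho>)" by (simp add: algebra_simps)
 also have "\<dots> \<le> norm (coeff h 0) * norm z + norm z * (d * norm (coeff h 0))"
  by (intro add_mono IH mult_left_mono[OF \<rho>]) simp
 also have "\<dots> = degree g * norm (coeff g 0)" unfolding d c by (simp add: norm_mult algebra_simps)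
 finally show ?case .
qed

text \<open>Up to sign, the quotient of the linear and the constant coefficient is the sum of the reciprocals of the roots,
 so the root of smallest modulus is as small as claimed.\<close>

lemma poly_small_root:
 fixes g :: "complex poly"
 assumes "coeff g 1 \<noteq> 0"
 obtains z where "poly g z = 0" "norm z * norm (coeff g 1) \<le> degree g * norm (coeff g 0)"
proof -
 have g: "g \<noteq> 0" "degree g \<noteq> 0" using assms le_degree by fastforce+
 define S where "S = {z. poly g z = 0}"
 have S: "finite S" unfolding S_def using g(1) by (rule poly_roots_finite)
 have "\<not> constant (poly g)" using g(2) constant_degree by metis
 then have "S \<noteq> {}" unfolding S_def using fundamental_theorem_of_algebra by blast
 then have "Min (norm ` S) \<in> norm ` S" using S by (intro Min_in) auto
 then obtain z where z: "z \<in> S" "norm z = Min (norm ` S)" by auto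
 have "norm (coeff g 1) * norm z \<le> degree g * norm (coeff g 0)"
 proof (rule poly_coeff1_bound)
  fix y assume "poly g y = 0"
  then show "norm z \<le> norm y" unfolding z(2) using S by (intro Min_le) (auto simp: S_def)
 qed simp
 then show ?thesis using that z(1) by (simp add: S_def mult.commute)
qed

lemma eventually_quotient_bound:
 fixes X Y a b :: "complex \<Rightarrow> complex"
 assumes "(X \<longlongrightarrow> x) (at 0)" "x \<noteq> 0" "(Y \<longlongrightarrow> y) (at 0)"
  "\<And>t. a t * X t = Y t * b t"
 shows "\<exists>C. eventually (\<lambda>t. norm (a t) \<le> C * norm (b t)) (at 0)"
proof -
 have "((\<lambda>t. norm (Y t / X t)) \<longlongrightarrow> norm (y / x)) (at 0)"
  using assms by (intro tendsto_norm tendsto_divide)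
 then have "eventually (\<lambda>t. norm (Y t / X t) < norm (y / x) + 1) (at 0)"
  by (rule order_tendstoD) simp
 moreover have "eventually (\<lambda>t. X t \<noteq> 0) (at 0)"
  using tendsto_imp_eventually_ne[OF assms(1,2)] .
 ultimately have "eventually (\<lambda>t. norm (a t) \<le> (norm (y / x) + 1) * norm (b t)) (at 0)"
 proof eventually_elim
  case (elim t)
  have "a t = Y t / X t * b t" using assms(4)[of t] elim(2) by (simp add: field_simps)
  then have "norm (a t) = norm (Y t / X t) * norm (b t)" by (simp add: norm_mult norm_divide)
  also have "\<dots> \<le> (norm (y / x) + 1) * norm (b t)" using elim(1) by (intro mult_right_mono) auto
  finally show ?case .
 qed
 then show ?thesis ..
qed

definition grad :: "nat \<Rightarrow> cpoly \<Rightarrow> complex vec \<Rightarrow> complex vec" where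
 "grad n f v = vec (Suc n) (\<lambda>i. ev (poly_partial i f) v)"

lemma grad_carr [simp]: "grad n f v \<in> carr n" by (simp add: grad_def)
lemma grad_dim [simp]: "dim_vec (grad n f v) = Suc n" by (simp add: grad_def)
lemma grad_index [simp]: "i \<le> n \<Longrightarrow> grad n f v $ i = ev (poly_partial i f) v" by (simp add: grad_def)

lemma dot_sum: "w \<in> carr n \<Longrightarrow> u \<bullet> w = (\<Sum>i\<le>n. u $ i * w $ i)"
 unfolding scalar_prod_def by (intro sum.cong) auto

lemma grad_dot: "w \<in> carr n \<Longrightarrow> grad n f v \<bullet> w = (\<Sum>i\<le>n. w $ i * ev (poly_partial i f) v)"
 by (subst dot_sum) (auto intro!: sum.cong)

lemma line_0 [simp]: "v \<in> carr n \<Longrightarrow> w \<in> carr n \<Longrightarrow> v + 0 \<cdot>\<^sub>v w = (v :: complex vec)"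
 by (intro eq_vecI) auto

lemma directional_derivative:
 assumes "p \<in> polys n" "v \<in> carr n" "w \<in> carr n"
 shows "((\<lambda>t. ev p (v + t \<cdot>\<^sub>v w)) has_field_derivative grad n p (v + x \<cdot>\<^sub>v w) \<bullet> w) (at x)"
 using poly_eval_has_derivative_line[OF assms] assms by (simp add: grad_dot)

lemma euler_identity:
 assumes "homogeneous n k p" "v \<in> carr n"
 shows "grad n p v \<bullet> v = of_nat k * ev p v"
proof -
 have "((\<lambda>t. ev p (v + t \<cdot>\<^sub>v v)) has_field_derivative grad n p v \<bullet> v) (at 0)"
  using directional_derivative[OF homogeneous_polys[OF assms(1)] assms(2) assms(2), of 0] assms by simp
 moreover have "ev p (v + t \<cdot>\<^sub>v v) = (1 + t) ^ k * ev p v" for t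
 proof -
  have "v + t \<cdot>\<^sub>v v = (1 + t) \<cdot>\<^sub>v v" by (intro eq_vecI) (auto simp: algebra_simps)
  then show ?thesis using homogeneous_eval[OF assms] by simp
 qed
 moreover have "((\<lambda>t. (1 + t) ^ k * ev p v) has_field_derivative of_nat k * ev p v) (at 0)"
  by (auto intro!: derivative_eq_intros)
 ultimately show ?thesis using DERIV_unique by fastforce
qed

lemma nonsingular_nonzero:
 assumes "nonsingular n f" "f \<in> polys n"
 obtains v where "v \<in> carr n" "ev f v \<noteq> 0"
proof (rule ccontr)
 assume "\<not> thesis"
 then have "f = 0" using that assms(2) polys_eq_0I by blast
 moreover have "unit_vec (Suc n) 0 \<in> carr n - {zvec n}"
  by (simp add: unit_vec_def zero_vec_def vec_eq_iff)
 ultimately show False using assms(1) unfolding nonsingular_def by fastforce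
qed

text \<open>The equation of a smooth hypersurface generates the ideal of all polynomials vanishing on it. Near a zero
 \<open>v\<close> with \<open>\<partial>\<^sub>j f(v) \<noteq> 0\<close>, a point \<open>u\<close> has a zero of \<open>f\<close>, hence of \<open>p\<close>, at distance at most a constant times
 \<open>\<bar>f(u)\<bar>\<close> in the direction of the \<open>j\<close>-th axis. So \<open>p / f\<close> is locally bounded, and \<open>polyfun_dividesI\<close> applies.\<close>

lemma nonsingular_divides:
 assumes "n \<ge> 1" "f \<in> polys n" "nonsingular n f" "p \<in> polys n"
  and zeros: "\<And>v. v \<in> carr n \<Longrightarrow> ev f v = 0 \<Longrightarrow> ev p v = 0"
 obtains q where "q \<in> polys n" "p = q * f"
proof -
 obtain u where u: "u \<in> carr n" "ev f u \<noteq> 0" using nonsingular_nonzero assms by blast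
 have "\<exists>C. eventually (\<lambda>t. norm (ev p (v + t \<cdot>\<^sub>v w)) \<le> C * norm (ev f (v + t \<cdot>\<^sub>v w))) (at 0)"
  if v: "v \<in> carr n" "w \<in> carr n" "v \<noteq> zvec n" for v w
 proof (cases "ev f v = 0")
  case False
  show ?thesis
   by (rule eventually_quotient_bound[OF polyfun_line_tendsto[OF polyfun_poly_eval[OF assms(2)] v(1,2)] False
      polyfun_line_tendsto[OF polyfun_poly_eval[OF assms(4)] v(1,2)]]) simp
 next
  case True
  then obtain j where j: "j \<le> n" "ev (poly_partial j f) v \<noteq> 0"
   using assms(3) v unfolding nonsingular_def by auto
  let ?e = "unit_vec (Suc n) j :: complex vec"
  have e: "?e \<in> carr n" by simp
  obtain F where F: "linefun n F" "\<And>u t. u \<in> carr n \<Longrightarrow> ev f (u + t \<cdot>\<^sub>v ?e) = poly (F u) t"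
   using polyfun_line[OF polyfun_poly_eval[OF assms(2)] e] by metis
  obtain P where P: "linefun n P" "\<And>u t. u \<in> carr n \<Longrightarrow> ev p (u + t \<cdot>\<^sub>v ?e) = poly (P u) t"
   using polyfun_line[OF polyfun_poly_eval[OF assms(4)] e] by metis
  obtain k where k: "\<And>u. u \<in> carr n \<Longrightarrow> degree (F u) \<le> k" using F(1) by (auto simp: linefun_def)
  obtain N where N: "\<And>u. u \<in> carr n \<Longrightarrow> degree (P u) \<le> N" using P(1) by (auto simp: linefun_def)
  have F0: "coeff (F u) 0 = ev f u" if "u \<in> carr n" for u
   using F(2)[OF that, of 0] that by (simp add: poly_0_coeff_0)
  have F1: "coeff (F u) 1 = ev (poly_partial j f) u" if "u \<in> carr n" for u
  proof -
   have "((\<lambda>t. poly (F u) t) has_field_derivative grad n f u \<bullet> ?e) (at 0)"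
    using directional_derivative[OF assms(2) that e, of 0] that F(2)[OF that] by simp
   then have "grad n f u \<bullet> ?e = poly (pderiv (F u)) 0" using poly_DERIV DERIV_unique by blast
   then show ?thesis using j(1) by (simp add: poly_0_coeff_0 coeff_pderiv)
  qed
  define c where "c = ev (poly_partial j f) v"
  define B where "B = (\<Sum>i=1..N. norm (coeff (P v) i) + 1)"
  have lim: "((\<lambda>t. G (v + t \<cdot>\<^sub>v w)) \<longlongrightarrow> G v) (at 0)" if "polyfun n G" for G
   by (rule polyfun_line_tendsto[OF that v(1,2)])
  have "\<forall>i\<in>{1..N}. eventually (\<lambda>t. norm (coeff (P (v + t \<cdot>\<^sub>v w)) i) < norm (coeff (P v) i) + 1) (at 0)"
  proof
   fix i
   have "((\<lambda>t. norm (coeff (P (v + t \<cdot>\<^sub>v w)) i)) \<longlongrightarrow> norm (coeff (P v) i)) (at 0)"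
    by (intro tendsto_norm lim linefun_coeff P(1))
   then show "eventually (\<lambda>t. norm (coeff (P (v + t \<cdot>\<^sub>v w)) i) < norm (coeff (P v) i) + 1) (at 0)"
    by (rule order_tendstoD) simp
  qed
  then have ev1: "eventually (\<lambda>t. \<forall>i\<in>{1..N}. norm (coeff (P (v + t \<cdot>\<^sub>v w)) i) < norm (coeff (P v) i) + 1) (at 0)"
   by (rule eventually_ball_finite[rotated]) simp
  have "((\<lambda>t. norm (ev (poly_partial j f) (v + t \<cdot>\<^sub>v w))) \<longlongrightarrow> norm c) (at 0)"
   unfolding c_def by (intro tendsto_norm lim polyfun_poly_eval polys_partial assms)
  then have ev2: "eventually (\<lambda>t. norm c / 2 < norm (ev (poly_partial j f) (v + t \<cdot>\<^sub>v w))) (at 0)"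
   by (rule order_tendstoD) (use j in \<open>simp add: c_def\<close>)
  have "((\<lambda>t. k * norm (ev f (v + t \<cdot>\<^sub>v w))) \<longlongrightarrow> k * norm (ev f v)) (at 0)"
   by (intro tendsto_mult tendsto_const tendsto_norm lim polyfun_poly_eval assms)
  then have ev3: "eventually (\<lambda>t. k * norm (ev f (v + t \<cdot>\<^sub>v w)) < norm c / 2) (at 0)"
   by (rule order_tendstoD) (use j True in \<open>simp add: c_def\<close>)
  have "eventually (\<lambda>t. norm (ev p (v + t \<cdot>\<^sub>v w)) \<le>
     (k / (norm c / 2) * B) * norm (ev f (v + t \<cdot>\<^sub>v w))) (at 0)"
   using ev1 ev2 ev3
  proof eventually_elim
   case (elim t)
   define u where "u = v + t \<cdot>\<^sub>v w"
   have u: "u \<in> carr n" using v by (simp add: u_def)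
   have c0: "norm c / 2 > 0" using j by (simp add: c_def)
   have "coeff (F u) 1 \<noteq> 0" using F1[OF u] elim(2) c0 by (auto simp: u_def)
   then obtain s where s: "poly (F u) s = 0" "norm s * norm (coeff (F u) 1) \<le> degree (F u) * norm (coeff (F u) 0)"
    using poly_small_root by blast
   have s1: "norm s * (norm c / 2) \<le> k * norm (ev f u)"
   proof -
    have "norm s * (norm c / 2) \<le> norm s * norm (coeff (F u) 1)"
     using elim(2) F1[OF u] by (intro mult_left_mono) (auto simp: u_def)
    also have "\<dots> \<le> degree (F u) * norm (coeff (F u) 0)" by (rule s)
    also have "\<dots> \<le> k * norm (ev f u)"
     using k[OF u] F0[OF u] by (intro mult_mono) auto
    finally show ?thesis .
   qed
   also have "\<dots> < norm c / 2" using elim(3) by (simp add: u_def)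
   finally have s2: "norm s \<le> 1" using c0 by (simp add: mult_less_cancel_right1 flip: not_less)
   have "ev p (u + s \<cdot>\<^sub>v ?e) = 0" using s(1) F(2)[OF u] by (intro zeros) (use u in auto)
   then have 0: "poly (P u) s = 0" using P(2)[OF u] by simp
   have "poly (P u) s = (\<Sum>i\<le>N. coeff (P u) i * s ^ i)"
    unfolding poly_altdef using N[OF u] by (intro sum.mono_neutral_left) (auto simp: coeff_eq_0)
   also have "\<dots> = coeff (P u) 0 + (\<Sum>i=1..N. coeff (P u) i * s ^ i)"
    by (simp add: atMost_atLeast0 sum.atLeast_Suc_atMost)
   also have "coeff (P u) 0 = ev p u"
    using P(2)[OF u, of 0] u by (simp add: poly_0_coeff_0)
   finally have "ev p u = - (\<Sum>i=1..N. coeff (P u) i * s ^ i)" using 0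
    by (simp add: eq_neg_iff_add_eq_0)
   then have "norm (ev p u) \<le> (\<Sum>i=1..N. norm (coeff (P u) i * s ^ i))"
    by (simp only: norm_minus_cancel norm_sum)
   also have "\<dots> \<le> (\<Sum>i=1..N. norm s * (norm (coeff (P v) i) + 1))"
   proof (rule sum_mono)
    fix i assume i: "i \<in> {1..N}"
    then obtain i' where i': "i = Suc i'" by (cases i) auto
    have "norm s ^ i' \<le> 1" using s2 by (simp add: power_le_one)
    then have "norm s * norm s ^ i' \<le> norm s * 1" by (intro mult_left_mono) auto
    moreover have "norm (coeff (P u) i) \<le> norm (coeff (P v) i) + 1"
     using elim(1) i by (force simp: u_def)
    ultimately show "norm (coeff (P u) i * s ^ i) \<le> norm s * (norm (coeff (P v) i) + 1)"
     unfolding i' norm_mult norm_power power_Suc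
     by (subst mult.commute[of "norm s" "_ + 1"], intro mult_mono) auto
   qed
   also have "\<dots> = norm s * B" by (simp only: B_def sum_distrib_left)
   also have "\<dots> \<le> (k * norm (ev f u) / (norm c / 2)) * B"
   proof (rule mult_right_mono)
    show "norm s \<le> k * norm (ev f u) / (norm c / 2)" using s1 c0 by (simp add: pos_le_divide_eq)
    show "0 \<le> B" unfolding B_def by (rule sum_nonneg) simp
   qed
   finally show ?case by (simp add: u_def ac_simps)
  qed
  then show ?thesis ..
 qed
 from polyfun_dividesI[OF assms(1) polyfun_poly_eval[OF assms(4)] polyfun_poly_eval[OF assms(2)] u this]
 obtain A where A: "polyfun n A" "\<And>v. v \<in> carr n \<Longrightarrow> ev p v = A v * ev f v" by blast
 then obtain q where q: "q \<in> polys n" "\<And>v. v \<in> carr n \<Longrightarrow> A v = ev q v" by (auto simp: polyfun_def)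
 have "p = q * f" by (rule polys_eqI[of _ n]) (use assms q A in auto)
 then show ?thesis using that q by blast
qed

lemma nonsingular_divides_homogeneous:
 assumes "n \<ge> 1" "homogeneous n k f" "nonsingular n f" "homogeneous n (e + k) p"
  and zeros: "\<And>v. v \<in> carr n \<Longrightarrow> ev f v = 0 \<Longrightarrow> ev p v = 0"
 obtains q where "homogeneous n e q" "p = q * f"
proof -
 obtain q where q: "q \<in> polys n" "p = q * f"
  using nonsingular_divides[OF assms(1) homogeneous_polys[OF assms(2)] assms(3) homogeneous_polys[OF assms(4)] zeros]
  by blast
 have "p = hcomp (e + k) p" using hcomp_homogeneous[OF assms(4)] by simp
 also have "\<dots> = hcomp e q * f" using hcomp_mult_homogeneous[OF assms(2)] q(2) by simp
 finally show ?thesis using that homogeneous_hcomp[OF q(1)] by blast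
qed

section \<open>Homogeneous regular functions on cones\<close>

text \<open>A function on a cone that is locally a quotient of homogeneous polynomials, the degrees differing by \<open>e\<close>.
 The denominator has positive degree, so that its non-vanishing excludes the origin.\<close>

definition hreg :: "nat \<Rightarrow> complex vec set \<Rightarrow> int \<Rightarrow> (complex vec \<Rightarrow> complex) \<Rightarrow> bool" where
 "hreg n K e F \<longleftrightarrow> (\<forall>v\<in>K. \<exists>c d g h. homogeneous n c g \<and> homogeneous n d h \<and> int c = int d + e \<and> d \<ge> 1 \<and>
   ev h v \<noteq> 0 \<and> (\<forall>u\<in>carr n. ev h u \<noteq> 0 \<longrightarrow> u \<in> K \<and> F u = ev g u / ev h u))"

lemma hregE:
 assumes "hreg n K e F" "v \<in> K"
 obtains c d g h where "homogeneous n c g" "homogeneous n d h" "int c = int d + e" "d \<ge> 1"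
  "ev h v \<noteq> 0" "\<And>u. u \<in> carr n \<Longrightarrow> ev h u \<noteq> 0 \<Longrightarrow> u \<in> K"
  "\<And>u. u \<in> carr n \<Longrightarrow> ev h u \<noteq> 0 \<Longrightarrow> F u = ev g u / ev h u"
 using bspec[OF assms(1)[unfolded hreg_def] assms(2)] by blast

lemma hreg_scale:
 assumes "hreg n K e F" "v \<in> K" "K \<subseteq> carr n" "t \<noteq> 0"
 shows "F (t \<cdot>\<^sub>v v) = t powi e * F v"
proof -
 obtain c d g h where *: "homogeneous n c g" "homogeneous n d h" "int c = int d + e"
  "ev h v \<noteq> 0" "\<And>u. u \<in> carr n \<Longrightarrow> ev h u \<noteq> 0 \<Longrightarrow> F u = ev g u / ev h u"
  by (rule hregE[OF assms(1,2)]) blast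
 have v: "v \<in> carr n" using assms by blast
 have "ev h (t \<cdot>\<^sub>v v) \<noteq> 0" using *(4) assms(4) homogeneous_eval[OF *(2) v] by simp
 then have "F (t \<cdot>\<^sub>v v) = (t ^ c * ev g v) / (t ^ d * ev h v)"
  using *(5)[of "t \<cdot>\<^sub>v v"] v homogeneous_eval[OF *(1) v] homogeneous_eval[OF *(2) v] by simp
 also have "t ^ c = t ^ d * t powi e"
  using *(3) assms(4) by (metis power_int_add power_int_of_nat)
 finally show ?thesis using *(4) *(5)[OF v *(4)] assms(4) by simp
qed

lemma homogenize:
 assumes "a \<in> polys n" "\<And>m. m \<in> supp a \<Longrightarrow> mdeg m \<le> N" "i \<le> n"
 obtains P where "homogeneous n N P"
  "\<And>v. v \<in> carr n \<Longrightarrow> v $ i \<noteq> 0 \<Longrightarrow> ev P v = v $ i ^ N * ev a ((1 / v $ i) \<cdot>\<^sub>v v)"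
proof
 let ?P = "\<Sum>m\<in>supp a. Poly_Mapping.single m (lkp a m) * Var i ^ (N - mdeg m)"
 show "homogeneous n N ?P"
 proof (rule homogeneous_sum)
  fix m assume m: "m \<in> supp a"
  then have "supp m \<subseteq> {..n}" using assms(1) by (auto simp: polys_iff)
  then have "homogeneous n (mdeg m + 1 * (N - mdeg m)) (Poly_Mapping.single m (lkp a m) * Var i ^ (N - mdeg m))"
   using assms(3) by (intro homogeneous_mult homogeneous_power homogeneous_single homogeneous_Var) auto
  then show "homogeneous n N (Poly_Mapping.single m (lkp a m) * Var i ^ (N - mdeg m))"
   using assms(2)[OF m] by simp
 qed
 fix v assume v: "v \<in> carr n" "v $ i \<noteq> 0"
 have "lkp a m * mon m v * v $ i ^ (N - mdeg m) = v $ i ^ N * (lkp a m * mon m ((1 / v $ i) \<cdot>\<^sub>v v))"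
  if m: "m \<in> supp a" for m
 proof -
  have "mon m ((1 / v $ i) \<cdot>\<^sub>v v) = (1 / v $ i) ^ mdeg m * mon m v"
   using assms(1) m v by (intro mon_smult[of _ n]) (auto simp: polys_iff)
  moreover have "v $ i ^ N = v $ i ^ (N - mdeg m) * v $ i ^ mdeg m"
   using assms(2)[OF m] by (simp flip: power_add)
  ultimately show ?thesis using v by (simp add: power_divide)
 qed
 then have "(\<Sum>m\<in>supp a. lkp a m * mon m v * v $ i ^ (N - mdeg m)) =
   (\<Sum>m\<in>supp a. v $ i ^ N * (lkp a m * mon m ((1 / v $ i) \<cdot>\<^sub>v v)))"
  by (rule sum.cong[OF refl])
 then show "ev ?P v = v $ i ^ N * ev a ((1 / v $ i) \<cdot>\<^sub>v v)"
  using mon_mono1[of i v] unfolding poly_eval_mon[of a] sum_distrib_left by simp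
qed

text \<open>Sections of a twist of the structure sheaf over the chart \<open>x\<^sub>i \<noteq> 0\<close>. The quotient is restricted to the affine
 slice \<open>x\<^sub>i = 1\<close>, where any two local quotients are proportional, so that a single one is locally bounded near every
 point; it is then a polynomial by \<open>polyfun_dividesI\<close>, and homogenizing returns to the chart.\<close>

lemma hreg_chart:
 assumes n: "n \<ge> 1" and i: "i \<le> n" and F: "hreg n {v\<in>carr n. v $ i \<noteq> 0} (int e) F"
 obtains N P where "homogeneous n (N + e) P"
  "\<And>v. v \<in> carr n \<Longrightarrow> v $ i \<noteq> 0 \<Longrightarrow> F v = ev P v / v $ i ^ N"
proof -
 let ?K = "{v\<in>carr n. v $ i \<noteq> 0}"
 define \<sigma> where "\<sigma> v = vec (Suc n) (\<lambda>j. if j = i then 1 else v $ j)" for v :: "complex vec"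
 have \<sigma>: "\<sigma> v \<in> carr n" "\<sigma> v \<in> ?K" for v using i by (auto simp: \<sigma>_def)
 have pf\<sigma>: "polyfun n (\<lambda>v. ev p (\<sigma> v))" if "p \<in> polys n" for p
 proof (rule polyfun_compose[OF polyfun_poly_eval[OF that]])
  fix j assume "j \<le> n"
  then show "polyfun n (\<lambda>v. \<sigma> v $ j)"
   by (cases "j = i") (auto simp: \<sigma>_def intro!: polyfun_coord)
 qed (rule \<sigma>)
 have fixed: "\<sigma> ((1 / v $ i) \<cdot>\<^sub>v v) = (1 / v $ i) \<cdot>\<^sub>v v" if "v \<in> ?K" for v
  using that i by (intro eq_vecI) (auto simp: \<sigma>_def)
 define v0 where "v0 = \<sigma> (zvec n)"
 have v0: "\<sigma> v0 = v0" unfolding v0_def by (intro eq_vecI) (auto simp: \<sigma>_def)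
 obtain c d g h where gh: "homogeneous n c g" "homogeneous n d h" "int c = int d + int e" "d \<ge> 1"
  "ev h v0 \<noteq> 0" "\<And>u. u \<in> carr n \<Longrightarrow> ev h u \<noteq> 0 \<Longrightarrow> u \<in> ?K"
  "\<And>u. u \<in> carr n \<Longrightarrow> ev h u \<noteq> 0 \<Longrightarrow> F u = ev g u / ev h u"
  by (rule hregE[OF F \<sigma>(2)[of "zvec n", folded v0_def]]) blast
 have ghp: "g \<in> polys n" "h \<in> polys n" using gh homogeneous_polys by auto
 have local: "\<exists>g' h'. g' \<in> polys n \<and> h' \<in> polys n \<and> ev h' s \<noteq> 0 \<and> F s = ev g' s / ev h' s \<and>
   (\<forall>u\<in>carr n. ev g u * ev h' u = ev g' u * ev h u)" if s: "s \<in> ?K" for s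
 proof -
  obtain c d g' h' where g'h': "homogeneous n c g'" "homogeneous n d h'" "ev h' s \<noteq> 0"
   "\<And>u. u \<in> carr n \<Longrightarrow> ev h' u \<noteq> 0 \<Longrightarrow> F u = ev g' u / ev h' u"
   by (rule hregE[OF F s]) blast
  have p: "g' \<in> polys n" "h' \<in> polys n" using g'h' homogeneous_polys by auto
  have "(h * h') * (g * h' - g' * h) = 0"
  proof (rule polys_eq_0I[of _ n])
   show "(h * h') * (g * h' - g' * h) \<in> polys n" using p ghp by auto
   fix u assume u: "u \<in> carr n"
   show "ev ((h * h') * (g * h' - g' * h)) u = 0"
   proof (cases "ev h u = 0 \<or> ev h' u = 0")
    case False
    then have "F u * ev h u = ev g u"
     using gh(7)[OF u] by (metis nonzero_eq_divide_eq)
    moreover have "F u * ev h' u = ev g' u"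
     using False g'h'(4)[OF u] by (metis nonzero_eq_divide_eq)
    ultimately have "ev g u * ev h' u = ev g' u * ev h u"
     by (metis mult.assoc mult.commute)
    then show ?thesis by simp
   qed auto
  qed
  moreover have "h \<noteq> 0" "h' \<noteq> 0" using gh(5) g'h'(3) by auto
  ultimately have "g * h' = g' * h" by simp
  then have "ev g u * ev h' u = ev g' u * ev h u" for u
   by (metis poly_eval_mult)
  then show ?thesis using p g'h' s by auto
 qed
 have bnd: "\<exists>C. eventually (\<lambda>t. norm (ev g (\<sigma> (v + t \<cdot>\<^sub>v w))) \<le> C * norm (ev h (\<sigma> (v + t \<cdot>\<^sub>v w)))) (at 0)"
  if vw: "v \<in> carr n" "w \<in> carr n" and "v \<noteq> zvec n" for v w
 proof -
  obtain g' h' where l: "g' \<in> polys n" "h' \<in> polys n" "ev h' (\<sigma> v) \<noteq> 0"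
   "\<And>u. u\<in>carr n \<Longrightarrow> ev g u * ev h' u = ev g' u * ev h u"
   using local[OF \<sigma>(2)[of v]] by blast
  show ?thesis
   by (rule eventually_quotient_bound[OF polyfun_line_tendsto[OF pf\<sigma>[OF l(2)] vw] l(3) polyfun_line_tendsto[OF pf\<sigma>[OF l(1)] vw]])
    (rule l(4)[OF \<sigma>(1)])
 qed
 have v0c: "v0 \<in> carr n" unfolding v0_def by (rule \<sigma>)
 have hv0: "ev h (\<sigma> v0) \<noteq> 0" using gh(5) v0 by simp
 from polyfun_dividesI[OF n pf\<sigma>[OF ghp(1)] pf\<sigma>[OF ghp(2)] v0c hv0 bnd]
 obtain A where A: "polyfun n A" "\<And>v. v \<in> carr n \<Longrightarrow> ev g (\<sigma> v) = A v * ev h (\<sigma> v)" by blast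
 then obtain a where a: "a \<in> polys n" "\<And>v. v \<in> carr n \<Longrightarrow> A v = ev a v" by (auto simp: polyfun_def)
 have FA: "F s = A s" if s: "s \<in> ?K" "\<sigma> s = s" for s
 proof -
  obtain g' h' where l: "g' \<in> polys n" "h' \<in> polys n" "ev h' s \<noteq> 0" "F s = ev g' s / ev h' s"
   "\<And>u. u\<in>carr n \<Longrightarrow> ev g u * ev h' u = ev g' u * ev h u"
   using local[OF s(1)] by blast
  have "(\<forall>v\<in>carr n. ev h (\<sigma> v) = 0) \<or> (\<forall>v\<in>carr n. A v * ev h' (\<sigma> v) - ev g' (\<sigma> v) = 0)"
  proof (rule polyfun_mult_eq_0)
   show "polyfun n (\<lambda>v. ev h (\<sigma> v))" by (rule pf\<sigma>[OF ghp(2)])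
   show "polyfun n (\<lambda>v. A v * ev h' (\<sigma> v) - ev g' (\<sigma> v))"
    by (intro polyfun_diff polyfun_mult A pf\<sigma> l)
   fix v assume "v \<in> carr n"
   then show "ev h (\<sigma> v) * (A v * ev h' (\<sigma> v) - ev g' (\<sigma> v)) = 0"
    using A(2)[of v] l(5)[OF \<sigma>(1)[of v]] by (simp add: algebra_simps)
  qed
  then have "\<forall>v\<in>carr n. A v * ev h' (\<sigma> v) - ev g' (\<sigma> v) = 0"
   using v0c hv0 by blast
  then have "A s * ev h' s = ev g' s" using s by force
  then show ?thesis using l(3,4) by (metis nonzero_eq_divide_eq)
 qed
 obtain N where N: "\<And>m. m \<in> supp a \<Longrightarrow> mdeg m \<le> N"
  using finite_nat_set_iff_bounded_le[of "mdeg ` supp a"] by auto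
 obtain P where P: "homogeneous n N P"
  "\<And>v. v \<in> carr n \<Longrightarrow> v $ i \<noteq> 0 \<Longrightarrow> ev P v = v $ i ^ N * ev a ((1 / v $ i) \<cdot>\<^sub>v v)"
  using homogenize[OF a(1) N i] by blast
 show ?thesis
 proof (rule that[of N "P * Var i ^ e"])
  show "homogeneous n (N + e) (P * Var i ^ e)"
   using homogeneous_mult[OF P(1) homogeneous_power[OF homogeneous_Var[OF i], of e]] by simp
  fix v assume v: "v \<in> carr n" "v $ i \<noteq> 0"
  then have vK: "v \<in> ?K" by simp
  have s: "(1 / v $ i) \<cdot>\<^sub>v v \<in> ?K" using v i by simp
  have "v = v $ i \<cdot>\<^sub>v ((1 / v $ i) \<cdot>\<^sub>v v)" using v by (intro eq_vecI) auto
  then have "F v = F (v $ i \<cdot>\<^sub>v ((1 / v $ i) \<cdot>\<^sub>v v))" by simp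
  also have "\<dots> = v $ i ^ e * F ((1 / v $ i) \<cdot>\<^sub>v v)"
   using hreg_scale[OF F s _ v(2)] by (auto simp: power_int_of_nat)
  also have "F ((1 / v $ i) \<cdot>\<^sub>v v) = ev a ((1 / v $ i) \<cdot>\<^sub>v v)"
   using FA[OF s fixed[OF vK]] a(2) v by simp
  finally show "F v = ev (P * Var i ^ e) v / v $ i ^ N"
   using P(2)[OF v] v mon_mono1[of i v] by simp
 qed
qed

section \<open>The homogeneous Nullstellensatz\<close>

definition poly_ideal :: "nat \<Rightarrow> cpoly set \<Rightarrow> bool" where
 "poly_ideal n I \<longleftrightarrow> I \<subseteq> polys n \<and> 0 \<in> I \<and> (\<forall>p\<in>I. \<forall>q\<in>I. p + q \<in> I) \<and> (\<forall>p\<in>I. \<forall>q\<in>polys n. q * p \<in> I)"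

lemma poly_idealD:
 assumes "poly_ideal n I"
 shows "p \<in> I \<Longrightarrow> p \<in> polys n" "0 \<in> I" "p \<in> I \<Longrightarrow> q \<in> I \<Longrightarrow> p + q \<in> I"
  "p \<in> I \<Longrightarrow> q \<in> polys n \<Longrightarrow> q * p \<in> I" "p \<in> I \<Longrightarrow> q \<in> polys n \<Longrightarrow> p * q \<in> I"
  "p \<in> I \<Longrightarrow> q \<in> I \<Longrightarrow> p - q \<in> I"
proof -
 show *: "p \<in> I \<Longrightarrow> p \<in> polys n" "0 \<in> I" "p \<in> I \<Longrightarrow> q \<in> I \<Longrightarrow> p + q \<in> I"
  "p \<in> I \<Longrightarrow> q \<in> polys n \<Longrightarrow> q * p \<in> I" for p q using assms by (auto simp: poly_ideal_def)
 then show "p \<in> I \<Longrightarrow> q \<in> polys n \<Longrightarrow> p * q \<in> I" by (metis mult.commute)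
 have "- 1 \<in> polys n" by (intro polys_uminus) simp
 then have "q \<in> I \<Longrightarrow> - q \<in> I" using *(4)[of q "- 1"] by simp
 then show "p \<in> I \<Longrightarrow> q \<in> I \<Longrightarrow> p - q \<in> I" using *(3)[of p "- q"] by simp
qed

lemma poly_ideal_sum: "poly_ideal n I \<Longrightarrow> (\<And>a. a \<in> A \<Longrightarrow> f a \<in> I) \<Longrightarrow> sum f A \<in> I"
 by (induction A rule: infinite_finite_induct) (auto dest: poly_idealD)

text \<open>Zorn's lemma, in the form needed for the Nullstellensatz.\<close>

lemma maximal_ideal_exists:
 assumes "poly_ideal n I" "1 \<notin> I"
 obtains M where "poly_ideal n M" "I \<subseteq> M" "1 \<notin> M"
  "\<And>J. poly_ideal n J \<Longrightarrow> M \<subseteq> J \<Longrightarrow> 1 \<notin> J \<Longrightarrow> J = M"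
proof -
 define \<A> where "\<A> = {J. poly_ideal n J \<and> I \<subseteq> J \<and> 1 \<notin> J}"
 have "\<exists>M\<in>\<A>. \<forall>X\<in>\<A>. M \<subseteq> X \<longrightarrow> X = M"
 proof (rule subset_Zorn_nonempty)
  show "\<A> \<noteq> {}" using assms by (auto simp: \<A>_def)
  fix \<C> assume C: "\<C> \<noteq> {}" "subset.chain \<A> \<C>"
  then have sub: "\<C> \<subseteq> \<A>" and lin: "\<And>X Y. X \<in> \<C> \<Longrightarrow> Y \<in> \<C> \<Longrightarrow> X \<subseteq> Y \<or> Y \<subseteq> X"
   by (auto simp: subset.chain_def)
  have "poly_ideal n (\<Union>\<C>)"
   unfolding poly_ideal_def
  proof (intro conjI ballI)
   show "\<Union>\<C> \<subseteq> polys n" "0 \<in> \<Union>\<C>" using sub C(1) by (auto simp: \<A>_def poly_ideal_def)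
   show "q * p \<in> \<Union>\<C>" if pq: "p \<in> \<Union>\<C>" "q \<in> polys n" for p q
   proof -
    obtain X where "X \<in> \<C>" "p \<in> X" using pq by blast
    then show ?thesis using sub pq(2) unfolding \<A>_def poly_ideal_def by blast
   qed
   fix p q assume "p \<in> \<Union>\<C>" "q \<in> \<Union>\<C>"
   then obtain X Y where XY: "X \<in> \<C>" "Y \<in> \<C>" "p \<in> X" "q \<in> Y" by auto
   then obtain Z where "Z \<in> \<C>" "p \<in> Z" "q \<in> Z" using lin[of X Y] by blast
   then have "p + q \<in> Z" using sub unfolding \<A>_def poly_ideal_def by blast
   then show "p + q \<in> \<Union>\<C>" using \<open>Z \<in> \<C>\<close> by blast
  qed
  moreover have "I \<subseteq> \<Union>\<C>" "1 \<notin> \<Union>\<C>" using C(1) sub by (auto simp: \<A>_def)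
  ultimately show "\<Union>\<C> \<in> \<A>" by (simp add: \<A>_def)
 qed
 then obtain M where M: "M \<in> \<A>" "\<And>X. X \<in> \<A> \<Longrightarrow> M \<subseteq> X \<Longrightarrow> X = M" by blast
 show ?thesis by (rule that[of M]) (use M in \<open>auto simp: \<A>_def\<close>)
qed

lemma sum_ideal:
 assumes "poly_ideal n I" "p \<in> polys n"
 shows "poly_ideal n {a + q * p | a q. a \<in> I \<and> q \<in> polys n}"
 unfolding poly_ideal_def
proof (intro conjI ballI subsetI)
 let ?J = "{a + q * p | a q. a \<in> I \<and> q \<in> polys n}"
 show "x \<in> polys n" if "x \<in> ?J" for x
  using that assms poly_idealD(1)[OF assms(1)] by auto
 show "0 \<in> ?J" using poly_idealD(2)[OF assms(1)] by (auto intro!: exI[of _ 0])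
 show "x + y \<in> ?J" if xy: "x \<in> ?J" "y \<in> ?J" for x y
 proof -
  obtain a q b r where "x = a + q * p" "a \<in> I" "q \<in> polys n" "y = b + r * p" "b \<in> I" "r \<in> polys n" using xy by auto
  then have "x + y = (a + b) + (q + r) * p" "a + b \<in> I" "q + r \<in> polys n"
   using poly_idealD(3)[OF assms(1)] by (auto simp: algebra_simps)
  then show ?thesis by blast
 qed
 show "y * x \<in> ?J" if xy: "x \<in> ?J" "y \<in> polys n" for x y
 proof -
  obtain a q where "x = a + q * p" "a \<in> I" "q \<in> polys n" using xy by auto
  then have "y * x = y * a + (y * q) * p" "y * a \<in> I" "y * q \<in> polys n"
   using poly_idealD(4)[OF assms(1)] xy by (auto simp: algebra_simps)
  then show ?thesis by blast
 qed
qed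

text \<open>The univariate polynomial \<open>r\<close>, read as a polynomial in the variable \<open>x\<^sub>i\<close>.\<close>

definition subst_var :: "nat \<Rightarrow> complex poly \<Rightarrow> cpoly" where
 "subst_var i r = poly (map_poly Const r) (Var i)"

lemma subst_var_0 [simp]: "subst_var i 0 = 0" by (simp add: subst_var_def)
lemma subst_var_pCons: "subst_var i (pCons a p) = Const a + Var i * subst_var i p"
 by (simp add: subst_var_def Polynomial.map_poly_pCons)
lemma subst_var_add: "subst_var i (p + q) = subst_var i p + subst_var i q"
 by (induction p q rule: poly_induct2) (simp_all add: subst_var_pCons single_add algebra_simps)
lemma subst_var_smult: "subst_var i (Polynomial.smult c p) = Const c * subst_var i p"
 by (induction p) (simp_all add: subst_var_pCons mult_single algebra_simps)
lemma subst_var_linear: "subst_var i ([:-z, 1:] * p) = (Var i - Const z) * subst_var i p"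
proof -
 have "[:-z, 1:] * p = Polynomial.smult (- z) p + pCons 0 p" by simp
 then show ?thesis
  by (simp only: subst_var_add subst_var_smult subst_var_pCons single_uminus) (simp add: algebra_simps)
qed
lemma subst_var_sum: "subst_var i (sum f A) = (\<Sum>a\<in>A. subst_var i (f a))"
 by (induction A rule: infinite_finite_induct) (auto simp: subst_var_add)
lemma subst_var_1: "subst_var i 1 = 1"
 by (simp add: one_pCons subst_var_pCons)
lemma subst_var_prod: "finite S \<Longrightarrow> subst_var i (\<Prod>b\<in>S. [:-b, 1:]) = (\<Prod>b\<in>S. Var i - Const b)"
 by (induction S rule: finite_induct) (simp_all add: subst_var_1 subst_var_linear del: mult_pCons_left)

lemma finite_bounded_monomials: "finite {m. supp m \<subseteq> {..n::nat} \<and> mdeg m \<le> d}"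
proof (induction d)
 case 0
 have "{m. supp m \<subseteq> {..n} \<and> mdeg m \<le> 0} \<subseteq> {0}" by (auto simp: mdeg_eq_0_iff)
 then show ?case by (rule finite_subset) simp
next
 case (Suc d)
 have "{m. supp m \<subseteq> {..n} \<and> mdeg m \<le> Suc d} \<subseteq>
   insert 0 ((\<lambda>(i, m). mono1 i + m) ` ({..n} \<times> {m. supp m \<subseteq> {..n} \<and> mdeg m \<le> d}))"
 proof
  fix m assume "m \<in> {m. supp m \<subseteq> {..n} \<and> mdeg m \<le> Suc d}"
  then have m: "supp m \<subseteq> {..n}" "mdeg m \<le> Suc d" by auto
  show "m \<in> insert 0 ((\<lambda>(i, m). mono1 i + m) ` ({..n} \<times> {m. supp m \<subseteq> {..n} \<and> mdeg m \<le> d}))"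
  proof (cases "m = 0")
   case False
   then obtain i where i: "lkp m i \<noteq> 0" using poly_mapping_eqI[of m 0] by auto
   define m' where "m' = m - mono1 i"
   have eq: "m = mono1 i + m'" unfolding m'_def by (rule split_off_variable[OF i])
   have "i \<in> {..n}" "supp m' \<subseteq> {..n}" "mdeg m' \<le> d"
    using m mdeg_mono1[of i] by (auto simp: eq supp_add_nat mdeg_add)
   then show ?thesis unfolding eq by (intro insertI2 image_eqI[of _ _ "(i, m')"]) auto
  qed simp
 qed
 then show ?case by (rule finite_subset) (use Suc in auto)
qed

interpretation cpoly_vs: vector_space "\<lambda>c (p::cpoly). Const c * p"
 by unfold_locales (auto simp: algebra_simps single_add mult_single)

text \<open>The field \<open>\<complex>\<close> is uncountable, while the polynomials form a union of countably many finite-dimensional spaces.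
 If no \<open>x\<^sub>i - a\<close> lies in a maximal ideal, the inverses of all \<open>x\<^sub>i - a\<close> modulo the ideal satisfy a linear relation;
 clearing denominators yields a non-zero polynomial in \<open>x\<^sub>i\<close> alone in the ideal, and one of its linear factors lies in
 the ideal after all. So a maximal ideal is the ideal of a point.\<close>

lemma weak_nullstellensatz:
 assumes I: "poly_ideal n I" "1 \<notin> I"
 obtains v where "v \<in> carr n" "\<And>p. p \<in> I \<Longrightarrow> ev p v = 0"
proof -
 obtain M where M: "poly_ideal n M" "I \<subseteq> M" "1 \<notin> M"
  "\<And>J. poly_ideal n J \<Longrightarrow> M \<subseteq> J \<Longrightarrow> 1 \<notin> J \<Longrightarrow> J = M"
  using maximal_ideal_exists[OF I] by blast
 note MD = poly_idealD[OF M(1)]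
 have inv: "\<exists>q\<in>polys n. 1 - q * p \<in> M" if p: "p \<in> polys n" "p \<notin> M" for p
 proof (rule ccontr)
  assume none: "\<not> ?thesis"
  let ?J = "{a + q * p | a q. a \<in> M \<and> q \<in> polys n}"
  have "1 \<notin> ?J"
  proof
   assume "1 \<in> ?J"
   then obtain a q where "1 = a + q * p" "a \<in> M" "q \<in> polys n" by auto
   then have "1 - q * p \<in> M" by (metis add_diff_cancel_right')
   then show False using none \<open>q \<in> polys n\<close> by blast
  qed
  moreover have "M \<subseteq> ?J" by (force intro: exI[of _ 0])
  ultimately have "?J = M" using sum_ideal[OF M(1) p(1)] M(4) by blast
  moreover have "0 + 1 * p \<in> ?J" using MD(2) polys_1 by blast
  ultimately show False using p by simp
 qed
 have prime: "p \<in> M \<or> q \<in> M" if pq: "p * q \<in> M" "p \<in> polys n" "q \<in> polys n" for p q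
 proof (rule ccontr)
  assume n: "\<not> (p \<in> M \<or> q \<in> M)"
  then obtain r where r: "r \<in> polys n" "1 - r * p \<in> M" using inv pq by blast
  have "r * (p * q) + (1 - r * p) * q \<in> M"
   by (intro MD(3) MD(4)[OF pq(1) r(1)] MD(5)[OF r(2) pq(3)])
  moreover have "r * (p * q) + (1 - r * p) * q = q" by (simp add: algebra_simps)
  ultimately show False using n by simp
 qed
 have C: "c = 0" if "Const c \<in> M" for c
 proof (rule ccontr)
  assume "c \<noteq> 0"
  moreover have "Const (1 / c) * Const c \<in> M" by (rule MD(4)[OF that polys_Const])
  ultimately show False using M(3) by (simp add: mult_single)
 qed
 have root: "\<exists>a. Var i - Const a \<in> M" if "i \<le> n" "r \<noteq> 0" "subst_var i r \<in> M" for i r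
  using that(2,3)
 proof (induction "degree r" arbitrary: r)
  case 0
  then obtain c where "r = [:c:]" "c \<noteq> 0" by (metis degree_eq_zeroE pCons_0_0)
  then show ?case using C[of c] 0 by (simp add: subst_var_pCons)
 next
  case (Suc d)
  then have "\<not> constant (poly r)" using constant_degree by (metis nat.simps(3))
  then obtain z where "poly r z = 0" using fundamental_theorem_of_algebra by blast
  then obtain r' where r: "r = [:-z, 1:] * r'" using poly_eq_0_iff_dvd by (metis dvdE)
  have r': "r' \<noteq> 0" using Suc.prems r by auto
  then have "degree r' = d" using Suc(2) unfolding r by (subst (asm) degree_mult_eq) auto
  moreover have "subst_var i r' \<in> polys n" for r'
   by (induction r') (use that(1) in \<open>auto simp: subst_var_pCons intro!: polys_add polys_mult\<close>)
  then have "Var i - Const z \<in> M \<or> subst_var i r' \<in> M"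
   using Suc.prems(2) that(1) unfolding r subst_var_linear by (intro prime) auto
  ultimately show ?case using Suc(1) r' by blast
 qed
 have "\<exists>a. Var i - Const a \<in> M" if i: "i \<le> n" for i
 proof (rule ccontr)
  assume none: "\<not> ?thesis"
  have "\<forall>a. \<exists>q. q \<in> polys n \<and> 1 - q * (Var i - Const a) \<in> M"
   using none i by (intro allI) (meson inv polys_Const polys_Var polys_diff)
  from choice[OF this] obtain q where q: "\<And>a. q a \<in> polys n" "\<And>a. 1 - q a * (Var i - Const a) \<in> M" by blast
  \<comment> \<open>The inverses are pairwise distinct, so uncountably many of them have bounded degree.\<close>
  have inj: "inj q"
  proof (rule injI, rule ccontr)
   fix a b assume ab: "q a = q b" "a \<noteq> b"
   have qab: "(1 - q b * (Var i - Const b)) - (1 - q a * (Var i - Const a)) \<in> M" by (intro MD q)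
   have eq: "(1 - q b * (Var i - Const b)) - (1 - q a * (Var i - Const a)) = Const (b - a) * q a"
    unfolding ab(1) by (simp add: algebra_simps single_diff)
   have "Const (1 / (b - a)) * (Const (b - a) * q a) \<in> M"
    by (rule MD(4)) (use qab eq in auto)
   moreover have "Const (1 / (b - a)) * (Const (b - a) * q a) = q a"
   proof -
    have "1 / (b - a) * (b - a) = 1" using ab(2) by simp
    then show ?thesis by (simp only: mult.assoc[symmetric] mult_single add_0_right) simp
   qed
   ultimately have "q a \<in> M" by (simp only:)
   then have "1 - q a * (Var i - Const a) + q a * (Var i - Const a) \<in> M"
    using i by (intro MD(3) q MD(5) polys_diff) auto
   then show False using M(3) by simp
  qed
  have "(\<Union>d. {a. \<forall>m\<in>supp (q a). mdeg m \<le> d}) = UNIV"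
  proof -
   have "\<exists>d. \<forall>m\<in>supp (q a). mdeg m \<le> d" for a
    using finite_nat_set_iff_bounded_le[of "mdeg ` supp (q a)"] by auto
   then show ?thesis by auto
  qed
  then have unc: "\<not> countable (\<Union>d. {a. \<forall>m\<in>supp (q a). mdeg m \<le> d})"
   using uncountable_UNIV_complex by simp
  have "\<exists>d. \<not> countable {a. \<forall>m\<in>supp (q a). mdeg m \<le> d}"
  proof (rule ccontr)
   assume "\<not> ?thesis"
   then have "countable (\<Union>d. {a. \<forall>m\<in>supp (q a). mdeg m \<le> d})" by (intro countable_UN) auto
   then show False using unc by simp
  qed
  then obtain d where d: "\<not> countable {a. \<forall>m\<in>supp (q a). mdeg m \<le> d}" ..
  define A where "A = {a. \<forall>m\<in>supp (q a). mdeg m \<le> d}"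
  have infA: "infinite A" using d countable_finite unfolding A_def by blast
  define B where "B = (\<lambda>m. Poly_Mapping.single m (1::complex)) ` {m. supp m \<subseteq> {..n} \<and> mdeg m \<le> d}"
  have B: "finite B" unfolding B_def by (intro finite_imageI finite_bounded_monomials)
  have span: "q ` A \<subseteq> cpoly_vs.span B"
  proof
   fix p assume "p \<in> q ` A"
   then have p: "\<And>m. m \<in> supp p \<Longrightarrow> supp m \<subseteq> {..n} \<and> mdeg m \<le> d" using q(1) by (auto simp: A_def polys_iff)
   have "p = (\<Sum>m\<in>supp p. Const (lkp p m) * Poly_Mapping.single m 1)"
    by (subst cpoly_expand) (simp add: mult_single)
   also have "\<dots> \<in> cpoly_vs.span B"
    by (intro cpoly_vs.span_sum cpoly_vs.span_scale cpoly_vs.span_base) (use p in \<open>auto simp: B_def\<close>)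
   finally show "p \<in> cpoly_vs.span B" .
  qed
  have "infinite (q ` A)" using infA finite_imageD inj inj_on_subset by blast
  then have "cpoly_vs.dependent (q ` A)" using cpoly_vs.independent_span_bound[OF B _ span] by blast
  then obtain T u where T: "finite T" "T \<subseteq> q ` A" "(\<Sum>p\<in>T. Const (u p) * p) = 0" "\<exists>p\<in>T. u p \<noteq> 0"
   unfolding cpoly_vs.dependent_explicit by blast
  define t where "t = q -` T"
  have Tt: "T = q ` t" using T(2) by (auto simp: t_def)
  have t: "finite t" unfolding t_def using T(1) inj by (rule finite_vimageI)
  have sum0: "(\<Sum>a\<in>t. Const (u (q a)) * q a) = 0"
   using T(3) unfolding Tt by (subst (asm) sum.reindex) (use inj inj_on_subset in auto)
  obtain a0 where a0: "a0 \<in> t" "u (q a0) \<noteq> 0" using T(4) Tt by auto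
  define r where "r = (\<Sum>a\<in>t. Polynomial.smult (u (q a)) (\<Prod>b\<in>t-{a}. [:-b, 1:]))"
  have "poly r a0 = (\<Sum>a\<in>t. u (q a) * (\<Prod>b\<in>t-{a}. a0 - b))"
   by (simp add: r_def poly_sum poly_prod)
  also have "\<dots> = (\<Sum>a\<in>t. if a = a0 then u (q a) * (\<Prod>b\<in>t-{a}. a0 - b) else 0)"
  proof (rule sum.cong[OF refl])
   fix a assume "a \<in> t"
   show "u (q a) * (\<Prod>b\<in>t-{a}. a0 - b) = (if a = a0 then u (q a) * (\<Prod>b\<in>t-{a}. a0 - b) else 0)"
    using a0 t by auto
  qed
  also have "\<dots> = u (q a0) * (\<Prod>b\<in>t-{a0}. a0 - b)" using a0 t by simp
  also have "\<dots> \<noteq> 0" using a0 t by auto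
  finally have "r \<noteq> 0" by auto
  let ?L = "\<lambda>b. Var i - Const b"
  have Lp: "?L b \<in> polys n" for b using i by auto
  have "subst_var i r = (\<Sum>a\<in>t. Const (u (q a)) * (\<Prod>b\<in>t-{a}. ?L b))"
   using t by (simp add: r_def subst_var_sum subst_var_smult subst_var_prod)
  also have "\<dots> = (\<Sum>a\<in>t. Const (u (q a)) * (1 - q a * ?L a) * (\<Prod>b\<in>t-{a}. ?L b))
    + (\<Sum>a\<in>t. Const (u (q a)) * q a) * (\<Prod>b\<in>t. ?L b)"
  proof -
   have "(\<Sum>a\<in>t. Const (u (q a)) * q a) * (\<Prod>b\<in>t. ?L b)
     = (\<Sum>a\<in>t. Const (u (q a)) * q a * (?L a * (\<Prod>b\<in>t-{a}. ?L b)))"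
    unfolding sum_distrib_right by (rule sum.cong[OF refl]) (use t in \<open>simp add: prod.remove\<close>)
   then show ?thesis unfolding sum.distrib[symmetric] by (simp add: sum.distrib[symmetric] algebra_simps)
  qed
  also have "\<dots> \<in> M"
  proof -
   have P: "(\<Prod>b\<in>S. ?L b) \<in> polys n" for S
    by (induction S rule: infinite_finite_induct) (use Lp in auto)
   show ?thesis unfolding sum0 by (simp, intro poly_ideal_sum[OF M(1)] MD(5) MD(4) q P) auto
  qed
  finally have "subst_var i r \<in> M" .
  then show False using root[OF i \<open>r \<noteq> 0\<close>] none by blast
 qed
 then have "\<forall>i\<in>{..n}. \<exists>a. Var i - Const a \<in> M" by auto
 from bchoice[OF this] obtain a where a: "\<And>i. i \<le> n \<Longrightarrow> Var i - Const (a i) \<in> M" by auto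
 define v where "v = vec (Suc n) a"
 have ev: "p - Const (ev p v) \<in> M" if "p \<in> polys n" for p
  using that
 proof (induction p rule: polys_induct)
  case (Const c) then show ?case using MD(2) by simp
 next
  case (Var i) then show ?case using a[of i] mon_mono1[of i v] by (simp add: v_def)
 next
  case (add p q)
  have "(p - Const (ev p v)) + (q - Const (ev q v)) \<in> M" by (rule MD(3)[OF add(3,4)])
  then show ?case by (simp add: algebra_simps single_add)
 next
  case (mult p q)
  have "(p - Const (ev p v)) * q + Const (ev p v) * (q - Const (ev q v)) \<in> M"
   by (rule MD(3)[OF MD(5)[OF mult(3) mult(2)] MD(4)[OF mult(4) polys_Const]])
  moreover have "(p - Const (ev p v)) * q + Const (ev p v) * (q - Const (ev q v))
    = p * q - Const (ev (p * q) v)"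
   by (simp add: algebra_simps mult_single)
  ultimately show ?case by simp
 qed
 show ?thesis
 proof (rule that)
  show "v \<in> carr n" by (simp add: v_def)
  fix p assume p: "p \<in> I"
  then have "p \<in> M" "p \<in> polys n" using M(2) MD(1) by auto
  then have "p - (p - Const (ev p v)) \<in> M" by (intro MD(6) ev)
  then show "ev p v = 0" by (intro C) simp
 qed
qed

lemma hcomp_diff: "hcomp d (p - q) = hcomp d p - hcomp d q"
 by (rule poly_mapping_eqI) (simp add: lookup_hcomp lookup_minus)

lemma hcomp_mult_low:
 assumes "homogeneous n k q" "d < k"
 shows "hcomp d (p * q) = 0"
proof (rule poly_mapping_eqI)
 fix m
 have "lkp (p * q) m = 0" if "mdeg m = d"
 proof (rule ccontr)
  assume "lkp (p * q) m \<noteq> 0"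
  then have "m \<in> supp (p * q)" by (simp add: in_keys_iff)
  then obtain a b where "m = a + b" "b \<in> supp q" using keys_mult[of p q] by blast
  then have "mdeg m = mdeg a + k" using assms(1) by (simp add: mdeg_add homogeneous_iff)
  then show False using that assms(2) by simp
 qed
 then show "lkp (hcomp d (p * q)) m = lkp 0 m" by (simp add: lookup_hcomp)
qed

lemma hcomp_vanishes_above:
 obtains d0 where "\<And>d. d \<ge> d0 \<Longrightarrow> hcomp d p = 0"
proof -
 obtain d where d: "\<And>m. m \<in> supp p \<Longrightarrow> mdeg m < d"
  using finite_nat_set_iff_bounded[of "mdeg ` supp p"] by auto
 have "hcomp e p = 0" if "e \<ge> d" for e
  by (rule poly_mapping_eqI) (use d that in \<open>force simp: lookup_hcomp in_keys_iff\<close>)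
 then show ?thesis using that by blast
qed

text \<open>The given forms and \<open>x\<^sub>i - 1\<close> have no common zero, so \<open>1 = a + h (x\<^sub>i - 1)\<close> with \<open>a\<close> in the ideal \<open>J\<close> of the forms.
 Comparing homogeneous components inductively gives \<open>x\<^sub>i\<^sup>d + h\<^sub>d \<in> J\<close> for all \<open>d\<close>, and \<open>h\<^sub>d = 0\<close> for large \<open>d\<close>.\<close>

lemma homogeneous_nullstellensatz:
 assumes g: "\<And>j. j \<le> n \<Longrightarrow> homogeneous n k (g j)"
  and nz: "\<And>v. v \<in> carr n \<Longrightarrow> v \<noteq> zvec n \<Longrightarrow> \<exists>j\<le>n. ev (g j) v \<noteq> 0"
  and i: "i \<le> n"
 obtains N h where "\<And>j. j \<le> n \<Longrightarrow> homogeneous n N (h j)" "Var i ^ (N + k) = (\<Sum>j\<le>n. h j * g j)"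
proof -
 define J where "J = {\<Sum>j\<le>n. h j * g j | h. \<forall>j\<le>n. h j \<in> polys n}"
 have J: "poly_ideal n J"
  unfolding poly_ideal_def
 proof (intro conjI ballI subsetI)
  show "x \<in> polys n" if "x \<in> J" for x
   using that g homogeneous_polys by (fastforce simp: J_def)
  show "0 \<in> J" unfolding J_def by (rule CollectI, rule exI[of _ "\<lambda>_. 0"]) simp
  show "x + y \<in> J" if xy: "x \<in> J" "y \<in> J" for x y
  proof -
   obtain h h' where h: "x = (\<Sum>j\<le>n. h j * g j)" "\<forall>j\<le>n. h j \<in> polys n"
    "y = (\<Sum>j\<le>n. h' j * g j)" "\<forall>j\<le>n. h' j \<in> polys n" using xy unfolding J_def by blast
   then show ?thesis unfolding J_def
    by (intro CollectI exI[of _ "\<lambda>j. h j + h' j"]) (auto simp: algebra_simps sum.distrib)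
  qed
  show "y * x \<in> J" if xy: "x \<in> J" "y \<in> polys n" for x y
  proof -
   obtain h where h: "x = (\<Sum>j\<le>n. h j * g j)" "\<forall>j\<le>n. h j \<in> polys n" using xy unfolding J_def by blast
   then show ?thesis unfolding J_def using xy
    by (intro CollectI exI[of _ "\<lambda>j. y * h j"]) (auto simp: sum_distrib_left mult.assoc)
  qed
 qed
 note JD = poly_idealD[OF J]
 have gJ: "g j \<in> J" if "j \<le> n" for j
 proof -
  have "(\<Sum>l\<le>n. (if l = j then 1 else 0) * g l) = (\<Sum>l\<le>n. if l = j then g l else 0)"
   by (rule sum.cong) auto
  also have "\<dots> = g j" using that by simp
  finally have "g j = (\<Sum>l\<le>n. (if l = j then 1 else 0) * g l)" ..
  then show ?thesis unfolding J_def by (intro CollectI exI[of _ "\<lambda>l. if l = j then 1 else 0"]) auto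
 qed
 have hc: "hcomp d (\<Sum>j\<le>n. h j * g j) = (\<Sum>j\<le>n. (if d < k then 0 else hcomp (d - k) (h j)) * g j)" for d h
 proof -
  have "hcomp d (h j * g j) = (if d < k then 0 else hcomp (d - k) (h j)) * g j" if "j \<le> n" for j
  proof (cases "d < k")
   case True then show ?thesis using hcomp_mult_low[OF g[OF that]] by simp
  next
   case False then show ?thesis using hcomp_mult_homogeneous[OF g[OF that], of "d - k" "h j"] by simp
  qed
  then show ?thesis by (simp add: hcomp_sum)
 qed
 have Jh: "hcomp d x \<in> J" if xJ: "x \<in> J" for d x
 proof -
  obtain h where h: "x = (\<Sum>j\<le>n. h j * g j)" "\<forall>j\<le>n. h j \<in> polys n" using xJ unfolding J_def by blast
  show ?thesis unfolding h(1) hc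
   by (intro poly_ideal_sum[OF J] JD(4) gJ) (use h(2) in \<open>auto intro: homogeneous_polys homogeneous_hcomp\<close>)
 qed
 let ?I = "{a + q * (Var i - 1) | a q. a \<in> J \<and> q \<in> polys n}"
 have vi: "Var i - 1 \<in> polys n" using i by auto
 have I: "poly_ideal n ?I" by (rule sum_ideal[OF J vi])
 have "1 \<in> ?I"
 proof (rule ccontr)
  assume "1 \<notin> ?I"
  then obtain v where v: "v \<in> carr n" "\<And>p. p \<in> ?I \<Longrightarrow> ev p v = 0"
   using weak_nullstellensatz[OF I] by blast
  have "0 + 1 * (Var i - 1) \<in> ?I" using JD(2) polys_1 by blast
  then have "ev (Var i - 1) v = 0" using v(2)[of "0 + 1 * (Var i - 1)"] by simp
  then have "v $ i = 1" using mon_mono1[of i v] by simp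
  then have "v \<noteq> zvec n" using i by auto
  then obtain j where j: "j \<le> n" "ev (g j) v \<noteq> 0" using nz v(1) by blast
  have "g j + 0 * (Var i - 1) \<in> ?I" using gJ[OF j(1)] polys_0 by blast
  then show False using v(2)[of "g j + 0 * (Var i - 1)"] j by simp
 qed
 then obtain a h where ah: "1 = a + h * (Var i - 1)" "a \<in> J" "h \<in> polys n" by blast
 then have eq: "1 = a + h * Var i - h" by (simp add: algebra_simps)
 have V1: "homogeneous n 1 (Var i)" by (rule homogeneous_Var[OF i])
 have ind: "Var i ^ d + hcomp d h \<in> J" for d
 proof (induction d)
  case 0
  have "hcomp 0 1 = hcomp 0 (a + h * Var i - h)" using eq by simp
  then have "1 = hcomp 0 a - hcomp 0 h"
   using hcomp_homogeneous[OF homogeneous_1[of n], of 0] hcomp_mult_low[OF V1, of 0 h]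
   by (simp add: hcomp_add hcomp_diff)
  then have "1 + hcomp 0 h = hcomp 0 a" by (metis diff_add_cancel)
  then show ?case using Jh[OF ah(2)] by simp
 next
  case (Suc d)
  have "hcomp (Suc d) 1 = hcomp (Suc d) (a + h * Var i - h)" using eq by simp
  then have "0 = hcomp (Suc d) a + hcomp d h * Var i - hcomp (Suc d) h"
   using hcomp_homogeneous[OF homogeneous_1[of n], of "Suc d"] hcomp_mult_homogeneous[OF V1, of d h]
   by (simp add: hcomp_add hcomp_diff)
  then have "hcomp (Suc d) h = hcomp (Suc d) a + hcomp d h * Var i" by (metis eq_iff_diff_eq_0)
  then have "Var i ^ Suc d + hcomp (Suc d) h = Var i * (Var i ^ d + hcomp d h) + hcomp (Suc d) a"
   by (simp add: algebra_simps)
  also have "\<dots> \<in> J" by (intro JD(3) JD(4)[OF Suc] Jh ah polys_Var i)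
  finally show ?case .
 qed
 obtain d0 where d0: "\<And>d. d \<ge> d0 \<Longrightarrow> hcomp d h = 0" using hcomp_vanishes_above by blast
 have "Var i ^ (d0 + k) \<in> J" using ind[of "d0 + k"] d0[of "d0 + k"] by simp
 then obtain h' where h': "Var i ^ (d0 + k) = (\<Sum>j\<le>n. h' j * g j)" "\<forall>j\<le>n. h' j \<in> polys n"
  unfolding J_def by blast
 have "homogeneous n (d0 + k) (Var i ^ (d0 + k))" using homogeneous_power[OF V1, of "d0 + k"] by simp
 then have "Var i ^ (d0 + k) = hcomp (d0 + k) (\<Sum>j\<le>n. h' j * g j)"
  unfolding h'(1)[symmetric] by (simp add: hcomp_homogeneous)
 then have "Var i ^ (d0 + k) = (\<Sum>j\<le>n. hcomp d0 (h' j) * g j)" unfolding hc by simp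
 then show ?thesis using that[of d0 "\<lambda>j. hcomp d0 (h' j)"] homogeneous_hcomp h'(2) by blast
qed

section \<open>Open cones\<close>

text \<open>The cones over Zariski open sets, described by basic neighbourhoods of their points.\<close>

definition ocone :: "nat \<Rightarrow> complex vec set \<Rightarrow> bool" where
 "ocone n K \<longleftrightarrow> K \<subseteq> carr n - {zvec n} \<and>
  (\<forall>v\<in>K. \<exists>d w. d \<ge> 1 \<and> homogeneous n d w \<and> ev w v \<noteq> 0 \<and>
    (\<forall>u\<in>carr n. ev w u \<noteq> 0 \<longrightarrow> u \<in> K))"

lemma oconeE:
 assumes "ocone n K" "v \<in> K"
 obtains d w where "d \<ge> 1" "homogeneous n d w" "ev w v \<noteq> 0"
  "\<And>u. u \<in> carr n \<Longrightarrow> ev w u \<noteq> 0 \<Longrightarrow> u \<in> K"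
proof -
 from assms have "\<exists>d w. d \<ge> 1 \<and> homogeneous n d w \<and> ev w v \<noteq> 0 \<and>
    (\<forall>u\<in>carr n. ev w u \<noteq> 0 \<longrightarrow> u \<in> K)" unfolding ocone_def by blast
 then show ?thesis using that by blast
qed

lemma ocone_carr: "ocone n K \<Longrightarrow> v \<in> K \<Longrightarrow> v \<in> carr n"
 by (auto simp: ocone_def)
lemma ocone_sub: "ocone n K \<Longrightarrow> K \<subseteq> carr n"
 by (auto simp: ocone_def)
lemma ocone_nonzero: "ocone n K \<Longrightarrow> v \<in> K \<Longrightarrow> v \<noteq> zvec n"
 by (auto simp: ocone_def)

lemma homogeneous_eval_0: "homogeneous n d w \<Longrightarrow> d \<ge> 1 \<Longrightarrow> ev w (zvec n) = 0"
proof -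
 assume w: "homogeneous n d w" "d \<ge> 1"
 have "0 \<cdot>\<^sub>v zvec n = (zvec n :: complex vec)" by (intro eq_vecI) auto
 then show ?thesis using homogeneous_eval[OF w(1), of "zvec n" 0] w(2) by (simp add: power_0_left)
qed

lemma nonzero_coord:
 assumes "v \<in> carr n" "v \<noteq> zvec n"
 obtains i where "i \<le> n" "v $ i \<noteq> 0"
 using assms by (metis carrier_vecD eq_vecI index_zero_vec(1,2) less_Suc_eq_le)

lemma ocone_Int:
 assumes "ocone n K" "ocone n L" shows "ocone n (K \<inter> L)"
 unfolding ocone_def
proof (intro conjI ballI)
 show "K \<inter> L \<subseteq> carr n - {zvec n}" using assms by (auto simp: ocone_def)
 fix v assume v: "v \<in> K \<inter> L"
 obtain d w where 1: "d \<ge> 1" "homogeneous n d w" "ev w v \<noteq> 0"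
  "\<And>u. u \<in> carr n \<Longrightarrow> ev w u \<noteq> 0 \<Longrightarrow> u \<in> K" using oconeE[OF assms(1)] v by blast
 obtain d' w' where 2: "d' \<ge> 1" "homogeneous n d' w'" "ev w' v \<noteq> 0"
  "\<And>u. u \<in> carr n \<Longrightarrow> ev w' u \<noteq> 0 \<Longrightarrow> u \<in> L" using oconeE[OF assms(2)] v by blast
 show "\<exists>d w. d \<ge> 1 \<and> homogeneous n d w \<and> ev w v \<noteq> 0 \<and>
    (\<forall>u\<in>carr n. ev w u \<noteq> 0 \<longrightarrow> u \<in> K \<inter> L)"
  using 1 2 homogeneous_mult[OF 1(2) 2(2)]
  by (intro exI[of _ "d + d'"] exI[of _ "w * w'"]) auto
qed

definition basic_cone :: "nat \<Rightarrow> cpoly \<Rightarrow> complex vec set" where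
 "basic_cone n h = {v\<in>carr n. v \<noteq> zvec n \<and> ev h v \<noteq> 0}"

lemma ocone_basic: "homogeneous n d h \<Longrightarrow> ocone n (basic_cone n h)"
 unfolding ocone_def
proof (intro conjI ballI)
 assume h: "homogeneous n d h"
 show "basic_cone n h \<subseteq> carr n - {zvec n}" by (auto simp: basic_cone_def)
 fix v assume v: "v \<in> basic_cone n h"
 then obtain i where i: "i \<le> n" "v $ i \<noteq> 0" using nonzero_coord by (auto simp: basic_cone_def)
 have "homogeneous n (d + 1) (h * Var i)" by (intro homogeneous_mult h homogeneous_Var i)
 moreover have "ev (h * Var i) v \<noteq> 0" using v i mon_mono1[of i v] by (simp add: basic_cone_def)
 moreover have "u \<in> basic_cone n h" if "u \<in> carr n" "ev (h * Var i) u \<noteq> 0" for u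
  using that i mon_mono1[of i u] by (auto simp: basic_cone_def)
 ultimately show "\<exists>d w. d \<ge> 1 \<and> homogeneous n d w \<and> ev w v \<noteq> 0 \<and>
    (\<forall>u\<in>carr n. ev w u \<noteq> 0 \<longrightarrow> u \<in> basic_cone n h)"
  by (intro exI[of _ "d + 1"] exI[of _ "h * Var i"]) auto
qed

lemma hregI:
 assumes "\<And>v. v \<in> K \<Longrightarrow> \<exists>c d g h. homogeneous n c g \<and> homogeneous n d h \<and> int c = int d + e \<and> d \<ge> 1 \<and>
   ev h v \<noteq> 0 \<and> (\<forall>u\<in>carr n. ev h u \<noteq> 0 \<longrightarrow> u \<in> K \<and> F u = ev g u / ev h u)"
 shows "hreg n K e F"
 using assms unfolding hreg_def by blast

lemma hreg_rep_eval_ne: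
 "homogeneous n d h \<Longrightarrow> d \<ge> 1 \<Longrightarrow> u \<in> carr n \<Longrightarrow> ev h u \<noteq> 0 \<Longrightarrow> u \<in> basic_cone n h"
 using homogeneous_eval_0 by (auto simp: basic_cone_def)

lemma hreg_cong:
 assumes "\<And>v. v \<in> K \<Longrightarrow> F v = G v" shows "hreg n K e F \<longleftrightarrow> hreg n K e G"
proof -
 have "hreg n K e G" if FG: "hreg n K e F" "\<And>v. v \<in> K \<Longrightarrow> F v = G v" for F G
 proof (rule hregI)
  fix v assume "v \<in> K"
  then obtain c d g h where "homogeneous n c g" "homogeneous n d h" "int c = int d + e" "d \<ge> 1"
  "ev h v \<noteq> 0" "\<And>u. u \<in> carr n \<Longrightarrow> ev h u \<noteq> 0 \<Longrightarrow> u \<in> K"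
  "\<And>u. u \<in> carr n \<Longrightarrow> ev h u \<noteq> 0 \<Longrightarrow> F u = ev g u / ev h u"
   by (rule hregE[OF FG(1)]) blast
  then show "\<exists>c d g h. homogeneous n c g \<and> homogeneous n d h \<and> int c = int d + e \<and> d \<ge> 1 \<and>
   ev h v \<noteq> 0 \<and> (\<forall>u\<in>carr n. ev h u \<noteq> 0 \<longrightarrow> u \<in> K \<and> G u = ev g u / ev h u)"
   using FG(2) by (intro exI[of _ c] exI[of _ d] exI[of _ g] exI[of _ h]) auto
 qed
 then show ?thesis using assms by metis
qed

lemma hreg_add:
 assumes "hreg n K e F" "hreg n K e G" shows "hreg n K e (\<lambda>v. F v + G v)"
proof (rule hregI)
 fix v assume v: "v \<in> K"
 obtain c d g h where 1: "homogeneous n c g" "homogeneous n d h" "int c = int d + e" "d \<ge> 1"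
  "ev h v \<noteq> 0" "\<And>u. u \<in> carr n \<Longrightarrow> ev h u \<noteq> 0 \<Longrightarrow> u \<in> K"
  "\<And>u. u \<in> carr n \<Longrightarrow> ev h u \<noteq> 0 \<Longrightarrow> F u = ev g u / ev h u"
  by (rule hregE[OF assms(1) v]) blast
 obtain c' d' g' h' where 2: "homogeneous n c' g'" "homogeneous n d' h'" "int c' = int d' + e" "d' \<ge> 1"
  "ev h' v \<noteq> 0" "\<And>u. u \<in> carr n \<Longrightarrow> ev h' u \<noteq> 0 \<Longrightarrow> u \<in> K"
  "\<And>u. u \<in> carr n \<Longrightarrow> ev h' u \<noteq> 0 \<Longrightarrow> G u = ev g' u / ev h' u"
  by (rule hregE[OF assms(2) v]) blast
 have "c' + d = c + d'" using 1(3) 2(3) by linarith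
 then have "homogeneous n (c + d') (g * h' + g' * h)"
  using homogeneous_mult[OF 1(1) 2(2)] homogeneous_mult[OF 2(1) 1(2)] by (intro homogeneous_add) auto
 then show "\<exists>c d g h. homogeneous n c g \<and> homogeneous n d h \<and> int c = int d + e \<and> d \<ge> 1 \<and>
   ev h v \<noteq> 0 \<and> (\<forall>u\<in>carr n. ev h u \<noteq> 0 \<longrightarrow> u \<in> K \<and> F u + G u = ev g u / ev h u)"
  using 1 2 homogeneous_mult[OF 1(2) 2(2)]
  by (intro exI[of _ "c + d'"] exI[of _ "d + d'"] exI[of _ "g * h' + g' * h"] exI[of _ "h * h'"])
   (auto simp: add_frac_eq)
qed

lemma hreg_mult:
 assumes "hreg n K e F" "hreg n K e' G" "e'' = e + e'" shows "hreg n K e'' (\<lambda>v. F v * G v)"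
proof (rule hregI)
 fix v assume v: "v \<in> K"
 obtain c d g h where 1: "homogeneous n c g" "homogeneous n d h" "int c = int d + e" "d \<ge> 1"
  "ev h v \<noteq> 0" "\<And>u. u \<in> carr n \<Longrightarrow> ev h u \<noteq> 0 \<Longrightarrow> u \<in> K"
  "\<And>u. u \<in> carr n \<Longrightarrow> ev h u \<noteq> 0 \<Longrightarrow> F u = ev g u / ev h u"
  by (rule hregE[OF assms(1) v]) blast
 obtain c' d' g' h' where 2: "homogeneous n c' g'" "homogeneous n d' h'" "int c' = int d' + e'" "d' \<ge> 1"
  "ev h' v \<noteq> 0" "\<And>u. u \<in> carr n \<Longrightarrow> ev h' u \<noteq> 0 \<Longrightarrow> u \<in> K"
  "\<And>u. u \<in> carr n \<Longrightarrow> ev h' u \<noteq> 0 \<Longrightarrow> G u = ev g' u / ev h' u"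
  by (rule hregE[OF assms(2) v]) blast
 show "\<exists>c d g h. homogeneous n c g \<and> homogeneous n d h \<and> int c = int d + e'' \<and> d \<ge> 1 \<and>
   ev h v \<noteq> 0 \<and> (\<forall>u\<in>carr n. ev h u \<noteq> 0 \<longrightarrow> u \<in> K \<and> F u * G u = ev g u / ev h u)"
  using 1 2 homogeneous_mult[OF 1(2) 2(2)] homogeneous_mult[OF 1(1) 2(1)] assms(3)
  by (intro exI[of _ "c + c'"] exI[of _ "d + d'"] exI[of _ "g * g'"] exI[of _ "h * h'"]) auto
qed

lemma hreg_quotient:
 assumes K: "ocone n K" and g: "homogeneous n c g" and h: "homogeneous n d h" "\<And>v. v \<in> K \<Longrightarrow> ev h v \<noteq> 0"
  and e: "e = int c - int d"
 shows "hreg n K e (\<lambda>v. ev g v / ev h v)"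
proof (rule hregI)
 fix v assume v: "v \<in> K"
 obtain l w where w: "l \<ge> 1" "homogeneous n l w" "ev w v \<noteq> 0"
  "\<And>u. u \<in> carr n \<Longrightarrow> ev w u \<noteq> 0 \<Longrightarrow> u \<in> K" using oconeE[OF K v] by blast
 show "\<exists>c d g' h'. homogeneous n c g' \<and> homogeneous n d h' \<and> int c = int d + e \<and> d \<ge> 1 \<and>
   ev h' v \<noteq> 0 \<and> (\<forall>u\<in>carr n. ev h' u \<noteq> 0 \<longrightarrow> u \<in> K \<and>
    ev g u / ev h u = ev g' u / ev h' u)"
  using w h(2)[OF v] homogeneous_mult[OF g w(2)] homogeneous_mult[OF h(1) w(2)] e
  by (intro exI[of _ "c + l"] exI[of _ "d + l"] exI[of _ "g * w"] exI[of _ "h * w"]) auto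
qed

lemma hreg_poly:
 assumes "ocone n K" "homogeneous n c g" shows "hreg n K (int c) (ev g)"
 using hreg_quotient[OF assms homogeneous_1, of "int c"] by simp

lemma hreg_const: "ocone n K \<Longrightarrow> hreg n K 0 (\<lambda>v. c)"
 using hreg_poly[of n K 0 "Const c"] hreg_cong[of K "ev (Const c)" "\<lambda>v. c" n 0] by simp

lemma hreg_coord: "ocone n K \<Longrightarrow> i \<le> n \<Longrightarrow> hreg n K 1 (\<lambda>v. v $ i)"
 using hreg_poly[of n K 1 "Var i"] homogeneous_Var[of i n] hreg_cong[of K "ev (Var i)" "\<lambda>v. v $ i" n 1] mon_mono1[of i]
 by simp

lemma hreg_cmult: "ocone n K \<Longrightarrow> hreg n K e F \<Longrightarrow> hreg n K e (\<lambda>v. c * F v)"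
 by (rule hreg_mult[OF hreg_const]) auto

lemma hreg_uminus: "ocone n K \<Longrightarrow> hreg n K e F \<Longrightarrow> hreg n K e (\<lambda>v. - F v)"
 using hreg_cmult[of n K e F "- 1"] by simp

lemma hreg_diff: "ocone n K \<Longrightarrow> hreg n K e F \<Longrightarrow> hreg n K e G \<Longrightarrow> hreg n K e (\<lambda>v. F v - G v)"
 using hreg_add[of n K e F "\<lambda>v. - G v"] hreg_uminus by auto

lemma hreg_0: "ocone n K \<Longrightarrow> hreg n K e (\<lambda>v. 0)"
proof (cases "e \<ge> 0")
 assume K: "ocone n K"
 case True
 then show ?thesis using hreg_quotient[OF K homogeneous_0[of n "nat e"] homogeneous_1, of e] by simp
next
 assume K: "ocone n K"
 case False
 show ?thesis
 proof (rule hregI)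
  fix v assume v: "v \<in> K"
  obtain d w where w: "d \<ge> 1" "homogeneous n d w" "ev w v \<noteq> 0"
   "\<And>u. u \<in> carr n \<Longrightarrow> ev w u \<noteq> 0 \<Longrightarrow> u \<in> K" using oconeE[OF K v] by blast
  show "\<exists>c d g h. homogeneous n c g \<and> homogeneous n d h \<and> int c = int d + e \<and> d \<ge> 1 \<and>
   ev h v \<noteq> 0 \<and> (\<forall>u\<in>carr n. ev h u \<noteq> 0 \<longrightarrow> u \<in> K \<and> 0 = ev g u / ev h u)"
   using w homogeneous_power[OF w(2), of "nat (- e)"] False
   by (intro exI[of _ "nat (int (d * nat (- e)) + e)"] exI[of _ "d * nat (- e)"] exI[of _ 0] exI[of _ "w ^ nat (- e)"])
    (auto simp: algebra_simps)
 qed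
qed

lemma hreg_sum:
 assumes "ocone n K" "\<And>a. a \<in> A \<Longrightarrow> hreg n K e (F a)"
 shows "hreg n K e (\<lambda>v. \<Sum>a\<in>A. F a v)"
 using assms(2) by (induction A rule: infinite_finite_induct) (auto intro: hreg_add hreg_0[OF assms(1)])

lemma hreg_subset:
 assumes "hreg n K e F" "ocone n L" "L \<subseteq> K" shows "hreg n L e F"
proof (rule hregI)
 fix v assume v: "v \<in> L"
 obtain c d g h where 1: "homogeneous n c g" "homogeneous n d h" "int c = int d + e" "d \<ge> 1"
  "ev h v \<noteq> 0" "\<And>u. u \<in> carr n \<Longrightarrow> ev h u \<noteq> 0 \<Longrightarrow> u \<in> K"
  "\<And>u. u \<in> carr n \<Longrightarrow> ev h u \<noteq> 0 \<Longrightarrow> F u = ev g u / ev h u"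
  by (rule hregE[OF assms(1) subsetD[OF assms(3) v]]) blast
 obtain l w where w: "l \<ge> 1" "homogeneous n l w" "ev w v \<noteq> 0"
  "\<And>u. u \<in> carr n \<Longrightarrow> ev w u \<noteq> 0 \<Longrightarrow> u \<in> L" using oconeE[OF assms(2) v] by blast
 show "\<exists>c d g h. homogeneous n c g \<and> homogeneous n d h \<and> int c = int d + e \<and> d \<ge> 1 \<and>
   ev h v \<noteq> 0 \<and> (\<forall>u\<in>carr n. ev h u \<noteq> 0 \<longrightarrow> u \<in> L \<and> F u = ev g u / ev h u)"
  using 1 w homogeneous_mult[OF 1(1) w(2)] homogeneous_mult[OF 1(2) w(2)]
  by (intro exI[of _ "c + l"] exI[of _ "d + l"] exI[of _ "g * w"] exI[of _ "h * w"]) auto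
qed

lemma hreg_local:
 assumes "\<And>v. v \<in> K \<Longrightarrow> \<exists>L. v \<in> L \<and> L \<subseteq> K \<and> hreg n L e F" shows "hreg n K e F"
proof (rule hregI)
 fix v assume v: "v \<in> K"
 obtain L where L: "v \<in> L" "L \<subseteq> K" "hreg n L e F" using assms[OF v] by blast
 obtain c d g h where 1: "homogeneous n c g" "homogeneous n d h" "int c = int d + e" "d \<ge> 1"
  "ev h v \<noteq> 0" "\<And>u. u \<in> carr n \<Longrightarrow> ev h u \<noteq> 0 \<Longrightarrow> u \<in> L"
  "\<And>u. u \<in> carr n \<Longrightarrow> ev h u \<noteq> 0 \<Longrightarrow> F u = ev g u / ev h u"
  by (rule hregE[OF L(3,1)]) blast
 then show "\<exists>c d g h. homogeneous n c g \<and> homogeneous n d h \<and> int c = int d + e \<and> d \<ge> 1 \<and>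
   ev h v \<noteq> 0 \<and> (\<forall>u\<in>carr n. ev h u \<noteq> 0 \<longrightarrow> u \<in> K \<and> F u = ev g u / ev h u)"
  using L(2) by (intro exI[of _ c] exI[of _ d] exI[of _ g] exI[of _ h]) auto
qed

text \<open>Non-empty open sets are dense, so a non-zero polynomial can be cancelled.\<close>

lemma hreg_zero_divisor:
 assumes F: "hreg n K e F" and f: "f \<in> polys n" "f \<noteq> 0" and z: "\<And>u. u \<in> K \<Longrightarrow> F u * ev f u = 0"
  and v: "v \<in> K" "K \<subseteq> carr n"
 shows "F v = 0"
proof -
 obtain c d g h where 1: "homogeneous n c g" "homogeneous n d h"
  "ev h v \<noteq> 0" "\<And>u. u \<in> carr n \<Longrightarrow> ev h u \<noteq> 0 \<Longrightarrow> u \<in> K"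
  "\<And>u. u \<in> carr n \<Longrightarrow> ev h u \<noteq> 0 \<Longrightarrow> F u = ev g u / ev h u"
  by (rule hregE[OF F v(1)]) blast
 have "g * f * h = 0"
 proof (rule polys_eq_0I[of _ n])
  show "g * f * h \<in> polys n"
   by (intro polys_mult f(1) homogeneous_polys[OF 1(1)] homogeneous_polys[OF 1(2)])
  fix u assume u: "u \<in> carr n"
  show "ev (g * f * h) u = 0"
   using z[OF 1(4)[OF u]] 1(5)[OF u] by (cases "ev h u = 0") auto
 qed
 moreover have "h \<noteq> 0" using 1(3) by auto
 ultimately have "g = 0" using f by simp
 then show ?thesis using 1(3) 1(5)[of v] v by auto
qed

section \<open>Regular functions on projective open sets\<close>

lemma proj_pointD:
 assumes "p \<in> proj_space n" "v \<in> p"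
 shows "v \<in> carr n" "v \<noteq> zvec n" "p = proj_point v"
proof -
 obtain w where w: "p = proj_point w" "w \<in> carr n" "w \<noteq> zvec n"
  using assms(1) by (auto simp: proj_space_def)
 obtain c where c: "c \<noteq> 0" "v = c \<cdot>\<^sub>v w" using assms(2) w(1) by (auto simp: proj_point_def)
 show "v \<in> carr n" using c w by simp
 have wv: "w = (1 / c) \<cdot>\<^sub>v v" using c w by (intro eq_vecI) auto
 show "v \<noteq> zvec n" using wv w(3) by auto
 have "\<exists>c''. c' \<cdot>\<^sub>v w = c'' \<cdot>\<^sub>v v \<and> c'' \<noteq> 0" if "c' \<noteq> 0" for c'
  using that c wv by (intro exI[of _ "c' * (1 / c)"]) (simp only: smult_smult_assoc, simp)
 moreover have "\<exists>c''. c' \<cdot>\<^sub>v v = c'' \<cdot>\<^sub>v w \<and> c'' \<noteq> 0" if "c' \<noteq> 0" for c'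
  using that c by (intro exI[of _ "c' * c"]) (simp only: smult_smult_assoc, simp)
 ultimately show "p = proj_point v" unfolding w(1) proj_point_def by blast
qed

lemma in_proj_point [simp]: "v \<in> proj_point v"
 unfolding proj_point_def by (rule CollectI, rule exI[of _ 1]) simp

lemma proj_point_in: "v \<in> carr n \<Longrightarrow> v \<noteq> zvec n \<Longrightarrow> proj_point v \<in> proj_space n"
 by (auto simp: proj_space_def)

text \<open>A set of projective points is a set of sets of vectors, so \<open>\<Union>U\<close> is the punctured cone over \<open>U\<close>.\<close>

lemma cone_iff:
 assumes "U \<subseteq> proj_space n"
 shows "v \<in> \<Union>U \<longleftrightarrow> v \<in> carr n \<and> v \<noteq> zvec n \<and> proj_point v \<in> U"
proof
 assume "v \<in> \<Union>U"
 then obtain p where "p \<in> U" "v \<in> p" by blast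
 then show "v \<in> carr n \<and> v \<noteq> zvec n \<and> proj_point v \<in> U" using proj_pointD[of p n v] assms by auto
qed (use in_proj_point in blast)

definition rep :: "ppoint \<Rightarrow> complex vec" where "rep p = (SOME v. v \<in> p)"

lemma rep_in: "p \<in> proj_space n \<Longrightarrow> rep p \<in> p"
 unfolding rep_def by (rule someI_ex) (auto simp: proj_space_def intro: in_proj_point)

lemma rep_props:
 assumes "p \<in> proj_space n" shows "rep p \<in> carr n" "rep p \<noteq> zvec n" "proj_point (rep p) = p"
 using proj_pointD[OF assms rep_in[OF assms]] by auto

lemma zariski_open_iff: "zariski_open n U \<longleftrightarrow> U \<subseteq> proj_space n \<and> ocone n (\<Union>U)"
proof
 assume "zariski_open n U"
 then obtain F where F: "\<And>f. f \<in> F \<Longrightarrow> \<exists>k. homogeneous n k f" "U = proj_space n - (\<Inter>f\<in>F. proj_zeros n f)"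
  by (auto simp: zariski_open_def)
 have sub: "U \<subseteq> proj_space n" using F by auto
 moreover have "ocone n (\<Union>U)"
  unfolding ocone_def
 proof (intro conjI ballI)
  show "\<Union>U \<subseteq> carr n - {zvec n}" using cone_iff[OF sub] by auto
  fix v assume v: "v \<in> \<Union>U"
  then have v': "v \<in> carr n" "v \<noteq> zvec n" "proj_point v \<in> U" using cone_iff[OF sub] by auto
  then obtain f v1 where f: "f \<in> F" "v1 \<in> proj_point v" "ev f v1 \<noteq> 0"
   unfolding F(2) proj_zeros_def by blast
  obtain k where k: "homogeneous n k f" using F f by blast
  obtain c where c: "v1 = c \<cdot>\<^sub>v v" using f(2) by (auto simp: proj_point_def)
  have fv: "ev f v \<noteq> 0" using f(3) homogeneous_eval[OF k v'(1)] unfolding c by auto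
  have b: "basic_cone n f \<subseteq> \<Union>U"
  proof
   fix u assume u: "u \<in> basic_cone n f"
   then have "proj_point u \<notin> proj_zeros n f" by (auto simp: basic_cone_def proj_zeros_def intro: in_proj_point)
   then have "proj_point u \<in> U" using F(2) f(1) u proj_point_in by (auto simp: basic_cone_def)
   then show "u \<in> \<Union>U" using in_proj_point by blast
  qed
  have "v \<in> basic_cone n f" using v' fv by (simp add: basic_cone_def)
  then obtain d w where "d \<ge> 1" "homogeneous n d w" "ev w v \<noteq> 0"
   "\<And>u. u \<in> carr n \<Longrightarrow> ev w u \<noteq> 0 \<Longrightarrow> u \<in> basic_cone n f"
   using oconeE[OF ocone_basic[OF k]] by blast
  then show "\<exists>d w. d \<ge> 1 \<and> homogeneous n d w \<and> ev w v \<noteq> 0 \<and>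
    (\<forall>u\<in>carr n. ev w u \<noteq> 0 \<longrightarrow> u \<in> \<Union>U)" using b by blast
 qed
 ultimately show "U \<subseteq> proj_space n \<and> ocone n (\<Union>U)" ..
next
 assume U: "U \<subseteq> proj_space n \<and> ocone n (\<Union>U)"
 define F where "F = {w. \<exists>d. homogeneous n d w \<and> (\<forall>u\<in>carr n. ev w u \<noteq> 0 \<longrightarrow> u \<in> \<Union>U)}"
 have "U = proj_space n - (\<Inter>f\<in>F. proj_zeros n f)"
 proof (intro equalityI subsetI)
  fix p assume p: "p \<in> U"
  then have p': "p \<in> proj_space n" using U by auto
  have "rep p \<in> \<Union>U" using rep_in[OF p'] p by blast
  then obtain d w where "homogeneous n d w" "ev w (rep p) \<noteq> 0"
   "\<And>u. u \<in> carr n \<Longrightarrow> ev w u \<noteq> 0 \<Longrightarrow> u \<in> \<Union>U"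
   using oconeE U by metis
  then have "w \<in> F" "p \<notin> proj_zeros n w" using rep_in[OF p'] by (auto simp: F_def proj_zeros_def)
  then show "p \<in> proj_space n - (\<Inter>f\<in>F. proj_zeros n f)" using p' by auto
 next
  fix p assume p: "p \<in> proj_space n - (\<Inter>f\<in>F. proj_zeros n f)"
  then obtain w v where w: "w \<in> F" "v \<in> p" "ev w v \<noteq> 0" by (auto simp: proj_zeros_def)
  have v: "v \<in> carr n" "p = proj_point v" using proj_pointD[of p n v] p w by auto
  then have "v \<in> \<Union>U" using w by (auto simp: F_def)
  then show "p \<in> U" using cone_iff U v by auto
 qed
 then show "zariski_open n U" unfolding zariski_open_def by (intro exI[of _ F]) (auto simp: F_def)
qed

lemma zopenD:
 assumes "zariski_open n U"
 shows "U \<subseteq> proj_space n" "ocone n (\<Union>U)"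
 using assms by (auto simp: zariski_open_iff)

lemma cone_Int:
 assumes "U \<subseteq> proj_space n" "V \<subseteq> proj_space n"
 shows "\<Union>(U \<inter> V) = \<Union>U \<inter> \<Union>V"
proof -
 have "U \<inter> V \<subseteq> proj_space n" using assms by auto
 then show ?thesis using cone_iff[OF assms(1)] cone_iff[OF assms(2)] cone_iff[of "U \<inter> V" n] by blast
qed

lemma zopen_Int:
 assumes "zariski_open n U" "zariski_open n V" shows "zariski_open n (U \<inter> V)"
 using zopenD[OF assms(1)] zopenD[OF assms(2)] cone_Int[of U n V] ocone_Int
 by (auto simp: zariski_open_iff)

definition basic :: "nat \<Rightarrow> cpoly \<Rightarrow> ppoint set" where
 "basic n h = proj_point ` basic_cone n h"

lemma basic_sub: "basic n h \<subseteq> proj_space n"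
 by (auto simp: basic_def basic_cone_def proj_point_in)

lemma cone_basic: "homogeneous n d h \<Longrightarrow> \<Union>(basic n h) = basic_cone n h"
proof (intro equalityI subsetI)
 assume h: "homogeneous n d h"
 fix v assume "v \<in> \<Union>(basic n h)"
 then obtain u where u: "u \<in> basic_cone n h" "v \<in> proj_point u" by (auto simp: basic_def)
 then obtain c where c: "c \<noteq> 0" "v = c \<cdot>\<^sub>v u" by (auto simp: proj_point_def)
 have "v \<in> carr n" "v \<noteq> zvec n" using proj_pointD[OF proj_point_in u(2)] u(1) by (auto simp: basic_cone_def)
 then show "v \<in> basic_cone n h" using u(1) c homogeneous_eval[OF h, of u c] by (auto simp: basic_cone_def)
qed (auto simp: basic_def intro: in_proj_point)

lemma zopen_basic: "homogeneous n d h \<Longrightarrow> zariski_open n (basic n h)"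
 by (simp add: zariski_open_iff basic_sub cone_basic ocone_basic)

lemma opens_in_iff: "V \<in> opens_in n U \<longleftrightarrow> zariski_open n V \<and> V \<subseteq> U"
 by (auto simp: opens_in_def)

lemma cone_mono: "V \<subseteq> U \<Longrightarrow> \<Union>V \<subseteq> \<Union>U" by auto

lemma cone_subset_iff:
 assumes "U \<subseteq> proj_space n" "V \<subseteq> proj_space n"
 shows "\<Union>V \<subseteq> \<Union>U \<longleftrightarrow> V \<subseteq> U"
proof
 assume s: "\<Union>V \<subseteq> \<Union>U"
 show "V \<subseteq> U"
 proof
  fix p assume p: "p \<in> V"
  then have p': "p \<in> proj_space n" using assms by auto
  have "rep p \<in> \<Union>U" using s p rep_in[OF p'] by blast
  then show "p \<in> U" using cone_iff[OF assms(1)] rep_props[OF p'] by auto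
 qed
qed auto

abbreviation lift :: "(ppoint \<Rightarrow> complex) \<Rightarrow> complex vec \<Rightarrow> complex" where
 "lift s \<equiv> \<lambda>v. s (proj_point v)"

lemma cone_ext:
 assumes "V \<subseteq> proj_space n" "s \<in> extensional V" "t \<in> extensional V"
  "\<And>v. v \<in> \<Union>V \<Longrightarrow> lift s v = lift t v"
 shows "s = t"
proof (rule extensionalityI[OF assms(2,3)])
 fix p assume p: "p \<in> V"
 then have p': "p \<in> proj_space n" using assms by auto
 have "rep p \<in> \<Union>V" using p rep_in[OF p'] by blast
 then show "s p = t p" using assms(4) rep_props(3)[OF p'] by metis
qed

text \<open>This moves all local computations from projective points to their coordinate vectors.\<close>

lemma regular_iff:
 assumes U: "zariski_open n U"
 shows "s \<in> regular n U \<longleftrightarrow> s \<in> extensional U \<and> hreg n (\<Union>U) 0 (lift s)"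
proof
 assume s: "s \<in> regular n U"
 have "hreg n (\<Union>U) 0 (lift s)"
 proof (rule hreg_local)
  fix v assume v: "v \<in> \<Union>U"
  then have v': "proj_point v \<in> U" using cone_iff[OF zopenD(1)[OF U]] by blast
  have "\<forall>p\<in>U. \<exists>W\<in>opens_in n U. p \<in> W \<and> (\<exists>d g h. homogeneous n d g \<and> homogeneous n d h \<and>
    (\<forall>q\<in>W. \<forall>u\<in>q. ev h u \<noteq> 0 \<and> s q = ev g u / ev h u))"
   using s unfolding regular_def by simp
  from bspec[OF this v'] obtain W d g h where W: "W \<in> opens_in n U" "proj_point v \<in> W" "homogeneous n d g" "homogeneous n d h"
   and W5: "\<forall>q\<in>W. \<forall>u\<in>q. ev h u \<noteq> 0 \<and> s q = ev g u / ev h u"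
   by (elim bexE conjE exE)
  have Wo: "zariski_open n W" "W \<subseteq> U" using W(1) by (auto simp: opens_in_iff)
  have q: "ev h u \<noteq> 0 \<and> lift s u = ev g u / ev h u" if "u \<in> \<Union>W" for u
   using bspec[OF bspec[OF W5, of "proj_point u"], of u] cone_iff[OF zopenD(1)[OF Wo(1)]] that in_proj_point by auto
  have "hreg n (\<Union>W) 0 (\<lambda>u. ev g u / ev h u)"
   by (rule hreg_quotient[OF zopenD(2)[OF Wo(1)] W(3,4)]) (use q in auto)
  then have "hreg n (\<Union>W) 0 (lift s)" using hreg_cong[of "\<Union>W" "lift s"] q by simp
  moreover have "v \<in> \<Union>W" using W(2) in_proj_point by blast
  ultimately show "\<exists>L. v \<in> L \<and> L \<subseteq> \<Union>U \<and> hreg n L 0 (lift s)" using Wo(2) by blast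
 qed
 then show "s \<in> extensional U \<and> hreg n (\<Union>U) 0 (lift s)" using s by (auto simp: regular_def)
next
 assume s: "s \<in> extensional U \<and> hreg n (\<Union>U) 0 (lift s)"
 have "\<exists>W\<in>opens_in n U. p \<in> W \<and> (\<exists>d g h. homogeneous n d g \<and> homogeneous n d h \<and>
    (\<forall>q\<in>W. \<forall>v\<in>q. ev h v \<noteq> 0 \<and> s q = ev g v / ev h v))" if p: "p \<in> U" for p
 proof -
  have p': "p \<in> proj_space n" using zopenD(1)[OF U] p by auto
  have v: "rep p \<in> \<Union>U" using p rep_in[OF p'] by blast
  have "hreg n (\<Union>U) 0 (lift s)" using s by simp
  then obtain c d g h where 1: "homogeneous n c g" "homogeneous n d h" "int c = int d + 0" "d \<ge> 1"
   "ev h (rep p) \<noteq> 0" "\<And>u. u \<in> carr n \<Longrightarrow> ev h u \<noteq> 0 \<Longrightarrow> u \<in> \<Union>U"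
   "\<And>u. u \<in> carr n \<Longrightarrow> ev h u \<noteq> 0 \<Longrightarrow> lift s u = ev g u / ev h u"
   by (rule hregE[OF _ v]) blast
  have cb: "\<Union>(basic n h) = basic_cone n h" by (rule cone_basic[OF 1(2)])
  have "basic n h \<in> opens_in n U"
   unfolding opens_in_iff cone_subset_iff[OF zopenD(1)[OF U] basic_sub, symmetric] cb
   using zopen_basic[OF 1(2)] 1(6) by (auto simp: basic_cone_def)
  moreover have "p \<in> basic n h"
   using rep_props[OF p'] 1(5) unfolding basic_def by (intro image_eqI[of _ _ "rep p"]) (auto simp: basic_cone_def)
  moreover have "ev h v \<noteq> 0 \<and> s q = ev g v / ev h v" if "q \<in> basic n h" "v \<in> q" for q v
  proof -
   have "v \<in> basic_cone n h" using that cb by blast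
   moreover have "q = proj_point v" using proj_pointD(3)[of q n v] that basic_sub by auto
   ultimately show ?thesis using 1(7)[of v] by (auto simp: basic_cone_def)
  qed
  ultimately show ?thesis using 1 by (intro bexI[of _ "basic n h"] conjI exI[of _ d] exI[of _ g] exI[of _ h]) auto
 qed
 then show "s \<in> regular n U" using s unfolding regular_def by blast
qed

text \<open>Functions on the cone that are invariant under scaling descend to projective space, and \<open>lift\<close> is the
 pullback in the other direction. Any representative can be used to define the value.\<close>

definition desc :: "ppoint set \<Rightarrow> (complex vec \<Rightarrow> complex) \<Rightarrow> ppoint \<Rightarrow> complex" where
 "desc V F = (\<lambda>p\<in>V. F (rep p))"

lemma lift_desc:
 assumes V: "zariski_open n V" and F: "hreg n (\<Union>V) 0 F" and v: "v \<in> \<Union>V"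
 shows "lift (desc V F) v = F v"
proof -
 have v': "v \<in> carr n" "v \<noteq> zvec n" "proj_point v \<in> V" using cone_iff[OF zopenD(1)[OF V]] v by auto
 have "rep (proj_point v) \<in> proj_point v" using rep_in[OF proj_point_in] v' by blast
 then obtain c where "c \<noteq> 0" "rep (proj_point v) = c \<cdot>\<^sub>v v" by (auto simp: proj_point_def)
 then show ?thesis
  using hreg_scale[OF F v ocone_sub[OF zopenD(2)[OF V]]] v' by (simp add: desc_def)
qed

lemma desc_regular:
 assumes V: "zariski_open n V" and F: "hreg n (\<Union>V) 0 F"
 shows "desc V F \<in> regular n V"
 unfolding regular_iff[OF V] using F hreg_cong[of "\<Union>V" "lift (desc V F)" F] lift_desc[OF V F]
 by (auto simp: desc_def)

section \<open>Vector fields as homogeneous vector functions\<close>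

definition ddir :: "(complex vec \<Rightarrow> complex) \<Rightarrow> complex vec \<Rightarrow> complex vec \<Rightarrow> complex" where
 "ddir F v w = (THE D. ((\<lambda>t. F (v + t \<cdot>\<^sub>v w)) has_field_derivative D) (at 0))"

lemma ddirI: "((\<lambda>t. F (v + t \<cdot>\<^sub>v w)) has_field_derivative D) (at 0) \<Longrightarrow> ddir F v w = D"
 unfolding ddir_def by (rule the_equality) (auto intro: DERIV_unique)

lemma line_eventually_ne:
 assumes "h \<in> polys n" "v \<in> carr n" "w \<in> carr n" "ev h v \<noteq> 0"
 shows "eventually (\<lambda>t. ev h (v + t \<cdot>\<^sub>v w) \<noteq> 0) (nhds 0)"
proof -
 have "eventually (\<lambda>t. ev h (v + t \<cdot>\<^sub>v w) \<noteq> 0) (at 0)"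
  by (rule tendsto_imp_eventually_ne[OF polyfun_line_tendsto[OF polyfun_poly_eval[OF assms(1)] assms(2,3)] assms(4)])
 then show ?thesis using assms by (simp add: eventually_nhds_conv_at)
qed

lemma line_eventually_cone:
 assumes "ocone n K" "v \<in> K" "w \<in> carr n"
 shows "eventually (\<lambda>t. v + t \<cdot>\<^sub>v w \<in> K) (nhds 0)"
proof -
 obtain d q where q: "homogeneous n d q" "ev q v \<noteq> 0"
  "\<And>u. u \<in> carr n \<Longrightarrow> ev q u \<noteq> 0 \<Longrightarrow> u \<in> K" using oconeE[OF assms(1,2)] by blast
 have v: "v \<in> carr n" using assms ocone_carr by blast
 show ?thesis
  by (rule eventually_mono[OF line_eventually_ne[OF homogeneous_polys[OF q(1)] v assms(3) q(2)]])
    (use q(3) v assms(3) in auto)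
qed

lemma deriv_local:
 assumes "eventually (\<lambda>t. F (v + t \<cdot>\<^sub>v w) = G (v + t \<cdot>\<^sub>v w)) (nhds 0)"
 shows "((\<lambda>t. F (v + t \<cdot>\<^sub>v w)) has_field_derivative D) (at 0) \<longleftrightarrow>
     ((\<lambda>t. G (v + t \<cdot>\<^sub>v w)) has_field_derivative D) (at (0::complex))"
 by (rule DERIV_cong_ev[OF refl assms refl])

lemma quotient_line_deriv:
 assumes "g \<in> polys n" "h \<in> polys n" "v \<in> carr n" "w \<in> carr n" "ev h v \<noteq> 0"
 shows "((\<lambda>t. ev g (v + t \<cdot>\<^sub>v w) / ev h (v + t \<cdot>\<^sub>v w)) has_field_derivative
  ((grad n g v \<bullet> w) * ev h v - ev g v * (grad n h v \<bullet> w)) / (ev h v * ev h v)) (at 0)"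
proof -
 have 1: "((\<lambda>t. ev g (v + t \<cdot>\<^sub>v w)) has_field_derivative (grad n g v \<bullet> w)) (at 0)"
  using directional_derivative[OF assms(1,3,4), of 0] assms by simp
 have 2: "((\<lambda>t. ev h (v + t \<cdot>\<^sub>v w)) has_field_derivative (grad n h v \<bullet> w)) (at 0)"
  using directional_derivative[OF assms(2,3,4), of 0] assms by simp
 show ?thesis using DERIV_divide[OF 1 2] assms by simp
qed

lemma ddir_quotient:
 assumes "g \<in> polys n" "h \<in> polys n" "v \<in> carr n" "w \<in> carr n" "ev h v \<noteq> 0"
 shows "ddir (\<lambda>u. ev g u / ev h u) v w =
  ((grad n g v \<bullet> w) * ev h v - ev g v * (grad n h v \<bullet> w)) / (ev h v * ev h v)"
 by (rule ddirI) (rule quotient_line_deriv[OF assms])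

lemma ddir_cong:
 assumes "ocone n K" "v \<in> K" "w \<in> carr n" "\<And>u. u \<in> K \<Longrightarrow> F u = G u"
 shows "ddir F v w = ddir G v w"
proof -
 have "eventually (\<lambda>t. F (v + t \<cdot>\<^sub>v w) = G (v + t \<cdot>\<^sub>v w)) (nhds 0)"
  by (rule eventually_mono[OF line_eventually_cone[OF assms(1-3)]]) (rule assms(4))
 then show ?thesis unfolding ddir_def by (simp add: deriv_local)
qed

lemma hreg_deriv:
 assumes F: "hreg n K e F" and v: "v \<in> K" and K: "K \<subseteq> carr n" and w: "w \<in> carr n"
 shows "((\<lambda>t. F (v + t \<cdot>\<^sub>v w)) has_field_derivative ddir F v w) (at 0)"
proof -
 obtain c d g h where 1: "homogeneous n c g" "homogeneous n d h"
  "ev h v \<noteq> 0" "\<And>u. u \<in> carr n \<Longrightarrow> ev h u \<noteq> 0 \<Longrightarrow> F u = ev g u / ev h u"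
  by (rule hregE[OF F v]) blast
 have vc: "v \<in> carr n" using v K by blast
 have "eventually (\<lambda>t. F (v + t \<cdot>\<^sub>v w) = (\<lambda>u. ev g u / ev h u) (v + t \<cdot>\<^sub>v w)) (nhds 0)"
  by (rule eventually_mono[OF line_eventually_ne[OF homogeneous_polys[OF 1(2)] vc w 1(3)]])
   (use 1(4) vc w in auto)
 from deriv_local[OF this] have "\<exists>D. ((\<lambda>t. F (v + t \<cdot>\<^sub>v w)) has_field_derivative D) (at 0)"
  using quotient_line_deriv[OF homogeneous_polys[OF 1(1)] homogeneous_polys[OF 1(2)] vc w 1(3)] by blast
 then show ?thesis using ddirI by blast
qed

lemma ddir_add:
 assumes "hreg n K e F" "hreg n K e' G" "v \<in> K" "K \<subseteq> carr n" "w \<in> carr n"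
 shows "ddir (\<lambda>u. F u + G u) v w = ddir F v w + ddir G v w"
 by (rule ddirI) (rule DERIV_add[OF hreg_deriv[OF assms(1,3-5)] hreg_deriv[OF assms(2-5)]])

lemma ddir_mult:
 assumes "hreg n K e F" "hreg n K e' G" "v \<in> K" "K \<subseteq> carr n" "w \<in> carr n"
 shows "ddir (\<lambda>u. F u * G u) v w = F v * ddir G v w + G v * ddir F v w"
proof (rule ddirI)
 have "((\<lambda>t. F (v + t \<cdot>\<^sub>v w) * G (v + t \<cdot>\<^sub>v w)) has_field_derivative
  ddir F v w * G (v + 0 \<cdot>\<^sub>v w) + ddir G v w * F (v + 0 \<cdot>\<^sub>v w)) (at 0)"
  by (rule DERIV_mult[OF hreg_deriv[OF assms(1,3-5)] hreg_deriv[OF assms(2-5)]])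
 moreover have "v + 0 \<cdot>\<^sub>v w = v" using assms by auto
 ultimately show "((\<lambda>t. F (v + t \<cdot>\<^sub>v w) * G (v + t \<cdot>\<^sub>v w)) has_field_derivative
  F v * ddir G v w + G v * ddir F v w) (at 0)" by (simp add: algebra_simps)
qed

lemma ddir_cmult:
 assumes "hreg n K e F" "v \<in> K" "K \<subseteq> carr n" "w \<in> carr n"
 shows "ddir (\<lambda>u. c * F u) v w = c * ddir F v w"
 by (rule ddirI) (rule DERIV_cmult[OF hreg_deriv[OF assms]])

definition vreg :: "nat \<Rightarrow> complex vec set \<Rightarrow> (complex vec \<Rightarrow> complex vec) \<Rightarrow> bool" where
 "vreg n K a \<longleftrightarrow> (\<forall>v\<in>K. a v \<in> carr n) \<and> (\<forall>j\<le>n. hreg n K 1 (\<lambda>v. a v $ j))"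

lemma vregD: "vreg n K a \<Longrightarrow> v \<in> K \<Longrightarrow> a v \<in> carr n" "vreg n K a \<Longrightarrow> j \<le> n \<Longrightarrow> hreg n K 1 (\<lambda>v. a v $ j)"
 by (auto simp: vreg_def)

lemma vreg_subset: "vreg n K a \<Longrightarrow> ocone n L \<Longrightarrow> L \<subseteq> K \<Longrightarrow> vreg n L a"
 unfolding vreg_def using hreg_subset by blast

lemma vreg_cong: "(\<And>v. v \<in> K \<Longrightarrow> a v = b v) \<Longrightarrow> vreg n K a \<longleftrightarrow> vreg n K b"
 unfolding vreg_def using hreg_cong[of K "\<lambda>v. a v $ _" "\<lambda>v. b v $ _"] by auto

text \<open>Differentiation lowers the degree by one and the coefficients of \<open>a\<close> raise it by one, so the quotient rule
 gives a function of degree zero.\<close>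

lemma hreg_ddir:
 assumes K: "ocone n K" and F: "hreg n K 0 F" and a: "vreg n K a"
 shows "hreg n K 0 (\<lambda>v. ddir F v (a v))"
proof (rule hreg_local)
 fix v assume v: "v \<in> K"
 obtain c d g h where 1: "homogeneous n c g" "homogeneous n d h" "int c = int d + 0" "d \<ge> 1" "ev h v \<noteq> 0"
  "\<And>u. u \<in> carr n \<Longrightarrow> ev h u \<noteq> 0 \<Longrightarrow> u \<in> K"
  "\<And>u. u \<in> carr n \<Longrightarrow> ev h u \<noteq> 0 \<Longrightarrow> F u = ev g u / ev h u"
  by (rule hregE[OF F v]) blast
 have cd: "c = d" using 1(3) by simp
 let ?L = "basic_cone n h"
 have L: "ocone n ?L" by (rule ocone_basic[OF 1(2)])
 have LK: "?L \<subseteq> K" using 1(6) by (auto simp: basic_cone_def)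
 have ne: "ev h u \<noteq> 0" "u \<in> carr n" if "u \<in> ?L" for u using that by (auto simp: basic_cone_def)
 have p: "g \<in> polys n" "h \<in> polys n" using 1 homogeneous_polys by auto
 define r where "r j = poly_partial j g * h - g * poly_partial j h" for j
 have r: "homogeneous n (2 * d - 1) (r j)" for j
 proof -
  have eq: "c - 1 + d = 2 * d - 1" "c + (d - 1) = 2 * d - 1" using 1(4) cd by auto
  show ?thesis unfolding r_def
   using homogeneous_mult[OF homogeneous_poly_partial[OF 1(1)] 1(2), of j]
    homogeneous_mult[OF 1(1) homogeneous_poly_partial[OF 1(2)], of j]
   unfolding eq by (rule homogeneous_diff)
 qed
 have hh: "homogeneous n (2 * d) (h * h)" using homogeneous_mult[OF 1(2) 1(2)] by (simp add: mult_2)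
 have "ddir F u (a u) = (\<Sum>j\<le>n. ev (r j) u / ev (h * h) u * a u $ j)" if u: "u \<in> ?L" for u
 proof -
  have au: "a u \<in> carr n" using vregD(1)[OF a] u LK by blast
  have "ddir F u (a u) = ddir (\<lambda>u. ev g u / ev h u) u (a u)"
   by (rule ddir_cong[OF L u au]) (use 1(7) ne in auto)
  also have "\<dots> = ((grad n g u \<bullet> a u) * ev h u - ev g u * (grad n h u \<bullet> a u)) / (ev h u * ev h u)"
   by (rule ddir_quotient[OF p _ au]) (use ne u in auto)
  also have "\<dots> = (\<Sum>j\<le>n. ev (r j) u / ev (h * h) u * a u $ j)"
   unfolding grad_dot[OF au] sum_distrib_left sum_distrib_right sum_subtractf[symmetric] sum_divide_distrib
  proof (rule sum.cong[OF refl])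
   fix j
   have "a u $ j * ev (poly_partial j g) u * ev h u - ev g u * (a u $ j * ev (poly_partial j h) u)
     = ev (r j) u * a u $ j" by (simp add: r_def algebra_simps)
   then show "(a u $ j * ev (poly_partial j g) u * ev h u -
     ev g u * (a u $ j * ev (poly_partial j h) u)) / (ev h u * ev h u) =
     ev (r j) u / ev (h * h) u * a u $ j" by simp
  qed
  finally show ?thesis .
 qed
 moreover have "hreg n ?L 0 (\<lambda>u. \<Sum>j\<le>n. ev (r j) u / ev (h * h) u * a u $ j)"
 proof (rule hreg_sum[OF L])
  fix j assume "j \<in> {..n}"
  then have "hreg n ?L 1 (\<lambda>u. a u $ j)" using vregD(2)[OF vreg_subset[OF a L LK]] by simp
  moreover have "hreg n ?L (-1) (\<lambda>u. ev (r j) u / ev (h * h) u)"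
   by (rule hreg_quotient[OF L r hh]) (use ne 1(4) in auto)
  ultimately show "hreg n ?L 0 (\<lambda>u. ev (r j) u / ev (h * h) u * a u $ j)"
   by (intro hreg_mult) auto
 qed
 ultimately have "hreg n ?L 0 (\<lambda>v. ddir F v (a v))"
  using hreg_cong[of ?L "\<lambda>v. ddir F v (a v)"] by simp
 moreover have "v \<in> ?L" using hreg_rep_eval_ne[OF 1(2,4) ocone_carr[OF K v] 1(5)] .
 ultimately show "\<exists>L. v \<in> L \<and> L \<subseteq> K \<and> hreg n L 0 (\<lambda>v. ddir F v (a v))" using LK by blast
qed

definition vfield_of :: "nat \<Rightarrow> ppoint set \<Rightarrow> (complex vec \<Rightarrow> complex vec) \<Rightarrow> vfield" where
 "vfield_of n U a = (\<lambda>V\<in>opens_in n U. \<lambda>s\<in>regular n V. desc V (\<lambda>v. ddir (lift s) v (a v)))"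

lemma opens_inD:
 assumes "V \<in> opens_in n U"
 shows "zariski_open n V" "V \<subseteq> U" "V \<subseteq> proj_space n" "ocone n (\<Union>V)" "\<Union>V \<subseteq> \<Union>U"
 using assms zopenD by (auto simp: opens_in_iff)

lemma opens_in_trans: "V \<in> opens_in n U \<Longrightarrow> W \<in> opens_in n V \<Longrightarrow> W \<in> opens_in n U"
 by (auto simp: opens_in_iff)

lemma opens_in_refl: "zariski_open n U \<Longrightarrow> U \<in> opens_in n U"
 by (auto simp: opens_in_iff)

lemma regularD:
 assumes "zariski_open n V" "s \<in> regular n V"
 shows "s \<in> extensional V" "hreg n (\<Union>V) 0 (lift s)"
 using regular_iff[OF assms(1)] assms(2) by auto

lemma vfield_of_apply:
 assumes "V \<in> opens_in n U" "vreg n (\<Union>U) a" "s \<in> regular n V"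
 shows "vfield_of n U a V s \<in> regular n V"
  "v \<in> \<Union>V \<Longrightarrow> lift (vfield_of n U a V s) v = ddir (lift s) v (a v)"
proof -
 note V = opens_inD[OF assms(1)]
 have h: "hreg n (\<Union>V) 0 (\<lambda>v. ddir (lift s) v (a v))"
  using hreg_ddir[OF V(4) regularD(2)[OF V(1) assms(3)] vreg_subset[OF assms(2) V(4,5)]] .
 have e: "vfield_of n U a V s = desc V (\<lambda>v. ddir (lift s) v (a v))"
  using assms by (simp add: vfield_of_def)
 show "vfield_of n U a V s \<in> regular n V" unfolding e by (rule desc_regular[OF V(1) h])
 show "v \<in> \<Union>V \<Longrightarrow> lift (vfield_of n U a V s) v = ddir (lift s) v (a v)"
  unfolding e by (rule lift_desc[OF V(1) h])
qed

lemma lift_restrict: "V \<subseteq> proj_space n \<Longrightarrow> v \<in> \<Union>V \<Longrightarrow> lift (restrict s V) v = lift s v"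
 using cone_iff[of V n v] by auto

lemma regular_restrictI:
 assumes V: "zariski_open n V" and "hreg n (\<Union>V) 0 (lift F)"
 shows "restrict F V \<in> regular n V"
 unfolding regular_iff[OF V]
 using assms lift_restrict[OF zopenD(1)[OF V]] hreg_cong[of "\<Union>V" "lift (restrict F V)" "lift F"] by simp

lemma regular_add: "zariski_open n V \<Longrightarrow> s \<in> regular n V \<Longrightarrow> t \<in> regular n V \<Longrightarrow> (\<lambda>p\<in>V. s p + t p) \<in> regular n V"
 using regularD by (intro regular_restrictI) (auto intro!: hreg_add)
lemma regular_mult: "zariski_open n V \<Longrightarrow> s \<in> regular n V \<Longrightarrow> t \<in> regular n V \<Longrightarrow> (\<lambda>p\<in>V. s p * t p) \<in> regular n V"
 using regularD by (intro regular_restrictI) (auto intro!: hreg_mult[of n "\<Union>V" 0 _ 0 _ 0])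
lemma regular_cmult: "zariski_open n V \<Longrightarrow> s \<in> regular n V \<Longrightarrow> (\<lambda>p\<in>V. c * s p) \<in> regular n V"
 using regularD zopenD by (intro regular_restrictI) (auto intro!: hreg_cmult)
lemma regular_restrict:
 assumes "zariski_open n V" "W \<in> opens_in n V" "s \<in> regular n V" shows "restrict s W \<in> regular n W"
 using assms opens_inD[OF assms(2)] by (intro regular_restrictI hreg_subset[OF regularD(2)[OF assms(1,3)]])

lemma vfield_of_tangent:
 assumes U: "zariski_open n U" and a: "vreg n (\<Union>U) a"
 shows "vfield_of n U a \<in> tangent_sections n U"
 unfolding tangent_sections_def
proof (intro CollectI conjI ballI allI)
 let ?\<theta> = "vfield_of n U a"
 show "?\<theta> \<in> (\<Pi>\<^sub>E V\<in>opens_in n U. regular n V \<rightarrow>\<^sub>E regular n V)"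
 proof (rule PiE_I)
  fix V assume V: "V \<in> opens_in n U"
  show "?\<theta> V \<in> regular n V \<rightarrow>\<^sub>E regular n V"
   using V vfield_of_apply(1)[OF V a] by (intro PiE_I) (auto simp: vfield_of_def)
 qed (simp add: vfield_of_def)
 fix V assume V: "V \<in> opens_in n U"
 note Vo = opens_inD[OF V]
 have sub: "\<Union>V \<subseteq> carr n" using Vo(4) ocone_sub by blast
 have av: "a v \<in> carr n" if "v \<in> \<Union>V" for v using vregD(1)[OF a] that Vo(5) by blast
 have ext: "?\<theta> V s \<in> extensional V" if "s \<in> regular n V" for s
  using vfield_of_apply(1)[OF V a that] regularD(1)[OF Vo(1)] by blast
 {
  fix s t assume s: "s \<in> regular n V" and t: "t \<in> regular n V"
  note h = regularD(2)[OF Vo(1) s] regularD(2)[OF Vo(1) t]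
  show "?\<theta> V (\<lambda>p\<in>V. s p + t p) = (\<lambda>p\<in>V. ?\<theta> V s p + ?\<theta> V t p)"
  proof (rule cone_ext[OF Vo(3) ext])
   show st: "(\<lambda>p\<in>V. s p + t p) \<in> regular n V" by (rule regular_add[OF Vo(1) s t])
   fix v assume v: "v \<in> \<Union>V"
   have "ddir (lift (\<lambda>p\<in>V. s p + t p)) v (a v) = ddir (\<lambda>u. lift s u + lift t u) v (a v)"
    by (rule ddir_cong[OF Vo(4) v av[OF v]]) (simp only: lift_restrict[OF Vo(3)])
   then show "lift (?\<theta> V (\<lambda>p\<in>V. s p + t p)) v = lift (\<lambda>p\<in>V. ?\<theta> V s p + ?\<theta> V t p) v"
    using v ddir_add[OF h v sub av[OF v]]
    by (simp only: vfield_of_apply(2)[OF V a st v] vfield_of_apply(2)[OF V a s v] vfield_of_apply(2)[OF V a t v]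
      lift_restrict[OF Vo(3) v])
  qed simp
  show "?\<theta> V (\<lambda>p\<in>V. s p * t p) = (\<lambda>p\<in>V. s p * ?\<theta> V t p + t p * ?\<theta> V s p)"
  proof (rule cone_ext[OF Vo(3) ext])
   show st: "(\<lambda>p\<in>V. s p * t p) \<in> regular n V" by (rule regular_mult[OF Vo(1) s t])
   fix v assume v: "v \<in> \<Union>V"
   have "ddir (lift (\<lambda>p\<in>V. s p * t p)) v (a v) = ddir (\<lambda>u. lift s u * lift t u) v (a v)"
    by (rule ddir_cong[OF Vo(4) v av[OF v]]) (simp only: lift_restrict[OF Vo(3)])
   then show "lift (?\<theta> V (\<lambda>p\<in>V. s p * t p)) v = lift (\<lambda>p\<in>V. s p * ?\<theta> V t p + t p * ?\<theta> V s p) v"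
    using v ddir_mult[OF h v sub av[OF v]]
    by (simp only: vfield_of_apply(2)[OF V a st v] vfield_of_apply(2)[OF V a s v] vfield_of_apply(2)[OF V a t v]
      lift_restrict[OF Vo(3) v])
  qed simp
 }
 {
  fix s c assume s: "s \<in> regular n V"
  note h = regularD(2)[OF Vo(1) s]
  show "?\<theta> V (\<lambda>p\<in>V. c * s p) = (\<lambda>p\<in>V. c * ?\<theta> V s p)"
  proof (rule cone_ext[OF Vo(3) ext])
   show st: "(\<lambda>p\<in>V. c * s p) \<in> regular n V" by (rule regular_cmult[OF Vo(1) s])
   fix v assume v: "v \<in> \<Union>V"
   have "ddir (lift (\<lambda>p\<in>V. c * s p)) v (a v) = ddir (\<lambda>u. c * lift s u) v (a v)"
    by (rule ddir_cong[OF Vo(4) v av[OF v]]) (simp only: lift_restrict[OF Vo(3)])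
   then show "lift (?\<theta> V (\<lambda>p\<in>V. c * s p)) v = lift (\<lambda>p\<in>V. c * ?\<theta> V s p) v"
    using v ddir_cmult[OF h v sub av[OF v]]
    by (simp only: vfield_of_apply(2)[OF V a st v] vfield_of_apply(2)[OF V a s v] lift_restrict[OF Vo(3) v])
  qed simp
 }
 fix W s assume W: "W \<in> opens_in n V" and s: "s \<in> regular n V"
 note Wo = opens_inD[OF W]
 have WU: "W \<in> opens_in n U" using opens_in_trans[OF V W] .
 have sW: "restrict s W \<in> regular n W" by (rule regular_restrict[OF Vo(1) W s])
 show "?\<theta> W (restrict s W) = restrict (?\<theta> V s) W"
 proof (rule cone_ext[OF Wo(3)])
  show "?\<theta> W (restrict s W) \<in> extensional W"
   using vfield_of_apply(1)[OF WU a sW] regularD(1)[OF Wo(1)] by blast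
  fix v assume v: "v \<in> \<Union>W"
  then have vV: "v \<in> \<Union>V" using Wo(5) by blast
  have "ddir (lift (restrict s W)) v (a v) = ddir (lift s) v (a v)"
   by (rule ddir_cong[OF Wo(4) v av[OF vV]]) (rule lift_restrict[OF Wo(3)])
  then show "lift (?\<theta> W (restrict s W)) v = lift (restrict (?\<theta> V s) W) v"
   by (simp only: vfield_of_apply(2)[OF WU a sW v] vfield_of_apply(2)[OF V a s vV] lift_restrict[OF Wo(3) v])
 qed simp
qed

lemma tangentD:
 assumes \<theta>: "\<theta> \<in> tangent_sections n U" and V: "V \<in> opens_in n U"
 shows "s \<in> regular n V \<Longrightarrow> \<theta> V s \<in> regular n V"
  "s \<in> regular n V \<Longrightarrow> t \<in> regular n V \<Longrightarrow> \<theta> V (\<lambda>p\<in>V. s p + t p) = (\<lambda>p\<in>V. \<theta> V s p + \<theta> V t p)"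
  "s \<in> regular n V \<Longrightarrow> t \<in> regular n V \<Longrightarrow> \<theta> V (\<lambda>p\<in>V. s p * t p) = (\<lambda>p\<in>V. s p * \<theta> V t p + t p * \<theta> V s p)"
  "s \<in> regular n V \<Longrightarrow> \<theta> V (\<lambda>p\<in>V. c * s p) = (\<lambda>p\<in>V. c * \<theta> V s p)"
  "W \<in> opens_in n V \<Longrightarrow> s \<in> regular n V \<Longrightarrow> \<theta> W (restrict s W) = restrict (\<theta> V s) W"
proof -
 from \<theta> have 1: "\<theta> \<in> (\<Pi>\<^sub>E V\<in>opens_in n U. regular n V \<rightarrow>\<^sub>E regular n V)"
  by (simp add: tangent_sections_def)
 have "\<theta> V \<in> regular n V \<rightarrow>\<^sub>E regular n V" using 1 V by (rule PiE_mem)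
 then show "s \<in> regular n V \<Longrightarrow> \<theta> V s \<in> regular n V" by (rule PiE_mem)
qed (use \<theta> V in \<open>auto simp: tangent_sections_def\<close>)

lemma tangent_ext:
 assumes "\<theta> \<in> tangent_sections n U" "\<eta> \<in> tangent_sections n U"
  "\<And>V s. V \<in> opens_in n U \<Longrightarrow> s \<in> regular n V \<Longrightarrow> \<theta> V s = \<eta> V s"
 shows "\<theta> = \<eta>"
proof -
 have 1: "\<theta> \<in> (\<Pi>\<^sub>E V\<in>opens_in n U. regular n V \<rightarrow>\<^sub>E regular n V)"
  "\<eta> \<in> (\<Pi>\<^sub>E V\<in>opens_in n U. regular n V \<rightarrow>\<^sub>E regular n V)"
  using assms by (auto simp: tangent_sections_def)
 show ?thesis
 proof (rule PiE_ext[OF 1])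
  fix V assume V: "V \<in> opens_in n U"
  show "\<theta> V = \<eta> V"
   by (rule PiE_ext[OF PiE_mem[OF 1(1) V] PiE_mem[OF 1(2) V] assms(3)[OF V]])
 qed
qed

lemma tangent_pointwise:
 assumes \<theta>: "\<theta> \<in> tangent_sections n U" and V: "V \<in> opens_in n U"
  and r: "r \<in> regular n V" and s: "s \<in> regular n V" and t: "t \<in> regular n V" and v: "v \<in> \<Union>V"
 shows "(\<And>u. u \<in> \<Union>V \<Longrightarrow> lift r u = lift s u + lift t u) \<Longrightarrow> lift (\<theta> V r) v = lift (\<theta> V s) v + lift (\<theta> V t) v"
  "(\<And>u. u \<in> \<Union>V \<Longrightarrow> lift r u = lift s u * lift t u) \<Longrightarrow>
    lift (\<theta> V r) v = lift s v * lift (\<theta> V t) v + lift t v * lift (\<theta> V s) v"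
  "(\<And>u. u \<in> \<Union>V \<Longrightarrow> lift r u = c * lift s u) \<Longrightarrow> lift (\<theta> V r) v = c * lift (\<theta> V s) v"
proof -
 note Vo = opens_inD[OF V]
 have re: "r \<in> extensional V" by (rule regularD(1)[OF Vo(1) r])
 {
  assume "\<And>u. u \<in> \<Union>V \<Longrightarrow> lift r u = lift s u + lift t u"
  then have r_eq: "r = (\<lambda>p\<in>V. s p + t p)"
   by (intro cone_ext[OF Vo(3) re restrict_extensional]) (simp only: lift_restrict[OF Vo(3)])
  show "lift (\<theta> V r) v = lift (\<theta> V s) v + lift (\<theta> V t) v"
   unfolding r_eq tangentD(2)[OF \<theta> V s t] by (rule lift_restrict[OF Vo(3) v])
 }
 {
  assume "\<And>u. u \<in> \<Union>V \<Longrightarrow> lift r u = lift s u * lift t u"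
  then have r_eq: "r = (\<lambda>p\<in>V. s p * t p)"
   by (intro cone_ext[OF Vo(3) re restrict_extensional]) (simp only: lift_restrict[OF Vo(3)])
  show "lift (\<theta> V r) v = lift s v * lift (\<theta> V t) v + lift t v * lift (\<theta> V s) v"
   unfolding r_eq tangentD(3)[OF \<theta> V s t] by (rule lift_restrict[OF Vo(3) v])
 }
 {
  assume "\<And>u. u \<in> \<Union>V \<Longrightarrow> lift r u = c * lift s u"
  then have r_eq: "r = (\<lambda>p\<in>V. c * s p)"
   by (intro cone_ext[OF Vo(3) re restrict_extensional]) (simp only: lift_restrict[OF Vo(3)])
  show "lift (\<theta> V r) v = c * lift (\<theta> V s) v"
   unfolding r_eq tangentD(4)[OF \<theta> V s] by (rule lift_restrict[OF Vo(3) v])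
 }
qed

lemma basic_coordinate: "i \<le> n \<Longrightarrow> basic_cone n (Var i) = {v\<in>carr n. v $ i \<noteq> 0}"
 using mon_mono1[of i] by (auto simp: basic_cone_def)

abbreviation chart :: "nat \<Rightarrow> nat \<Rightarrow> ppoint set" where "chart n i \<equiv> basic n (Var i)"

lemma chart_cone: "i \<le> n \<Longrightarrow> \<Union>(chart n i) = {v\<in>carr n. v $ i \<noteq> 0}"
 using cone_basic[OF homogeneous_Var] basic_coordinate by simp

lemma chart_coord: "i \<le> n \<Longrightarrow> V \<subseteq> chart n i \<Longrightarrow> v \<in> \<Union>V \<Longrightarrow> v $ i \<noteq> 0"
 using chart_cone by blast

lemma hreg_chart_quotient:
 assumes "i \<le> n" "ocone n K" "\<And>v. v \<in> K \<Longrightarrow> v $ i \<noteq> 0" "homogeneous n d p"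
 shows "hreg n K 0 (\<lambda>v. ev p v / v $ i ^ d)"
proof -
 have "homogeneous n (1 * d) (Var i ^ d)" by (intro homogeneous_power homogeneous_Var assms)
 then have "hreg n K 0 (\<lambda>v. ev p v / ev (Var i ^ d) v)"
  using assms mon_mono1[of i] by (intro hreg_quotient[OF assms(2,4), of d "Var i ^ d"]) auto
 then show ?thesis using mon_mono1[of i] by simp
qed

text \<open>The derivation rules extend agreement on the affine coordinates \<open>x\<^sub>j / x\<^sub>i\<close> to monomials, to polynomials in them
 and to quotients of such polynomials.\<close>

lemma derivation_eqI:
 assumes \<theta>: "\<theta> \<in> tangent_sections n U" and \<eta>: "\<eta> \<in> tangent_sections n U'"
  and V: "V \<in> opens_in n U" "V \<in> opens_in n U'" and i: "i \<le> n" "V \<subseteq> chart n i"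
  and coord: "\<And>j. j \<le> n \<Longrightarrow> \<theta> V (desc V (\<lambda>v. v $ j / v $ i)) = \<eta> V (desc V (\<lambda>v. v $ j / v $ i))"
  and W: "W \<in> opens_in n V" and s: "s \<in> regular n W"
 shows "\<theta> W s = \<eta> W s"
proof -
 note Vo = opens_inD[OF V(1)]
 have quo: "hreg n (\<Union>W) 0 (\<lambda>v. ev p v / v $ i ^ d)" if "W \<in> opens_in n V" "homogeneous n d p" for W d p
  using that i opens_inD[OF that(1)] chart_coord[of i n W] by (intro hreg_chart_quotient) auto
 have crd: "hreg n (\<Union>W) 0 (\<lambda>v. v $ j / v $ i)" if "W \<in> opens_in n V" "j \<le> n" for W j
  using quo[OF that(1) homogeneous_Var[OF that(2)]] mon_mono1[of j] by simp
 have poly_agree: "\<theta> W (desc W (\<lambda>v. ev p v / v $ i ^ d)) = \<eta> W (desc W (\<lambda>v. ev p v / v $ i ^ d))"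
  if W: "W \<in> opens_in n V" and p: "homogeneous n d p" for W d p
 proof -
  note Wo = opens_inD[OF W]
  have W1: "W \<in> opens_in n U" and W2: "W \<in> opens_in n U'" using opens_in_trans V W by auto
  have sub: "\<Union>W \<subseteq> carr n" using Wo(4) ocone_sub by blast
  have wi: "v $ i \<noteq> 0" if "v \<in> \<Union>W" for v using chart_coord[of i n W v] i Wo(2) that by auto
  let ?A = "\<lambda>r. r \<in> regular n W \<and> \<theta> W r = \<eta> W r"
  have pt: "\<theta> W r = \<eta> W r" if "r \<in> regular n W" "\<And>v. v \<in> \<Union>W \<Longrightarrow> lift (\<theta> W r) v = lift (\<eta> W r) v" for r
   by (rule cone_ext[OF Wo(3)])
    (use that regularD(1)[OF Wo(1) tangentD(1)[OF \<theta> W1]] regularD(1)[OF Wo(1) tangentD(1)[OF \<eta> W2]] in auto)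
  have addA: "?A r" if "?A s" "?A t" "r \<in> regular n W" "\<And>u. u \<in> \<Union>W \<Longrightarrow> lift r u = lift s u + lift t u" for r s t
   using that tangent_pointwise(1)[OF \<theta> W1, of r s t] tangent_pointwise(1)[OF \<eta> W2, of r s t] by (intro conjI pt) auto
  have multA: "?A r" if "?A s" "?A t" "r \<in> regular n W" "\<And>u. u \<in> \<Union>W \<Longrightarrow> lift r u = lift s u * lift t u" for r s t
   using that tangent_pointwise(2)[OF \<theta> W1, of r s t] tangent_pointwise(2)[OF \<eta> W2, of r s t] by (intro conjI pt) auto
  have cmultA: "?A r" if "?A s" "r \<in> regular n W" "\<And>u. u \<in> \<Union>W \<Longrightarrow> lift r u = c * lift s u" for r s c
   using that tangent_pointwise(3)[OF \<theta> W1, of r s s _ c] tangent_pointwise(3)[OF \<eta> W2, of r s s _ c] by (intro conjI pt) auto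
  have one: "?A (desc W (\<lambda>v. 1))"
  proof -
   have h: "hreg n (\<Union>W) 0 (\<lambda>v. 1)" by (rule hreg_const[OF Wo(4)])
   note d = desc_regular[OF Wo(1) h] lift_desc[OF Wo(1) h]
   have "lift (\<theta> W (desc W (\<lambda>v. 1))) v = 0" if "v \<in> \<Union>W" for v
    using tangent_pointwise(2)[OF \<theta> W1 d(1) d(1) d(1) that] d(2) that by simp
   moreover have "lift (\<eta> W (desc W (\<lambda>v. 1))) v = 0" if "v \<in> \<Union>W" for v
    using tangent_pointwise(2)[OF \<eta> W2 d(1) d(1) d(1) that] d(2) that by simp
   ultimately show ?thesis using d(1) by (intro conjI pt) auto
  qed
  have coordA: "?A (desc W (\<lambda>v. v $ j / v $ i))" if j: "j \<le> n" for j
  proof -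
   note dV = desc_regular[OF Vo(1) crd[OF opens_in_refl[OF Vo(1)] j]] lift_desc[OF Vo(1) crd[OF opens_in_refl[OF Vo(1)] j]]
   note dW = desc_regular[OF Wo(1) crd[OF W j]] lift_desc[OF Wo(1) crd[OF W j]]
   have eq: "desc W (\<lambda>v. v $ j / v $ i) = restrict (desc V (\<lambda>v. v $ j / v $ i)) W"
    using Wo(2) by (auto simp: desc_def fun_eq_iff)
   show ?thesis using dW(1) unfolding eq tangentD(5)[OF \<theta> V(1) W dV(1)] tangentD(5)[OF \<eta> V(2) W dV(1)] coord[OF j] by simp
  qed
  have monA: "?A (desc W (\<lambda>v. mon m v / v $ i ^ mdeg m))" if "supp m \<subseteq> {..n}" for m
   using that
  proof (induction m rule: monomial_induct)
   case zero then show ?case using one by simp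
  next
   case (var j m)
   have j: "j \<le> n" using var by simp
   have hm: "hreg n (\<Union>W) 0 (\<lambda>v. mon m v / v $ i ^ mdeg m)" if "supp m \<subseteq> {..n}" for m
    using quo[OF W homogeneous_single[OF that refl, of 1]] by simp
   have sm: "supp (mono1 j + m) \<subseteq> {..n}" using var by (auto simp: supp_add_nat)
   show ?case
   proof (rule multA[OF coordA[OF j] var.IH desc_regular[OF Wo(1) hm[OF sm]]])
    fix u assume u: "u \<in> \<Union>W"
    show "lift (desc W (\<lambda>v. mon (mono1 j + m) v / v $ i ^ mdeg (mono1 j + m))) u =
     lift (desc W (\<lambda>v. v $ j / v $ i)) u * lift (desc W (\<lambda>v. mon m v / v $ i ^ mdeg m)) u"
     unfolding lift_desc[OF Wo(1) hm[OF sm] u] lift_desc[OF Wo(1) hm[OF var.hyps(2)] u] lift_desc[OF Wo(1) crd[OF W j] u]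
     using mon_mono1[of j u] mdeg_mono1[of j] by (simp add: mon_add mdeg_add)
   qed
  qed
  have sums: "?A (desc W (\<lambda>v. \<Sum>m\<in>B. lkp p m * (mon m v / v $ i ^ d)))" if "finite B" "B \<subseteq> supp p" for B
   using that
  proof (induction B)
   case empty
   have h: "hreg n (\<Union>W) 0 (\<lambda>v. 0)" by (rule hreg_const[OF Wo(4)])
   have "?A (desc W (\<lambda>v. 0))"
    by (rule cmultA[OF one desc_regular[OF Wo(1) h], of 0]) (simp add: lift_desc[OF Wo(1) h])
   then show ?case by simp
  next
   case (insert m B)
   have m: "supp m \<subseteq> {..n}" "mdeg m = d" using insert p by (auto simp: homogeneous_iff)
   have hs: "hreg n (\<Union>W) 0 (\<lambda>v. \<Sum>m\<in>B. lkp p m * (mon m v / v $ i ^ d))" if "B \<subseteq> supp p" for B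
   proof (intro hreg_sum[OF Wo(4)] hreg_cmult[OF Wo(4)])
    fix m assume "m \<in> B"
    then have "supp m \<subseteq> {..n}" "mdeg m = d" using that p by (auto simp: homogeneous_iff)
    then show "hreg n (\<Union>W) 0 (\<lambda>v. mon m v / v $ i ^ d)" using quo[OF W homogeneous_single[of m n d 1]] by simp
   qed
   have hm: "hreg n (\<Union>W) 0 (\<lambda>v. mon m v / v $ i ^ d)" using quo[OF W homogeneous_single[OF m, of 1]] by simp
   have hc: "hreg n (\<Union>W) 0 (\<lambda>v. lkp p m * (mon m v / v $ i ^ d))" by (rule hreg_cmult[OF Wo(4) hm])
   have "?A (desc W (\<lambda>v. mon m v / v $ i ^ d))" using monA[OF m(1)] m(2) by simp
   then have mA: "?A (desc W (\<lambda>v. lkp p m * (mon m v / v $ i ^ d)))"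
    by (rule cmultA[OF _ desc_regular[OF Wo(1) hc], of _ "lkp p m"]) (simp only: lift_desc[OF Wo(1) hc] lift_desc[OF Wo(1) hm])
   have BA: "?A (desc W (\<lambda>v. \<Sum>m\<in>B. lkp p m * (mon m v / v $ i ^ d)))" using insert by simp
   have hsB: "B \<subseteq> supp p" using insert by simp
   show ?case
   proof (rule addA[OF mA BA desc_regular[OF Wo(1) hs[OF insert.prems]]])
    fix u assume u: "u \<in> \<Union>W"
    show "lift (desc W (\<lambda>v. \<Sum>m\<in>insert m B. lkp p m * (mon m v / v $ i ^ d))) u =
     lift (desc W (\<lambda>v. lkp p m * (mon m v / v $ i ^ d))) u +
     lift (desc W (\<lambda>v. \<Sum>m\<in>B. lkp p m * (mon m v / v $ i ^ d))) u"
     unfolding lift_desc[OF Wo(1) hs[OF insert.prems] u] lift_desc[OF Wo(1) hs[OF hsB] u] lift_desc[OF Wo(1) hc u]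
     by (rule sum.insert[OF insert.hyps(1,2)])
   qed
  qed
  have "(\<lambda>v. \<Sum>m\<in>supp p. lkp p m * (mon m v / v $ i ^ d)) = (\<lambda>v. ev p v / v $ i ^ d)"
   by (simp add: poly_eval_mon sum_divide_distrib)
  then show ?thesis using sums[of "supp p"] by simp
 qed
 note Wo = opens_inD[OF W]
 have W1: "W \<in> opens_in n U" and W2: "W \<in> opens_in n U'" using opens_in_trans V W by auto
 show ?thesis
 proof (rule cone_ext[OF Wo(3)])
  show "\<theta> W s \<in> extensional W" "\<eta> W s \<in> extensional W"
   using regularD(1)[OF Wo(1)] tangentD(1)[OF \<theta> W1 s] tangentD(1)[OF \<eta> W2 s] by auto
  fix v assume v: "v \<in> \<Union>W"
  obtain c d g h where 1: "homogeneous n c g" "homogeneous n d h" "int c = int d + 0" "d \<ge> 1" "ev h v \<noteq> 0"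
   "\<And>u. u \<in> carr n \<Longrightarrow> ev h u \<noteq> 0 \<Longrightarrow> u \<in> \<Union>W"
   "\<And>u. u \<in> carr n \<Longrightarrow> ev h u \<noteq> 0 \<Longrightarrow> lift s u = ev g u / ev h u"
   by (rule hregE[OF regularD(2)[OF Wo(1) s] v]) blast
  have cd: "c = d" using 1(3) by simp
  let ?B = "basic n h"
  have cb: "\<Union>?B = basic_cone n h" by (rule cone_basic[OF 1(2)])
  have BW: "?B \<in> opens_in n W"
   unfolding opens_in_iff cone_subset_iff[OF Wo(3) basic_sub, symmetric] cb
   using zopen_basic[OF 1(2)] 1(6) by (auto simp: basic_cone_def)
  have BV: "?B \<in> opens_in n V" using opens_in_trans[OF W BW] .
  note Bo = opens_inD[OF BW]
  have B1: "?B \<in> opens_in n U" and B2: "?B \<in> opens_in n U'" using opens_in_trans V BV by auto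
  have vB: "v \<in> \<Union>?B" unfolding cb using hreg_rep_eval_ne[OF 1(2,4) _ 1(5)] ocone_carr[OF Wo(4) v] by simp
  let ?s = "restrict s ?B" and ?h = "desc ?B (\<lambda>v. ev h v / v $ i ^ d)" and ?g = "desc ?B (\<lambda>v. ev g v / v $ i ^ d)"
  have sB: "?s \<in> regular n ?B" by (rule regular_restrict[OF Wo(1) BW s])
  have gd: "homogeneous n d g" using 1(1) cd by simp
  have gB: "?g \<in> regular n ?B" and hB: "?h \<in> regular n ?B"
   using desc_regular[OF Bo(1) quo[OF BV gd]] desc_regular[OF Bo(1) quo[OF BV 1(2)]] by auto
  have lg: "lift ?g u = ev g u / u $ i ^ d" and lh: "lift ?h u = ev h u / u $ i ^ d" if "u \<in> \<Union>?B" for u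
   using lift_desc[OF Bo(1) quo[OF BV gd] that] lift_desc[OF Bo(1) quo[OF BV 1(2)] that] by auto
  have ls: "lift ?s u = ev g u / ev h u" if "u \<in> \<Union>?B" for u
   using lift_restrict[OF Bo(3) that] 1(7)[of u] that unfolding cb by (auto simp: basic_cone_def)
  have prod: "lift ?g u = lift ?s u * lift ?h u" if u: "u \<in> \<Union>?B" for u
   using u unfolding lg[OF u] lh[OF u] ls[OF u] cb by (simp add: basic_cone_def)
  have "lift (\<theta> ?B ?g) v = lift ?s v * lift (\<theta> ?B ?h) v + lift ?h v * lift (\<theta> ?B ?s) v"
   by (rule tangent_pointwise(2)[OF \<theta> B1 gB sB hB vB prod])
  moreover have "lift (\<eta> ?B ?g) v = lift ?s v * lift (\<eta> ?B ?h) v + lift ?h v * lift (\<eta> ?B ?s) v"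
   by (rule tangent_pointwise(2)[OF \<eta> B2 gB sB hB vB prod])
  moreover have "\<theta> ?B ?g = \<eta> ?B ?g" "\<theta> ?B ?h = \<eta> ?B ?h" using poly_agree[OF BV gd] poly_agree[OF BV 1(2)] by auto
  moreover have "lift ?h v \<noteq> 0"
   using lh[OF vB] 1(5) chart_coord[of i n ?B v] i Wo(2) Bo(2) vB by auto
  ultimately have "lift (\<theta> ?B ?s) v = lift (\<eta> ?B ?s) v" by simp
  then show "lift (\<theta> W s) v = lift (\<eta> W s) v"
   unfolding tangentD(5)[OF \<theta> W1 BW s] tangentD(5)[OF \<eta> W2 BW s] lift_restrict[OF Bo(3) vB] .
 qed
qed

section \<open>Logarithmic vector fields\<close>

lemma proj_zeros_iff:
 assumes "homogeneous n k f" "v \<in> carr n" "v \<noteq> zvec n"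
 shows "proj_point v \<in> proj_zeros n f \<longleftrightarrow> ev f v = 0"
proof
 assume "proj_point v \<in> proj_zeros n f"
 then show "ev f v = 0" using in_proj_point[of v] by (auto simp: proj_zeros_def)
next
 assume "ev f v = 0"
 then have "\<forall>u\<in>proj_point v. ev f u = 0"
  using homogeneous_eval[OF assms(1,2)] by (auto simp: proj_point_def)
 then show "proj_point v \<in> proj_zeros n f" using proj_point_in[OF assms(2,3)] by (simp add: proj_zeros_def)
qed

lemma ddir_quotient_coord:
 assumes "i \<le> n" "g \<in> polys n" "v \<in> carr n" "w \<in> carr n" "v $ i \<noteq> 0"
 shows "ddir (\<lambda>u. ev g u / u $ i ^ d) v w =
  (grad n g v \<bullet> w) / v $ i ^ d - of_nat d * ev g v * w $ i / v $ i ^ (Suc d)"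
proof (rule ddirI)
 have 1: "((\<lambda>t. ev g (v + t \<cdot>\<^sub>v w)) has_field_derivative (grad n g v \<bullet> w)) (at 0)"
  using directional_derivative[OF assms(2,3,4), of 0] assms by simp
 have "((\<lambda>t. (v $ i + t * w $ i) ^ d) has_field_derivative of_nat d * v $ i ^ (d - 1) * w $ i) (at 0)"
  by (auto intro!: derivative_eq_intros)
 then have 2: "((\<lambda>t. (v + t \<cdot>\<^sub>v w) $ i ^ d) has_field_derivative of_nat d * v $ i ^ (d - 1) * w $ i) (at 0)"
  using assms by simp
 have "((\<lambda>t. ev g (v + t \<cdot>\<^sub>v w) / (v + t \<cdot>\<^sub>v w) $ i ^ d) has_field_derivative
   ((grad n g v \<bullet> w) * (v + 0 \<cdot>\<^sub>v w) $ i ^ d - ev g (v + 0 \<cdot>\<^sub>v w) * (of_nat d * v $ i ^ (d - 1) * w $ i)) /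
   ((v + 0 \<cdot>\<^sub>v w) $ i ^ d * (v + 0 \<cdot>\<^sub>v w) $ i ^ d)) (at 0)"
  by (rule DERIV_divide[OF 1 2]) (use assms in simp)
 moreover have "((grad n g v \<bullet> w) * (v + 0 \<cdot>\<^sub>v w) $ i ^ d - ev g (v + 0 \<cdot>\<^sub>v w) * (of_nat d * v $ i ^ (d - 1) * w $ i)) /
   ((v + 0 \<cdot>\<^sub>v w) $ i ^ d * (v + 0 \<cdot>\<^sub>v w) $ i ^ d) =
   (grad n g v \<bullet> w) / v $ i ^ d - of_nat d * ev g v * w $ i / v $ i ^ (Suc d)"
 proof -
  have "of_nat d * v $ i ^ (d - 1) / (v $ i ^ d * v $ i ^ d) = of_nat d / v $ i ^ Suc d"
  proof (cases d)
   case (Suc e)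
   then show ?thesis using assms(5) by (simp add: field_simps)
  qed simp
  then have "ev g v * (of_nat d * v $ i ^ (d - 1) * w $ i) / (v $ i ^ d * v $ i ^ d)
   = of_nat d * ev g v * w $ i / v $ i ^ (Suc d)"
  proof -
   have "ev g v * (of_nat d * v $ i ^ (d - 1) * w $ i) / (v $ i ^ d * v $ i ^ d)
    = (of_nat d * v $ i ^ (d - 1) / (v $ i ^ d * v $ i ^ d)) * (ev g v * w $ i)" by simp
   also have "\<dots> = (of_nat d / v $ i ^ Suc d) * (ev g v * w $ i)"
    using \<open>of_nat d * v $ i ^ (d - 1) / (v $ i ^ d * v $ i ^ d) = of_nat d / v $ i ^ Suc d\<close> by (simp only:)
   finally show ?thesis by simp
  qed
  then show ?thesis using assms by (simp add: diff_divide_distrib)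
 qed
 ultimately show "((\<lambda>t. ev g (v + t \<cdot>\<^sub>v w) / (v + t \<cdot>\<^sub>v w) $ i ^ d) has_field_derivative
   (grad n g v \<bullet> w) / v $ i ^ d - of_nat d * ev g v * w $ i / v $ i ^ (Suc d)) (at 0)" by metis
qed

lemma zopen_chart: "i \<le> n \<Longrightarrow> zariski_open n (chart n i)"
 by (rule zopen_basic[OF homogeneous_Var])

locale smooth_form =
 fixes n k :: nat and f :: cpoly
 assumes n: "n \<ge> 1" and k: "k \<ge> 1" and hom: "homogeneous n k f" and ns: "nonsingular n f"
begin

abbreviation divisor :: "ppoint set" where "divisor \<equiv> proj_zeros n f"

lemma fp: "f \<in> polys n" using hom homogeneous_polys by blast

lemma f_nonzero: "f \<noteq> 0"
proof
 assume "f = 0"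
 obtain v where "ev f v \<noteq> 0" by (rule nonsingular_nonzero[OF ns fp])
 then show False unfolding \<open>f = 0\<close> by simp
qed

lemma gradient_nonzero:
 assumes "v \<in> carr n" "v \<noteq> zvec n"
 obtains j where "j \<le> n" "ev (poly_partial j f) v \<noteq> 0"
proof (cases "ev f v = 0")
 case True
 then show ?thesis using that ns assms unfolding nonsingular_def by auto
next
 case False
 then have "grad n f v \<bullet> v \<noteq> 0" using euler_identity[OF hom assms(1)] k by simp
 then have "\<exists>j\<le>n. ev (poly_partial j f) v \<noteq> 0" unfolding grad_dot[OF assms(1)]
  by (metis (no_types, lifting) atMost_iff mult_zero_right sum.neutral)
 then show ?thesis using that by blast
qed

text \<open>Local quotients of \<open>s\<close> by the equation of the divisor exist by \<open>nonsingular_divides_homogeneous\<close>. They glue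
 because \<open>f\<close> is not a zero divisor.\<close>

lemma chart_divide:
 assumes V: "zariski_open n V" "i \<le> n" "V \<subseteq> chart n i" and s: "s \<in> regular n V"
  and z: "\<And>v. v \<in> \<Union>V \<Longrightarrow> ev f v = 0 \<Longrightarrow> lift s v = 0"
 obtains b where "b \<in> regular n V" "\<And>v. v \<in> \<Union>V \<Longrightarrow> lift s v = lift b v * (ev f v / v $ i ^ k)"
proof -
 note Vo = zopenD[OF V(1)]
 define rp where "rp d g h \<longleftrightarrow> homogeneous n d g \<and> homogeneous n d h \<and> d \<ge> 1 \<and>
   (\<forall>u\<in>carr n. ev h u \<noteq> 0 \<longrightarrow> u \<in> \<Union>V \<and> lift s u = ev g u / ev h u * (ev f u / u $ i ^ k))" for d g h
 have uniq: "ev g u / ev h u = ev g' u / ev h' u"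
  if 1: "rp d g h" "ev h u \<noteq> 0" and 2: "rp d' g' h'" "ev h' u \<noteq> 0" for d g h d' g' h' u
 proof -
  have p: "g \<in> polys n" "h \<in> polys n" "g' \<in> polys n" "h' \<in> polys n"
   using 1 2 homogeneous_polys unfolding rp_def by blast+
  have "h * h' * f * (g * h' - g' * h) = 0"
  proof (rule polys_eq_0I[of _ n])
   show "h * h' * f * (g * h' - g' * h) \<in> polys n" using p fp by (intro polys_mult polys_diff)
   fix w assume w: "w \<in> carr n"
   show "ev (h * h' * f * (g * h' - g' * h)) w = 0"
   proof (cases "ev h w = 0 \<or> ev h' w = 0 \<or> ev f w = 0")
    case False
    then have "w \<in> \<Union>V" and e: "ev g w / ev h w * (ev f w / w $ i ^ k) =
      ev g' w / ev h' w * (ev f w / w $ i ^ k)"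
     using 1(1) 2(1) w unfolding rp_def by (blast, metis)
    then have "w $ i \<noteq> 0" using chart_coord[OF V(2,3)] by blast
    then have "ev f w / w $ i ^ k \<noteq> 0" using False by simp
    then have "ev g w / ev h w = ev g' w / ev h' w" using e by (metis mult_right_cancel)
    then show ?thesis using False by (simp add: frac_eq_eq)
   qed auto
  qed
  moreover have "h \<noteq> 0" "h' \<noteq> 0" using 1(2) 2(2) by auto
  ultimately have "g * h' = g' * h" using f_nonzero by simp
  then have "ev g u * ev h' u = ev g' u * ev h u" by (metis poly_eval_mult)
  then show ?thesis using 1(2) 2(2) by (simp add: frac_eq_eq)
 qed
 have ex: "\<exists>d g h. rp d g h \<and> ev h v \<noteq> 0" if v: "v \<in> \<Union>V" for v
 proof -
  obtain c d P Q where 1: "homogeneous n c P" "homogeneous n d Q" "int c = int d + 0" "d \<ge> 1" "ev Q v \<noteq> 0"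
   "\<And>u. u \<in> carr n \<Longrightarrow> ev Q u \<noteq> 0 \<Longrightarrow> u \<in> \<Union>V"
   "\<And>u. u \<in> carr n \<Longrightarrow> ev Q u \<noteq> 0 \<Longrightarrow> lift s u = ev P u / ev Q u"
   by (rule hregE[OF regularD(2)[OF V(1) s] v]) blast
  have cd: "c = d" using 1(3) by simp
  have Vk: "homogeneous n k (Var i ^ k)" using homogeneous_power[OF homogeneous_Var[OF V(2)], of k] by simp
  have "homogeneous n (d + d + k) (P * Q * Var i ^ k)"
   using 1 cd by (intro homogeneous_mult Vk) auto
  then obtain r where r: "homogeneous n (d + d) r" "P * Q * Var i ^ k = r * f"
  proof (rule nonsingular_divides_homogeneous[OF n hom ns])
   fix u assume u: "u \<in> carr n" "ev f u = 0"
   show "ev (P * Q * Var i ^ k) u = 0"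
    using z[OF 1(6)[OF u(1)] u(2)] 1(7)[OF u(1)] by (cases "ev Q u = 0") auto
  qed blast
  have "rp (d + d) r (Q * Q)" unfolding rp_def
  proof (intro conjI ballI impI)
   show "homogeneous n (d + d) r" "homogeneous n (d + d) (Q * Q)" "d + d \<ge> 1"
    using r 1 homogeneous_mult[OF 1(2) 1(2)] by auto
   fix u assume u: "u \<in> carr n" "ev (Q * Q) u \<noteq> 0"
   then have Q: "ev Q u \<noteq> 0" by auto
   show uV: "u \<in> \<Union>V" using 1(6)[OF u(1) Q] .
   have ui: "u $ i \<noteq> 0" using chart_coord[OF V(2,3) uV] .
   have "ev (P * Q * Var i ^ k) u = ev (r * f) u" using r by simp
   then have "ev P u * ev Q u * u $ i ^ k = ev r u * ev f u"
    using mon_mono1[of i u] by simp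
   then show "lift s u = ev r u / ev (Q * Q) u * (ev f u / u $ i ^ k)"
   proof -
    have "ev r u / ev (Q * Q) u * (ev f u / u $ i ^ k) =
      (ev r u * ev f u) / (ev Q u * ev Q u * u $ i ^ k)" by simp
    also have "\<dots> = (ev P u * ev Q u * u $ i ^ k) / (ev Q u * ev Q u * u $ i ^ k)"
     using \<open>ev P u * ev Q u * u $ i ^ k = ev r u * ev f u\<close> by (simp only:)
    also have "\<dots> = ev P u / ev Q u" using Q ui by simp
    finally show ?thesis using 1(7)[OF u(1) Q] by simp
   qed
  qed
  then show ?thesis using 1(5) by (intro exI[of _ "d + d"] exI[of _ r] exI[of _ "Q * Q"]) auto
 qed
 define B where "B u = (THE z. \<exists>d g h. rp d g h \<and> ev h u \<noteq> 0 \<and> z = ev g u / ev h u)" for u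
 have B: "B u = ev g u / ev h u" if "rp d g h" "ev h u \<noteq> 0" for d g h u
  unfolding B_def
 proof (rule the_equality)
  show "\<exists>d g' h'. rp d g' h' \<and> ev h' u \<noteq> 0 \<and> ev g u / ev h u = ev g' u / ev h' u"
   using that by blast
 qed (use uniq that in metis)
 have hB: "hreg n (\<Union>V) 0 B"
 proof (rule hregI)
  fix v assume "v \<in> \<Union>V"
  then obtain d g h where 1: "rp d g h" "ev h v \<noteq> 0" using ex by blast
  show "\<exists>c d g h. homogeneous n c g \<and> homogeneous n d h \<and> int c = int d + 0 \<and> d \<ge> 1 \<and>
   ev h v \<noteq> 0 \<and> (\<forall>u\<in>carr n. ev h u \<noteq> 0 \<longrightarrow> u \<in> \<Union>V \<and> B u = ev g u / ev h u)"
   using 1 B[OF 1(1)] unfolding rp_def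
   by (intro exI[of _ d] exI[of _ g] exI[of _ h]) auto
 qed
 show ?thesis
 proof (rule that[OF desc_regular[OF V(1) hB]])
  fix v assume v: "v \<in> \<Union>V"
  then obtain d g h where 1: "rp d g h" "ev h v \<noteq> 0" using ex by blast
  have "lift s v = ev g v / ev h v * (ev f v / v $ i ^ k)"
   using 1 ocone_carr[OF Vo(2) v] unfolding rp_def by blast
  then show "lift s v = lift (desc V B) v * (ev f v / v $ i ^ k)"
   using B[OF 1] lift_desc[OF V(1) hB v] by simp
 qed
qed

text \<open>The local equation of the divisor in the chart \<open>x\<^sub>i \<noteq> 0\<close>.\<close>

definition eqn :: "nat \<Rightarrow> ppoint set \<Rightarrow> ppoint \<Rightarrow> complex" where
 "eqn i V = desc V (\<lambda>v. ev f v / v $ i ^ k)"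

lemma eqn_regular:
 assumes V: "zariski_open n V" "i \<le> n" "V \<subseteq> chart n i"
 shows "eqn i V \<in> regular n V" "v \<in> \<Union>V \<Longrightarrow> lift (eqn i V) v = ev f v / v $ i ^ k"
proof -
 have h: "hreg n (\<Union>V) 0 (\<lambda>v. ev f v / v $ i ^ k)"
  using chart_coord[OF V(2,3)] by (intro hreg_chart_quotient V zopenD hom) auto
 show "eqn i V \<in> regular n V" "v \<in> \<Union>V \<Longrightarrow> lift (eqn i V) v = ev f v / v $ i ^ k"
  unfolding eqn_def using desc_regular[OF V(1) h] lift_desc[OF V(1) h] by auto
qed

lemma divisor_iff:
 assumes "V \<subseteq> proj_space n" "v \<in> \<Union>V"
 shows "proj_point v \<in> divisor \<longleftrightarrow> ev f v = 0"
 using proj_zeros_iff[OF hom, of v] cone_iff[OF assms(1), of v] assms(2) by blast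

lemma vanish_iff:
 assumes "W \<subseteq> proj_space n"
 shows "(\<forall>p\<in>W \<inter> divisor. g p = 0) \<longleftrightarrow> (\<forall>v\<in>\<Union>W. ev f v = 0 \<longrightarrow> lift g v = 0)"
proof
 assume a: "\<forall>p\<in>W \<inter> divisor. g p = 0"
 show "\<forall>v\<in>\<Union>W. ev f v = 0 \<longrightarrow> lift g v = 0"
  using a divisor_iff[OF assms] cone_iff[OF assms] by blast
next
 assume a: "\<forall>v\<in>\<Union>W. ev f v = 0 \<longrightarrow> lift g v = 0"
 show "\<forall>p\<in>W \<inter> divisor. g p = 0"
 proof
  fix p assume p: "p \<in> W \<inter> divisor"
  then have p': "p \<in> proj_space n" using assms by auto
  have "rep p \<in> \<Union>W" using p rep_in[OF p'] by blast
  moreover have "ev f (rep p) = 0" using p rep_in[OF p'] by (auto simp: proj_zeros_def)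
  ultimately show "g p = 0" using a rep_props(3)[OF p'] by metis
 qed
qed

lemma eqn_local_equation:
 assumes V: "zariski_open n V" "i \<le> n" "V \<subseteq> chart n i"
 shows "local_equation n divisor V (eqn i V)"
 unfolding local_equation_def
proof (intro conjI ballI)
 show "eqn i V \<in> regular n V" by (rule eqn_regular[OF V])
 fix W g assume W: "W \<in> opens_in n V" and g: "g \<in> regular n W"
 note Wo = opens_inD[OF W]
 have WV: "W \<subseteq> chart n i" using Wo V by auto
 show "(\<forall>p\<in>W \<inter> divisor. g p = 0) \<longleftrightarrow> (\<exists>a\<in>regular n W. g = (\<lambda>p\<in>W. a p * eqn i V p))"
  unfolding vanish_iff[OF Wo(3)]
 proof
  assume "\<forall>v\<in>\<Union>W. ev f v = 0 \<longrightarrow> lift g v = 0"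
  then obtain b where b: "b \<in> regular n W" "\<And>v. v \<in> \<Union>W \<Longrightarrow> lift g v = lift b v * (ev f v / v $ i ^ k)"
   using chart_divide[OF Wo(1) V(2) WV g] by blast
  have "g = (\<lambda>p\<in>W. b p * eqn i V p)"
  proof (rule cone_ext[OF Wo(3) regularD(1)[OF Wo(1) g] restrict_extensional])
   fix v assume v: "v \<in> \<Union>W"
   then have vV: "v \<in> \<Union>V" using Wo by blast
   show "lift g v = lift (\<lambda>p\<in>W. b p * eqn i V p) v"
    unfolding lift_restrict[OF Wo(3) v] eqn_regular(2)[OF V vV] by (rule b(2)[OF v])
  qed
  then show "\<exists>a\<in>regular n W. g = (\<lambda>p\<in>W. a p * eqn i V p)" using b(1) by blast
 next
  assume "\<exists>a\<in>regular n W. g = (\<lambda>p\<in>W. a p * eqn i V p)"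
  then obtain a where a: "g = (\<lambda>p\<in>W. a p * eqn i V p)" by blast
  show "\<forall>v\<in>\<Union>W. ev f v = 0 \<longrightarrow> lift g v = 0"
  proof (intro ballI impI)
   fix v assume v: "v \<in> \<Union>W" "ev f v = 0"
   then have vV: "v \<in> \<Union>V" using Wo by blast
   show "lift g v = 0" unfolding a lift_restrict[OF Wo(3) v(1)] eqn_regular(2)[OF V vV] using v(2) by simp
  qed
 qed
qed

text \<open>A local equation of the divisor vanishes at the zeros of \<open>f\<close>, so it has the form \<open>b f / x\<^sub>i\<^sup>k\<close>. By the product rule, its
 derivative along \<open>a\<close> vanishes at the zeros of \<open>f\<close> too, and hence is a multiple of the local equation.\<close>

lemma vfield_of_log:
 assumes U: "zariski_open n U" and a: "vreg n (\<Union>U) a" and t: "\<And>v. v \<in> \<Union>U \<Longrightarrow> grad n f v \<bullet> a v = 0"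
 shows "vfield_of n U a \<in> log_sections n divisor U"
 unfolding log_sections_def
proof (intro CollectI conjI ballI allI impI)
 show "vfield_of n U a \<in> tangent_sections n U" by (rule vfield_of_tangent[OF U a])
 fix V h assume V: "V \<in> opens_in n U" and le: "local_equation n divisor V h"
 note Vo = opens_inD[OF V]
 have h: "h \<in> regular n V" using le by (simp add: local_equation_def)
 have iff: "(\<forall>v\<in>\<Union>V. ev f v = 0 \<longrightarrow> lift g v = 0) \<longleftrightarrow> (\<exists>a\<in>regular n V. g = (\<lambda>p\<in>V. a p * h p))"
  if "g \<in> regular n V" for g
  using le opens_in_refl[OF Vo(1)] that unfolding local_equation_def vanish_iff[OF Vo(3), symmetric] by blast
 have one: "(\<lambda>p\<in>V. 1) \<in> regular n V" by (rule regular_restrictI[OF Vo(1) hreg_const[OF Vo(4)]])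
 have "h = (\<lambda>p\<in>V. (\<lambda>p\<in>V. 1) p * h p)"
  using regularD(1)[OF Vo(1) h] by (auto simp: fun_eq_iff extensional_def)
 then have hv: "\<forall>v\<in>\<Union>V. ev f v = 0 \<longrightarrow> lift h v = 0" using iff[OF h] one by blast
 have th: "vfield_of n U a V h \<in> regular n V" by (rule vfield_of_apply(1)[OF V a h])
 show "\<exists>a'\<in>regular n V. vfield_of n U a V h = (\<lambda>p\<in>V. a' p * h p)"
  unfolding iff[OF th, symmetric]
 proof (intro ballI impI)
  fix v assume v: "v \<in> \<Union>V" and fv: "ev f v = 0"
  have vc: "v \<in> carr n" "v \<noteq> zvec n" using ocone_carr[OF Vo(4) v] ocone_nonzero[OF Vo(4) v] by auto
  obtain i where i: "i \<le> n" "v $ i \<noteq> 0" using nonzero_coord[OF vc] .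
  let ?V = "V \<inter> chart n i"
  have cone: "\<Union>?V = \<Union>V \<inter> \<Union>(chart n i)" by (rule cone_Int[OF Vo(3) basic_sub])
  have Vi: "?V \<in> opens_in n V"
   using zopen_Int[OF Vo(1) zopen_basic[OF homogeneous_Var[OF i(1)]]] by (auto simp: opens_in_iff)
  note Vio = opens_inD[OF Vi]
  have vVi: "v \<in> \<Union>?V" unfolding cone chart_cone[OF i(1)] using v vc i by auto
  obtain b where b: "b \<in> regular n ?V"
   "\<And>u. u \<in> \<Union>?V \<Longrightarrow> lift (restrict h ?V) u = lift b u * (ev f u / u $ i ^ k)"
  proof (rule chart_divide[OF Vio(1) i(1) _ regular_restrict[OF Vo(1) Vi h]])
   fix u assume u: "u \<in> \<Union>?V" "ev f u = 0"
   show "lift (restrict h ?V) u = 0" unfolding lift_restrict[OF Vio(3) u(1)] using hv u Vio(5) by blast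
  qed auto
  have av: "a v \<in> carr n" using vregD(1)[OF a] v Vo(5) by blast
  have "lift (vfield_of n U a V h) v = ddir (lift h) v (a v)" by (rule vfield_of_apply(2)[OF V a h v])
  also have "\<dots> = ddir (\<lambda>u. lift b u * (ev f u / u $ i ^ k)) v (a v)"
   by (rule ddir_cong[OF Vio(4) vVi av]) (use b(2) lift_restrict[OF Vio(3), of _ h] in simp)
  also have "\<dots> = lift b v * ddir (\<lambda>u. ev f u / u $ i ^ k) v (a v) + ev f v / v $ i ^ k * ddir (lift b) v (a v)"
  proof (rule ddir_mult[OF regularD(2)[OF Vio(1) b(1)] _ vVi ocone_sub[OF Vio(4)] av])
   show "hreg n (\<Union>?V) 0 (\<lambda>u. ev f u / u $ i ^ k)"
    by (rule hreg_chart_quotient[OF i(1) Vio(4) _ hom]) (rule chart_coord[OF i(1), of ?V], auto)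
  qed
  also have "ddir (\<lambda>u. ev f u / u $ i ^ k) v (a v) = 0"
   using t[of v] v Vo(5) fv ddir_quotient_coord[OF i(1) fp vc(1) av i(2), of k] by auto
  finally show "lift (vfield_of n U a V h) v = 0" using fv by simp
 qed
qed

definition represents :: "ppoint set \<Rightarrow> vfield \<Rightarrow> (complex vec \<Rightarrow> complex vec) \<Rightarrow> bool" where
 "represents U \<theta> a \<longleftrightarrow> vreg n (\<Union>U) a \<and> (\<forall>v\<in>\<Union>U. grad n f v \<bullet> a v = 0) \<and>
  (\<forall>V\<in>opens_in n U. \<forall>s\<in>regular n V. \<forall>v\<in>\<Union>V. lift (\<theta> V s) v = ddir (lift s) v (a v))"

lemma representsD:
 assumes "represents U \<theta> a"
 shows "vreg n (\<Union>U) a" "v \<in> \<Union>U \<Longrightarrow> grad n f v \<bullet> a v = 0"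
  "V \<in> opens_in n U \<Longrightarrow> s \<in> regular n V \<Longrightarrow> v \<in> \<Union>V \<Longrightarrow> lift (\<theta> V s) v = ddir (lift s) v (a v)"
 using assms unfolding represents_def by blast+

lemma coord_regular:
 assumes V: "zariski_open n V" "i \<le> n" "V \<subseteq> chart n i" and j: "j \<le> n"
 shows "hreg n (\<Union>V) 0 (\<lambda>v. v $ j / v $ i)"
 using hreg_chart_quotient[OF V(2) zopenD(2)[OF V(1)] chart_coord[OF V(2,3)] homogeneous_Var[OF j]] mon_mono1[of j] by simp

lemma ddir_coord:
 assumes "i \<le> n" "j \<le> n" "v \<in> carr n" "w \<in> carr n" "v $ i \<noteq> 0"
 shows "ddir (\<lambda>u. u $ j / u $ i) v w = w $ j / v $ i - v $ j * w $ i / (v $ i * v $ i)"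
proof -
 have g: "grad n (Var j) v \<bullet> w = w $ j"
 proof -
  have "((\<lambda>t. ev (Var j) (v + t \<cdot>\<^sub>v w)) has_field_derivative grad n (Var j) v \<bullet> w) (at 0)"
   using directional_derivative[OF polys_Var[OF assms(2)] assms(3,4), of 0] assms by simp
  moreover have "ev (Var j) (v + t \<cdot>\<^sub>v w) = v $ j + t * w $ j" for t
   using assms mon_mono1[of j "v + t \<cdot>\<^sub>v w"] by simp
  moreover have "((\<lambda>t. v $ j + t * w $ j) has_field_derivative w $ j) (at 0)" by (auto intro!: derivative_eq_intros)
  ultimately show ?thesis using DERIV_unique by fastforce
 qed
 show ?thesis
  using ddir_quotient_coord[OF assms(1) polys_Var[OF assms(2)] assms(3,4,5), of 1] g mon_mono1[of j] by simp
qed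

text \<open>Two representatives act equally on the affine coordinates, hence differ by \<open>\<mu> v\<close>. Then
 \<open>0 = \<nabla>f(v) \<bullet> \<mu> v = k \<mu> f(v)\<close>, and \<open>\<mu>\<close> vanishes because \<open>f\<close> is not a zero divisor.\<close>

lemma represents_unique:
 assumes U: "zariski_open n U" "zariski_open n U'" and r: "represents U \<theta> a" "represents U' \<theta> a'"
  and v: "v \<in> \<Union>U" "v \<in> \<Union>U'"
 shows "a v = a' v"
proof -
 have vc: "v \<in> carr n" "v \<noteq> zvec n" using ocone_carr[OF zopenD(2)[OF U(1)] v(1)] ocone_nonzero[OF zopenD(2)[OF U(1)] v(1)] by auto
 obtain i where i: "i \<le> n" "v $ i \<noteq> 0" using nonzero_coord[OF vc] .
 let ?V = "U \<inter> U' \<inter> chart n i"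
 have Vo: "zariski_open n ?V" by (intro zopen_Int U zopen_chart i)
 have V: "?V \<in> opens_in n U" "?V \<in> opens_in n U'" using Vo by (auto simp: opens_in_iff)
 have "\<Union>?V = \<Union>U \<inter> \<Union>U' \<inter> \<Union>(chart n i)"
  using cone_Int[OF zopenD(1)[OF U(1)] zopenD(1)[OF U(2)]] cone_Int[OF zopenD(1)[OF zopen_Int[OF U]] basic_sub] by simp
 then have vV: "v \<in> \<Union>?V" using v vc i chart_cone[OF i(1)] by auto
 have av: "a u \<in> carr n" "a' u \<in> carr n" if "u \<in> \<Union>?V" for u
  using vregD(1)[OF representsD(1)[OF r(1)]] vregD(1)[OF representsD(1)[OF r(2)]] that by blast+
 define \<mu> where "\<mu> u = a u $ i - a' u $ i" for u
 have d: "a u $ j - a' u $ j = \<mu> u / u $ i * u $ j" if u: "u \<in> \<Union>?V" and j: "j \<le> n" for u j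
 proof -
  have uc: "u \<in> carr n" using ocone_carr[OF zopenD(2)[OF Vo] u] .
  have ui: "u $ i \<noteq> 0" using chart_coord[OF i(1) _ u] by auto
  have ch: "?V \<subseteq> chart n i" by auto
  note reg = desc_regular[OF Vo coord_regular[OF Vo i(1) ch j]] lift_desc[OF Vo coord_regular[OF Vo i(1) ch j]]
  let ?s = "desc ?V (\<lambda>v. v $ j / v $ i)"
  have "ddir (lift ?s) u w = w $ j / u $ i - u $ j * w $ i / (u $ i * u $ i)" if "w \<in> carr n" for w
   using ddir_cong[OF zopenD(2)[OF Vo] u that reg(2)] ddir_coord[OF i(1) j uc that ui] by simp
  moreover have "ddir (lift ?s) u (a u) = ddir (lift ?s) u (a' u)"
   using representsD(3)[OF r(1) V(1) reg(1) u] representsD(3)[OF r(2) V(2) reg(1) u] by simp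
  ultimately have "a u $ j / u $ i - u $ j * a u $ i / (u $ i * u $ i) = a' u $ j / u $ i - u $ j * a' u $ i / (u $ i * u $ i)"
   using av[OF u] by simp
  then have "(a u $ j / u $ i - u $ j * a u $ i / (u $ i * u $ i)) * u $ i = (a' u $ j / u $ i - u $ j * a' u $ i / (u $ i * u $ i)) * u $ i"
   by simp
  then have "a u $ j - u $ j * a u $ i / u $ i = a' u $ j - u $ j * a' u $ i / u $ i"
   using ui by (simp add: left_diff_distrib)
  then show ?thesis unfolding \<mu>_def by (simp add: algebra_simps diff_divide_distrib)
 qed
 have \<mu>0: "\<mu> u * ev f u = 0" if u: "u \<in> \<Union>?V" for u
 proof -
  have uc: "u \<in> carr n" using ocone_carr[OF zopenD(2)[OF Vo] u] .
  have ui: "u $ i \<noteq> 0" using chart_coord[OF i(1) _ u] by auto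
  have uU: "u \<in> \<Union>U" "u \<in> \<Union>U'" using u by blast+
  have "0 = grad n f u \<bullet> a u - grad n f u \<bullet> a' u"
   unfolding representsD(2)[OF r(1) uU(1)] representsD(2)[OF r(2) uU(2)] by simp
  also have "\<dots> = (\<Sum>j\<le>n. (a u $ j - a' u $ j) * ev (poly_partial j f) u)"
   unfolding grad_dot[OF av(1)[OF u]] grad_dot[OF av(2)[OF u]] by (simp add: sum_subtractf left_diff_distrib)
  also have "\<dots> = (\<Sum>j\<le>n. \<mu> u / u $ i * (u $ j * ev (poly_partial j f) u))"
   by (rule sum.cong[OF refl]) (use d[OF u] in simp)
  also have "\<dots> = \<mu> u / u $ i * (grad n f u \<bullet> u)" unfolding grad_dot[OF uc] by (simp add: sum_distrib_left)
  also have "\<dots> = \<mu> u / u $ i * (of_nat k * ev f u)" using euler_identity[OF hom uc] by simp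
  finally show ?thesis using ui k by simp
 qed
 have sub: "\<Union>?V \<subseteq> \<Union>U" "\<Union>?V \<subseteq> \<Union>U'" by (rule cone_mono, blast)+
 have "hreg n (\<Union>?V) 1 \<mu>"
  unfolding \<mu>_def
  by (rule hreg_diff[OF zopenD(2)[OF Vo]
     vregD(2)[OF vreg_subset[OF representsD(1)[OF r(1)] zopenD(2)[OF Vo] sub(1)] i(1)]
     vregD(2)[OF vreg_subset[OF representsD(1)[OF r(2)] zopenD(2)[OF Vo] sub(2)] i(1)]])
 then have "\<mu> v = 0"
  by (rule hreg_zero_divisor[OF _ fp f_nonzero \<mu>0 vV ocone_sub[OF zopenD(2)[OF Vo]]])
 then have "a v $ j = a' v $ j" if "j \<le> n" for j using d[OF vV that] by simp
 then show ?thesis using av[OF vV] by (intro eq_vecI) auto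
qed

text \<open>The values on the affine coordinates give a vector function up to a multiple of the Euler field. As the
 field is logarithmic, \<open>\<nabla>f \<bullet> a\<close> is a multiple of \<open>f\<close>, and a suitable Euler multiple removes it.\<close>

lemma represents_chart:
 assumes \<theta>: "\<theta> \<in> log_sections n divisor U" and U: "zariski_open n U" and i: "i \<le> n"
 obtains a where "represents (U \<inter> chart n i) \<theta> a"
proof -
 let ?V = "U \<inter> chart n i"
 have Vo: "zariski_open n ?V" by (intro zopen_Int U zopen_chart i)
 have V: "?V \<in> opens_in n U" using Vo by (auto simp: opens_in_iff)
 have ch: "?V \<subseteq> chart n i" by auto
 note o = zopenD[OF Vo]
 have t: "\<theta> \<in> tangent_sections n U" using \<theta> by (simp add: log_sections_def)
 let ?y = "\<lambda>j. desc ?V (\<lambda>v. v $ j / v $ i)"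
 have yr: "?y j \<in> regular n ?V" "v \<in> \<Union>?V \<Longrightarrow> lift (?y j) v = v $ j / v $ i" if "j \<le> n" for j v
  using desc_regular[OF Vo coord_regular[OF Vo i ch that]] lift_desc[OF Vo coord_regular[OF Vo i ch that]] by auto
 have "\<exists>c\<in>regular n ?V. \<theta> ?V (eqn i ?V) = (\<lambda>p\<in>?V. c p * eqn i ?V p)"
  using \<theta> V eqn_local_equation[OF Vo i ch] unfolding log_sections_def by blast
 then obtain c where c: "c \<in> regular n ?V" "\<theta> ?V (eqn i ?V) = (\<lambda>p\<in>?V. c p * eqn i ?V p)" by blast
 define b where "b j = lift (\<theta> ?V (?y j))" for j
 have br: "hreg n (\<Union>?V) 0 (b j)" if "j \<le> n" for j
  unfolding b_def using regularD(2)[OF Vo tangentD(1)[OF t V yr(1)[OF that]]] .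
 \<comment> \<open>By the Euler identity, the second term cancels the multiple of f in the derivative of f along the first.\<close>
 define a where "a v = vec (Suc n) (\<lambda>j. v $ i * b j v - lift c v / of_nat k * v $ j)" for v
 have aj: "a v $ j = v $ i * b j v - lift c v / of_nat k * v $ j" if "j \<le> n" for v j using that by (simp add: a_def)
 have ac: "a v \<in> carr n" for v by (simp add: a_def)
 have vr: "vreg n (\<Union>?V) a" unfolding vreg_def
 proof (intro conjI ballI allI impI)
  fix j assume j: "j \<le> n"
  have "hreg n (\<Union>?V) 1 (\<lambda>v. v $ i * b j v - 1 / of_nat k * (lift c v * v $ j))"
   by (intro hreg_diff hreg_cmult o(2) hreg_mult[OF hreg_coord[OF o(2) i] br[OF j]]
     hreg_mult[OF regularD(2)[OF Vo c(1)] hreg_coord[OF o(2) j]]) auto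
  then show "hreg n (\<Union>?V) 1 (\<lambda>v. a v $ j)" using aj[OF j] by simp
 qed (rule ac)
 let ?\<eta> = "vfield_of n ?V a"
 have \<eta>: "?\<eta> \<in> tangent_sections n ?V" by (rule vfield_of_tangent[OF Vo vr])
 have VV: "?V \<in> opens_in n ?V" by (rule opens_in_refl[OF Vo])
 have bi: "b i v = 0" if v: "v \<in> \<Union>?V" for v
 proof -
  have one: "lift (?y i) u = 1" if "u \<in> \<Union>?V" for u using yr(2)[OF i that] chart_coord[OF i ch that] by simp
  show ?thesis unfolding b_def
   using tangent_pointwise(2)[OF t V yr(1)[OF i] yr(1)[OF i] yr(1)[OF i] v] one v by simp
 qed
 have ddir_y: "ddir (lift (?y j)) v w = w $ j / v $ i - v $ j * w $ i / (v $ i * v $ i)"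
  if "j \<le> n" "v \<in> \<Union>?V" "w \<in> carr n" for j v w
  using ddir_cong[OF o(2) that(2,3) yr(2)[OF that(1)]]
   ddir_coord[OF i that(1) ocone_carr[OF o(2) that(2)] that(3) chart_coord[OF i ch that(2)]] by simp
 have coord: "\<theta> ?V (?y j) = ?\<eta> ?V (?y j)" if j: "j \<le> n" for j
 proof (rule cone_ext[OF o(1)])
  show "\<theta> ?V (?y j) \<in> extensional ?V" "?\<eta> ?V (?y j) \<in> extensional ?V"
   using regularD(1)[OF Vo] tangentD(1)[OF t V yr(1)[OF j]] tangentD(1)[OF \<eta> VV yr(1)[OF j]] by auto
  fix v assume v: "v \<in> \<Union>?V"
  have vi: "v $ i \<noteq> 0" by (rule chart_coord[OF i ch v])
  have "lift (?\<eta> ?V (?y j)) v = ddir (lift (?y j)) v (a v)" by (rule vfield_of_apply(2)[OF VV vr yr(1)[OF j] v])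
  also have "\<dots> = a v $ j / v $ i - v $ j * a v $ i / (v $ i * v $ i)" by (rule ddir_y[OF j v ac])
  also have "\<dots> = b j v"
   unfolding aj[OF j] aj[OF i] bi[OF v] using vi k by (simp add: diff_divide_distrib)
  finally show "lift (\<theta> ?V (?y j)) v = lift (?\<eta> ?V (?y j)) v" by (simp add: b_def)
 qed
 have eq: "\<theta> W s = ?\<eta> W s" if "W \<in> opens_in n ?V" "s \<in> regular n W" for W s
  by (rule derivation_eqI[OF t \<eta> V VV i ch coord that])
 have "grad n f v \<bullet> a v = 0" if v: "v \<in> \<Union>?V" for v
 proof -
  have vi: "v $ i \<noteq> 0" by (rule chart_coord[OF i ch v])
  have vc: "v \<in> carr n" by (rule ocone_carr[OF o(2) v])
  have "lift c v * (ev f v / v $ i ^ k) = lift (\<theta> ?V (eqn i ?V)) v"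
   unfolding c(2) lift_restrict[OF o(1) v] eqn_regular(2)[OF Vo i ch v] ..
  also have "\<dots> = ddir (lift (eqn i ?V)) v (a v)"
   unfolding eq[OF VV eqn_regular(1)[OF Vo i ch]] by (rule vfield_of_apply(2)[OF VV vr eqn_regular(1)[OF Vo i ch] v])
  also have "\<dots> = ddir (\<lambda>v. ev f v / v $ i ^ k) v (a v)"
   by (rule ddir_cong[OF o(2) v ac eqn_regular(2)[OF Vo i ch]])
  also have "\<dots> = (grad n f v \<bullet> a v) / v $ i ^ k - of_nat k * ev f v * a v $ i / v $ i ^ (Suc k)"
   by (rule ddir_quotient_coord[OF i fp vc ac vi])
  also have "of_nat k * ev f v * a v $ i / v $ i ^ (Suc k) = - lift c v * (ev f v / v $ i ^ k)"
   unfolding aj[OF i] bi[OF v] using vi k by simp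
  finally show ?thesis using vi by simp
 qed
 then have "represents ?V \<theta> a"
  unfolding represents_def using vr eq vfield_of_apply(2)[OF _ vr] by auto
 then show ?thesis by (rule that)
qed

text \<open>The representatives over the charts glue by uniqueness.\<close>

lemma represents_exists:
 assumes \<theta>: "\<theta> \<in> log_sections n divisor U" and U: "zariski_open n U"
 obtains a where "represents U \<theta> a"
proof -
 note o = zopenD[OF U]
 have "\<forall>i\<in>{..n}. \<exists>a. represents (U \<inter> chart n i) \<theta> a" using represents_chart[OF \<theta> U] by auto
 from bchoice[OF this] obtain A where A: "\<And>i. i \<le> n \<Longrightarrow> represents (U \<inter> chart n i) \<theta> (A i)" by auto
 define a where "a v = A (LEAST i. v $ i \<noteq> 0) v" for v
 have Ui: "zariski_open n (U \<inter> chart n i)" "\<Union>(U \<inter> chart n i) = \<Union>U \<inter> {v\<in>carr n. v $ i \<noteq> 0}" if "i \<le> n" for i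
  using zopen_Int[OF U zopen_basic[OF homogeneous_Var[OF that]]] cone_Int[OF o(1) basic_sub] chart_cone[OF that] by auto
 have a: "a v = A i v" if "i \<le> n" "v \<in> \<Union>(U \<inter> chart n i)" for i v
 proof -
  let ?l = "LEAST i. v $ i \<noteq> 0"
  have "v $ i \<noteq> 0" "v \<in> \<Union>U" "v \<in> carr n" using that Ui(2) by auto
  then have "v $ ?l \<noteq> 0" "?l \<le> n" using LeastI[of "\<lambda>i. v $ i \<noteq> 0" i] Least_le[of "\<lambda>i. v $ i \<noteq> 0" i] that(1) by auto
  then have "v \<in> \<Union>(U \<inter> chart n ?l)" using Ui(2)[of ?l] \<open>v \<in> \<Union>U\<close> \<open>v \<in> carr n\<close> by auto
  then show ?thesis unfolding a_def
   using represents_unique[OF Ui(1)[OF \<open>?l \<le> n\<close>] Ui(1)[OF that(1)] A[OF \<open>?l \<le> n\<close>] A[OF that(1)]] that(2) by blast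
 qed
 have cov: "\<exists>i\<le>n. v \<in> \<Union>(U \<inter> chart n i)" if "v \<in> \<Union>U" for v
  using nonzero_coord[OF ocone_carr[OF o(2) that] ocone_nonzero[OF o(2) that]] Ui(2) that ocone_carr[OF o(2) that] by (metis (mono_tags, lifting) IntI mem_Collect_eq)
 have "represents U \<theta> a" unfolding represents_def
 proof (intro conjI ballI)
  show "vreg n (\<Union>U) a" unfolding vreg_def
  proof (intro conjI ballI allI impI)
   fix v assume "v \<in> \<Union>U"
   then obtain i where i: "i \<le> n" "v \<in> \<Union>(U \<inter> chart n i)" using cov by blast
   then show "a v \<in> carr n" using a[OF i] vregD(1)[OF representsD(1)[OF A[OF i(1)]] i(2)] by simp
  next
   fix j assume j: "j \<le> n"
   show "hreg n (\<Union>U) 1 (\<lambda>v. a v $ j)"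
   proof (rule hreg_local)
    fix v assume "v \<in> \<Union>U"
    then obtain i where i: "i \<le> n" "v \<in> \<Union>(U \<inter> chart n i)" using cov by blast
    have "hreg n (\<Union>(U \<inter> chart n i)) 1 (\<lambda>v. a v $ j)"
     using hreg_cong[of "\<Union>(U \<inter> chart n i)" "\<lambda>v. a v $ j" "\<lambda>v. A i v $ j"] a[OF i(1)]
      vregD(2)[OF representsD(1)[OF A[OF i(1)]] j] by simp
    then show "\<exists>L. v \<in> L \<and> L \<subseteq> \<Union>U \<and> hreg n L 1 (\<lambda>v. a v $ j)"
     using i(2) cone_mono[OF Int_lower1] by (intro exI[of _ "\<Union>(U \<inter> chart n i)"] conjI)
   qed
  qed
  fix v assume "v \<in> \<Union>U"
  then obtain i where i: "i \<le> n" "v \<in> \<Union>(U \<inter> chart n i)" using cov by blast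
  then show "grad n f v \<bullet> a v = 0" using a[OF i] representsD(2)[OF A[OF i(1)] i(2)] by simp
 next
  fix V s v assume V: "V \<in> opens_in n U" and s: "s \<in> regular n V" and v: "v \<in> \<Union>V"
  note Vo = opens_inD[OF V]
  obtain i where i: "i \<le> n" "v \<in> \<Union>(U \<inter> chart n i)" using cov v Vo(5) by blast
  let ?V = "V \<inter> chart n i"
  have z: "zariski_open n ?V" using zopen_Int[OF Vo(1) zopen_basic[OF homogeneous_Var[OF i(1)]]] .
  have V1: "?V \<in> opens_in n V" "?V \<in> opens_in n (U \<inter> chart n i)" using z Vo(2) by (auto simp: opens_in_iff)
  have vV: "v \<in> \<Union>?V" using cone_Int[OF Vo(3) basic_sub] Ui(2)[OF i(1)] i(2) chart_cone[OF i(1)] v by auto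
  have t: "\<theta> \<in> tangent_sections n U" using \<theta> by (simp add: log_sections_def)
  note Vio = opens_inD[OF V1(1)]
  have av: "A i v \<in> carr n" using vregD(1)[OF representsD(1)[OF A[OF i(1)]] i(2)] .
  have "lift (\<theta> V s) v = lift (\<theta> ?V (restrict s ?V)) v"
   unfolding tangentD(5)[OF t V V1(1) s] lift_restrict[OF Vio(3) vV] ..
  also have "\<dots> = ddir (lift (restrict s ?V)) v (A i v)"
   by (rule representsD(3)[OF A[OF i(1)] V1(2) regular_restrict[OF Vo(1) V1(1) s] vV])
  also have "\<dots> = ddir (lift s) v (A i v)"
   by (rule ddir_cong[OF Vio(4) vV av lift_restrict[OF Vio(3)]])
  finally show "lift (\<theta> V s) v = ddir (lift s) v (a v)" using a[OF i] by simp
 qed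
 then show ?thesis by (rule that)
qed

text \<open>The kernel of \<open>\<nabla>f\<close> on vector functions of degree one: the concrete form of the logarithmic sheaf.\<close>

definition fields :: "ppoint set \<Rightarrow> (complex vec \<Rightarrow> complex vec) set" where
 "fields U = {a \<in> extensional (\<Union>U). vreg n (\<Union>U) a \<and> (\<forall>v\<in>\<Union>U. grad n f v \<bullet> a v = 0)}"

lemma bij_fields:
 assumes U: "zariski_open n U"
 shows "bij_betw (vfield_of n U) (fields U) (log_sections n divisor U)"
 unfolding bij_betw_def
proof
 have rep: "represents U (vfield_of n U a) a" if "a \<in> fields U" for a
  using that vfield_of_apply(2)[of _ n U a] unfolding represents_def fields_def by auto
 show "inj_on (vfield_of n U) (fields U)"
 proof (rule inj_onI)
  fix a b assume ab: "a \<in> fields U" "b \<in> fields U" "vfield_of n U a = vfield_of n U b"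
  have "a v = b v" if "v \<in> \<Union>U" for v
   using represents_unique[OF U U rep[OF ab(1)] rep[OF ab(2), folded ab(3)] that that] .
  then show "a = b" using ab(1,2) by (intro extensionalityI[of _ "\<Union>U"]) (auto simp: fields_def)
 qed
 show "vfield_of n U ` fields U = log_sections n divisor U"
 proof (intro equalityI subsetI)
  fix \<theta> assume "\<theta> \<in> vfield_of n U ` fields U"
  then show "\<theta> \<in> log_sections n divisor U" using vfield_of_log[OF U] by (auto simp: fields_def)
 next
  fix \<theta> assume \<theta>: "\<theta> \<in> log_sections n divisor U"
  obtain a where a: "represents U \<theta> a" using represents_exists[OF \<theta> U] .
  have t: "\<theta> \<in> tangent_sections n U" using \<theta> by (simp add: log_sections_def)
  let ?a = "restrict a (\<Union>U)"
  have vr: "vreg n (\<Union>U) ?a" using representsD(1)[OF a] vreg_cong[of "\<Union>U" ?a a] by simp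
  have "?a \<in> fields U" using vr representsD(2)[OF a] by (auto simp: fields_def)
  moreover have "\<theta> = vfield_of n U ?a"
  proof (rule tangent_ext[OF t vfield_of_tangent[OF U vr]])
   fix V s assume V: "V \<in> opens_in n U" and s: "s \<in> regular n V"
   note Vo = opens_inD[OF V]
   show "\<theta> V s = vfield_of n U ?a V s"
   proof (rule cone_ext[OF Vo(3)])
    show "\<theta> V s \<in> extensional V" "vfield_of n U ?a V s \<in> extensional V"
     using regularD(1)[OF Vo(1)] tangentD(1)[OF t V s] vfield_of_apply(1)[OF V vr s] by auto
    fix v assume v: "v \<in> \<Union>V"
    then have "?a v = a v" using Vo(5) by auto
    then show "lift (\<theta> V s) v = lift (vfield_of n U ?a V s) v"
     unfolding vfield_of_apply(2)[OF V vr s v] representsD(3)[OF a V s v] by simp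
   qed
  qed
  ultimately show "\<theta> \<in> vfield_of n U ` fields U" by blast
 qed
qed

end

section \<open>Isomorphisms of logarithmic sheaves\<close>

lemma ddir_linear:
 assumes F: "hreg n K e F" and v: "v \<in> K" "K \<subseteq> carr n" and w: "w \<in> carr n" "w' \<in> carr n"
 shows "ddir F v (w + w') = ddir F v w + ddir F v w'" "ddir F v (c \<cdot>\<^sub>v w) = c * ddir F v w"
proof -
 obtain c d g h where 1: "homogeneous n c g" "homogeneous n d h" "d \<ge> 1"
  "ev h v \<noteq> 0" "\<And>u. u \<in> carr n \<Longrightarrow> ev h u \<noteq> 0 \<Longrightarrow> F u = ev g u / ev h u"
  by (rule hregE[OF F v(1)]) blast
 have vc: "v \<in> carr n" using v by blast
 have vB: "v \<in> basic_cone n h" by (rule hreg_rep_eval_ne[OF 1(2,3) vc 1(4)])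
 have p: "g \<in> polys n" "h \<in> polys n" using 1 homogeneous_polys by auto
 have eq: "ddir F v x = ((grad n g v \<bullet> x) * ev h v - ev g v * (grad n h v \<bullet> x)) / (ev h v * ev h v)"
  if x: "x \<in> carr n" for x
 proof -
  have "ddir F v x = ddir (\<lambda>u. ev g u / ev h u) v x"
   by (rule ddir_cong[OF ocone_basic[OF 1(2)] vB x]) (use 1(5) in \<open>auto simp: basic_cone_def\<close>)
  then show ?thesis using ddir_quotient[OF p vc x 1(4)] by simp
 qed
 show "ddir F v (w + w') = ddir F v w + ddir F v w'"
  using w by (simp add: eq scalar_prod_add_distrib[OF grad_carr w] add_divide_distrib[symmetric] algebra_simps)
 show "ddir F v (c' \<cdot>\<^sub>v w) = c' * ddir F v w" for c'
  using w by (simp add: eq scalar_prod_smult_distrib[OF grad_carr w(1)] algebra_simps)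
qed

definition field_add :: "ppoint set \<Rightarrow> (complex vec \<Rightarrow> complex vec) \<Rightarrow> (complex vec \<Rightarrow> complex vec) \<Rightarrow> complex vec \<Rightarrow> complex vec" where
 "field_add U a b = (\<lambda>v\<in>\<Union>U. a v + b v)"

definition field_smult :: "ppoint set \<Rightarrow> (ppoint \<Rightarrow> complex) \<Rightarrow> (complex vec \<Rightarrow> complex vec) \<Rightarrow> complex vec \<Rightarrow> complex vec" where
 "field_smult U s a = (\<lambda>v\<in>\<Union>U. lift s v \<cdot>\<^sub>v a v)"

context smooth_form
begin

lemma fieldsD:
 assumes "a \<in> fields U"
 shows "a \<in> extensional (\<Union>U)" "vreg n (\<Union>U) a" "v \<in> \<Union>U \<Longrightarrow> grad n f v \<bullet> a v = 0" "v \<in> \<Union>U \<Longrightarrow> a v \<in> carr n"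
proof -
 show "a \<in> extensional (\<Union>U)" and vr: "vreg n (\<Union>U) a" and "v \<in> \<Union>U \<Longrightarrow> grad n f v \<bullet> a v = 0"
  using assms unfolding fields_def by blast+
 show "v \<in> \<Union>U \<Longrightarrow> a v \<in> carr n" by (rule vregD(1)[OF vr])
qed

lemma fields_add:
 assumes U: "zariski_open n U" and a: "a \<in> fields U" and b: "b \<in> fields U"
 shows "field_add U a b \<in> fields U"
proof -
 have "vreg n (\<Union>U) (\<lambda>v. a v + b v)"
  unfolding vreg_def
 proof (intro conjI ballI allI impI)
  fix j assume j: "j \<le> n"
  have "hreg n (\<Union>U) 1 (\<lambda>v. a v $ j + b v $ j)"
   by (intro hreg_add vregD(2)[OF fieldsD(2)] a b j)
  then show "hreg n (\<Union>U) 1 (\<lambda>v. (a v + b v) $ j)"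
   using hreg_cong[of "\<Union>U" "\<lambda>v. (a v + b v) $ j" "\<lambda>v. a v $ j + b v $ j"] fieldsD(4)[OF b] j by fastforce
 qed (use fieldsD(4)[OF a] fieldsD(4)[OF b] in auto)
 then have "vreg n (\<Union>U) (field_add U a b)"
  using vreg_cong[of "\<Union>U" "field_add U a b" "\<lambda>v. a v + b v"] by (simp add: field_add_def)
 moreover have "grad n f v \<bullet> field_add U a b v = 0" if v: "v \<in> \<Union>U" for v
 proof -
  have "grad n f v \<bullet> (a v + b v) = 0"
   unfolding scalar_prod_add_distrib[OF grad_carr fieldsD(4)[OF a v] fieldsD(4)[OF b v]]
    fieldsD(3)[OF a v] fieldsD(3)[OF b v] by simp
  moreover have "field_add U a b v = a v + b v" using v unfolding field_add_def by (rule restrict_apply')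
  ultimately show ?thesis by simp
 qed
 ultimately show ?thesis unfolding fields_def field_add_def by blast
qed

lemma fields_smult:
 assumes U: "zariski_open n U" and s: "s \<in> regular n U" and a: "a \<in> fields U"
 shows "field_smult U s a \<in> fields U"
proof -
 have "vreg n (\<Union>U) (\<lambda>v. lift s v \<cdot>\<^sub>v a v)"
  unfolding vreg_def
 proof (intro conjI ballI allI impI)
  fix j assume j: "j \<le> n"
  have "hreg n (\<Union>U) 1 (\<lambda>v. lift s v * a v $ j)"
   by (rule hreg_mult[OF regularD(2)[OF U s] vregD(2)[OF fieldsD(2)[OF a] j]]) simp
  then show "hreg n (\<Union>U) 1 (\<lambda>v. (lift s v \<cdot>\<^sub>v a v) $ j)"
   using hreg_cong[of "\<Union>U" "\<lambda>v. (lift s v \<cdot>\<^sub>v a v) $ j" "\<lambda>v. lift s v * a v $ j"] fieldsD(4)[OF a] j by fastforce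
 qed (use fieldsD(4)[OF a] in auto)
 then have "vreg n (\<Union>U) (field_smult U s a)"
  using vreg_cong[of "\<Union>U" "field_smult U s a" "\<lambda>v. lift s v \<cdot>\<^sub>v a v"] by (simp add: field_smult_def)
 moreover have "grad n f v \<bullet> field_smult U s a v = 0" if v: "v \<in> \<Union>U" for v
 proof -
  have "grad n f v \<bullet> (lift s v \<cdot>\<^sub>v a v) = 0"
   unfolding scalar_prod_smult_distrib[OF grad_carr fieldsD(4)[OF a v]] fieldsD(3)[OF a v] by simp
  moreover have "field_smult U s a v = lift s v \<cdot>\<^sub>v a v" using v unfolding field_smult_def by (rule restrict_apply')
  ultimately show ?thesis by simp
 qed
 ultimately show ?thesis unfolding fields_def field_smult_def by blast
qed

lemma fields_restrict:
 assumes W: "W \<in> opens_in n U" and a: "a \<in> fields U"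
 shows "restrict a (\<Union>W) \<in> fields W"
proof -
 note Wo = opens_inD[OF W]
 have "vreg n (\<Union>W) (restrict a (\<Union>W))"
  using vreg_cong[of "\<Union>W" "restrict a (\<Union>W)" a] vreg_subset[OF fieldsD(2)[OF a] Wo(4,5)] by simp
 moreover have "grad n f v \<bullet> restrict a (\<Union>W) v = 0" if v: "v \<in> \<Union>W" for v
  unfolding restrict_apply'[OF v] by (rule fieldsD(3)[OF a]) (use v Wo(5) in blast)
 ultimately show ?thesis unfolding fields_def by blast
qed

lemma vfield_of_add:
 assumes U: "zariski_open n U" and a: "a \<in> fields U" and b: "b \<in> fields U"
 shows "vfield_of n U (field_add U a b) =
  (\<lambda>V\<in>opens_in n U. \<lambda>s\<in>regular n V. \<lambda>p\<in>V. vfield_of n U a V s p + vfield_of n U b V s p)" (is "_ = ?R")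
proof -
 note ab = fields_add[OF U a b]
 have "vfield_of n U (field_add U a b) V s = (\<lambda>p\<in>V. vfield_of n U a V s p + vfield_of n U b V s p)"
  if V: "V \<in> opens_in n U" and s: "s \<in> regular n V" for V s
 proof (rule cone_ext)
  note Vo = opens_inD[OF V]
  show "V \<subseteq> proj_space n" by (rule Vo)
  show "vfield_of n U (field_add U a b) V s \<in> extensional V"
   by (rule regularD(1)[OF Vo(1) vfield_of_apply(1)[OF V fieldsD(2)[OF ab] s]])
  fix v assume v: "v \<in> \<Union>V"
  have vU: "v \<in> \<Union>U" using v Vo(5) by blast
  have e: "field_add U a b v = a v + b v" using vU unfolding field_add_def by (rule restrict_apply')
  show "lift (vfield_of n U (field_add U a b) V s) v = lift (\<lambda>p\<in>V. vfield_of n U a V s p + vfield_of n U b V s p) v"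
   unfolding lift_restrict[OF Vo(3) v] vfield_of_apply(2)[OF V fieldsD(2)[OF ab] s v] vfield_of_apply(2)[OF V fieldsD(2)[OF a] s v]
    vfield_of_apply(2)[OF V fieldsD(2)[OF b] s v] e
   by (rule ddir_linear(1)[OF regularD(2)[OF Vo(1) s] v ocone_sub[OF Vo(4)] fieldsD(4)[OF a vU] fieldsD(4)[OF b vU]])
 qed simp
 then show ?thesis
  by (subst vfield_of_def) (intro restrict_ext, simp add: vfield_of_def)
qed

lemma vfield_of_smult:
 assumes U: "zariski_open n U" and c: "c \<in> regular n U" and a: "a \<in> fields U"
 shows "vfield_of n U (field_smult U c a) =
  (\<lambda>V\<in>opens_in n U. \<lambda>s\<in>regular n V. \<lambda>p\<in>V. c p * vfield_of n U a V s p)" (is "_ = ?R")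
proof -
 note ca = fields_smult[OF U c a]
 have "vfield_of n U (field_smult U c a) V s = (\<lambda>p\<in>V. c p * vfield_of n U a V s p)"
  if V: "V \<in> opens_in n U" and s: "s \<in> regular n V" for V s
 proof (rule cone_ext)
  note Vo = opens_inD[OF V]
  show "V \<subseteq> proj_space n" by (rule Vo)
  show "vfield_of n U (field_smult U c a) V s \<in> extensional V"
   by (rule regularD(1)[OF Vo(1) vfield_of_apply(1)[OF V fieldsD(2)[OF ca] s]])
  fix v assume v: "v \<in> \<Union>V"
  have vU: "v \<in> \<Union>U" using v Vo(5) by blast
  have e: "field_smult U c a v = lift c v \<cdot>\<^sub>v a v" using vU unfolding field_smult_def by (rule restrict_apply')
  show "lift (vfield_of n U (field_smult U c a) V s) v = lift (\<lambda>p\<in>V. c p * vfield_of n U a V s p) v"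
   unfolding lift_restrict[OF Vo(3) v] vfield_of_apply(2)[OF V fieldsD(2)[OF ca] s v] vfield_of_apply(2)[OF V fieldsD(2)[OF a] s v] e
   by (rule ddir_linear(2)[OF regularD(2)[OF Vo(1) s] v ocone_sub[OF Vo(4)] fieldsD(4)[OF a vU] fieldsD(4)[OF a vU]])
 qed simp
 then show ?thesis
  by (subst vfield_of_def) (intro restrict_ext, simp add: vfield_of_def)
qed

lemma vfield_of_restrict:
 assumes U: "zariski_open n U" and W: "W \<in> opens_in n U" and a: "a \<in> fields U"
 shows "vfield_restrict n W (vfield_of n U a) = vfield_of n W (restrict a (\<Union>W))"
proof -
 note Wo = opens_inD[OF W]
 note aW = fields_restrict[OF W a]
 have "vfield_of n U a V s = vfield_of n W (restrict a (\<Union>W)) V s"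
  if V: "V \<in> opens_in n W" and s: "s \<in> regular n V" for V s
 proof (rule cone_ext)
  note Vo = opens_inD[OF V]
  have VU: "V \<in> opens_in n U" by (rule opens_in_trans[OF W V])
  show "V \<subseteq> proj_space n" by (rule Vo)
  show "vfield_of n U a V s \<in> extensional V" "vfield_of n W (restrict a (\<Union>W)) V s \<in> extensional V"
   by (rule regularD(1)[OF Vo(1) vfield_of_apply(1)[OF VU fieldsD(2)[OF a] s]],
     rule regularD(1)[OF Vo(1) vfield_of_apply(1)[OF V fieldsD(2)[OF aW] s]])
  fix v assume v: "v \<in> \<Union>V"
  have vW: "v \<in> \<Union>W" using v Vo(5) by blast
  show "lift (vfield_of n U a V s) v = lift (vfield_of n W (restrict a (\<Union>W)) V s) v"
   unfolding vfield_of_apply(2)[OF VU fieldsD(2)[OF a] s v] vfield_of_apply(2)[OF V fieldsD(2)[OF aW] s v]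
    restrict_apply'[OF vW] ..
 qed
 moreover have "V \<in> opens_in n U" if "V \<in> opens_in n W" for V using opens_in_trans[OF W that] .
 ultimately show ?thesis
  unfolding vfield_restrict_def
  by (subst (2) vfield_of_def) (intro restrict_ext, simp add: vfield_of_def, intro restrict_ext, simp)
qed

end

abbreviation tfields :: "nat \<Rightarrow> cpoly \<Rightarrow> ppoint set \<Rightarrow> (complex vec \<Rightarrow> complex vec) set" where
 "tfields \<equiv> smooth_form.fields"

text \<open>An isomorphism of logarithmic sheaves, transported to vector functions on cones.\<close>

definition field_iso :: "nat \<Rightarrow> cpoly \<Rightarrow> cpoly \<Rightarrow> (ppoint set \<Rightarrow> (complex vec \<Rightarrow> complex vec) \<Rightarrow> complex vec \<Rightarrow> complex vec) \<Rightarrow> bool" where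
 "field_iso n f g \<Phi> \<longleftrightarrow> (\<forall>U. zariski_open n U \<longrightarrow>
   bij_betw (\<Phi> U) (tfields n f U) (tfields n g U) \<and>
   (\<forall>a\<in>tfields n f U. \<forall>b\<in>tfields n f U. \<Phi> U (field_add U a b) = field_add U (\<Phi> U a) (\<Phi> U b)) \<and>
   (\<forall>s\<in>regular n U. \<forall>a\<in>tfields n f U. \<Phi> U (field_smult U s a) = field_smult U s (\<Phi> U a)) \<and>
   (\<forall>W\<in>opens_in n U. \<forall>a\<in>tfields n f U. \<Phi> W (restrict a (\<Union>W)) = restrict (\<Phi> U a) (\<Union>W)))"

lemma field_isoI_of_sheaf_iso:
 assumes f: "smooth_form n k f" and g: "smooth_form n l g"
  and iso: "log_sheaf_iso n (proj_zeros n f) (proj_zeros n g)"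
 obtains \<Phi> where "field_iso n f g \<Phi>"
proof -
 interpret F: smooth_form n k f by (rule f)
 interpret G: smooth_form n l g by (rule g)
 obtain \<phi> where
  hom: "\<And>U. zariski_open n U \<Longrightarrow> \<phi> U \<in> module_hom (structure_ring n U) (log_module n (proj_zeros n f) U) (log_module n (proj_zeros n g) U)"
  and bij: "\<And>U. zariski_open n U \<Longrightarrow> bij_betw (\<phi> U) (log_sections n (proj_zeros n f) U) (log_sections n (proj_zeros n g) U)"
  and res: "\<And>U W \<theta>. zariski_open n U \<Longrightarrow> W \<in> opens_in n U \<Longrightarrow> \<theta> \<in> log_sections n (proj_zeros n f) U \<Longrightarrow>
   \<phi> W (vfield_restrict n W \<theta>) = vfield_restrict n W (\<phi> U \<theta>)"
  using iso unfolding log_sheaf_iso_def by blast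
 define \<Phi> where "\<Phi> U a = inv_into (G.fields U) (vfield_of n U) (\<phi> U (vfield_of n U a))" for U a
 have vf: "vfield_of n U a \<in> log_sections n (proj_zeros n f) U" if "zariski_open n U" "a \<in> F.fields U" for U a
  using F.bij_fields[OF that(1)] that(2) by (rule bij_betwE[rule_format])
 have phiv: "\<phi> U (vfield_of n U a) \<in> log_sections n (proj_zeros n g) U" if "zariski_open n U" "a \<in> F.fields U" for U a
  using bij[OF that(1)] vf[OF that] by (rule bij_betwE[rule_format])
 have \<Phi>: "\<Phi> U a \<in> G.fields U" "vfield_of n U (\<Phi> U a) = \<phi> U (vfield_of n U a)" if "zariski_open n U" "a \<in> F.fields U" for U a
  using bij_betw_inv_into_right[OF G.bij_fields[OF that(1)] phiv[OF that]]
   bij_betwE[rule_format, OF bij_betw_inv_into[OF G.bij_fields[OF that(1)]] phiv[OF that]] by (simp_all add: \<Phi>_def)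
 have inj: "a = b" if "zariski_open n U" "a \<in> G.fields U" "b \<in> G.fields U" "vfield_of n U a = vfield_of n U b" for U a b
  using bij_betw_imp_inj_on[OF G.bij_fields[OF that(1)]] that(2-4) by (auto dest: inj_onD)
 have "field_iso n f g \<Phi>" unfolding field_iso_def
 proof (intro allI impI conjI ballI)
  fix U assume U: "zariski_open n U"
  have "bij_betw (inv_into (G.fields U) (vfield_of n U) \<circ> (\<phi> U \<circ> vfield_of n U)) (F.fields U) (G.fields U)"
   by (rule bij_betw_trans[OF bij_betw_trans[OF F.bij_fields[OF U] bij[OF U]] bij_betw_inv_into[OF G.bij_fields[OF U]]])
  then show "bij_betw (\<Phi> U) (F.fields U) (G.fields U)" by (simp add: \<Phi>_def[abs_def] comp_def)
  {
   fix a b assume a: "a \<in> F.fields U" and b: "b \<in> F.fields U"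
   have "\<phi> U (vfield_of n U (field_add U a b)) =
     (\<lambda>V\<in>opens_in n U. \<lambda>s\<in>regular n V. \<lambda>p\<in>V. \<phi> U (vfield_of n U a) V s p + \<phi> U (vfield_of n U b) V s p)"
    using hom[OF U] vf[OF U a] vf[OF U b]
    unfolding F.vfield_of_add[OF U a b] module_hom_def log_module_def by auto
   also have "\<dots> = vfield_of n U (field_add U (\<Phi> U a) (\<Phi> U b))"
    unfolding G.vfield_of_add[OF U \<Phi>(1)[OF U a] \<Phi>(1)[OF U b]] \<Phi>(2)[OF U a] \<Phi>(2)[OF U b] ..
   finally show "\<Phi> U (field_add U a b) = field_add U (\<Phi> U a) (\<Phi> U b)"
    using \<Phi>[OF U F.fields_add[OF U a b]] G.fields_add[OF U \<Phi>(1)[OF U a] \<Phi>(1)[OF U b]] inj[OF U] by metis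
  }
  {
   fix s a assume s: "s \<in> regular n U" and a: "a \<in> F.fields U"
   have "\<phi> U (vfield_of n U (field_smult U s a)) =
     (\<lambda>V\<in>opens_in n U. \<lambda>t\<in>regular n V. \<lambda>p\<in>V. s p * \<phi> U (vfield_of n U a) V t p)"
    using hom[OF U] vf[OF U a] s
    unfolding F.vfield_of_smult[OF U s a] module_hom_def log_module_def structure_ring_def by auto
   also have "\<dots> = vfield_of n U (field_smult U s (\<Phi> U a))"
    unfolding G.vfield_of_smult[OF U s \<Phi>(1)[OF U a]] \<Phi>(2)[OF U a] ..
   finally show "\<Phi> U (field_smult U s a) = field_smult U s (\<Phi> U a)"
    using \<Phi>[OF U F.fields_smult[OF U s a]] G.fields_smult[OF U s \<Phi>(1)[OF U a]] inj[OF U] by metis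
  }
  fix W a assume W: "W \<in> opens_in n U" and a: "a \<in> F.fields U"
  note Wo = opens_inD[OF W]
  have "vfield_of n W (\<Phi> W (restrict a (\<Union>W))) = vfield_restrict n W (vfield_of n U (\<Phi> U a))"
   unfolding \<Phi>(2)[OF Wo(1) F.fields_restrict[OF W a]] \<Phi>(2)[OF U a] F.vfield_of_restrict[OF U W a, symmetric]
   by (rule res[OF U W vf[OF U a]])
  also have "\<dots> = vfield_of n W (restrict (\<Phi> U a) (\<Union>W))" by (rule G.vfield_of_restrict[OF U W \<Phi>(1)[OF U a]])
  finally show "\<Phi> W (restrict a (\<Union>W)) = restrict (\<Phi> U a) (\<Union>W)"
   by (rule inj[OF Wo(1) \<Phi>(1)[OF Wo(1) F.fields_restrict[OF W a]] G.fields_restrict[OF W \<Phi>(1)[OF U a]]])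
 qed
 then show ?thesis by (rule that)
qed

lemma sheaf_iso_of_field_iso:
 assumes f: "smooth_form n k f" and g: "smooth_form n l g" and iso: "field_iso n f g \<Phi>"
 shows "log_sheaf_iso n (proj_zeros n f) (proj_zeros n g)"
proof -
 interpret F: smooth_form n k f by (rule f)
 interpret G: smooth_form n l g by (rule g)
 define \<alpha> where "\<alpha> U = inv_into (F.fields U) (vfield_of n U)" for U
 define \<phi> where "\<phi> U \<theta> = vfield_of n U (\<Phi> U (\<alpha> U \<theta>))" for U \<theta>
 have \<alpha>: "\<alpha> U \<theta> \<in> F.fields U" "vfield_of n U (\<alpha> U \<theta>) = \<theta>"
  if "zariski_open n U" "\<theta> \<in> log_sections n (proj_zeros n f) U" for U \<theta>
  using bij_betw_inv_into_right[OF F.bij_fields[OF that(1)] that(2)]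
   bij_betwE[rule_format, OF bij_betw_inv_into[OF F.bij_fields[OF that(1)]] that(2)] by (simp_all add: \<alpha>_def)
 have \<alpha>v: "\<alpha> U (vfield_of n U a) = a" if "zariski_open n U" "a \<in> F.fields U" for U a
  unfolding \<alpha>_def using bij_betw_inv_into_left[OF F.bij_fields[OF that(1)] that(2)] .
 have bij\<Phi>: "bij_betw (\<Phi> U) (F.fields U) (G.fields U)"
  and add: "\<And>a b. a \<in> F.fields U \<Longrightarrow> b \<in> F.fields U \<Longrightarrow> \<Phi> U (field_add U a b) = field_add U (\<Phi> U a) (\<Phi> U b)"
  and smult: "\<And>s a. s \<in> regular n U \<Longrightarrow> a \<in> F.fields U \<Longrightarrow> \<Phi> U (field_smult U s a) = field_smult U s (\<Phi> U a)"
  and res: "\<And>W a. W \<in> opens_in n U \<Longrightarrow> a \<in> F.fields U \<Longrightarrow> \<Phi> W (restrict a (\<Union>W)) = restrict (\<Phi> U a) (\<Union>W)"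
  if "zariski_open n U" for U
  using iso that unfolding field_iso_def by blast+
 have \<Phi>: "\<Phi> U a \<in> G.fields U" if "zariski_open n U" "a \<in> F.fields U" for U a
  using bij\<Phi>[OF that(1)] that(2) by (rule bij_betwE[rule_format])
 have bij: "bij_betw (\<phi> U) (log_sections n (proj_zeros n f) U) (log_sections n (proj_zeros n g) U)"
  if U: "zariski_open n U" for U
 proof -
  have "bij_betw (vfield_of n U \<circ> (\<Phi> U \<circ> \<alpha> U)) (log_sections n (proj_zeros n f) U) (log_sections n (proj_zeros n g) U)"
   unfolding \<alpha>_def
   by (rule bij_betw_trans[OF bij_betw_trans[OF bij_betw_inv_into[OF F.bij_fields[OF U]] bij\<Phi>[OF U]] G.bij_fields[OF U]])
  then show ?thesis by (simp add: \<phi>_def[abs_def] comp_def)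
 qed
 have hom: "\<phi> U \<in> module_hom (structure_ring n U) (log_module n (proj_zeros n f) U) (log_module n (proj_zeros n g) U)"
  if U: "zariski_open n U" for U
 proof -
  have maps: "\<phi> U \<theta> \<in> log_sections n (proj_zeros n g) U" if "\<theta> \<in> log_sections n (proj_zeros n f) U" for \<theta>
   using bij[OF U] that by (rule bij_betwE[rule_format])
  have ad: "\<phi> U (\<lambda>V\<in>opens_in n U. \<lambda>s\<in>regular n V. \<lambda>p\<in>V. \<theta> V s p + \<eta> V s p) =
    (\<lambda>V\<in>opens_in n U. \<lambda>s\<in>regular n V. \<lambda>p\<in>V. \<phi> U \<theta> V s p + \<phi> U \<eta> V s p)"
   if \<theta>: "\<theta> \<in> log_sections n (proj_zeros n f) U" and \<eta>: "\<eta> \<in> log_sections n (proj_zeros n f) U" for \<theta> \<eta>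
  proof -
   note a = \<alpha>[OF U \<theta>] and b = \<alpha>[OF U \<eta>]
   have "(\<lambda>V\<in>opens_in n U. \<lambda>s\<in>regular n V. \<lambda>p\<in>V. \<theta> V s p + \<eta> V s p) = vfield_of n U (field_add U (\<alpha> U \<theta>) (\<alpha> U \<eta>))"
    unfolding F.vfield_of_add[OF U a(1) b(1)] a(2) b(2) ..
   then have "\<phi> U (\<lambda>V\<in>opens_in n U. \<lambda>s\<in>regular n V. \<lambda>p\<in>V. \<theta> V s p + \<eta> V s p) =
     vfield_of n U (field_add U (\<Phi> U (\<alpha> U \<theta>)) (\<Phi> U (\<alpha> U \<eta>)))"
    unfolding \<phi>_def using \<alpha>v[OF U F.fields_add[OF U a(1) b(1)]] add[OF U a(1) b(1)] by simp
   then show ?thesis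
    unfolding G.vfield_of_add[OF U \<Phi>[OF U a(1)] \<Phi>[OF U b(1)]] \<phi>_def .
  qed
  have sm: "\<phi> U (\<lambda>V\<in>opens_in n U. \<lambda>t\<in>regular n V. \<lambda>p\<in>V. s p * \<theta> V t p) =
    (\<lambda>V\<in>opens_in n U. \<lambda>t\<in>regular n V. \<lambda>p\<in>V. s p * \<phi> U \<theta> V t p)"
   if s: "s \<in> regular n U" and \<theta>: "\<theta> \<in> log_sections n (proj_zeros n f) U" for s \<theta>
  proof -
   note a = \<alpha>[OF U \<theta>]
   have "(\<lambda>V\<in>opens_in n U. \<lambda>t\<in>regular n V. \<lambda>p\<in>V. s p * \<theta> V t p) = vfield_of n U (field_smult U s (\<alpha> U \<theta>))"
    unfolding F.vfield_of_smult[OF U s a(1)] a(2) ..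
   then have "\<phi> U (\<lambda>V\<in>opens_in n U. \<lambda>t\<in>regular n V. \<lambda>p\<in>V. s p * \<theta> V t p) =
     vfield_of n U (field_smult U s (\<Phi> U (\<alpha> U \<theta>)))"
    unfolding \<phi>_def using \<alpha>v[OF U F.fields_smult[OF U s a(1)]] smult[OF U s a(1)] by simp
   then show ?thesis
    unfolding G.vfield_of_smult[OF U s \<Phi>[OF U a(1)]] \<phi>_def .
  qed
  show ?thesis
   unfolding module_hom_def log_module_def structure_ring_def using maps ad sm by auto
 qed
 have rs: "\<phi> W (vfield_restrict n W \<theta>) = vfield_restrict n W (\<phi> U \<theta>)"
  if U: "zariski_open n U" and W: "W \<in> opens_in n U" and \<theta>: "\<theta> \<in> log_sections n (proj_zeros n f) U" for U W \<theta>
 proof -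
  note Wo = opens_inD[OF W] and a = \<alpha>[OF U \<theta>]
  have "vfield_restrict n W \<theta> = vfield_of n W (restrict (\<alpha> U \<theta>) (\<Union>W))"
   using F.vfield_of_restrict[OF U W a(1)] a(2) by simp
  then have "\<phi> W (vfield_restrict n W \<theta>) = vfield_of n W (restrict (\<Phi> U (\<alpha> U \<theta>)) (\<Union>W))"
   unfolding \<phi>_def using \<alpha>v[OF Wo(1) F.fields_restrict[OF W a(1)]] res[OF U W a(1)] by simp
  then show ?thesis
   unfolding G.vfield_of_restrict[OF U W \<Phi>[OF U a(1)], symmetric] \<phi>_def .
 qed
 show ?thesis unfolding log_sheaf_iso_def using hom bij rs by (intro exI[of _ \<phi>]) blast
qed

text \<open>A constant matrix that relates two gradients maps the kernel of one to the kernel of the other.\<close>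

lemma sheaf_iso_of_linear_gradient:
 assumes f: "smooth_form n k f" and g: "smooth_form n l g"
  and B: "B \<in> carrier_mat (Suc n) (Suc n)" and C: "C \<in> carrier_mat (Suc n) (Suc n)"
  and inv: "B * C = 1\<^sub>m (Suc n)" "C * B = 1\<^sub>m (Suc n)"
  and gr: "\<And>v w. v \<in> carr n \<Longrightarrow> w \<in> carr n \<Longrightarrow> grad n g v \<bullet> (B *\<^sub>v w) = grad n f v \<bullet> w"
 shows "log_sheaf_iso n (proj_zeros n f) (proj_zeros n g)"
proof -
 interpret F: smooth_form n k f by (rule f)
 interpret G: smooth_form n l g by (rule g)
 have BC: "B *\<^sub>v (C *\<^sub>v w) = w" "C *\<^sub>v (B *\<^sub>v w) = w" if "w \<in> carr n" for w
  using that assoc_mult_mat_vec[OF B C that] assoc_mult_mat_vec[OF C B that] inv by auto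
 have gr': "grad n f v \<bullet> (C *\<^sub>v w) = grad n g v \<bullet> w" if "v \<in> carr n" "w \<in> carr n" for v w
  using gr[OF that(1), of "C *\<^sub>v w"] BC(1)[OF that(2)] C that by auto
 have vr: "vreg n K (\<lambda>v. M *\<^sub>v a v)" if K: "ocone n K" and M: "M \<in> carrier_mat (Suc n) (Suc n)" and a: "vreg n K a" for K M a
  unfolding vreg_def
 proof (intro conjI ballI allI impI)
  show "M *\<^sub>v a v \<in> carr n" if "v \<in> K" for v using M vregD(1)[OF a that] by auto
  fix j assume j: "j \<le> n"
  have "hreg n K 1 (\<lambda>v. \<Sum>l\<le>n. M $$ (j, l) * a v $ l)"
   by (intro hreg_sum hreg_cmult K vregD(2)[OF a]) auto
  moreover have "(M *\<^sub>v a v) $ j = (\<Sum>l\<le>n. M $$ (j, l) * a v $ l)" if "v \<in> K" for v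
   using M j vregD(1)[OF a that] by (simp add: dot_sum)
  ultimately show "hreg n K 1 (\<lambda>v. (M *\<^sub>v a v) $ j)"
   using hreg_cong[of K "\<lambda>v. (M *\<^sub>v a v) $ j" "\<lambda>v. \<Sum>l\<le>n. M $$ (j, l) * a v $ l"] by simp
 qed
 have mem: "(\<lambda>v\<in>\<Union>U. M *\<^sub>v a v) \<in> tfields n g' U"
  if U: "zariski_open n U" and M: "M \<in> carrier_mat (Suc n) (Suc n)" and s: "smooth_form n k1 f'" "smooth_form n k2 g'"
   and a: "a \<in> tfields n f' U" and m: "\<And>v w. v \<in> carr n \<Longrightarrow> w \<in> carr n \<Longrightarrow> grad n g' v \<bullet> (M *\<^sub>v w) = grad n f' v \<bullet> w"
  for U M f' g' k1 k2 a
 proof -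
  note aD = smooth_form.fieldsD[OF s(1) a]
  have "vreg n (\<Union>U) (\<lambda>v\<in>\<Union>U. M *\<^sub>v a v)"
   using vr[OF zopenD(2)[OF U] M aD(2)] vreg_cong[of "\<Union>U" "\<lambda>v\<in>\<Union>U. M *\<^sub>v a v" "\<lambda>v. M *\<^sub>v a v"] by simp
  moreover have "grad n g' v \<bullet> (M *\<^sub>v a v) = 0" if "v \<in> \<Union>U" for v
   using m[OF ocone_carr[OF zopenD(2)[OF U] that] aD(4)[OF that]] aD(3)[OF that] by simp
  ultimately show ?thesis unfolding smooth_form.fields_def[OF s(2)] by auto
 qed
 define \<Phi> where "\<Phi> U a = (\<lambda>v\<in>\<Union>U. B *\<^sub>v a v)" for U :: "ppoint set" and a
 have "field_iso n f g \<Phi>" unfolding field_iso_def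
 proof (intro allI impI conjI ballI)
  fix U assume U: "zariski_open n U"
  show "bij_betw (\<Phi> U) (F.fields U) (G.fields U)"
  proof (rule bij_betw_byWitness[where f' = "\<lambda>a. \<lambda>v\<in>\<Union>U. C *\<^sub>v a v"])
   show "\<forall>a\<in>F.fields U. (\<lambda>v\<in>\<Union>U. C *\<^sub>v \<Phi> U a v) = a"
   proof
    fix a assume a: "a \<in> F.fields U"
    show "(\<lambda>v\<in>\<Union>U. C *\<^sub>v \<Phi> U a v) = a"
     by (rule extensionalityI[OF _ F.fieldsD(1)[OF a]]) (use BC(2) F.fieldsD(4)[OF a] in \<open>auto simp: \<Phi>_def\<close>)
   qed
   show "\<forall>a\<in>G.fields U. \<Phi> U (\<lambda>v\<in>\<Union>U. C *\<^sub>v a v) = a"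
   proof
    fix a assume a: "a \<in> G.fields U"
    show "\<Phi> U (\<lambda>v\<in>\<Union>U. C *\<^sub>v a v) = a"
     by (rule extensionalityI[OF _ G.fieldsD(1)[OF a]]) (use BC(1) G.fieldsD(4)[OF a] in \<open>auto simp: \<Phi>_def\<close>)
   qed
   show "\<Phi> U ` F.fields U \<subseteq> G.fields U"
    using mem[OF U B f g _ gr] by (auto simp: \<Phi>_def)
   show "(\<lambda>a. \<lambda>v\<in>\<Union>U. C *\<^sub>v a v) ` G.fields U \<subseteq> F.fields U"
    using mem[OF U C g f _ gr'] by auto
  qed
  {
   fix a b assume a: "a \<in> F.fields U" and b: "b \<in> F.fields U"
   show "\<Phi> U (field_add U a b) = field_add U (\<Phi> U a) (\<Phi> U b)"
    unfolding \<Phi>_def field_add_def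
    by (rule restrict_ext) (simp add: mult_add_distrib_mat_vec[OF B F.fieldsD(4)[OF a] F.fieldsD(4)[OF b]] del: Union_iff)
  }
  {
   fix s a assume s: "s \<in> regular n U" and a: "a \<in> F.fields U"
   show "\<Phi> U (field_smult U s a) = field_smult U s (\<Phi> U a)"
    unfolding \<Phi>_def field_smult_def
    by (rule restrict_ext) (simp add: mult_mat_vec[OF B F.fieldsD(4)[OF a]] del: Union_iff)
  }
  fix W a assume W: "W \<in> opens_in n U" and a: "a \<in> F.fields U"
  have "v \<in> \<Union>U" if "v \<in> \<Union>W" for v using opens_inD(5)[OF W] that by blast
  then show "\<Phi> W (restrict a (\<Union>W)) = restrict (\<Phi> U a) (\<Union>W)"
   unfolding \<Phi>_def by (intro restrict_ext) (simp del: Union_iff)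
 qed
 then show ?thesis by (rule sheaf_iso_of_field_iso[OF f g])
qed

section \<open>A splitting of monomials\<close>

lemma Var_power: "Var i ^ Q = Poly_Mapping.single (Poly_Mapping.single i Q) (1::complex)"
proof (induction Q)
 case (Suc Q)
 have "mono1 i + Poly_Mapping.single i Q = Poly_Mapping.single i (Suc Q)"
  by (simp add: single_add[symmetric])
 then show ?case using Suc by (simp add: mult_single)
qed simp

lemma lookup_times_Var_power:
 "lkp (p * Var i ^ Q) m = (if Q \<le> lkp m i then lkp p (m - Poly_Mapping.single i Q) else 0)"
proof -
 have "p * Var i ^ Q = (\<Sum>m'\<in>supp p. Poly_Mapping.single (m' + Poly_Mapping.single i Q) (lkp p m'))"
  by (subst cpoly_expand[of p]) (simp add: sum_distrib_right Var_power mult_single)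
 then have "lkp (p * Var i ^ Q) m = (\<Sum>m'\<in>supp p. lkp p m' when m' + Poly_Mapping.single i Q = m)"
  by (simp add: lookup_sum lookup_single)
 also have "\<dots> = (\<Sum>m'\<in>supp p. if m' = m - Poly_Mapping.single i Q then (if Q \<le> lkp m i then lkp p m' else 0) else 0)"
 proof (rule sum.cong[OF refl])
  fix m'
  have "m' + Poly_Mapping.single i Q = m \<longleftrightarrow> m' = m - Poly_Mapping.single i Q \<and> Q \<le> lkp m i"
  proof
   assume "m' + Poly_Mapping.single i Q = m"
   then show "m' = m - Poly_Mapping.single i Q \<and> Q \<le> lkp m i" by (auto simp: lookup_add)
  next
   assume "m' = m - Poly_Mapping.single i Q \<and> Q \<le> lkp m i"
   then show "m' + Poly_Mapping.single i Q = m"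
    by (intro poly_mapping_eqI) (auto simp: lookup_add lookup_minus lookup_single when_def)
  qed
  then show "(lkp p m' when m' + Poly_Mapping.single i Q = m) =
    (if m' = m - Poly_Mapping.single i Q then (if Q \<le> lkp m i then lkp p m' else 0) else 0)"
   by (simp add: when_def)
 qed
 also have "\<dots> = (if Q \<le> lkp m i then lkp p (m - Poly_Mapping.single i Q) else 0)"
  by (auto simp: in_keys_iff)
 finally show ?thesis .
qed

text \<open>Divisibility by a power of a variable can be read off the exponents, monomial by monomial.\<close>

lemma Var_power_divides:
 assumes "homogeneous n d p" "\<And>m. m \<in> supp p \<Longrightarrow> Q \<le> lkp m i"
 obtains z where "homogeneous n (d - Q) z" "p = z * Var i ^ Q"
proof
 let ?z = "\<Sum>m\<in>supp p. Poly_Mapping.single (m - Poly_Mapping.single i Q) (lkp p m)"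
 have m: "m = (m - Poly_Mapping.single i Q) + Poly_Mapping.single i Q" if "m \<in> supp p" for m
  using assms(2)[OF that] by (intro poly_mapping_eqI) (auto simp: lookup_add lookup_minus lookup_single when_def)
 show "homogeneous n (d - Q) ?z"
 proof (rule homogeneous_sum, rule homogeneous_single)
  fix m assume "m \<in> supp p"
  note m = m[OF this] and p = assms(1)[unfolded homogeneous_iff, rule_format, OF this]
  have "supp m = supp (m - Poly_Mapping.single i Q) \<union> supp (Poly_Mapping.single i Q)"
   "mdeg m = mdeg (m - Poly_Mapping.single i Q) + mdeg (Poly_Mapping.single i Q)"
   by (subst m, rule supp_add_nat) (subst m, rule mdeg_add)
  moreover have "mdeg (Poly_Mapping.single i Q) = Q" by (cases "Q = 0") (auto simp: mdeg_def)
  ultimately show "supp (m - Poly_Mapping.single i Q) \<subseteq> {..n}" "mdeg (m - Poly_Mapping.single i Q) = d - Q"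
   using p by auto
 qed
 have "?z * Var i ^ Q = (\<Sum>m\<in>supp p. Poly_Mapping.single m (lkp p m))"
  unfolding Var_power sum_distrib_right mult_single using m by (intro sum.cong) auto
 then show "p = ?z * Var i ^ Q" using cpoly_expand[of p] by simp
qed

lemma supp_times_Var_power_eq:
 assumes "p * Var j ^ Q = q * Var i ^ Q'" "i \<noteq> j" "m \<in> supp p"
 shows "Q' \<le> lkp m i"
proof -
 have "lkp (p * Var j ^ Q) (m + Poly_Mapping.single j Q) = lkp p m"
  by (simp add: lookup_times_Var_power lookup_add)
 then have "lkp (q * Var i ^ Q') (m + Poly_Mapping.single j Q) \<noteq> 0" using assms by (simp add: in_keys_iff)
 then have "Q' \<le> lkp (m + Poly_Mapping.single j Q) i"
  unfolding lookup_times_Var_power by (rule contrapos_np) simp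
 then show ?thesis using assms(2) by (simp add: lookup_add lookup_single)
qed

text \<open>Every monomial of \<open>p\<close> is divisible by \<open>x\<^sub>0\<^sup>Q\<close> or by \<open>x\<^sub>1\<^sup>Q\<close>, because multiplication by a power of \<open>x\<^sub>2\<close> changes
 neither exponent. This is where a third variable is indispensable.\<close>

lemma cech_splitting:
 assumes p: "homogeneous n d p" and eq: "p * Var 2 ^ M = a * Var 1 ^ Q - b * Var 0 ^ Q"
 obtains u w where "homogeneous n (d - Q) u" "homogeneous n (d - Q) w" "p = u * Var 0 ^ Q + w * Var 1 ^ Q"
proof -
 define p0 where "p0 = (\<Sum>m\<in>{m\<in>supp p. Q \<le> lkp m 0}. Poly_Mapping.single m (lkp p m))"
 have lp0: "lkp p0 m = (if Q \<le> lkp m 0 then lkp p m else 0)" for m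
  by (auto simp: p0_def lookup_sum lookup_single when_def in_keys_iff)
 have h0: "homogeneous n d p0" using p by (auto simp: homogeneous_iff in_keys_iff lp0 split: if_splits)
 have h1: "homogeneous n d (p - p0)" using p h0 by (rule homogeneous_diff)
 have "Q \<le> lkp m 0" if "m \<in> supp p0" for m
  using that by (simp add: in_keys_iff lp0 split: if_splits)
 then obtain u where u: "homogeneous n (d - Q) u" "p0 = u * Var 0 ^ Q"
  using Var_power_divides[OF h0] by blast
 have "Q \<le> lkp m 1" if "m \<in> supp (p - p0)" for m
 proof -
  have m: "lkp p m \<noteq> 0" "\<not> Q \<le> lkp m 0" using that by (simp_all add: in_keys_iff lookup_minus lp0 split: if_splits)
  let ?m = "m + Poly_Mapping.single 2 M"
  have "lkp (p * Var 2 ^ M) ?m = lkp p m"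
   by (simp add: lookup_times_Var_power lookup_add)
  then have "lkp (a * Var 1 ^ Q) ?m - lkp (b * Var 0 ^ Q) ?m \<noteq> 0" using m(1) by (simp add: eq lookup_minus)
  moreover have "lkp (b * Var 0 ^ Q) ?m = 0" using m(2) by (simp add: lookup_times_Var_power lookup_add lookup_single)
  ultimately have "lkp (a * Var 1 ^ Q) ?m \<noteq> 0" by simp
  then have "Q \<le> lkp ?m 1" unfolding lookup_times_Var_power by (rule contrapos_np) simp
  then show ?thesis by (simp add: lookup_add lookup_single)
 qed
 then obtain w where w: "homogeneous n (d - Q) w" "p - p0 = w * Var 1 ^ Q"
  using Var_power_divides[OF h1] by blast
 show ?thesis by (rule that[OF u(1) w(1)]) (use u(2) w(2) in \<open>simp add: algebra_simps\<close>)
qed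

lemma Var_nonzero: "Var i \<noteq> (0::cpoly)"
proof
 assume "Var i = (0::cpoly)"
 then have "lkp (Var i) (mono1 i) = (0::complex)" by (simp only: lookup_zero)
 then show False by simp
qed

lemma polys_eqI_chart:
 assumes "p \<in> polys n" "q \<in> polys n" "i \<le> n" "i' \<le> n"
  "\<And>v. v \<in> carr n \<Longrightarrow> v $ i \<noteq> 0 \<Longrightarrow> v $ i' \<noteq> 0 \<Longrightarrow> ev p v = ev q v"
 shows "p = q"
proof -
 have "(p - q) * Var i * Var i' = 0"
 proof (rule polys_eq_0I[of _ n])
  show "(p - q) * Var i * Var i' \<in> polys n" using assms by (intro polys_mult polys_diff) auto
  fix v assume "v \<in> carr n"
  then show "ev ((p - q) * Var i * Var i') v = 0"
   using assms(5)[of v] mon_mono1[of i v] mon_mono1[of i' v] by (cases "v $ i = 0 \<or> v $ i' = 0") auto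
 qed
 then show ?thesis using Var_nonzero by auto
qed

text \<open>On a line that misses the origin the polynomial has no zero, so it is constant there. Enough such lines
 connect any two points.\<close>

lemma nonvanishing_constant:
 assumes n: "n \<ge> 1" and p: "p \<in> polys n"
  and nz: "\<And>v. v \<in> carr n \<Longrightarrow> v \<noteq> zvec n \<Longrightarrow> ev p v \<noteq> 0"
 obtains c where "\<And>v. v \<in> carr n \<Longrightarrow> v \<noteq> zvec n \<Longrightarrow> ev p v = c"
proof -
 have line: "ev p a = ev p b" if ab: "a \<in> carr n" "b \<in> carr n"
  and av: "\<And>t. a + t \<cdot>\<^sub>v (b - a) \<noteq> zvec n" for a b
 proof -
  have ba: "b - a \<in> carr n" using ab by simp
  obtain Q where Q: "\<And>t. ev p (a + t \<cdot>\<^sub>v (b - a)) = poly (Q a) t"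
   using polyfun_line[OF polyfun_poly_eval[OF p] ba] ab(1) by metis
  have "poly (Q a) t \<noteq> 0" for t
   using nz[OF _ av, of t] ab ba Q[of t] by auto
  then have "constant (poly (Q a))" using fundamental_theorem_of_algebra by blast
  then have "poly (Q a) 0 = poly (Q a) 1" unfolding constant_def by blast
  moreover have "a + 0 \<cdot>\<^sub>v (b - a) = a" "a + 1 \<cdot>\<^sub>v (b - a) = b" using ab by (auto intro!: eq_vecI)
  ultimately show ?thesis using Q[of 0] Q[of 1] by simp
 qed
 let ?e = "\<lambda>i. unit_vec (Suc n) i :: complex vec"
 have e01: "ev p v = ev p (?e i)"
  if v: "v \<in> carr n" and ij: "i \<le> n" "j \<le> n" "i \<noteq> j" and vj: "v $ j \<noteq> 0" for v i j
 proof (rule line[symmetric])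
  show "?e i + t \<cdot>\<^sub>v (v - ?e i) \<noteq> zvec n" for t
  proof
   assume a: "?e i + t \<cdot>\<^sub>v (v - ?e i) = zvec n"
   have "(?e i + t \<cdot>\<^sub>v (v - ?e i)) $ j = 0" "(?e i + t \<cdot>\<^sub>v (v - ?e i)) $ i = 0" unfolding a using ij by auto
   then have "t * v $ j = 0" "1 + t * (v $ i - 1) = 0" using ij v by (auto simp: unit_vec_def)
   then show False using vj by simp
  qed
 qed (use v in auto)
 show ?thesis
 proof (rule that[of "ev p (?e 0)"])
  fix v assume v: "v \<in> carr n" "v \<noteq> zvec n"
  then obtain j where j: "j \<le> n" "v $ j \<noteq> 0" by (rule nonzero_coord)
  show "ev p v = ev p (?e 0)"
  proof (cases "j = 0")
   case False then show ?thesis using e01[OF v(1) _ j(1) _ j(2), of 0] by simp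
  next
   case True
   have "ev p v = ev p (?e 1)" using e01[OF v(1) n j(1) _ j(2)] True by simp
   also have "\<dots> = ev p (?e 0)" using e01[of "?e 1" 0 1] n by (simp add: unit_vec_def)
   finally show ?thesis .
  qed
 qed
qed

context smooth_form
begin

section \<open>Rigidity of isomorphisms\<close>

text \<open>If the derivative of \<open>f\<close> along \<open>u\<close> vanishes identically, then Euler's identity for the partial derivatives gives
 \<open>\<nabla>f(u) = 0\<close>. So a smooth hypersurface of degree at least two is not a cone.\<close>

lemma not_cone:
 assumes "k \<ge> 2" "u \<in> carr n" "(\<Sum>i\<le>n. Const (u $ i) * poly_partial i f) = 0"
 shows "u = zvec n"
proof (rule ccontr)
 assume u: "u \<noteq> zvec n"
 obtain j where j: "j \<le> n" "ev (poly_partial j f) u \<noteq> 0" by (rule gradient_nonzero[OF assms(2) u])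
 have "of_nat (k - 1) * ev (poly_partial j f) u = grad n (poly_partial j f) u \<bullet> u"
  using euler_identity[OF homogeneous_poly_partial[OF hom] assms(2)] by simp
 also have "\<dots> = (\<Sum>i\<le>n. u $ i * ev (poly_partial j (poly_partial i f)) u)"
  unfolding grad_dot[OF assms(2)] by (simp add: poly_partial_commute)
 also have "\<dots> = ev (poly_partial j (\<Sum>i\<le>n. Const (u $ i) * poly_partial i f)) u"
 proof -
  have "poly_partial j (Const c * p) = Const c * poly_partial j p" for c p
  proof (rule poly_mapping_eqI)
   fix m
   have cm: "lkp (Const c * q) m' = c * lkp q m'" for q :: cpoly and m'
    by (simp add: mult_map_scale_conv_mult[symmetric] Poly_Mapping.map.rep_eq when_def)
   show "lkp (poly_partial j (Const c * p)) m = lkp (Const c * poly_partial j p) m"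
    by (simp add: lookup_poly_partial cm)
  qed
  then show ?thesis by (simp add: poly_partial_sum)
 qed
 also have "\<dots> = 0" using assms(3) by simp
 finally show False using j assms(1) by simp
qed

lemma gradient_nullstellensatz:
 assumes "i \<le> n"
 obtains N h where "\<And>j. j \<le> n \<Longrightarrow> homogeneous n N (h j)" "Var i ^ (N + (k - 1)) = (\<Sum>j\<le>n. h j * poly_partial j f)"
proof (rule homogeneous_nullstellensatz[OF homogeneous_poly_partial[OF hom] _ assms])
 fix v assume v: "v \<in> carr n" "v \<noteq> zvec n"
 obtain j where "j \<le> n" "ev (poly_partial j f) v \<noteq> 0" by (rule gradient_nonzero[OF v])
 then show "\<exists>j\<le>n. ev (poly_partial j f) v \<noteq> 0" by blast
qed (rule that)

lemma fieldI:
 assumes U: "zariski_open n U" and c: "\<And>j. j \<le> n \<Longrightarrow> hreg n (\<Union>U) 1 (\<lambda>v. c j v)"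
  and z: "\<And>v. v \<in> \<Union>U \<Longrightarrow> (\<Sum>j\<le>n. c j v * ev (poly_partial j f) v) = 0"
 shows "(\<lambda>v\<in>\<Union>U. vec (Suc n) (\<lambda>j. c j v)) \<in> fields U"
proof -
 have "vreg n (\<Union>U) (\<lambda>v. vec (Suc n) (\<lambda>j. c j v))" unfolding vreg_def using c by auto
 then have "vreg n (\<Union>U) (\<lambda>v\<in>\<Union>U. vec (Suc n) (\<lambda>j. c j v))"
  using vreg_cong[of "\<Union>U" "\<lambda>v\<in>\<Union>U. vec (Suc n) (\<lambda>j. c j v)" "\<lambda>v. vec (Suc n) (\<lambda>j. c j v)"] by simp
 moreover have "grad n f v \<bullet> vec (Suc n) (\<lambda>j. c j v) = 0" if "v \<in> \<Union>U" for v
  using z[OF that] by (subst grad_dot) auto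
 ultimately show ?thesis unfolding fields_def by (auto simp del: Union_iff)
qed

lemma zero_field: "zariski_open n U \<Longrightarrow> (\<lambda>v\<in>\<Union>U. vec (Suc n) (\<lambda>j. 0)) \<in> fields U"
 by (rule fieldI) (auto intro: hreg_0 zopenD)

text \<open>The partial derivative, made homogeneous of degree zero over the chart \<open>x\<^sub>i \<noteq> 0\<close>.\<close>

definition dehom :: "nat \<Rightarrow> nat \<Rightarrow> complex vec \<Rightarrow> complex" where
 "dehom i t v = ev (poly_partial t f) v / v $ i ^ (k - 1)"

text \<open>The Koszul relation \<open>f\<^sub>j e\<^sub>l - f\<^sub>l e\<^sub>j\<close> between the partial derivatives of \<open>f\<close>, brought to degree one by powers of
 the coordinate \<open>x\<^sub>i\<close>.\<close>

definition koszul :: "nat \<Rightarrow> ppoint set \<Rightarrow> nat \<Rightarrow> nat \<Rightarrow> complex vec \<Rightarrow> complex vec" where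
 "koszul i V l j = (\<lambda>v\<in>\<Union>V. vec (Suc n)
   (\<lambda>t. v $ i * ((if t = l then dehom i j v else 0) - (if t = j then dehom i l v else 0))))"

lemma koszul_sum:
 assumes "l \<le> n" "j \<le> n"
 shows "(\<Sum>t\<le>n. v $ i * ((if t = l then dehom i j v else 0) - (if t = j then dehom i l v else 0)) * X t)
  = v $ i * (dehom i j v * X l - dehom i l v * X j)"
proof -
 have "(\<Sum>t\<le>n. v $ i * ((if t = l then dehom i j v else 0) - (if t = j then dehom i l v else 0)) * X t)
  = (\<Sum>t\<le>n. (if t = l then v $ i * dehom i j v * X t else 0) - (if t = j then v $ i * dehom i l v * X t else 0))"
  by (rule sum.cong[OF refl]) (auto simp: algebra_simps)
 then show ?thesis using assms by (simp add: sum_subtractf algebra_simps)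
qed

lemma koszul_fields:
 assumes i: "i \<le> n" and V: "zariski_open n V" "V \<subseteq> chart n i" and "l \<le> n" "j \<le> n"
 shows "koszul i V l j \<in> fields V"
 unfolding koszul_def
proof (rule fieldI[OF V(1)])
 note o = zopenD(2)[OF V(1)]
 have hc: "hreg n (\<Union>V) 0 (\<lambda>v. dehom i t v)" for t
  unfolding dehom_def by (intro hreg_chart_quotient[OF i o _ homogeneous_poly_partial[OF hom]]) (rule chart_coord[OF i V(2)])
 have hc': "hreg n (\<Union>V) 0 (\<lambda>v. if t = s then dehom i r v else 0)" for t s r
  using hc[of r] hreg_0[OF o] by (cases "t = s") auto
 show "hreg n (\<Union>V) 1 (\<lambda>v. v $ i * ((if t = l then dehom i j v else 0) - (if t = j then dehom i l v else 0)))" for t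
  by (intro hreg_mult[OF hreg_coord[OF o i] hreg_diff[OF o hc' hc']]) simp
 show "(\<Sum>t\<le>n. v $ i * ((if t = l then dehom i j v else 0) - (if t = j then dehom i l v else 0)) * ev (poly_partial t f) v) = 0" for v
  unfolding koszul_sum[OF assms(4,5)] by (simp add: dehom_def)
qed

lemma koszul_dot:
 assumes "l \<le> n" "j \<le> n" "v \<in> \<Union>V"
 shows "(\<Sum>t\<le>n. koszul i V l j v $ t * X t) = v $ i * (dehom i j v * X l - dehom i l v * X j)"
proof -
 have "(\<Sum>t\<le>n. koszul i V l j v $ t * X t)
  = (\<Sum>t\<le>n. v $ i * ((if t = l then dehom i j v else 0) - (if t = j then dehom i l v else 0)) * X t)"
  unfolding koszul_def restrict_apply'[OF assms(3)] by (rule sum.cong[OF refl]) simp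
 then show ?thesis unfolding koszul_sum[OF assms(1,2)] .
qed

end

locale iso_pair = F: smooth_form n k f + G: smooth_form n k' g for n k f k' g +
 fixes \<Phi> assumes iso: "field_iso n f g \<Phi>" and n2: "n \<ge> 2"
begin

abbreviation df :: "nat \<Rightarrow> cpoly" where "df j \<equiv> poly_partial j f"
abbreviation dg :: "nat \<Rightarrow> cpoly" where "dg j \<equiv> poly_partial j g"

lemma
 assumes "zariski_open n U"
 shows bij: "bij_betw (\<Phi> U) (F.fields U) (G.fields U)"
  and add: "\<And>a b. a \<in> F.fields U \<Longrightarrow> b \<in> F.fields U \<Longrightarrow> \<Phi> U (field_add U a b) = field_add U (\<Phi> U a) (\<Phi> U b)"
  and smult: "\<And>s a. s \<in> regular n U \<Longrightarrow> a \<in> F.fields U \<Longrightarrow> \<Phi> U (field_smult U s a) = field_smult U s (\<Phi> U a)"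
  and res: "\<And>W a. W \<in> opens_in n U \<Longrightarrow> a \<in> F.fields U \<Longrightarrow> \<Phi> W (restrict a (\<Union>W)) = restrict (\<Phi> U a) (\<Union>W)"
 using iso assms unfolding field_iso_def by blast+

lemma \<Phi>_fields: "zariski_open n U \<Longrightarrow> a \<in> F.fields U \<Longrightarrow> \<Phi> U a \<in> G.fields U"
 using bij_betwE[OF bij] by blast

lemma \<Phi>_carr: "zariski_open n U \<Longrightarrow> a \<in> F.fields U \<Longrightarrow> v \<in> \<Union>U \<Longrightarrow> \<Phi> U a v \<in> carr n"
 by (rule G.fieldsD(4)[OF \<Phi>_fields])

lemma field_add_apply: "v \<in> \<Union>U \<Longrightarrow> field_add U a b v = a v + b v"
 unfolding field_add_def by (rule restrict_apply')
lemma field_smult_apply: "v \<in> \<Union>U \<Longrightarrow> field_smult U s a v = lift s v \<cdot>\<^sub>v a v"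
 unfolding field_smult_def by (rule restrict_apply')

lemma \<Phi>_zero:
 assumes U: "zariski_open n U" and v: "v \<in> \<Union>U" and m: "m \<le> n"
 shows "\<Phi> U (\<lambda>v\<in>\<Union>U. vec (Suc n) (\<lambda>j. 0)) v $ m = 0"
proof -
 let ?Z = "\<lambda>v\<in>\<Union>U. vec (Suc n) (\<lambda>j. 0 :: complex)"
 let ?s = "desc U (\<lambda>v. 0)"
 note h = hreg_const[OF zopenD(2)[OF U], of 0]
 have "field_smult U ?s ?Z = ?Z"
  unfolding field_smult_def by (intro restrict_ext) (auto simp del: Union_iff simp: lift_desc[OF U h])
 then have "\<Phi> U ?Z = field_smult U ?s (\<Phi> U ?Z)" using smult[OF U desc_regular[OF U h] F.zero_field[OF U]] by simp
 then have "\<Phi> U ?Z v = lift ?s v \<cdot>\<^sub>v \<Phi> U ?Z v" using field_smult_apply[OF v] by metis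
 then have "\<Phi> U ?Z v $ m = (lift ?s v \<cdot>\<^sub>v \<Phi> U ?Z v) $ m" by simp
 then show ?thesis using \<Phi>_carr[OF U F.zero_field[OF U] v] m by (simp add: lift_desc[OF U h v])
qed

text \<open>If \<open>x\<^sub>i\<^sup>E = \<Sum> h\<^sub>j \<partial>\<^sub>j f\<close>, then \<open>h / x\<^sub>i\<^sup>E\<close> is a right inverse of \<open>\<nabla>f\<close>, and the projection of the standard basis
 vector \<open>e\<^sub>l\<close> along it lies in the kernel of \<open>\<nabla>f\<close>. The factor \<open>x\<^sub>i\<close> makes the degree one.\<close>

definition frame :: "nat \<Rightarrow> nat \<Rightarrow> (nat \<Rightarrow> cpoly) \<Rightarrow> nat \<Rightarrow> complex vec \<Rightarrow> complex vec" where
 "frame i E h l = (\<lambda>v\<in>\<Union>(chart n i). vec (Suc n) (\<lambda>j. v $ i * ((if j = l then 1 else 0) - ev (df l * h j) v / v $ i ^ E)))"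

context
 fixes i N h E
 assumes i: "i \<le> n" and h: "\<And>j. j \<le> n \<Longrightarrow> homogeneous n N (h j)" and E: "E = N + (k - 1)"
  and sum: "Var i ^ E = (\<Sum>j\<le>n. h j * df j)"
begin

lemma frame_fields: "l \<le> n \<Longrightarrow> frame i E h l \<in> F.fields (chart n i)"
 unfolding frame_def
proof (rule F.fieldI)
 assume l: "l \<le> n"
 show Z: "zariski_open n (chart n i)" by (rule zopen_chart[OF i])
 note o = zopenD(2)[OF Z]
 fix j assume j: "j \<le> n"
 have "homogeneous n E (df l * h j)"
  using homogeneous_mult[OF homogeneous_poly_partial[OF F.hom] h[OF j]] by (simp add: E add.commute)
 then have "hreg n (\<Union>(chart n i)) 0 (\<lambda>v. ev (df l * h j) v / v $ i ^ E)"
  by (intro hreg_chart_quotient[OF i o]) (rule chart_coord[OF i order_refl])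
 then show "hreg n (\<Union>(chart n i)) 1 (\<lambda>v. v $ i * ((if j = l then 1 else 0) - ev (df l * h j) v / v $ i ^ E))"
  by (intro hreg_mult[OF hreg_coord[OF o i] hreg_diff[OF o hreg_const[OF o]]]) auto
next
 assume l: "l \<le> n"
 fix v assume "v \<in> \<Union>(chart n i)"
 then have vi: "v $ i \<noteq> 0" by (rule chart_coord[OF i order_refl])
 have "v $ i ^ E = (\<Sum>j\<le>n. ev (h j) v * ev (df j) v)"
  using arg_cong[OF sum, of "\<lambda>p. ev p v"] mon_mono1[of i v] by simp
 then have s: "(\<Sum>j\<le>n. ev (df l * h j) v / v $ i ^ E * ev (df j) v) = ev (df l) v"
 proof -
  have "(\<Sum>j\<le>n. ev (df l * h j) v / v $ i ^ E * ev (df j) v)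
    = ev (df l) v / v $ i ^ E * (\<Sum>j\<le>n. ev (h j) v * ev (df j) v)"
   unfolding sum_distrib_left by (rule sum.cong[OF refl]) simp
  also have "\<dots> = ev (df l) v / v $ i ^ E * v $ i ^ E"
   using \<open>v $ i ^ E = (\<Sum>j\<le>n. ev (h j) v * ev (df j) v)\<close> by (simp only:)
  also have "\<dots> = ev (df l) v" using vi by simp
  finally show ?thesis .
 qed
 have "(\<Sum>j\<le>n. v $ i * ((if j = l then 1 else 0) - ev (df l * h j) v / v $ i ^ E) * ev (df j) v)
   = v $ i * ((\<Sum>j\<le>n. if j = l then ev (df j) v else 0) - (\<Sum>j\<le>n. ev (df l * h j) v / v $ i ^ E * ev (df j) v))"
  unfolding sum_subtractf[symmetric] sum_distrib_left by (rule sum.cong[OF refl]) (simp add: algebra_simps)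
 also have "\<dots> = 0" unfolding s using l by simp
 finally show "(\<Sum>j\<le>n. v $ i * ((if j = l then 1 else 0) - ev (df l * h j) v / v $ i ^ E) * ev (df j) v) = 0" .
qed

text \<open>A vector \<open>a\<close> in the kernel of \<open>\<nabla>f\<close> equals its own projection, so it is the combination of the projected basis
 vectors with the coefficients \<open>a\<^sub>l\<close>. Now apply linearity of \<open>\<Phi>\<close>.\<close>

lemma frame_expansion:
 assumes V: "V \<in> opens_in n (chart n i)" and a: "a \<in> F.fields V" and v: "v \<in> \<Union>V" and m: "m \<le> n"
 shows "\<Phi> V a v $ m = (\<Sum>l\<le>n. a v $ l / v $ i * \<Phi> (chart n i) (frame i E h l) v $ m)"
proof -
 note Vo = opens_inD[OF V]
 note aD = F.fieldsD[OF a]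
 note Z = zopen_chart[OF i]
 have vi: "u $ i \<noteq> 0" if "u \<in> \<Union>V" for u by (rule chart_coord[OF i Vo(2) that])
 have uc: "u \<in> \<Union>(chart n i)" if "u \<in> \<Union>V" for u using that Vo(5) by blast
 define s where "s l = desc V (\<lambda>u. a u $ l / u $ i)" for l
 have hs: "hreg n (\<Union>V) 0 (\<lambda>u. a u $ l / u $ i)" if "l \<le> n" for l
 proof -
  have "hreg n (\<Union>V) (-1) (\<lambda>u. ev 1 u / ev (Var i) u)"
   by (rule hreg_quotient[OF Vo(4) homogeneous_1 homogeneous_Var[OF i]]) (use vi mon_mono1[of i] in auto)
  from hreg_mult[OF vregD(2)[OF aD(2) that] this, of 0] show ?thesis using mon_mono1[of i] by simp
 qed
 have s: "s l \<in> regular n V" "u \<in> \<Union>V \<Longrightarrow> lift (s l) u = a u $ l / u $ i" if "l \<le> n" for l u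
  unfolding s_def using desc_regular[OF Vo(1) hs[OF that]] lift_desc[OF Vo(1) hs[OF that]] by auto
 define T where "T l = field_smult V (s l) (restrict (frame i E h l) (\<Union>V))" for l
 have fr: "restrict (frame i E h l) (\<Union>V) \<in> F.fields V" if "l \<le> n" for l
  by (rule F.fields_restrict[OF V frame_fields[OF that]])
 have T: "T l \<in> F.fields V" if "l \<le> n" for l
  unfolding T_def by (rule F.fields_smult[OF Vo(1) s(1)[OF that] fr[OF that]])
 have Tj: "T l u $ j = a u $ l / u $ i * (u $ i * ((if j = l then 1 else 0) - ev (df l * h j) u / u $ i ^ E))"
  if "l \<le> n" "j \<le> n" "u \<in> \<Union>V" for l j u
  unfolding T_def field_smult_apply[OF that(3)] restrict_apply'[OF that(3)] frame_def restrict_apply'[OF uc[OF that(3)]]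
  using s(2)[OF that(1,3)] that(2) by simp
 have \<Phi>T: "\<Phi> V (T l) u $ m = a u $ l / u $ i * \<Phi> (chart n i) (frame i E h l) u $ m" if l: "l \<le> n" and u: "u \<in> \<Union>V" for l u
 proof -
  have "\<Phi> V (T l) u = lift (s l) u \<cdot>\<^sub>v restrict (\<Phi> (chart n i) (frame i E h l)) (\<Union>V) u"
   unfolding T_def smult[OF Vo(1) s(1)[OF l] fr[OF l]] res[OF Z V frame_fields[OF l]] by (rule field_smult_apply[OF u])
  then show ?thesis
   unfolding restrict_apply'[OF u] s(2)[OF l u] using \<Phi>_carr[OF Z frame_fields[OF l] uc[OF u]] m by simp
 qed
 define AA where "AA = rec_nat (\<lambda>v\<in>\<Union>V. vec (Suc n) (\<lambda>j. 0)) (\<lambda>L A. field_add V A (T L))"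
 have AA0: "AA 0 = (\<lambda>v\<in>\<Union>V. vec (Suc n) (\<lambda>j. 0))" and AAS: "AA (Suc L) = field_add V (AA L) (T L)" for L
  by (simp_all add: AA_def)
 have AA: "AA L \<in> F.fields V \<and> (\<forall>u\<in>\<Union>V. (\<forall>j\<le>n. AA L u $ j = (\<Sum>l<L. T l u $ j)) \<and> \<Phi> V (AA L) u $ m = (\<Sum>l<L. \<Phi> V (T l) u $ m))"
  if "L \<le> Suc n" for L
  using that
 proof (induction L)
  case 0
  show ?case unfolding AA0
  proof (intro conjI ballI allI impI F.zero_field[OF Vo(1)])
   fix u assume u: "u \<in> \<Union>V"
   show "(\<lambda>v\<in>\<Union>V. vec (Suc n) (\<lambda>j. 0)) u $ j = (\<Sum>l<0. T l u $ j)" if "j \<le> n" for j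
    unfolding restrict_apply'[OF u] using that by simp
   show "\<Phi> V (\<lambda>v\<in>\<Union>V. vec (Suc n) (\<lambda>j. 0)) u $ m = (\<Sum>l<0. \<Phi> V (T l) u $ m)"
    using \<Phi>_zero[OF Vo(1) u m] by simp
  qed
 next
  case (Suc L)
  then have IH: "AA L \<in> F.fields V" "\<And>u j. u \<in> \<Union>V \<Longrightarrow> j \<le> n \<Longrightarrow> AA L u $ j = (\<Sum>l<L. T l u $ j)"
   "\<And>u. u \<in> \<Union>V \<Longrightarrow> \<Phi> V (AA L) u $ m = (\<Sum>l<L. \<Phi> V (T l) u $ m)" and L: "L \<le> n" by auto
  show ?case unfolding AAS
  proof (intro conjI ballI allI impI)
   show "field_add V (AA L) (T L) \<in> F.fields V" by (rule F.fields_add[OF Vo(1) IH(1) T[OF L]])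
   fix u assume u: "u \<in> \<Union>V"
   show "field_add V (AA L) (T L) u $ j = (\<Sum>l<Suc L. T l u $ j)" if j: "j \<le> n" for j
    unfolding field_add_apply[OF u] using F.fieldsD(4)[OF T[OF L] u] IH(2)[OF u j] j by simp
   show "\<Phi> V (field_add V (AA L) (T L)) u $ m = (\<Sum>l<Suc L. \<Phi> V (T l) u $ m)"
    unfolding add[OF Vo(1) IH(1) T[OF L]] field_add_apply[OF u] using \<Phi>_carr[OF Vo(1) T[OF L] u] IH(3)[OF u] m by simp
  qed
 qed
 have "AA (Suc n) = a"
 proof (rule extensionalityI)
  show "AA (Suc n) \<in> extensional (\<Union>V)" "a \<in> extensional (\<Union>V)" using F.fieldsD(1) AA[of "Suc n"] a by auto
  fix u assume u: "u \<in> \<Union>V"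
  have tang: "(\<Sum>l\<le>n. a u $ l * ev (df l) u) = 0"
   using aD(3)[OF u] unfolding grad_dot[OF aD(4)[OF u]] .
  have "AA (Suc n) u $ j = a u $ j" if j: "j \<le> n" for j
  proof -
   have "AA (Suc n) u $ j = (\<Sum>l\<le>n. T l u $ j)" using AA[of "Suc n"] u j by (simp only: lessThan_Suc_atMost)
   also have "\<dots> = (\<Sum>l\<le>n. (if l = j then a u $ l else 0) - a u $ l * ev (df l) u * (ev (h j) u / u $ i ^ E))"
    by (rule sum.cong[OF refl]) (use vi[OF u] j in \<open>auto simp: Tj[OF _ j u] right_diff_distrib\<close>)
   also have "\<dots> = a u $ j - (\<Sum>l\<le>n. a u $ l * ev (df l) u) * (ev (h j) u / u $ i ^ E)"
    using j by (simp only: sum_subtractf sum_distrib_right) simp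
   finally show ?thesis unfolding tang by simp
  qed
  then show "AA (Suc n) u = a u" using F.fieldsD(4)[OF _ u] AA[of "Suc n"] aD(4)[OF u] by (intro eq_vecI) auto
 qed
 then have "\<Phi> V a v $ m = (\<Sum>l<Suc n. \<Phi> V (T l) v $ m)" using AA[of "Suc n"] v by auto
 also have "\<dots> = (\<Sum>l\<le>n. a v $ l / v $ i * \<Phi> (chart n i) (frame i E h l) v $ m)"
  unfolding lessThan_Suc_atMost by (rule sum.cong[OF refl]) (use \<Phi>T[OF _ v] in auto)
 finally show ?thesis .
qed

text \<open>The power of \<open>x\<^sub>i\<close> in the denominator can be increased at will, so a common one exists for finitely many
 entries.\<close>

lemma frame_polynomial:
 assumes "l \<le> n" "m \<le> n"
 obtains M0 where "\<And>M. M \<ge> M0 \<Longrightarrow> \<exists>P. homogeneous n M P \<and>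
   (\<forall>v\<in>carr n. v $ i \<noteq> 0 \<longrightarrow> \<Phi> (chart n i) (frame i E h l) v $ m / v $ i = ev P v / v $ i ^ M)"
proof -
 have "hreg n (\<Union>(chart n i)) 1 (\<lambda>v. \<Phi> (chart n i) (frame i E h l) v $ m)"
  by (rule vregD(2)[OF G.fieldsD(2)[OF \<Phi>_fields[OF zopen_chart[OF i] frame_fields[OF assms(1)]]] assms(2)])
 then have "hreg n {v\<in>carr n. v $ i \<noteq> 0} (int 1) (\<lambda>v. \<Phi> (chart n i) (frame i E h l) v $ m)"
  unfolding chart_cone[OF i] by simp
 then obtain M1 P where P: "homogeneous n (M1 + 1) P"
  "\<And>v. v \<in> carr n \<Longrightarrow> v $ i \<noteq> 0 \<Longrightarrow> \<Phi> (chart n i) (frame i E h l) v $ m = ev P v / v $ i ^ M1"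
  using hreg_chart[OF F.n i] by blast
 show ?thesis
 proof (rule that[of "M1 + 1"], intro exI conjI ballI impI)
  fix M assume M: "M \<ge> M1 + 1"
  show "homogeneous n M (P * Var i ^ (M - (M1 + 1)))"
   using homogeneous_mult[OF P(1) homogeneous_power[OF homogeneous_Var[OF i], of "M - (M1 + 1)"]] M by simp
  fix v assume v: "v \<in> carr n" "v $ i \<noteq> 0"
  have e: "M = (M1 + 1) + (M - (M1 + 1))" using M by simp
  have "v $ i ^ M = v $ i ^ M1 * v $ i * v $ i ^ (M - (M1 + 1))"
   by (subst e) (simp add: power_add)
  then show "\<Phi> (chart n i) (frame i E h l) v $ m / v $ i = ev (P * Var i ^ (M - (M1 + 1))) v / v $ i ^ M"
   using P(2)[OF v] v mon_mono1[of i v] by simp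
 qed
qed

end

end

lemma homogeneous_0_const:
 assumes "homogeneous n 0 p" obtains c where "p = Const c"
proof (rule that[of "lkp p 0"], rule poly_mapping_eqI)
 fix m
 have "lkp p m = 0" if "m \<noteq> 0"
  using assms that unfolding homogeneous_iff by (metis in_keys_iff mdeg_eq_0_iff)
 then show "lkp p m = lkp (Const (lkp p 0)) m" by (simp add: lookup_single when_def)
qed

lemma finite_common_bound:
 fixes Q :: "'a \<Rightarrow> nat \<Rightarrow> bool"
 assumes "finite S" "\<And>x. x \<in> S \<Longrightarrow> \<exists>M0. \<forall>M\<ge>M0. Q x M"
 shows "\<exists>M0. \<forall>M\<ge>M0. \<forall>x\<in>S. Q x M"
 using assms
proof (induction S)
 case (insert x S)
 obtain M1 M2 where "\<forall>M\<ge>M1. \<forall>y\<in>S. Q y M" "\<forall>M\<ge>M2. Q x M" using insert by blast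
 then show ?case by (intro exI[of _ "max M1 M2"]) auto
qed simp

lemma poly_cancel_left: "(q::cpoly) \<noteq> 0 \<Longrightarrow> q * a = q * b \<Longrightarrow> a = b" by simp

context iso_pair
begin

lemma common_nullstellensatz:
 obtains N h where "\<And>i j. i \<le> 2 \<Longrightarrow> j \<le> n \<Longrightarrow> homogeneous n N (h i j)"
  "\<And>i. i \<le> 2 \<Longrightarrow> Var i ^ (N + (k - 1)) = (\<Sum>j\<le>n. h i j * df j)"
proof -
 have "\<forall>i\<in>{..2}. \<exists>N h. (\<forall>j\<le>n. homogeneous n N (h j)) \<and> Var i ^ (N + (k - 1)) = (\<Sum>j\<le>n. h j * df j)"
 proof
  fix i :: nat assume "i \<in> {..2}"
  then have i: "i \<le> n" using n2 by simp
  obtain N h where "\<And>j. j \<le> n \<Longrightarrow> homogeneous n N (h j)" "Var i ^ (N + (k - 1)) = (\<Sum>j\<le>n. h j * df j)"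
   using F.gradient_nullstellensatz[OF i] by blast
  then show "\<exists>N h. (\<forall>j\<le>n. homogeneous n N (h j)) \<and> Var i ^ (N + (k - 1)) = (\<Sum>j\<le>n. h j * df j)" by blast
 qed
 from bchoice[OF this] obtain N where N: "\<forall>i\<in>{..2}. \<exists>h. (\<forall>j\<le>n. homogeneous n (N i) (h j)) \<and> Var i ^ (N i + (k - 1)) = (\<Sum>j\<le>n. h j * df j)" ..
 from bchoice[OF this] obtain h where h: "\<And>i j. i \<le> 2 \<Longrightarrow> j \<le> n \<Longrightarrow> homogeneous n (N i) (h i j)"
  "\<And>i. i \<le> 2 \<Longrightarrow> Var i ^ (N i + (k - 1)) = (\<Sum>j\<le>n. h i j * df j)" by auto
 define N' where "N' = N 0 + N 1 + N 2"
 have le: "N i \<le> N'" if "i \<le> 2" for i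
 proof -
  have "i = 0 \<or> i = 1 \<or> i = 2" using that by auto
  then show ?thesis unfolding N'_def by auto
 qed
 show ?thesis
 proof (rule that[of N' "\<lambda>i j. h i j * Var i ^ (N' - N i)"])
  fix i :: nat assume i: "i \<le> 2"
  have iv: "homogeneous n (N' - N i) (Var i ^ (N' - N i))"
   using homogeneous_power[OF homogeneous_Var, of i n "N' - N i"] i n2 by simp
  show "homogeneous n N' (h i j * Var i ^ (N' - N i))" if "j \<le> n" for j
   using homogeneous_mult[OF h(1)[OF i that] iv] le[OF i] by simp
  have "N' + (k - 1) = N i + (k - 1) + (N' - N i)" using le[OF i] by simp
  then have "Var i ^ (N' + (k - 1)) = Var i ^ (N i + (k - 1)) * Var i ^ (N' - N i)"
   by (simp only: power_add)
  also have "\<dots> = (\<Sum>j\<le>n. h i j * Var i ^ (N' - N i) * df j)"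
   unfolding h(2)[OF i] sum_distrib_right by (rule sum.cong[OF refl]) (simp add: ac_simps)
  finally show "Var i ^ (N' + (k - 1)) = (\<Sum>j\<le>n. h i j * Var i ^ (N' - N i) * df j)" .
 qed
qed

text \<open>Over each of the three charts \<open>\<Phi>\<close> is given by a matrix of polynomials divided by one power of the chart
 coordinate. Its rows are tangent to \<open>V(g)\<close>, since they are images of kernel elements.\<close>

lemma chart_matrices:
 obtains N h M P where
  "\<And>i j. i \<le> 2 \<Longrightarrow> j \<le> n \<Longrightarrow> homogeneous n N (h i j)"
  "\<And>i. i \<le> 2 \<Longrightarrow> Var i ^ (N + (k - 1)) = (\<Sum>j\<le>n. h i j * df j)"
  "\<And>i l m. i \<le> 2 \<Longrightarrow> l \<le> n \<Longrightarrow> m \<le> n \<Longrightarrow> homogeneous n M (P i l m)"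
  "\<And>i V a v m. i \<le> 2 \<Longrightarrow> V \<in> opens_in n (chart n i) \<Longrightarrow> a \<in> F.fields V \<Longrightarrow> v \<in> \<Union>V \<Longrightarrow> m \<le> n \<Longrightarrow>
    \<Phi> V a v $ m = (\<Sum>l\<le>n. a v $ l * (ev (P i l m) v / v $ i ^ M))"
  "\<And>i l v. i \<le> 2 \<Longrightarrow> l \<le> n \<Longrightarrow> v \<in> carr n \<Longrightarrow> v $ i \<noteq> 0 \<Longrightarrow>
    (\<Sum>m\<le>n. ev (dg m) v * ev (P i l m) v) = 0"
proof -
 obtain N h where h: "\<And>i j. i \<le> 2 \<Longrightarrow> j \<le> n \<Longrightarrow> homogeneous n N (h i j)"
  "\<And>i. i \<le> 2 \<Longrightarrow> Var i ^ (N + (k - 1)) = (\<Sum>j\<le>n. h i j * df j)" using common_nullstellensatz by blast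
 define E where "E = N + (k - 1)"
 have hE: "Var i ^ E = (\<Sum>j\<le>n. h i j * df j)" if "i \<le> 2" for i using h(2)[OF that] by (simp add: E_def)
 have in2: "i \<le> n" if "i \<le> 2" for i using that n2 by simp
 define b where "b i l m v = \<Phi> (chart n i) (frame i E (h i) l) v $ m" for i l m v
 define Q where "Q x M \<longleftrightarrow> (case x of (i, l, m) \<Rightarrow> \<exists>P. homogeneous n M P \<and>
   (\<forall>v\<in>carr n. v $ i \<noteq> 0 \<longrightarrow> b i l m v / v $ i = ev P v / v $ i ^ M))" for x M
 have "\<exists>M0. \<forall>M\<ge>M0. \<forall>x\<in>{..2::nat} \<times> {..n} \<times> {..n}. Q x M"
 proof (rule finite_common_bound)
  fix x assume x: "x \<in> {..2::nat} \<times> {..n} \<times> {..n}"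
  obtain i l m where xe: "x = (i, l, m)" by (cases x)
  then have i: "i \<le> 2" and l: "l \<le> n" and m: "m \<le> n" using x by auto
  show "\<exists>M0. \<forall>M\<ge>M0. Q x M"
   using frame_polynomial[OF in2[OF i] h(1)[OF i] E_def hE[OF i] l m] unfolding Q_def xe b_def prod.case by blast
 qed simp
 then obtain M where M: "\<forall>x\<in>{..2::nat} \<times> {..n} \<times> {..n}. Q x M" by blast
 have "\<forall>x\<in>{..2::nat} \<times> {..n} \<times> {..n}. \<exists>P. case x of (i, l, m) \<Rightarrow> homogeneous n M P \<and>
   (\<forall>v\<in>carr n. v $ i \<noteq> 0 \<longrightarrow> b i l m v / v $ i = ev P v / v $ i ^ M)"
  using M unfolding Q_def by fast
 from bchoice[OF this] obtain P' where P': "\<forall>x\<in>{..2::nat} \<times> {..n} \<times> {..n}. case x of (i, l, m) \<Rightarrow> homogeneous n M (P' x) \<and>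
   (\<forall>v\<in>carr n. v $ i \<noteq> 0 \<longrightarrow> b i l m v / v $ i = ev (P' x) v / v $ i ^ M)" ..
 define P where "P i l m = P' (i, l, m)" for i l m
 have P: "homogeneous n M (P i l m)" "v \<in> carr n \<Longrightarrow> v $ i \<noteq> 0 \<Longrightarrow> b i l m v / v $ i = ev (P i l m) v / v $ i ^ M"
  if "i \<le> 2" "l \<le> n" "m \<le> n" for i l m v
  using bspec[OF P', of "(i, l, m)"] that unfolding P_def by auto
 show ?thesis
 proof (rule that[OF h P(1)])
  fix i V a v m
  assume i: "i \<le> 2" and V: "V \<in> opens_in n (chart n i)" and a: "a \<in> F.fields V" and v: "v \<in> \<Union>V" and m: "m \<le> n"
  note Vo = opens_inD[OF V]
  have vc: "v \<in> carr n" "v $ i \<noteq> 0" using ocone_carr[OF Vo(4) v] chart_coord[OF in2[OF i] Vo(2) v] by auto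
  have "\<Phi> V a v $ m = (\<Sum>l\<le>n. a v $ l / v $ i * b i l m v)"
   unfolding b_def by (rule frame_expansion[OF in2[OF i] h(1)[OF i] E_def hE[OF i] V a v m])
  also have "\<dots> = (\<Sum>l\<le>n. a v $ l * (b i l m v / v $ i))" by simp
  also have "\<dots> = (\<Sum>l\<le>n. a v $ l * (ev (P i l m) v / v $ i ^ M))"
   by (rule sum.cong[OF refl]) (use P(2)[OF i _ m vc] in auto)
  finally show "\<Phi> V a v $ m = (\<Sum>l\<le>n. a v $ l * (ev (P i l m) v / v $ i ^ M))" .
 next
  fix i l v assume i: "i \<le> 2" and l: "l \<le> n" and v: "v \<in> carr n" "v $ i \<noteq> 0"
  have fr: "frame i E (h i) l \<in> F.fields (chart n i)"
   by (rule frame_fields[OF in2[OF i] h(1)[OF i] E_def hE[OF i] l])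
  have vc: "v \<in> \<Union>(chart n i)" unfolding chart_cone[OF in2[OF i]] using v by simp
  note Z = zopen_chart[OF in2[OF i]]
  have "(\<Sum>m\<le>n. b i l m v * ev (dg m) v) = 0"
   using G.fieldsD(3)[OF \<Phi>_fields[OF Z fr] vc] unfolding grad_dot[OF \<Phi>_carr[OF Z fr vc]] b_def .
  moreover have "b i l m v = v $ i * ev (P i l m) v / v $ i ^ M" if "m \<le> n" for m
   using P(2)[OF i l that v] v(2) by (metis nonzero_mult_div_cancel_left times_divide_eq_right)
  ultimately have "(\<Sum>m\<le>n. v $ i / v $ i ^ M * (ev (dg m) v * ev (P i l m) v)) = 0"
   by (simp add: ac_simps)
  then have "v $ i / v $ i ^ M * (\<Sum>m\<le>n. ev (dg m) v * ev (P i l m) v) = 0"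
   unfolding sum_distrib_left .
  then show "(\<Sum>m\<le>n. ev (dg m) v * ev (P i l m) v) = 0" using v(2) by simp
 qed
qed

text \<open>Each column of the chart matrices is treated separately. Applying \<open>\<Phi>\<close> to the Koszul fields shows that the
 difference of two chart matrices is \<open>\<nabla>f\<close> times a homogeneous rational function. These functions satisfy the cocycle
 identity on the triple overlap, and \<open>cech_splitting\<close> writes the first of them as a difference of functions
 on the two charts. Correcting both matrices by multiples of \<open>\<nabla>f\<close>, which does not affect \<open>\<Phi>\<close> on the
 kernel of \<open>\<nabla>f\<close>, makes them agree on the overlap. The common entries have degree zero and no poles, so they are
 constants.\<close>

lemma constant_matrix:
 obtains A \<rho> where "\<And>l. l \<le> n \<Longrightarrow> (\<Sum>m\<le>n. Const (A l m) * dg m) = df l * \<rho>" "\<rho> \<in> polys n"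
  "\<And>a v m. a \<in> F.fields (chart n 0) \<Longrightarrow> v \<in> \<Union>(chart n 0) \<Longrightarrow> m \<le> n \<Longrightarrow>
    \<Phi> (chart n 0) a v $ m = (\<Sum>l\<le>n. a v $ l * A l m)"
proof -
 obtain N h M P where
  h: "\<And>i j. i \<le> 2 \<Longrightarrow> j \<le> n \<Longrightarrow> homogeneous n N (h i j)"
  and hs: "\<And>i. i \<le> 2 \<Longrightarrow> Var i ^ (N + (k - 1)) = (\<Sum>j\<le>n. h i j * df j)"
  and P: "\<And>i l m. i \<le> 2 \<Longrightarrow> l \<le> n \<Longrightarrow> m \<le> n \<Longrightarrow> homogeneous n M (P i l m)"
  and ex: "\<And>i V a v m. i \<le> 2 \<Longrightarrow> V \<in> opens_in n (chart n i) \<Longrightarrow> a \<in> F.fields V \<Longrightarrow> v \<in> \<Union>V \<Longrightarrow> m \<le> n \<Longrightarrow>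
    \<Phi> V a v $ m = (\<Sum>l\<le>n. a v $ l * (ev (P i l m) v / v $ i ^ M))"
  and tg: "\<And>i l v. i \<le> 2 \<Longrightarrow> l \<le> n \<Longrightarrow> v \<in> carr n \<Longrightarrow> v $ i \<noteq> 0 \<Longrightarrow>
    (\<Sum>m\<le>n. ev (dg m) v * ev (P i l m) v) = 0"
  using chart_matrices by blast
 have in2: "i \<le> n" if "i \<le> 2" for i using that n2 by simp
 define E where "E = N + (k - 1)"
 have hE: "Var i ^ E = (\<Sum>j\<le>n. h i j * df j)" if "i \<le> 2" for i using hs[OF that] by (simp add: E_def)
 have Pp: "P i l m \<in> polys n" if "i \<le> 2" "l \<le> n" "m \<le> n" for i l m using P[OF that] homogeneous_polys by blast
 have dfh: "homogeneous n (k - 1) (df l)" for l by (rule homogeneous_poly_partial[OF F.hom])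
 have dgh: "homogeneous n (k' - 1) (dg l)" for l by (rule homogeneous_poly_partial[OF G.hom])
 have dfp: "df l \<in> polys n" and dgp: "dg l \<in> polys n" for l using dfh dgh homogeneous_polys by blast+
 have Vh: "homogeneous n q (Var i ^ q)" if "i \<le> 2" for i q
  using homogeneous_power[OF homogeneous_Var[OF in2[OF that]], of q] by simp
 have Vp: "Var i ^ q \<in> polys n" if "i \<le> 2" for i q using Vh[OF that] homogeneous_polys by blast
 \<comment> \<open>Up to powers of the coordinates, the difference of the matrices on two charts.\<close>
 define \<Delta> where "\<Delta> m i i' l = P i l m * Var i' ^ M - P i' l m * Var i ^ M" for m i i' l
 have \<Delta>h: "homogeneous n (M + M) (\<Delta> m i i' l)" if "i \<le> 2" "i' \<le> 2" "l \<le> n" "m \<le> n" for m i i' l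
  unfolding \<Delta>_def by (intro homogeneous_diff homogeneous_mult P Vh that)
 \<comment> \<open>Both chart matrices compute the image of the same Koszul field.\<close>
 have compat: "df j * \<Delta> m i i' l = df l * \<Delta> m i i' j"
  if i: "i \<le> 2" and i': "i' \<le> 2" and l: "l \<le> n" and j: "j \<le> n" and m: "m \<le> n" for i i' l j m
 proof (rule polys_eqI_chart[OF _ _ in2[OF i] in2[OF i']])
  show "df j * \<Delta> m i i' l \<in> polys n" "df l * \<Delta> m i i' j \<in> polys n"
   unfolding \<Delta>_def by (intro polys_mult polys_diff dfp Pp Vp i i' l j m)+
  fix v assume v: "v \<in> carr n" "v $ i \<noteq> 0" "v $ i' \<noteq> 0"
  let ?V = "chart n i \<inter> chart n i'"
  have Vo: "zariski_open n ?V" by (intro zopen_Int zopen_chart in2 i i')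
  have V: "?V \<in> opens_in n (chart n i)" "?V \<in> opens_in n (chart n i')" using Vo by (auto simp: opens_in_iff)
  have vV: "v \<in> \<Union>?V" unfolding cone_Int[OF basic_sub basic_sub] chart_cone[OF in2[OF i]] chart_cone[OF in2[OF i']] using v by auto
  let ?c = "\<lambda>t. F.dehom i t v"
  have af: "F.koszul i ?V l j \<in> F.fields ?V" by (rule F.koszul_fields[OF in2[OF i] Vo _ l j]) simp
  have e: "\<Phi> ?V (F.koszul i ?V l j) v $ m = v $ i * (?c j * (ev (P r l m) v / v $ r ^ M) - ?c l * (ev (P r j m) v / v $ r ^ M))"
   if r: "r \<le> 2" "?V \<in> opens_in n (chart n r)" for r
   unfolding ex[OF r af vV m] by (rule F.koszul_dot[OF l j vV])
  have "v $ i * (?c j * (ev (P i l m) v / v $ i ^ M) - ?c l * (ev (P i j m) v / v $ i ^ M))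
    = v $ i * (?c j * (ev (P i' l m) v / v $ i' ^ M) - ?c l * (ev (P i' j m) v / v $ i' ^ M))"
   by (rule trans[OF e[OF i V(1), symmetric] e[OF i' V(2)]])
  then have "?c j * (ev (P i l m) v / v $ i ^ M) - ?c l * (ev (P i j m) v / v $ i ^ M)
    = ?c j * (ev (P i' l m) v / v $ i' ^ M) - ?c l * (ev (P i' j m) v / v $ i' ^ M)" using v(2) by simp
  then have "v $ i ^ (k - 1) * (?c j * (ev (P i l m) v / v $ i ^ M) - ?c l * (ev (P i j m) v / v $ i ^ M)) * (v $ i ^ M * v $ i' ^ M)
    = v $ i ^ (k - 1) * (?c j * (ev (P i' l m) v / v $ i' ^ M) - ?c l * (ev (P i' j m) v / v $ i' ^ M)) * (v $ i ^ M * v $ i' ^ M)" by simp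
  then have "ev (df j) v * ev (P i l m) v * v $ i' ^ M - ev (df l) v * ev (P i j m) v * v $ i' ^ M
    = ev (df j) v * ev (P i' l m) v * v $ i ^ M - ev (df l) v * ev (P i' j m) v * v $ i ^ M"
   using v(2,3) by (simp add: F.dehom_def left_diff_distrib right_diff_distrib mult.assoc)
  then show "ev (df j * \<Delta> m i i' l) v = ev (df l * \<Delta> m i i' j) v"
   by (simp add: \<Delta>_def algebra_simps)
 qed
 obtain l0 where l0: "l0 \<le> n" "df l0 \<noteq> 0"
 proof -
  let ?e = "unit_vec (Suc n) 0 :: complex vec"
  have "?e \<noteq> zvec n" by simp
  from F.gradient_nonzero[OF unit_vec_carrier this] obtain j where j: "j \<le> n" "ev (df j) ?e \<noteq> 0" .
  have "df j \<noteq> 0"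
  proof
   assume "df j = 0"
   then show False using j(2) by simp
  qed
  with j(1) show ?thesis by (rule that)
 qed
 define Q where "Q = E + M"
 have col: "\<exists>A u w. homogeneous n (N + M) u \<and> homogeneous n (N + M) w \<and>
   (\<forall>l\<le>n. P 0 l m * Var 0 ^ E - df l * w = Const (A l) * Var 0 ^ Q \<and> P 1 l m * Var 1 ^ E + df l * u = Const (A l) * Var 1 ^ Q)"
  if m: "m \<le> n" for m
 proof -
  define C where "C i0 i i' = (\<Sum>j\<le>n. h i0 j * \<Delta> m i i' j)" for i0 i i'
  have C: "Var i0 ^ E * \<Delta> m i i' l = df l * C i0 i i'" if "i0 \<le> 2" "i \<le> 2" "i' \<le> 2" "l \<le> n" for i0 i i' l
  proof -
   have "Var i0 ^ E * \<Delta> m i i' l = (\<Sum>j\<le>n. h i0 j * (df j * \<Delta> m i i' l))"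
    unfolding hE[OF that(1)] sum_distrib_right by (simp add: mult.assoc)
   also have "\<dots> = (\<Sum>j\<le>n. h i0 j * (df l * \<Delta> m i i' j))"
    by (rule sum.cong[OF refl]) (use compat[OF that(2,3,4) _ m] in auto)
   also have "\<dots> = df l * C i0 i i'" unfolding C_def sum_distrib_left by (rule sum.cong[OF refl]) (simp add: ac_simps)
   finally show ?thesis .
  qed
  have Ch: "homogeneous n (N + (M + M)) (C i0 i i')" if "i0 \<le> 2" "i \<le> 2" "i' \<le> 2" for i0 i i'
   unfolding C_def by (intro homogeneous_sum homogeneous_mult h \<Delta>h that m) auto
  let ?p = "C 0 0 1 * Var 1 ^ E"
  have ph: "homogeneous n (N + (M + M) + E) ?p" by (intro homogeneous_mult Ch Vh) auto
  \<comment> \<open>The three differences of three chart matrices add up to zero.\<close>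
  have cocycle: "Var 2 ^ M * \<Delta> m 0 1 l0 + Var 0 ^ M * \<Delta> m 1 2 l0 = Var 1 ^ M * \<Delta> m 0 2 l0"
   unfolding \<Delta>_def by (simp add: algebra_simps)
  \<comment> \<open>A non-zero partial derivative is multiplied in, to be cancelled at the end.\<close>
  have "df l0 * (?p * Var 2 ^ M) = df l0 * (C 0 0 2 * Var 1 ^ Q - C 1 1 2 * Var 0 ^ Q)"
  proof -
   have "df l0 * (?p * Var 2 ^ M) = (df l0 * C 0 0 1) * (Var 1 ^ E * Var 2 ^ M)" by (simp add: ac_simps)
   also have "\<dots> = (Var 0 ^ E * Var 1 ^ E) * (Var 2 ^ M * \<Delta> m 0 1 l0)"
    using C[of 0 0 1 l0] l0(1) by (simp add: ac_simps)
   also have "\<dots> = (Var 0 ^ E * Var 1 ^ E) * (Var 1 ^ M * \<Delta> m 0 2 l0 - Var 0 ^ M * \<Delta> m 1 2 l0)"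
    unfolding cocycle[symmetric] by simp
   also have "\<dots> = (Var 0 ^ E * \<Delta> m 0 2 l0) * Var 1 ^ Q - (Var 1 ^ E * \<Delta> m 1 2 l0) * Var 0 ^ Q"
    unfolding Q_def power_add by (simp add: algebra_simps)
   also have "\<dots> = df l0 * (C 0 0 2 * Var 1 ^ Q - C 1 1 2 * Var 0 ^ Q)"
    using C[of 0 0 2 l0] C[of 1 1 2 l0] l0(1) by (simp add: algebra_simps)
   finally show ?thesis .
  qed
  then have "?p * Var 2 ^ M = C 0 0 2 * Var 1 ^ Q - C 1 1 2 * Var 0 ^ Q" using l0(2) by (rule poly_cancel_left[rotated])
  then obtain u w where uw: "homogeneous n (N + (M + M) + E - Q) u" "homogeneous n (N + (M + M) + E - Q) w"
   "?p = u * Var 0 ^ Q + w * Var 1 ^ Q" using cech_splitting[OF ph] by blast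
  have deg: "N + (M + M) + E - Q = N + M" by (simp add: Q_def)
  have "\<exists>c. P 0 l m * Var 0 ^ E - df l * w = Const c * Var 0 ^ Q \<and> P 1 l m * Var 1 ^ E + df l * u = Const c * Var 1 ^ Q"
   if l: "l \<le> n" for l
  proof -
   \<comment> \<open>The corrected entries over the charts 0 and 1, which agree on the overlap.\<close>
   let ?X = "P 0 l m * Var 0 ^ E - df l * w" and ?Y = "P 1 l m * Var 1 ^ E + df l * u"
   have "?X * Var 1 ^ Q - ?Y * Var 0 ^ Q = Var 1 ^ E * (Var 0 ^ E * \<Delta> m 0 1 l) - df l * (u * Var 0 ^ Q + w * Var 1 ^ Q)"
    unfolding \<Delta>_def Q_def power_add by (simp add: algebra_simps)
   also have "\<dots> = 0" unfolding uw(3)[symmetric] using C[of 0 0 1 l] l by (simp add: ac_simps)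
   finally have XY: "?X * Var 1 ^ Q = ?Y * Var 0 ^ Q" by simp
   have Xh: "homogeneous n Q ?X"
   proof (rule homogeneous_diff)
    show "homogeneous n Q (P 0 l m * Var 0 ^ E)"
     using homogeneous_mult[OF P[of 0 l m] Vh[of 0 E]] l m by (simp add: Q_def add.commute)
    have "k - 1 + (N + M) = Q" by (simp add: Q_def E_def)
    then show "homogeneous n Q (df l * w)" using homogeneous_mult[OF dfh uw(2)[unfolded deg]] by simp
   qed
   obtain z where z: "homogeneous n (Q - Q) z" "?X = z * Var 0 ^ Q"
    using Var_power_divides[OF Xh supp_times_Var_power_eq[OF XY]] by auto
   then obtain c where c: "z = Const c" using homogeneous_0_const by auto
   have "Var 0 ^ Q * ?Y = Var 0 ^ Q * (Const c * Var 1 ^ Q)"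
    using XY unfolding z(2) c by (simp only: ac_simps)
   then have "?Y = Const c * Var 1 ^ Q" by (rule poly_cancel_left[rotated]) (simp add: Var_nonzero)
   then show ?thesis using z(2) c by blast
  qed
  then have "\<forall>l\<in>{..n}. \<exists>c. P 0 l m * Var 0 ^ E - df l * w = Const c * Var 0 ^ Q \<and> P 1 l m * Var 1 ^ E + df l * u = Const c * Var 1 ^ Q" by blast
  from bchoice[OF this] obtain A where "\<forall>l\<in>{..n}. P 0 l m * Var 0 ^ E - df l * w = Const (A l) * Var 0 ^ Q \<and> P 1 l m * Var 1 ^ E + df l * u = Const (A l) * Var 1 ^ Q" ..
  then show ?thesis using uw(1,2) unfolding deg by blast
 qed
 have "\<forall>m\<in>{..n}. \<exists>A u w. homogeneous n (N + M) u \<and> homogeneous n (N + M) w \<and>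
   (\<forall>l\<le>n. P 0 l m * Var 0 ^ E - df l * w = Const (A l) * Var 0 ^ Q \<and> P 1 l m * Var 1 ^ E + df l * u = Const (A l) * Var 1 ^ Q)"
  using col by blast
 from bchoice[OF this] obtain A' where "\<forall>m\<in>{..n}. \<exists>u w. homogeneous n (N + M) u \<and> homogeneous n (N + M) w \<and>
   (\<forall>l\<le>n. P 0 l m * Var 0 ^ E - df l * w = Const (A' m l) * Var 0 ^ Q \<and> P 1 l m * Var 1 ^ E + df l * u = Const (A' m l) * Var 1 ^ Q)" ..
 from bchoice[OF this] obtain u where "\<forall>m\<in>{..n}. \<exists>w. homogeneous n (N + M) (u m) \<and> homogeneous n (N + M) w \<and>
   (\<forall>l\<le>n. P 0 l m * Var 0 ^ E - df l * w = Const (A' m l) * Var 0 ^ Q \<and> P 1 l m * Var 1 ^ E + df l * u m = Const (A' m l) * Var 1 ^ Q)" ..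
 from bchoice[OF this] obtain w where
  uw: "\<And>m. m \<le> n \<Longrightarrow> homogeneous n (N + M) (u m)" "\<And>m. m \<le> n \<Longrightarrow> homogeneous n (N + M) (w m)"
  and eq0: "\<And>m l. m \<le> n \<Longrightarrow> l \<le> n \<Longrightarrow> P 0 l m * Var 0 ^ E - df l * w m = Const (A' m l) * Var 0 ^ Q"
  and eq1: "\<And>m l. m \<le> n \<Longrightarrow> l \<le> n \<Longrightarrow> P 1 l m * Var 1 ^ E + df l * u m = Const (A' m l) * Var 1 ^ Q" by blast
 define A where "A l m = A' m l" for l m
 have tang: "(\<Sum>m\<le>n. dg m * P i l m) = 0" if "i \<le> 2" "l \<le> n" for i l
  by (rule polys_eqI_chart[OF _ _ in2[OF that(1)] in2[OF that(1)]])
   (use tg[OF that] that in \<open>auto intro!: polys_sum polys_mult dgp Pp\<close>)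
 define G where "G l = (\<Sum>m\<le>n. Const (A l m) * dg m)" for l
 define R where "R = - (\<Sum>m\<le>n. dg m * w m)"
 define R' where "R' = (\<Sum>m\<le>n. dg m * u m)"
 have G0: "G l * Var 0 ^ Q = df l * R" if l: "l \<le> n" for l
 proof -
  have "G l * Var 0 ^ Q = (\<Sum>m\<le>n. dg m * (P 0 l m * Var 0 ^ E - df l * w m))"
   unfolding G_def sum_distrib_right
  proof (rule sum.cong[OF refl])
   fix m assume "m \<in> {..n}"
   then have m: "m \<le> n" by simp
   show "Const (A l m) * dg m * Var 0 ^ Q = dg m * (P 0 l m * Var 0 ^ E - df l * w m)"
    unfolding eq0[OF m l] A_def by (simp only: ac_simps)
  qed
  also have "\<dots> = (\<Sum>m\<le>n. dg m * P 0 l m) * Var 0 ^ E - df l * (\<Sum>m\<le>n. dg m * w m)"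
   unfolding sum_distrib_left sum_distrib_right sum_subtractf[symmetric] by (rule sum.cong[OF refl]) (simp add: algebra_simps)
  finally show ?thesis using tang[of 0 l] l by (simp add: R_def)
 qed
 have G1: "G l * Var 1 ^ Q = df l * R'" if l: "l \<le> n" for l
 proof -
  have "G l * Var 1 ^ Q = (\<Sum>m\<le>n. dg m * (P 1 l m * Var 1 ^ E + df l * u m))"
   unfolding G_def sum_distrib_right
  proof (rule sum.cong[OF refl])
   fix m assume "m \<in> {..n}"
   then have m: "m \<le> n" by simp
   show "Const (A l m) * dg m * Var 1 ^ Q = dg m * (P 1 l m * Var 1 ^ E + df l * u m)"
    unfolding eq1[OF m l] A_def by (simp only: ac_simps)
  qed
  also have "\<dots> = (\<Sum>m\<le>n. dg m * P 1 l m) * Var 1 ^ E + df l * (\<Sum>m\<le>n. dg m * u m)"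
   unfolding sum_distrib_left sum_distrib_right sum.distrib[symmetric] by (rule sum.cong[OF refl]) (simp add: algebra_simps)
  finally show ?thesis using tang[of 1 l] l by (simp add: R'_def)
 qed
 have "df l0 * (R * Var 1 ^ Q) = df l0 * (R' * Var 0 ^ Q)"
  unfolding mult.assoc[symmetric] G0[OF l0(1), symmetric] G1[OF l0(1), symmetric] by (simp only: ac_simps)
 then have RR: "R * Var 1 ^ Q = R' * Var 0 ^ Q" using l0(2) by (rule poly_cancel_left[rotated])
 have Rh: "homogeneous n (k' - 1 + (N + M)) R"
  unfolding R_def by (intro homogeneous_uminus homogeneous_sum homogeneous_mult dgh uw) auto
 obtain \<rho> where \<rho>: "homogeneous n (k' - 1 + (N + M) - Q) \<rho>" "R = \<rho> * Var 0 ^ Q"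
  by (rule Var_power_divides[OF Rh supp_times_Var_power_eq[OF RR]]) auto
 show ?thesis
 proof (rule that[of A \<rho>])
  show "(\<Sum>m\<le>n. Const (A l m) * dg m) = df l * \<rho>" if l: "l \<le> n" for l
  proof -
   have "Var 0 ^ Q * G l = Var 0 ^ Q * (df l * \<rho>)" using G0[OF l] unfolding \<rho>(2) by (simp only: ac_simps)
   then have "G l = df l * \<rho>" by (rule poly_cancel_left[rotated]) (simp add: Var_nonzero)
   then show ?thesis by (simp add: G_def)
  qed
  show "\<rho> \<in> polys n" using \<rho>(1) homogeneous_polys by blast
  fix a v m assume a: "a \<in> F.fields (chart n 0)" and v: "v \<in> \<Union>(chart n 0)" and m: "m \<le> n"
  have Z: "zariski_open n (chart n 0)" by (rule zopen_chart) simp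
  have v0: "v $ 0 \<noteq> 0" "v \<in> carr n" using v unfolding chart_cone[OF le0] by auto
  have "\<Phi> (chart n 0) a v $ m = (\<Sum>l\<le>n. a v $ l * (ev (P 0 l m) v / v $ 0 ^ M))"
   by (rule ex[OF _ opens_in_refl[OF Z] a v m]) simp
  also have "\<dots> = (\<Sum>l\<le>n. a v $ l * A l m + (a v $ l * ev (df l) v) * (ev (w m) v / v $ 0 ^ Q))"
  proof (rule sum.cong[OF refl])
   fix l assume "l \<in> {..n}"
   then have l: "l \<le> n" by simp
   have "ev (P 0 l m) v * v $ 0 ^ E - ev (df l) v * ev (w m) v = A l m * v $ 0 ^ Q"
    using arg_cong[OF eq0[OF m l], of "\<lambda>p. ev p v"] mon_mono1[of 0 v] by (simp add: A_def)
   then have "ev (P 0 l m) v * v $ 0 ^ E / v $ 0 ^ Q = A l m + ev (df l) v * ev (w m) v / v $ 0 ^ Q"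
    using v0(1) by (simp add: add_divide_distrib[symmetric] field_simps)
   moreover have "ev (P 0 l m) v * v $ 0 ^ E / v $ 0 ^ Q = ev (P 0 l m) v / v $ 0 ^ M"
    using v0(1) by (simp add: Q_def power_add)
   ultimately have q: "ev (P 0 l m) v / v $ 0 ^ M = A l m + ev (df l) v * ev (w m) v / v $ 0 ^ Q"
    by simp
   show "a v $ l * (ev (P 0 l m) v / v $ 0 ^ M) =
     a v $ l * A l m + (a v $ l * ev (df l) v) * (ev (w m) v / v $ 0 ^ Q)"
    unfolding q by (simp add: algebra_simps)
  qed
  also have "\<dots> = (\<Sum>l\<le>n. a v $ l * A l m) + (\<Sum>l\<le>n. a v $ l * ev (df l) v) * (ev (w m) v / v $ 0 ^ Q)"
   unfolding sum.distrib sum_distrib_right ..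
  also have "(\<Sum>l\<le>n. a v $ l * ev (df l) v) = 0"
   using F.fieldsD(3)[OF a v] unfolding grad_dot[OF F.fieldsD(4)[OF a v]] .
  finally show "\<Phi> (chart n 0) a v $ m = (\<Sum>l\<le>n. a v $ l * A l m)" by simp
 qed
qed

end

context iso_pair begin

text \<open>From \<open>A \<nabla>g = \<rho> \<nabla>f\<close> it remains to see that \<open>\<rho>\<close> is a non-zero constant. If \<open>\<rho> = 0\<close>, the image of \<open>\<Phi>\<close> is
 orthogonal to every value \<open>y\<close> of \<open>\<nabla>g\<close>; by surjectivity the Koszul fields of \<open>g\<close> are orthogonal to \<open>y\<close>, so the
 partial derivatives of \<open>g\<close> are all proportional and \<open>V(g)\<close> is a cone. Injectivity of \<open>\<Phi>\<close> makes \<open>A\<close> invertible, so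
 \<open>\<rho>\<close> has no zero besides the origin, because \<open>\<nabla>g\<close> has none.\<close>

theorem gradients_linearly_related:
 assumes k': "k' \<ge> 2"
 obtains A c where "c \<noteq> 0" "\<And>v l. l \<le> n \<Longrightarrow> (\<Sum>m\<le>n. A l m * ev (dg m) v) = c * ev (df l) v"
proof -
 obtain A \<rho> where G: "\<And>l. l \<le> n \<Longrightarrow> (\<Sum>m\<le>n. Const (A l m) * dg m) = df l * \<rho>" and \<rho>: "\<rho> \<in> polys n"
  and ex: "\<And>a v m. a \<in> F.fields (chart n 0) \<Longrightarrow> v \<in> \<Union>(chart n 0) \<Longrightarrow> m \<le> n \<Longrightarrow>
    \<Phi> (chart n 0) a v $ m = (\<Sum>l\<le>n. a v $ l * A l m)" using constant_matrix by blast
 let ?U = "chart n 0"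
 have Z: "zariski_open n ?U" by (rule zopen_chart) simp
 note o = zopenD(2)[OF Z]
 have ev: "(\<Sum>m\<le>n. A l m * ev (dg m) v) = ev (df l) v * ev \<rho> v" if "l \<le> n" for l v
  using arg_cong[OF G[OF that], of "\<lambda>p. ev p v"] by simp
 have dgp: "dg l \<in> polys n" for l using polys_partial[OF G.fp] .
 have "\<rho> \<noteq> 0"
 proof
  assume "\<rho> = 0"
  let ?e = "unit_vec (Suc n) 0 :: complex vec"
  have e0: "?e \<noteq> zvec n" by simp
  define y where "y m = ev (dg m) ?e" for m
  obtain j0 where j0: "j0 \<le> n" "y j0 \<noteq> 0" using G.gradient_nonzero[OF unit_vec_carrier e0] unfolding y_def by blast
  have Ay: "(\<Sum>m\<le>n. A l m * y m) = 0" if "l \<le> n" for l using ev[OF that] \<open>\<rho> = 0\<close> by (simp add: y_def)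
  \<comment> \<open>The Koszul fields of g lie in the image, which is orthogonal to the gradient value y.\<close>
  have prp: "Const (y j) * dg l = Const (y l) * dg j" if l: "l \<le> n" and j: "j \<le> n" for l j
  proof (rule polys_eqI_chart[of _ n _ 0 0])
   show "Const (y j) * dg l \<in> polys n" "Const (y l) * dg j \<in> polys n" by (intro polys_mult polys_Const dgp)+
   fix v assume v: "v \<in> carr n" "v $ 0 \<noteq> 0"
   let ?c = "\<lambda>t. G.dehom 0 t v" and ?b = "G.koszul 0 ?U j l"
   have "?b \<in> G.fields ?U" by (rule G.koszul_fields[OF le0 Z order_refl j l])
   then have "?b \<in> \<Phi> ?U ` F.fields ?U" unfolding bij_betw_imp_surj_on[OF bij[OF Z]] .
   then obtain a where a: "a \<in> F.fields ?U" "\<Phi> ?U a = ?b" by (auto simp del: Union_iff)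
   have vU: "v \<in> \<Union>?U" unfolding chart_cone[OF le0] using v by simp
   have "v $ 0 * (?c l * y j - ?c j * y l) = (\<Sum>t\<le>n. ?b v $ t * y t)"
    by (rule G.koszul_dot[OF j l vU, symmetric])
   also have "\<dots> = (\<Sum>t\<le>n. (\<Sum>i\<le>n. a v $ i * A i t) * y t)"
    by (rule sum.cong[OF refl]) (use ex[OF a(1) vU] a(2) in auto)
   also have "\<dots> = (\<Sum>i\<le>n. a v $ i * (\<Sum>t\<le>n. A i t * y t))"
    unfolding sum_distrib_left sum_distrib_right by (subst sum.swap) (simp add: ac_simps)
   also have "\<dots> = 0" using Ay by simp
   finally have "?c l * y j = ?c j * y l" using v(2) by simp
   then show "ev (Const (y j) * dg l) v = ev (Const (y l) * dg j) v"
    using v(2) by (simp add: G.dehom_def mult.commute)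
  qed auto
  obtain i1 where i1: "i1 \<le> n" "i1 \<noteq> j0"
  proof (cases "j0 = 0")
   case True then show ?thesis using that[of 1] F.n by simp
  next
   case False then show ?thesis using that[of 0] by simp
  qed
  define w where "w = vec (Suc n) (\<lambda>i. if i = j0 then - y i1 else if i = i1 then y j0 else 0)"
  have "w = zvec n"
  proof (rule G.not_cone[OF k'])
   show "w \<in> carr n" by (simp add: w_def)
   have "(\<Sum>i\<le>n. Const (w $ i) * dg i) = (\<Sum>i\<le>n. (if i = j0 then Const (- y i1) * dg i else 0) + (if i = i1 then Const (y j0) * dg i else 0))"
    by (rule sum.cong[OF refl]) (use i1 in \<open>auto simp: w_def\<close>)
   also have "\<dots> = Const (- y i1) * dg j0 + Const (y j0) * dg i1" using i1 j0 by (simp add: sum.distrib)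
   also have "\<dots> = 0" using prp[OF i1(1) j0(1)] by (simp add: single_uminus)
   finally show "(\<Sum>i\<le>n. Const (w $ i) * dg i) = 0" .
  qed
  then have "w $ i1 = 0" using i1 by simp
  then show False using i1 j0 by (simp add: w_def)
 qed
 have inj: "a0 = zvec n"
  if a0: "a0 \<in> carr n" and z: "\<And>m. m \<le> n \<Longrightarrow> (\<Sum>t\<le>n. a0 $ t * A t m) = 0" for a0
 proof -
  have "(\<Sum>t\<le>n. Const (a0 $ t) * df t) * \<rho> = (\<Sum>t\<le>n. Const (a0 $ t) * (\<Sum>m\<le>n. Const (A t m) * dg m))"
   unfolding sum_distrib_right by (rule sum.cong[OF refl]) (simp add: G mult.assoc)
  also have "\<dots> = (\<Sum>m\<le>n. Const (\<Sum>t\<le>n. a0 $ t * A t m) * dg m)"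
  proof -
   have "Const (\<Sum>t\<le>n. X t) = (\<Sum>t\<le>n. Const (X t))" for X :: "nat \<Rightarrow> complex"
    by (rule poly_mapping_eqI) (simp add: lookup_sum lookup_single when_def)
   then have "(\<Sum>m\<le>n. Const (\<Sum>t\<le>n. a0 $ t * A t m) * dg m) = (\<Sum>m\<le>n. \<Sum>t\<le>n. Const (a0 $ t * A t m) * dg m)"
    by (simp add: sum_distrib_right)
   also have "\<dots> = (\<Sum>t\<le>n. \<Sum>m\<le>n. Const (a0 $ t * A t m) * dg m)" by (rule sum.swap)
   also have "\<dots> = (\<Sum>t\<le>n. Const (a0 $ t) * (\<Sum>m\<le>n. Const (A t m) * dg m))"
    by (simp add: sum_distrib_left mult.assoc[symmetric] mult_single)
   finally show ?thesis ..
  qed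
  also have "\<dots> = 0" using z by simp
  finally have cone: "(\<Sum>t\<le>n. Const (a0 $ t) * df t) = 0" using \<open>\<rho> \<noteq> 0\<close> by simp
  define a where "a = (\<lambda>v\<in>\<Union>?U. vec (Suc n) (\<lambda>t. v $ 0 * a0 $ t))"
  have af: "a \<in> F.fields ?U" unfolding a_def
  proof (rule F.fieldI[OF Z])
   show "hreg n (\<Union>?U) 1 (\<lambda>v. v $ 0 * a0 $ t)" for t
    using hreg_mult[OF hreg_coord[OF o le0] hreg_const[OF o]] by simp
   show "(\<Sum>t\<le>n. v $ 0 * a0 $ t * ev (df t) v) = 0" for v
    using arg_cong[OF cone, of "\<lambda>p. v $ 0 * ev p v"] by (simp add: sum_distrib_left mult.assoc)
  qed
  let ?Z = "\<lambda>v\<in>\<Union>?U. vec (Suc n) (\<lambda>j. 0 :: complex)"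
  have "\<Phi> ?U a = \<Phi> ?U ?Z"
  proof (rule extensionalityI)
   show "\<Phi> ?U a \<in> extensional (\<Union>?U)" "\<Phi> ?U ?Z \<in> extensional (\<Union>?U)"
    using G.fieldsD(1)[OF \<Phi>_fields[OF Z af]] G.fieldsD(1)[OF \<Phi>_fields[OF Z F.zero_field[OF Z]]] by auto
   fix v assume v: "v \<in> \<Union>?U"
   show "\<Phi> ?U a v = \<Phi> ?U ?Z v"
   proof (rule eq_vecI)
    fix m assume "m < dim_vec (\<Phi> ?U ?Z v)"
    then have m: "m \<le> n" using \<Phi>_carr[OF Z F.zero_field[OF Z] v] by simp
    have "\<Phi> ?U a v $ m = (\<Sum>l\<le>n. v $ 0 * (a0 $ l * A l m))"
    proof (rule trans[OF ex[OF af v m]], rule sum.cong[OF refl])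
     fix l assume "l \<in> {..n}"
     then show "a v $ l * A l m = v $ 0 * (a0 $ l * A l m)" unfolding a_def restrict_apply'[OF v] by simp
    qed
    also have "\<dots> = 0" using z[OF m] by (simp only: sum_distrib_left[symmetric]) simp
    finally show "\<Phi> ?U a v $ m = \<Phi> ?U ?Z v $ m" using \<Phi>_zero[OF Z v m] by simp
   qed (use \<Phi>_carr[OF Z F.zero_field[OF Z] v] \<Phi>_carr[OF Z af v] in auto)
  qed
  then have aZ: "a = ?Z" using bij_betw_imp_inj_on[OF bij[OF Z]] af F.zero_field[OF Z] by (auto dest: inj_onD)
  let ?e = "unit_vec (Suc n) 0 :: complex vec"
  have e: "?e \<in> \<Union>?U" unfolding chart_cone[OF le0] by simp
  have ae: "a ?e = vec (Suc n) (\<lambda>t. ?e $ 0 * a0 $ t)" unfolding a_def by (rule restrict_apply'[OF e])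
  have "a ?e = vec (Suc n) (\<lambda>t. 0)" unfolding aZ by (rule restrict_apply'[OF e])
  then have "vec (Suc n) (\<lambda>t. ?e $ 0 * a0 $ t) = vec (Suc n) (\<lambda>t. 0)" using ae by simp
  then have "a0 $ t = 0" if "t < Suc n" for t using that by (metis index_unit_vec(1) index_vec mult_1 zero_less_Suc)
  then show ?thesis using a0 by (intro eq_vecI) auto
 qed
 have "ev \<rho> x \<noteq> 0" if x: "x \<in> carr n" "x \<noteq> zvec n" for x
 proof
  assume r0: "ev \<rho> x = 0"
  define AM where "AM = mat (Suc n) (Suc n) (\<lambda>(l, m). A l m)"
  have AM: "AM \<in> carrier_mat (Suc n) (Suc n)" by (simp add: AM_def)
  have "AM *\<^sub>v grad n g x = zvec n"
  proof (rule eq_vecI)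
   fix l assume "l < dim_vec (zvec n :: complex vec)"
   then have l: "l \<le> n" by simp
   have "(AM *\<^sub>v grad n g x) $ l = (\<Sum>m\<le>n. A l m * ev (dg m) x)"
    using l dot_sum[OF grad_carr[of n g x], of "vec (Suc n) (A l)"] by (simp add: AM_def)
   then show "(AM *\<^sub>v grad n g x) $ l = zvec n $ l" using ev[OF l, of x] r0 l by simp
  qed (simp add: AM_def)
  moreover have "grad n g x \<noteq> zvec n"
  proof -
   obtain j where j: "j \<le> n" "ev (dg j) x \<noteq> 0" using G.gradient_nonzero[OF x] .
   then have "grad n g x $ j \<noteq> zvec n $ j" by simp
   then show ?thesis by metis
  qed
  ultimately have "det AM = 0" using det_0_iff_vec_prod_zero[OF AM] grad_carr by blast
  then have "det (transpose_mat AM) = 0" using det_transpose[OF AM] by simp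
  then obtain a0 where a0: "a0 \<in> carr n" "a0 \<noteq> zvec n" "transpose_mat AM *\<^sub>v a0 = zvec n"
   using det_0_iff_vec_prod_zero[of "transpose_mat AM" "Suc n"] AM by auto
  have "(\<Sum>t\<le>n. a0 $ t * A t m) = 0" if m: "m \<le> n" for m
  proof -
   have "(transpose_mat AM *\<^sub>v a0) $ m = (\<Sum>t\<le>n. A t m * a0 $ t)"
    using m dot_sum[OF a0(1), of "row (transpose_mat AM) m"] by (simp add: AM_def)
   then show ?thesis using a0(3) m by (simp add: mult.commute)
  qed
  then show False using inj[OF a0(1)] a0(2) by blast
 qed
 then obtain c where c: "\<And>v. v \<in> carr n \<Longrightarrow> v \<noteq> zvec n \<Longrightarrow> ev \<rho> v = c"
  using nonvanishing_constant[OF F.n \<rho>] by blast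
 have "\<rho> = Const c"
 proof (rule polys_eqI_chart[OF \<rho> polys_Const le0 le0])
  fix v assume "v \<in> carr n" "v $ 0 \<noteq> 0"
  moreover from this have "v \<noteq> zvec n" by auto
  ultimately show "ev \<rho> v = ev (Const c) v" using c by simp
 qed
 moreover from this have "c \<noteq> 0" using \<open>\<rho> \<noteq> 0\<close> by auto
 ultimately show ?thesis using that[of c A] ev by (simp add: mult.commute)
qed

end

section \<open>Linear substitutions\<close>

lemma poly_vars_add: "poly_vars (p + q) \<subseteq> poly_vars p \<union> poly_vars q"
 using Poly_Mapping.keys_add[of p q] by (fastforce simp: poly_vars_def)

lemma poly_vars_mult: "poly_vars (p * q) \<subseteq> poly_vars p \<union> poly_vars q"
 using keys_mult[of p q] by (fastforce simp: poly_vars_def supp_add_nat)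

lemma poly_vars_Const: "poly_vars (Const c) = {}"
 by (auto simp: poly_vars_def split: if_splits)

lemma poly_vars_linear: "poly_vars (\<Sum>j\<in>J. Const (c j) * Var j) \<subseteq> J"
proof (induction J rule: infinite_finite_induct)
 case (insert j J)
 have "poly_vars (Const (c j) * Var j) \<subseteq> {j}"
  by (auto simp: poly_vars_def mult_single split: if_splits)
 then show ?case using insert poly_vars_add[of "Const (c j) * Var j" "\<Sum>j\<in>J. Const (c j) * Var j"] by auto
qed (simp_all add: poly_vars_def)

lemma substitution_vars:
 assumes "f \<in> polys n" "\<And>i. i \<le> n \<Longrightarrow> poly_vars (L i) \<subseteq> S"
 shows "\<exists>q. poly_vars q \<subseteq> S \<and> (\<forall>v. ev q v = ev f (vec (Suc n) (\<lambda>i. ev (L i) v)))"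
 using assms(1)
proof (induction f rule: polys_induct)
 case (Const c)
 then show ?case by (intro exI[of _ "Const c"]) (simp add: poly_vars_Const)
next
 case (Var i)
 then show ?case using assms(2)[OF Var] by (intro exI[of _ "L i"]) simp
next
 case (add p q)
 then obtain p' q' where "poly_vars p' \<subseteq> S" "\<forall>v. ev p' v = ev p (vec (Suc n) (\<lambda>i. ev (L i) v))"
  "poly_vars q' \<subseteq> S" "\<forall>v. ev q' v = ev q (vec (Suc n) (\<lambda>i. ev (L i) v))" by blast
 then show ?case using poly_vars_add[of p' q'] by (intro exI[of _ "p' + q'"]) auto
next
 case (mult p q)
 then obtain p' q' where "poly_vars p' \<subseteq> S" "\<forall>v. ev p' v = ev p (vec (Suc n) (\<lambda>i. ev (L i) v))"
  "poly_vars q' \<subseteq> S" "\<forall>v. ev q' v = ev q (vec (Suc n) (\<lambda>i. ev (L i) v))" by blast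
 then show ?case using poly_vars_mult[of p' q'] by (intro exI[of _ "p' * q'"]) auto
qed

lemma poly_eval_cong_vars: "(\<And>i. i \<in> poly_vars f \<Longrightarrow> v $ i = w $ i) \<Longrightarrow> ev f v = ev f w"
proof -
 assume eq: "\<And>i. i \<in> poly_vars f \<Longrightarrow> v $ i = w $ i"
 have "(\<Prod>i\<in>supp m. v $ i ^ lkp m i) = (\<Prod>i\<in>supp m. w $ i ^ lkp m i)" if "m \<in> supp f" for m
  by (rule prod.cong[OF refl]) (use that in \<open>simp add: eq poly_vars_def bexI[of _ m]\<close>)
 then show ?thesis unfolding poly_eval_def by simp
qed

lemma homogeneous_prod_power:
 assumes "finite I" "\<And>i. i \<in> I \<Longrightarrow> homogeneous n 1 (L i)"
 shows "homogeneous n (\<Sum>i\<in>I. e i) (\<Prod>i\<in>I. L i ^ e i)"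
 using assms
proof (induction I rule: finite_induct)
 case (insert i I)
 then show ?case
  using homogeneous_mult[OF homogeneous_power[of n 1 "L i" "e i"], of "\<Sum>i\<in>I. e i" "\<Prod>i\<in>I. L i ^ e i"] by simp
qed simp

lemma line_image:
 assumes "M \<in> carrier_mat (Suc n) (Suc n)" "v \<in> carr n" "w \<in> carr n"
 shows "M *\<^sub>v (v + t \<cdot>\<^sub>v w) = M *\<^sub>v v + t \<cdot>\<^sub>v (M *\<^sub>v (w :: complex vec))"
proof -
 have "M *\<^sub>v (v + t \<cdot>\<^sub>v w) = M *\<^sub>v v + M *\<^sub>v (t \<cdot>\<^sub>v w)"
  by (rule mult_add_distrib_mat_vec[OF assms(1,2)]) (use assms(3) in simp)
 also have "M *\<^sub>v (t \<cdot>\<^sub>v w) = t \<cdot>\<^sub>v (M *\<^sub>v w)" by (rule mult_mat_vec[OF assms(1,3)])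
 finally show ?thesis .
qed

lemma gradient_composite:
 assumes "f \<in> polys n" "M \<in> carrier_mat (Suc n) (Suc n)" "v \<in> carr n" "w \<in> carr n"
 shows "((\<lambda>t. ev f (M *\<^sub>v (v + t \<cdot>\<^sub>v w))) has_field_derivative grad n f (M *\<^sub>v v) \<bullet> (M *\<^sub>v w)) (at 0)"
proof -
 have c: "M *\<^sub>v v \<in> carr n" "M *\<^sub>v w \<in> carr n" using assms by auto
 show ?thesis unfolding line_image[OF assms(2-4)] using directional_derivative[OF assms(1) c, of 0] c by simp
qed

lemma gradient_eqI:
 assumes "g \<in> polys n" "v \<in> carr n" "w \<in> carr n"
  and "((\<lambda>t. ev g (v + t \<cdot>\<^sub>v w)) has_field_derivative d) (at 0)"
 shows "grad n g v \<bullet> w = d"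
 using DERIV_unique[OF directional_derivative[OF assms(1-3), of 0] assms(4)] assms(2,3) by simp

text \<open>The composite of a form with a linear map is again a form, with the gradient given by the chain rule.\<close>

lemma linear_substitution:
 assumes f: "homogeneous n k f" and M: "M \<in> carrier_mat (Suc n) (Suc n)"
 obtains g where "homogeneous n k g" "\<And>v. v \<in> carr n \<Longrightarrow> ev g v = ev f (M *\<^sub>v v)"
  "\<And>v w. v \<in> carr n \<Longrightarrow> w \<in> carr n \<Longrightarrow> grad n g v \<bullet> w = grad n f (M *\<^sub>v v) \<bullet> (M *\<^sub>v w)"
proof -
 define L where "L i = (\<Sum>j\<le>n. Const (M $$ (i, j)) * Var j)" for i
 define g where "g = (\<Sum>m\<in>supp f. Const (lkp f m) * (\<Prod>i\<in>supp m. L i ^ lkp m i))"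
 have L: "homogeneous n 1 (L i)" for i
  unfolding L_def by (intro homogeneous_sum homogeneous_Const_mult homogeneous_Var) simp
 have g: "homogeneous n k g" unfolding g_def
 proof (rule homogeneous_sum, rule homogeneous_Const_mult)
  fix m assume "m \<in> supp f"
  then have "k = (\<Sum>i\<in>supp m. lkp m i)" using f by (simp add: homogeneous_def)
  then show "homogeneous n k (\<Prod>i\<in>supp m. L i ^ lkp m i)" using homogeneous_prod_power[of "supp m" n L "lkp m"] L by simp
 qed
 have Lv: "ev (L i) v = (M *\<^sub>v v) $ i" if "i \<le> n" "v \<in> carr n" for i v
  using that M dot_sum[OF that(2), of "row M i"] by (simp add: L_def)
 have ge: "ev g v = ev f (M *\<^sub>v v)" if v: "v \<in> carr n" for v
  unfolding g_def poly_eval_def[of f]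
 proof (simp, rule sum.cong[OF refl])
  fix m assume "m \<in> supp f"
  then have "supp m \<subseteq> {..n}" using f by (auto simp: homogeneous_iff)
  then have "(\<Prod>i\<in>supp m. ev (L i) v ^ lkp m i) = (\<Prod>i\<in>supp m. (M *\<^sub>v v) $ i ^ lkp m i)"
   using Lv[OF _ v] by (intro prod.cong) auto
  then show "lkp f m * (\<Prod>i\<in>supp m. ev (L i) v ^ lkp m i) = lkp f m * (\<Prod>i\<in>supp m. (M *\<^sub>v v) $ i ^ lkp m i)" by simp
 qed
 show ?thesis
 proof (rule that[OF g ge])
  fix v w assume v: "v \<in> carr n" and w: "w \<in> carr n"
  have "ev g (v + t \<cdot>\<^sub>v w) = ev f (M *\<^sub>v (v + t \<cdot>\<^sub>v w))" for t using ge v w by simp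
  then show "grad n g v \<bullet> w = grad n f (M *\<^sub>v v) \<bullet> (M *\<^sub>v w)"
   using gradient_composite[OF homogeneous_polys[OF f] M v w]
   by (intro gradient_eqI[OF homogeneous_polys[OF g] v w]) simp
 qed
qed

section \<open>Splittings and Sebastiani--Thom type\<close>

text \<open>A linear coordinate system is kept as a pair of inverse matrices, the columns of \<open>P\<close> being the basis.\<close>

locale coordinates =
 fixes n :: nat and P Q :: "complex mat"
 assumes P: "P \<in> carrier_mat (Suc n) (Suc n)" and Q: "Q \<in> carrier_mat (Suc n) (Suc n)"
  and PQ: "P * Q = 1\<^sub>m (Suc n)" and QP: "Q * P = 1\<^sub>m (Suc n)"
begin

definition scaling :: "(nat \<Rightarrow> complex) \<Rightarrow> complex mat" where
 "scaling h = P * (mat_diag (Suc n) h * Q)"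

abbreviation part :: "nat set \<Rightarrow> complex mat" where "part S \<equiv> scaling (indicator S)"

text \<open>The polynomial is a sum over two complementary coordinate subspaces. This is Sebastiani--Thom type with an
 arbitrary index set in place of an initial segment, and without reference to the two summands.\<close>

definition splits :: "cpoly \<Rightarrow> nat set \<Rightarrow> bool" where
 "splits f S \<longleftrightarrow> (\<forall>v\<in>carr n. ev f v = ev f (part S *\<^sub>v v) + ev f (part (- S) *\<^sub>v v))"

lemma scaling_carr [simp]: "scaling h \<in> carrier_mat (Suc n) (Suc n)"
 unfolding scaling_def by (rule mult_carrier_mat[OF P mult_carrier_mat[OF mat_diag_dim Q]])

lemma scaling_vec_carr [simp]: "v \<in> carr n \<Longrightarrow> scaling h *\<^sub>v v \<in> carr n"
 by (rule mult_mat_vec_carrier[OF scaling_carr])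

lemma QP_vec: "v \<in> carr n \<Longrightarrow> Q *\<^sub>v (P *\<^sub>v v) = v"
 using assoc_mult_mat_vec[OF Q P] QP by auto

lemma scaling_vec: "v \<in> carr n \<Longrightarrow> scaling h *\<^sub>v v = P *\<^sub>v vec (Suc n) (\<lambda>i. h i * (Q *\<^sub>v v) $ i)"
proof -
 assume v: "v \<in> carr n"
 have Qv: "Q *\<^sub>v v \<in> carr n" by (rule mult_mat_vec_carrier[OF Q v])
 have "mat_diag (Suc n) h *\<^sub>v u = vec (Suc n) (\<lambda>i. h i * u $ i)" if "u \<in> carr n" for u
 proof (rule eq_vecI)
  fix i assume "i < dim_vec (vec (Suc n) (\<lambda>i. h i * u $ i))"
  then have i: "i \<le> n" by simp
  have "(mat_diag (Suc n) h *\<^sub>v u) $ i = row (mat_diag (Suc n) h) i \<bullet> u" using i by (simp add: mat_diag_def)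
  also have "\<dots> = (\<Sum>j\<le>n. row (mat_diag (Suc n) h) i $ j * u $ j)" by (rule dot_sum[OF that])
  also have "\<dots> = (\<Sum>j\<le>n. (if j = i then h j * u $ j else 0))"
   by (rule sum.cong[OF refl]) (use i in \<open>auto simp: mat_diag_def\<close>)
  finally have "(mat_diag (Suc n) h *\<^sub>v u) $ i = (\<Sum>j\<le>n. (if j = i then h j * u $ j else 0))" .
  then show "(mat_diag (Suc n) h *\<^sub>v u) $ i = vec (Suc n) (\<lambda>i. h i * u $ i) $ i" using i by simp
 qed (simp add: mat_diag_def)
 note diag = this[OF Qv]
 show ?thesis unfolding scaling_def assoc_mult_mat_vec[OF P mult_carrier_mat[OF mat_diag_dim Q] v]
  assoc_mult_mat_vec[OF mat_diag_dim Q v] diag ..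
qed

lemma scaling_mult: "scaling h * scaling g = scaling (\<lambda>i. h i * g i)"
proof -
 let ?H = "mat_diag (Suc n) h" and ?G = "mat_diag (Suc n) g"
 note c = P Q mat_diag_dim[of "Suc n" h] mat_diag_dim[of "Suc n" g] mult_carrier_mat[OF mat_diag_dim[of "Suc n" h] Q]
  mult_carrier_mat[OF mat_diag_dim[of "Suc n" g] Q]
 have "scaling h * scaling g = P * (?H * Q * (P * (?G * Q)))"
  unfolding scaling_def by (rule assoc_mult_mat[OF P c(5) mult_carrier_mat[OF P c(6)]])
 also have "?H * Q * (P * (?G * Q)) = ?H * (Q * (P * (?G * Q)))"
  by (rule assoc_mult_mat[OF c(3) Q mult_carrier_mat[OF P c(6)]])
 also have "Q * (P * (?G * Q)) = ?G * Q"
  using assoc_mult_mat[OF Q P c(6)] QP left_mult_one_mat[OF c(6)] by simp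
 also have "?H * (?G * Q) = ?H * ?G * Q" by (rule assoc_mult_mat[OF c(3,4) Q, symmetric])
 finally show ?thesis by (simp add: scaling_def)
qed

lemma scaling_one: "(\<And>i. i \<le> n \<Longrightarrow> h i = 1) \<Longrightarrow> scaling h = 1\<^sub>m (Suc n)"
proof -
 assume "\<And>i. i \<le> n \<Longrightarrow> h i = 1"
 then have "mat_diag (Suc n) h = 1\<^sub>m (Suc n)" by (intro eq_matI) (auto simp: mat_diag_def)
 then show ?thesis using PQ Q by (simp add: scaling_def)
qed

lemma scaling_mult_vec: "v \<in> carr n \<Longrightarrow> scaling h *\<^sub>v (scaling g *\<^sub>v v) = scaling (\<lambda>i. h i * g i) *\<^sub>v v"
 by (subst assoc_mult_mat_vec[OF scaling_carr scaling_carr, symmetric]) (simp_all add: scaling_mult)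

lemma scaling_smult: "v \<in> carr n \<Longrightarrow> scaling (\<lambda>i. c * h i) *\<^sub>v v = c \<cdot>\<^sub>v (scaling h *\<^sub>v v)"
proof -
 assume v: "v \<in> carr n"
 have "vec (Suc n) (\<lambda>i. c * h i * (Q *\<^sub>v v) $ i) = c \<cdot>\<^sub>v vec (Suc n) (\<lambda>i. h i * (Q *\<^sub>v v) $ i)" by (intro eq_vecI) auto
 then show ?thesis unfolding scaling_vec[OF v] by (simp add: mult_mat_vec[OF P])
qed

lemma scaling_add: "v \<in> carr n \<Longrightarrow> scaling (\<lambda>i. g i + h i) *\<^sub>v v = scaling g *\<^sub>v v + scaling h *\<^sub>v v"
proof -
 assume v: "v \<in> carr n"
 have "vec (Suc n) (\<lambda>i. (g i + h i) * (Q *\<^sub>v v) $ i) = vec (Suc n) (\<lambda>i. g i * (Q *\<^sub>v v) $ i) + vec (Suc n) (\<lambda>i. h i * (Q *\<^sub>v v) $ i)"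
  by (intro eq_vecI) (auto simp: algebra_simps)
 then show ?thesis unfolding scaling_vec[OF v] by (simp add: mult_add_distrib_mat_vec[OF P])
qed

lemma part_add: "v \<in> carr n \<Longrightarrow> part S *\<^sub>v v + part (- S) *\<^sub>v v = v"
proof -
 assume v: "v \<in> carr n"
 have "part S *\<^sub>v v + part (- S) *\<^sub>v v = scaling (\<lambda>i. indicator S i + indicator (- S) i) *\<^sub>v v"
  by (rule scaling_add[OF v, symmetric])
 also have "\<dots> = 1\<^sub>m (Suc n) *\<^sub>v v" by (subst scaling_one) (auto simp: indicator_def)
 finally show ?thesis using v by simp
qed

lemma splits_commute: "splits f S \<Longrightarrow> splits f (- S)"
 unfolding splits_def double_compl by (subst add.commute)

text \<open>A permutation of the coordinates turns the index set into an initial segment. The two summands are the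
 restrictions of \<open>f\<close> to the coordinate subspaces.\<close>

lemma splits_imp_sebastiani_thom:
 assumes f: "f \<in> polys n" and sp: "splits f S"
  and i0: "i0 \<le> n" "i0 \<in> S" and i1: "i1 \<le> n" "i1 \<notin> S"
 shows "sebastiani_thom n f"
proof -
 define T where "T = S \<inter> {..n}"
 have T: "T \<subset> {..n}" "T \<noteq> {}" using i0 i1 by (auto simp: T_def)
 define l where "l = card T - 1"
 have cT: "card T = Suc l" using T finite_subset[of T "{..n}"] by (auto simp: l_def card_gt_0_iff)
 have l: "l < n" using psubset_card_mono[OF _ T(1)] cT by simp
 have "card {..l} = card T" using cT by simp
 then obtain \<sigma>1 where s1: "bij_betw \<sigma>1 {..l} T"
  using finite_same_card_bij[of "{..l}" T] T(1) finite_subset by blast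
 have "card {Suc l..n} = card ({..n} - T)" using card_Diff_subset[of T "{..n}"] T(1) finite_subset[of T] cT by auto
 then obtain \<sigma>2 where s2: "bij_betw \<sigma>2 {Suc l..n} ({..n} - T)"
  using finite_same_card_bij[of "{Suc l..n}" "{..n} - T"] by auto
 define \<sigma> where "\<sigma> i = (if i \<le> l then \<sigma>1 i else \<sigma>2 i)" for i
 have b1: "bij_betw \<sigma> {..l} T" using s1 by (subst bij_betw_cong[of _ _ \<sigma>1]) (auto simp: \<sigma>_def)
 have b2: "bij_betw \<sigma> {Suc l..n} ({..n} - T)" using s2 by (subst bij_betw_cong[of _ _ \<sigma>2]) (auto simp: \<sigma>_def)
 have "bij_betw \<sigma> ({..l} \<union> {Suc l..n}) (T \<union> ({..n} - T))" by (rule bij_betw_combine[OF b1 b2]) auto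
 moreover have "{..l} \<union> {Suc l..n} = {..n}" "T \<union> ({..n} - T) = {..n}" using l T(1) by auto
 ultimately have b: "bij_betw \<sigma> {..n} {..n}" by simp
 have \<sigma>n: "\<sigma> i \<le> n" if "i \<le> n" for i using bij_betwE[OF b] that by auto
 define A where "A = mat (Suc n) (Suc n) (\<lambda>(i, j). Q $$ (\<sigma> i, j))"
 define B where "B = mat (Suc n) (Suc n) (\<lambda>(i, j). P $$ (i, \<sigma> j))"
 have A: "A \<in> carrier_mat (Suc n) (Suc n)" and B: "B \<in> carrier_mat (Suc n) (Suc n)" by (simp_all add: A_def B_def)
 have ent: "(\<Sum>t\<le>n. X $$ (i, t) * Y $$ (t, j)) = (X * Y) $$ (i, j)"
  if "X \<in> carrier_mat (Suc n) (Suc n)" "Y \<in> carrier_mat (Suc n) (Suc n)" "i \<le> n" "j \<le> n" for X Y :: "complex mat" and i j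
 proof -
  have c: "col Y j \<in> carr n" by (rule carrier_vecI) (use carrier_matD(1)[OF that(2)] in simp)
  have "(X * Y) $$ (i, j) = row X i \<bullet> col Y j"
   using that(3,4) carrier_matD[OF that(1)] carrier_matD[OF that(2)] by simp
  also have "\<dots> = (\<Sum>t\<le>n. row X i $ t * col Y j $ t)" by (rule dot_sum[OF c])
  also have "\<dots> = (\<Sum>t\<le>n. X $$ (i, t) * Y $$ (t, j))"
   by (rule sum.cong[OF refl]) (use that(3,4) carrier_matD[OF that(1)] carrier_matD[OF that(2)] in simp)
  finally show ?thesis by simp
 qed
 have AB: "A * B = 1\<^sub>m (Suc n)"
 proof (rule eq_matI)
  fix i j assume "i < dim_row (1\<^sub>m (Suc n) :: complex mat)" "j < dim_col (1\<^sub>m (Suc n) :: complex mat)"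
  then have i: "i \<le> n" and j: "j \<le> n" by auto
  have "(A * B) $$ (i, j) = (\<Sum>t\<le>n. Q $$ (\<sigma> i, t) * P $$ (t, \<sigma> j))"
   unfolding ent[OF A B i j, symmetric] using i j by (intro sum.cong) (auto simp: A_def B_def)
  also have "\<dots> = (if \<sigma> i = \<sigma> j then 1 else 0)" unfolding ent[OF Q P \<sigma>n[OF i] \<sigma>n[OF j]] QP
   using le_imp_less_Suc[OF \<sigma>n[OF i]] le_imp_less_Suc[OF \<sigma>n[OF j]] by simp
  also have "\<sigma> i = \<sigma> j \<longleftrightarrow> i = j" using inj_on_eq_iff[OF bij_betw_imp_inj_on[OF b], of i j] i j by simp
  finally show "(A * B) $$ (i, j) = 1\<^sub>m (Suc n) $$ (i, j)" using i j by simp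
 qed (use A B in auto)
 have BA: "B * A = 1\<^sub>m (Suc n)"
 proof (rule eq_matI)
  fix i j assume "i < dim_row (1\<^sub>m (Suc n) :: complex mat)" "j < dim_col (1\<^sub>m (Suc n) :: complex mat)"
  then have i: "i \<le> n" and j: "j \<le> n" by auto
  have "(B * A) $$ (i, j) = (\<Sum>t\<le>n. P $$ (i, \<sigma> t) * Q $$ (\<sigma> t, j))"
   unfolding ent[OF B A i j, symmetric] using i j by (intro sum.cong) (auto simp: A_def B_def)
  also have "\<dots> = (\<Sum>t\<le>n. P $$ (i, t) * Q $$ (t, j))" by (rule sum.reindex_bij_betw[OF b])
  finally show "(B * A) $$ (i, j) = 1\<^sub>m (Suc n) $$ (i, j)" unfolding ent[OF P Q i j] PQ .
 qed (use A B in auto)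
 have inv: "invertible_mat A"
  unfolding invertible_mat_def inverts_mat_def using A B AB BA by (auto intro!: exI[of _ B] simp: square_mat.simps)
 have Av: "(A *\<^sub>v v) $ j = (Q *\<^sub>v v) $ \<sigma> j" if "j \<le> n" "v \<in> carr n" for j v
 proof -
  have "row A j = row Q (\<sigma> j)"
   using that(1) \<sigma>n[OF that(1)] Q by (intro eq_vecI) (auto simp: A_def)
  then show ?thesis using that(1) \<sigma>n[OF that(1)] A Q by simp
 qed
 have pt: "\<exists>p. poly_vars p \<subseteq> I \<and> (\<forall>v\<in>carr n. ev p (A *\<^sub>v v) = ev f (part R *\<^sub>v v))"
  if I: "I \<subseteq> {..n}" "bij_betw \<sigma> I (R \<inter> {..n})" for I R
 proof -
  define L where "L i = (\<Sum>j\<in>I. Const (P $$ (i, \<sigma> j)) * Var j)" for i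
  obtain p where p: "poly_vars p \<subseteq> I" "\<And>v. ev p v = ev f (vec (Suc n) (\<lambda>i. ev (L i) v))"
  proof -
   have "poly_vars (L i) \<subseteq> I" if "i \<le> n" for i unfolding L_def by (rule poly_vars_linear)
   from substitution_vars[where L = L and S = I, OF f this] show ?thesis using that by blast
  qed
  have "ev p (A *\<^sub>v v) = ev f (part R *\<^sub>v v)" if v: "v \<in> carr n" for v
  proof -
   have "vec (Suc n) (\<lambda>i. ev (L i) (A *\<^sub>v v)) = part R *\<^sub>v v"
   proof (rule eq_vecI)
    fix i assume "i < dim_vec (part R *\<^sub>v v)"
    then have i: "i \<le> n" unfolding carrier_vecD[OF scaling_vec_carr[OF v]] by simp
    have "ev (L i) (A *\<^sub>v v) = (\<Sum>j\<in>I. P $$ (i, \<sigma> j) * (Q *\<^sub>v v) $ \<sigma> j)"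
    proof -
     have "ev (L i) (A *\<^sub>v v) = (\<Sum>j\<in>I. P $$ (i, \<sigma> j) * (A *\<^sub>v v) $ j)" by (simp add: L_def)
     also have "\<dots> = (\<Sum>j\<in>I. P $$ (i, \<sigma> j) * (Q *\<^sub>v v) $ \<sigma> j)"
      by (rule sum.cong[OF refl], subst Av[OF _ v]) (use I(1) in auto)
     finally show ?thesis .
    qed
    also have "\<dots> = (\<Sum>j\<in>R \<inter> {..n}. P $$ (i, j) * (Q *\<^sub>v v) $ j)" by (rule sum.reindex_bij_betw[OF I(2)])
    also have "\<dots> = (\<Sum>j\<le>n. P $$ (i, j) * (indicator R j * (Q *\<^sub>v v) $ j))"
     by (rule sum.mono_neutral_cong_left) (auto simp: indicator_def)
    also have "\<dots> = (part R *\<^sub>v v) $ i"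
    proof -
     let ?z = "vec (Suc n) (\<lambda>j. indicator R j * (Q *\<^sub>v v) $ j)"
     have "(part R *\<^sub>v v) $ i = row P i \<bullet> ?z" unfolding scaling_vec[OF v] using i P by simp
     also have "\<dots> = (\<Sum>j\<le>n. row P i $ j * ?z $ j)" by (rule dot_sum) simp
     also have "\<dots> = (\<Sum>j\<le>n. P $$ (i, j) * (indicator R j * (Q *\<^sub>v v) $ j))"
      by (rule sum.cong[OF refl]) (use i carrier_matD[OF P] in simp)
     finally show ?thesis ..
    qed
    finally show "vec (Suc n) (\<lambda>i. ev (L i) (A *\<^sub>v v)) $ i = (part R *\<^sub>v v) $ i" using i by simp
   qed (simp add: carrier_matD(1)[OF scaling_carr])
   then show ?thesis using p(2) by simp
  qed
  with p(1) show ?thesis by blast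
 qed
 obtain f1 where f1: "poly_vars f1 \<subseteq> {0..l}" "\<And>v. v \<in> carr n \<Longrightarrow> ev f1 (A *\<^sub>v v) = ev f (part S *\<^sub>v v)"
 proof -
  have "{..l} \<subseteq> {..n}" using l by auto
  from pt[OF this b1[unfolded T_def]] show ?thesis using that unfolding atLeast0AtMost by blast
 qed
 have "- S \<inter> {..n} = {..n} - T" by (auto simp: T_def)
 then obtain f2 where f2: "poly_vars f2 \<subseteq> {Suc l..n}" "\<And>v. v \<in> carr n \<Longrightarrow> ev f2 (A *\<^sub>v v) = ev f (part (- S) *\<^sub>v v)"
 proof -
  assume e: "- S \<inter> {..n} = {..n} - T"
  have "{Suc l..n} \<subseteq> {..n}" by auto
  from pt[OF this b2[folded e]] show ?thesis using that by blast
 qed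
 have "ev f v = ev f1 (A *\<^sub>v v) + ev f2 (A *\<^sub>v v)" if "v \<in> carr n" for v
  unfolding f1(2)[OF that] f2(2)[OF that] using sp that unfolding splits_def by blast
 then show ?thesis unfolding sebastiani_thom_def using A inv l f1(1) f2(1) by blast
qed

end

text \<open>Each summand in the definition is constant on the opposite coordinate subspace, and the two constants
 cancel since \<open>f\<close> vanishes at the origin.\<close>

lemma sebastiani_thom_splits:
 assumes st: "sebastiani_thom n f" and hom: "homogeneous n k f" and k: "k \<ge> 1"
 obtains P Q l where "coordinates n P Q" "l < n" "coordinates.splits n P Q f {..l}"
proof -
 obtain A l f1 f2 where A: "A \<in> carrier_mat (Suc n) (Suc n)" "invertible_mat A" and l: "l < n"
  and f1: "poly_vars f1 \<subseteq> {0..l}" and f2: "poly_vars f2 \<subseteq> {Suc l..n}"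
  and f: "\<And>v. v \<in> carr n \<Longrightarrow> ev f v = ev f1 (A *\<^sub>v v) + ev f2 (A *\<^sub>v v)"
  using st unfolding sebastiani_thom_def by blast
 obtain B where B: "A * B = 1\<^sub>m (Suc n)" "B * A = 1\<^sub>m (dim_row B)"
  using A unfolding invertible_mat_def inverts_mat_def by auto
 have dB: "B \<in> carrier_mat (Suc n) (Suc n)"
 proof -
  have "dim_col (A * B) = Suc n" "dim_col (B * A) = dim_row B" using B by auto
  then show ?thesis using A(1) by auto
 qed
 then have co: "coordinates n B A" using A(1) B by unfold_locales auto
 interpret coordinates n B A by (rule co)
 have z: "zvec n \<in> carr n" by simp
 have f0: "ev f1 (zvec n) + ev f2 (zvec n) = 0"
 proof -
  have "ev f (0 \<cdot>\<^sub>v zvec n) = 0" using homogeneous_eval[OF hom z, of 0] k by simp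
  moreover have "0 \<cdot>\<^sub>v zvec n = (zvec n :: complex vec)" by (intro eq_vecI) auto
  moreover have "A *\<^sub>v zvec n = zvec n" using A(1) by (intro eq_vecI) auto
  ultimately show ?thesis using f[OF z] by simp
 qed
 have pv: "ev f (part S *\<^sub>v v) = ev f1 (vec (Suc n) (\<lambda>i. indicator S i * (A *\<^sub>v v) $ i)) + ev f2 (vec (Suc n) (\<lambda>i. indicator S i * (A *\<^sub>v v) $ i))"
  if v: "v \<in> carr n" for S v
  unfolding f[OF scaling_vec_carr[OF v]] unfolding scaling_vec[OF v] by (simp add: QP_vec)
 have "splits f {..l}" unfolding splits_def
 proof
  fix v :: "complex vec" assume v: "v \<in> carr n"
  let ?X = "\<lambda>S. vec (Suc n) (\<lambda>i. indicator S i * (A *\<^sub>v v) $ i)"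
  have in1: "i \<le> l" "i \<le> n" if "i \<in> poly_vars f1" for i using subsetD[OF f1 that] l by auto
  have in2: "\<not> i \<le> l" "i \<le> n" if "i \<in> poly_vars f2" for i using subsetD[OF f2 that] by auto
  have X: "?X {..l} $ i = (if i \<le> l then (A *\<^sub>v v) $ i else 0)" "?X (- {..l}) $ i = (if i \<le> l then 0 else (A *\<^sub>v v) $ i)"
   if "i \<le> n" for i using that by (simp_all add: indicator_def)
  have "ev f1 (?X {..l}) = ev f1 (A *\<^sub>v v)"
  proof (rule poly_eval_cong_vars)
   fix i assume i: "i \<in> poly_vars f1"
   show "?X {..l} $ i = (A *\<^sub>v v) $ i" unfolding X(1)[OF in1(2)[OF i]] using in1[OF i] by simp
  qed
  moreover have "ev f1 (?X (- {..l})) = ev f1 (zvec n)"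
  proof (rule poly_eval_cong_vars)
   fix i assume i: "i \<in> poly_vars f1"
   show "?X (- {..l}) $ i = (zvec n) $ i" unfolding X(2)[OF in1(2)[OF i]] using in1[OF i] by simp
  qed
  moreover have "ev f2 (?X {..l}) = ev f2 (zvec n)"
  proof (rule poly_eval_cong_vars)
   fix i assume i: "i \<in> poly_vars f2"
   show "?X {..l} $ i = (zvec n) $ i" unfolding X(1)[OF in2(2)[OF i]] using in2[OF i] by simp
  qed
  moreover have "ev f2 (?X (- {..l})) = ev f2 (A *\<^sub>v v)"
  proof (rule poly_eval_cong_vars)
   fix i assume i: "i \<in> poly_vars f2"
   show "?X (- {..l}) $ i = (A *\<^sub>v v) $ i" unfolding X(2)[OF in2(2)[OF i]] using in2[OF i] by simp
  qed
  ultimately show "ev f v = ev f (part {..l} *\<^sub>v v) + ev f (part (- {..l}) *\<^sub>v v)"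
   unfolding pv[OF v] unfolding f[OF v] using f0 by (simp only:) (metis add.assoc add.commute add.right_neutral)
 qed
 then show ?thesis using that[OF co l] by simp
qed

section \<open>From a splitting to a second divisor\<close>

lemma complex_root_exists:
 assumes "k \<ge> 1" obtains w :: complex where "w ^ k = z"
proof
 have "rcis (root k (cmod z)) (Arg z / of_nat k) ^ k = rcis (root k (cmod z) ^ k) (of_nat k * (Arg z / of_nat k))"
  by (rule DeMoivre2)
 also have "\<dots> = z" using assms by (simp add: rcis_cmod_Arg)
 finally show "rcis (root k (cmod z)) (Arg z / of_nat k) ^ k = z" .
qed

lemma mat_mult_zero_vec: "M \<in> carrier_mat m n \<Longrightarrow> M *\<^sub>v 0\<^sub>v n = (0\<^sub>v m :: complex vec)"
 by (intro eq_vecI) auto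

context coordinates begin

lemma splitsD: "splits f S \<Longrightarrow> v \<in> carr n \<Longrightarrow>
  ev f v = ev f (part S *\<^sub>v v) + ev f (part (- S) *\<^sub>v v)"
 unfolding splits_def by (erule bspec)

lemma splits_gradient:
 assumes "f \<in> polys n" "splits f S" "v \<in> carr n" "w \<in> carr n"
 shows "grad n f v \<bullet> w = grad n f (part S *\<^sub>v v) \<bullet> (part S *\<^sub>v w) + grad n f (part (- S) *\<^sub>v v) \<bullet> (part (- S) *\<^sub>v w)"
proof (rule gradient_eqI[OF assms(1,3,4)])
 have "ev f (v + t \<cdot>\<^sub>v w) = ev f (part S *\<^sub>v (v + t \<cdot>\<^sub>v w)) + ev f (part (- S) *\<^sub>v (v + t \<cdot>\<^sub>v w))" for t
  by (rule splitsD[OF assms(2)]) (use assms in simp)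
 note eq = this
 show "((\<lambda>t. ev f (v + t \<cdot>\<^sub>v w)) has_field_derivative
   grad n f (part S *\<^sub>v v) \<bullet> (part S *\<^sub>v w) + grad n f (part (- S) *\<^sub>v v) \<bullet> (part (- S) *\<^sub>v w)) (at 0)"
  unfolding eq by (rule DERIV_add[OF gradient_composite[OF assms(1) scaling_carr assms(3,4)] gradient_composite[OF assms(1) scaling_carr assms(3,4)]])
qed

lemma part_unit:
 assumes "i \<le> n"
 shows "part S *\<^sub>v (P *\<^sub>v unit_vec (Suc n) i) = (indicator S i :: complex) \<cdot>\<^sub>v (P *\<^sub>v unit_vec (Suc n) i)"
proof -
 have "vec (Suc n) (\<lambda>j. indicator S j * unit_vec (Suc n) i $ j) = (indicator S i :: complex) \<cdot>\<^sub>v unit_vec (Suc n) i"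
  using assms by (intro eq_vecI) (auto simp: unit_vec_def)
 then show ?thesis
  by (subst scaling_vec) (simp_all add: QP_vec mult_mat_vec_carrier[OF P] mult_mat_vec[OF P])
qed

lemma frame_vec_nonzero:
 assumes "i \<le> n" shows "P *\<^sub>v unit_vec (Suc n) i \<noteq> zvec n"
proof
 assume "P *\<^sub>v unit_vec (Suc n) i = zvec n"
 then have "Q *\<^sub>v (P *\<^sub>v unit_vec (Suc n) i) = Q *\<^sub>v zvec n" by simp
 also have "\<dots> = zvec n" using Q by (intro eq_vecI) auto
 finally have "unit_vec (Suc n) i = (zvec n :: complex vec)" by (simp add: QP_vec)
 then have "unit_vec (Suc n) i $ i = (zvec n :: complex vec) $ i" by simp
 then show False using assms by simp
qed

text \<open>Otherwise \<open>f\<close> does not depend on the coordinates from \<open>S\<close>, so it is the equation of a cone.\<close>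

lemma part_nonzero:
 assumes f: "smooth_form n k f" and k: "k \<ge> 2" and sp: "splits f S" and i: "i \<le> n" "i \<in> S"
 obtains x where "x \<in> carr n" "ev f (part S *\<^sub>v x) \<noteq> 0"
proof (rule ccontr)
 assume "\<not> thesis"
 then have z: "ev f (part S *\<^sub>v x) = 0" if "x \<in> carr n" for x using \<open>\<And>x. x \<in> carr n \<Longrightarrow> ev f (part S *\<^sub>v x) \<noteq> 0 \<Longrightarrow> thesis\<close> that by blast
 interpret F: smooth_form n k f by (rule f)
 define u where "u = P *\<^sub>v unit_vec (Suc n) i"
 have u: "u \<in> carr n" unfolding u_def by (rule mult_mat_vec_carrier[OF P]) simp
 have Eu: "part (- S) *\<^sub>v u = 0 \<cdot>\<^sub>v u" unfolding u_def part_unit[OF i(1)] using i(2) by simp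
 have "grad n f v \<bullet> u = 0" if v: "v \<in> carr n" for v
 proof (rule gradient_eqI[OF F.fp v u])
  have "ev f (v + t \<cdot>\<^sub>v u) = ev f (part (- S) *\<^sub>v v)" for t
  proof -
   have "ev f (v + t \<cdot>\<^sub>v u) = ev f (part (- S) *\<^sub>v (v + t \<cdot>\<^sub>v u))"
   proof -
    have c: "v + t \<cdot>\<^sub>v u \<in> carr n" using v u by simp
    show ?thesis using splitsD[OF sp c] unfolding z[OF c] by (simp only: add_0)
   qed
   also have "part (- S) *\<^sub>v (v + t \<cdot>\<^sub>v u) = part (- S) *\<^sub>v v"
    unfolding line_image[OF scaling_carr v u] Eu using carrier_vecD[OF u] carrier_vecD[OF scaling_vec_carr[OF v, of "indicator (- S)"]]
    by (intro eq_vecI) (auto simp del: index_mult_mat_vec)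
   finally show ?thesis .
  qed
  note eq = this
  show "((\<lambda>t. ev f (v + t \<cdot>\<^sub>v u)) has_field_derivative 0) (at 0)" unfolding eq by (rule DERIV_const)
 qed
 then have "(\<Sum>j\<le>n. Const (u $ j) * poly_partial j f) = 0"
  using u by (intro polys_eq_0I[where n = n] polys_sum polys_mult polys_Const polys_partial F.fp)
   (simp add: grad_dot)
 from F.not_cone[OF k u this] show False using frame_vec_nonzero[OF i(1)] unfolding u_def by simp
qed

lemma part_part:
 assumes "v \<in> carr n"
 shows "part S *\<^sub>v (scaling h *\<^sub>v v) = scaling (\<lambda>i. indicator S i * h i) *\<^sub>v v"
 by (rule scaling_mult_vec[OF assms])

text \<open>Doubling one summand changes the zero set but multiplies the gradient by an invertible constant matrix. The
 resulting form is a linear substitution of \<open>f\<close>, so it is nonsingular as well.\<close>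

lemma splits_not_torelli:
 assumes f: "smooth_form n k f" and k: "k \<ge> 2" and sp: "splits f S"
  and i0: "i0 \<le> n" "i0 \<in> S" and i1: "i1 \<le> n" "i1 \<notin> S"
 shows "\<not> torelli n (proj_zeros n f)"
proof -
 interpret F: smooth_form n k f by (rule f)
 have "k \<ge> 1" using k by simp
 then obtain \<mu> :: complex where \<mu>: "\<mu> ^ k = 2" by (rule complex_root_exists)
 then have \<mu>0: "\<mu> \<noteq> 0" using k by (auto simp: power_0_left)
 define m where "m c = (\<lambda>i. if i \<in> S then 1 else c :: complex)" for c
 have m1: "indicator S i * m c i = indicator S i" "indicator (- S) i * m c i = c * indicator (- S) i" for c i
  by (auto simp: m_def indicator_def)
 have pm: "part S *\<^sub>v (scaling (m c) *\<^sub>v v) = part S *\<^sub>v v" "part (- S) *\<^sub>v (scaling (m c) *\<^sub>v v) = c \<cdot>\<^sub>v (part (- S) *\<^sub>v v)"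
  if "v \<in> carr n" for c v
  unfolding part_part[OF that] m1 by (simp_all add: scaling_smult[OF that])
 have mm: "scaling (m c) * scaling (m d) = 1\<^sub>m (Suc n)" if "c * d = 1" for c d
  unfolding scaling_mult by (rule scaling_one) (use that in \<open>simp add: m_def\<close>)
 \<comment> \<open>Scaling the second part by a k-th root of 2 doubles the second summand.\<close>
 define M where "M = scaling (m \<mu>)"
 have M: "M \<in> carrier_mat (Suc n) (Suc n)" by (simp add: M_def)
 obtain g where g: "homogeneous n k g" "\<And>v. v \<in> carr n \<Longrightarrow> ev g v = ev f (M *\<^sub>v v)"
  and gg: "\<And>v w. v \<in> carr n \<Longrightarrow> w \<in> carr n \<Longrightarrow> grad n g v \<bullet> w = grad n f (M *\<^sub>v v) \<bullet> (M *\<^sub>v w)"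
  using linear_substitution[OF F.hom M] by blast
 have gp: "g \<in> polys n" by (rule homogeneous_polys[OF g(1)])
 have gv: "ev g v = ev f (part S *\<^sub>v v) + 2 * ev f (part (- S) *\<^sub>v v)" if v: "v \<in> carr n" for v
 proof -
  have "ev g v = ev f (part S *\<^sub>v (M *\<^sub>v v)) + ev f (part (- S) *\<^sub>v (M *\<^sub>v v))"
   unfolding g(2)[OF v] by (rule splitsD[OF sp mult_mat_vec_carrier[OF M v]])
  then show ?thesis unfolding M_def pm[OF v] using homogeneous_eval[OF F.hom, of "part (- S) *\<^sub>v v" \<mu>] v \<mu> by simp
 qed
 have "nonsingular n g" unfolding nonsingular_def
 proof (intro ballI impI, rule ccontr)
  fix v assume v: "v \<in> carr n - {zvec n}" and no: "\<not> (\<exists>i\<le>n. ev (poly_partial i g) v \<noteq> 0)"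
  have v': "v \<in> carr n" using v by simp
  have gz: "grad n g v \<bullet> w = 0" if "w \<in> carr n" for w unfolding grad_dot[OF that] using no by (intro sum.neutral) auto
  let ?N = "scaling (m (1 / \<mu>))"
  have NM: "?N *\<^sub>v (M *\<^sub>v w) = w" "M *\<^sub>v (?N *\<^sub>v w) = w" if "w \<in> carr n" for w
   using assoc_mult_mat_vec[OF scaling_carr M that, of "m (1 / \<mu>)"] assoc_mult_mat_vec[OF M scaling_carr that, of "m (1 / \<mu>)"]
    mm[of "1 / \<mu>" \<mu>] mm[of \<mu> "1 / \<mu>"] \<mu>0 that unfolding M_def by simp_all
  have Mv: "M *\<^sub>v v \<in> carr n" by (rule mult_mat_vec_carrier[OF M v'])
  have "M *\<^sub>v v \<noteq> zvec n"
  proof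
   assume "M *\<^sub>v v = zvec n"
   then have "v = ?N *\<^sub>v zvec n" using NM(1)[OF v'] by simp
   also have "\<dots> = zvec n" by (rule mat_mult_zero_vec[OF scaling_carr])
   finally show False using v by simp
  qed
  then obtain j where j: "j \<le> n" "ev (poly_partial j f) (M *\<^sub>v v) \<noteq> 0" using F.gradient_nonzero[OF Mv] by blast
  have "grad n f (M *\<^sub>v v) \<bullet> unit_vec (Suc n) j = 0"
   using gg[OF v', of "?N *\<^sub>v unit_vec (Suc n) j"] gz[of "?N *\<^sub>v unit_vec (Suc n) j"] NM(2)[of "unit_vec (Suc n) j"] by simp
  then show False using j by simp
 qed
 then have G: "smooth_form n k g" using F.n F.k g(1) by unfold_locales auto
 have "log_sheaf_iso n (proj_zeros n g) (proj_zeros n f)"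
 proof (rule sheaf_iso_of_linear_gradient[OF G f, of "scaling (m 2)" "scaling (m (1 / 2))"])
  fix v w assume v: "v \<in> carr n" and w: "w \<in> carr n"
  have "grad n g v \<bullet> w = grad n f (part S *\<^sub>v v) \<bullet> (part S *\<^sub>v w) + 2 * (grad n f (part (- S) *\<^sub>v v) \<bullet> (part (- S) *\<^sub>v w))"
  proof (rule gradient_eqI[OF gp v w])
   have "ev g (v + t \<cdot>\<^sub>v w) = ev f (part S *\<^sub>v (v + t \<cdot>\<^sub>v w)) + 2 * ev f (part (- S) *\<^sub>v (v + t \<cdot>\<^sub>v w))" for t
    by (rule gv) (use v w in simp)
   note eq = this
   show "((\<lambda>t. ev g (v + t \<cdot>\<^sub>v w)) has_field_derivative
     grad n f (part S *\<^sub>v v) \<bullet> (part S *\<^sub>v w) + 2 * (grad n f (part (- S) *\<^sub>v v) \<bullet> (part (- S) *\<^sub>v w))) (at 0)"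
    unfolding eq by (rule DERIV_add[OF gradient_composite[OF F.fp scaling_carr v w] DERIV_cmult[OF gradient_composite[OF F.fp scaling_carr v w]]])
  qed
  moreover have "grad n f v \<bullet> (scaling (m 2) *\<^sub>v w) =
    grad n f (part S *\<^sub>v v) \<bullet> (part S *\<^sub>v w) + grad n f (part (- S) *\<^sub>v v) \<bullet> (2 \<cdot>\<^sub>v (part (- S) *\<^sub>v w))"
   using splits_gradient[OF F.fp sp v scaling_vec_carr[OF w, of "m 2"]] unfolding pm[OF w] .
  moreover have "grad n f (part (- S) *\<^sub>v v) \<bullet> (2 \<cdot>\<^sub>v (part (- S) *\<^sub>v w)) = 2 * (grad n f (part (- S) *\<^sub>v v) \<bullet> (part (- S) *\<^sub>v w))"
   using scaling_vec_carr[OF w] by (intro scalar_prod_smult_right) (simp add: carrier_matD(1)[OF scaling_carr])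
  ultimately show "grad n f v \<bullet> (scaling (m 2) *\<^sub>v w) = grad n g v \<bullet> w" by simp
 qed (auto intro: mm)
 moreover have "smooth_divisor n (proj_zeros n g)"
  unfolding smooth_divisor_def smooth_divisor_of_def using G unfolding smooth_form_def by blast
 moreover have "proj_zeros n g \<noteq> proj_zeros n f"
 proof -
  obtain x where x: "x \<in> carr n" "ev f (part S *\<^sub>v x) \<noteq> 0" by (rule part_nonzero[OF f k sp i0])
  have "i1 \<in> - S" using i1 by simp
  then obtain y where y: "y \<in> carr n" "ev f (part (- S) *\<^sub>v y) \<noteq> 0" by (rule part_nonzero[OF f k splits_commute[OF sp] i1(1)])
  \<comment> \<open>At the sum of x and s y the two summands of f cancel, but those of g do not.\<close>
  obtain s where s: "s ^ k = - ev f (part S *\<^sub>v x) / ev f (part (- S) *\<^sub>v y)"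
   using complex_root_exists[OF F.k] by blast
  define v where "v = part S *\<^sub>v x + s \<cdot>\<^sub>v (part (- S) *\<^sub>v y)"
  have v: "v \<in> carr n" unfolding v_def using x y by simp
  have ii: "part S *\<^sub>v (part S *\<^sub>v x) = part S *\<^sub>v x" "part (- S) *\<^sub>v (part S *\<^sub>v x) = 0 \<cdot>\<^sub>v (part S *\<^sub>v x)" if "x \<in> carr n" for x S
  proof -
   have "indicator S i * indicator S i = (indicator S i :: complex)" "indicator (- S) i * indicator S i = (0 * indicator S i :: complex)" for i
    by (auto simp: indicator_def)
   then show "part S *\<^sub>v (part S *\<^sub>v x) = part S *\<^sub>v x" "part (- S) *\<^sub>v (part S *\<^sub>v x) = 0 \<cdot>\<^sub>v (part S *\<^sub>v x)"
    unfolding part_part[OF that] by (simp_all only: scaling_smult[OF that])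
  qed
  have c: "part S *\<^sub>v x \<in> carr n" "part (- S) *\<^sub>v y \<in> carr n" using x y by auto
  have Ev: "part S *\<^sub>v v = part S *\<^sub>v x" "part (- S) *\<^sub>v v = s \<cdot>\<^sub>v (part (- S) *\<^sub>v y)"
  proof -
   have "part S *\<^sub>v v = part S *\<^sub>v x + s \<cdot>\<^sub>v (0 \<cdot>\<^sub>v (part (- S) *\<^sub>v y))"
    unfolding v_def line_image[OF scaling_carr c] ii(1)[OF x(1)] using ii(2)[OF y(1), of "- S"] by simp
   then show "part S *\<^sub>v v = part S *\<^sub>v x" using carrier_vecD[OF c(1)] carrier_vecD[OF c(2)]
    by (intro eq_vecI) (auto simp del: index_mult_mat_vec)
   have "part (- S) *\<^sub>v v = 0 \<cdot>\<^sub>v (part S *\<^sub>v x) + s \<cdot>\<^sub>v (part (- S) *\<^sub>v y)"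
    unfolding v_def line_image[OF scaling_carr c] ii(2)[OF x(1)] ii(1)[OF y(1)] ..
   then show "part (- S) *\<^sub>v v = s \<cdot>\<^sub>v (part (- S) *\<^sub>v y)" using carrier_vecD[OF c(1)] carrier_vecD[OF c(2)]
    by (intro eq_vecI) (auto simp del: index_mult_mat_vec)
  qed
  have sy: "ev f (s \<cdot>\<^sub>v (part (- S) *\<^sub>v y)) = - ev f (part S *\<^sub>v x)"
   unfolding homogeneous_eval[OF F.hom c(2)] s using y(2) by simp
  have fv: "ev f v = 0" using splitsD[OF sp v] unfolding Ev sy by simp
  have gv0: "ev g v \<noteq> 0" unfolding gv[OF v] Ev sy using x(2) by simp
  have "v \<noteq> zvec n"
  proof
   assume "v = zvec n"
   then have "v = 0 \<cdot>\<^sub>v v" by (intro eq_vecI) auto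
   then have "ev g v = 0 ^ k * ev g v" using homogeneous_eval[OF g(1) v, of 0] by simp
   then show False using gv0 F.k by (simp add: power_0_left)
  qed
  then show ?thesis using proj_zeros_iff[OF F.hom v] proj_zeros_iff[OF g(1) v] fv gv0 by blast
 qed
 ultimately show ?thesis unfolding torelli_def by blast
qed

end

text \<open>The gradients of all linear forms are non-zero constants, so any two of them are related by an invertible
 matrix.\<close>

lemma hyperplane_not_torelli:
 assumes f: "smooth_form n 1 f" shows "\<not> torelli n (proj_zeros n f)"
proof -
 interpret F: smooth_form n 1 f by (rule f)
 have "\<exists>c. poly_partial i f = Const c" for i
  using homogeneous_0_const[of n "poly_partial i f"] homogeneous_poly_partial[OF F.hom, of i] by auto
 then obtain c where c: "\<And>i. poly_partial i f = Const (c i)" by metis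
 have fv: "ev f v = (\<Sum>i\<le>n. v $ i * c i)" if "v \<in> carr n" for v
  using euler_identity[OF F.hom that] unfolding grad_dot[OF that] c by simp
 have e0: "unit_vec (Suc n) 0 \<noteq> (zvec n :: complex vec)" by simp
 obtain i where i: "i \<le> n" "c i \<noteq> 0" using F.gradient_nonzero[OF unit_vec_carrier e0] unfolding c by auto
 obtain j where j: "j \<le> n" "j \<noteq> i"
 proof (cases "i = 0")
  case True then show ?thesis using that[of 1] F.n by simp
 next
  case False then show ?thesis using that[of 0] by simp
 qed
 \<comment> \<open>A shear of the coordinates takes one linear form to the other.\<close>
 define g where "g = f + Const (c i) * Var j"
 have g: "homogeneous n 1 g" unfolding g_def by (intro homogeneous_add F.hom homogeneous_Const_mult homogeneous_Var j)
 have gp: "g \<in> polys n" by (rule homogeneous_polys[OF g])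
 have gv: "ev g v = ev f v + c i * v $ j" for v by (simp add: g_def)
 have gg: "grad n g v \<bullet> w = grad n f v \<bullet> w + c i * w $ j" if v: "v \<in> carr n" and w: "w \<in> carr n" for v w
 proof (rule gradient_eqI[OF gp v w])
  have "((\<lambda>t. c i * (v $ j + t * w $ j)) has_field_derivative c i * w $ j) (at 0)"
   by (auto intro!: derivative_eq_intros)
  from DERIV_add[OF directional_derivative[OF F.fp v w, of 0] this]
  show "((\<lambda>t. ev g (v + t \<cdot>\<^sub>v w)) has_field_derivative grad n f v \<bullet> w + c i * w $ j) (at 0)"
   using j v w by (simp add: gv)
 qed
 let ?B = "\<lambda>a. addrow_mat (Suc n) a i j :: complex mat"
 have B: "?B a *\<^sub>v w = w + (a * w $ j) \<cdot>\<^sub>v unit_vec (Suc n) i" if w: "w \<in> carr n" for a w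
 proof (rule eq_vecI)
  fix r assume "r < dim_vec (w + (a * w $ j) \<cdot>\<^sub>v unit_vec (Suc n) i)"
  then have r: "r \<le> n" by simp
  have "(?B a *\<^sub>v w) $ r = row (?B a) r \<bullet> w" using r by (simp add: addrow_mat_def)
  also have "\<dots> = (\<Sum>t\<le>n. row (?B a) r $ t * w $ t)" by (rule dot_sum[OF w])
  also have "\<dots> = (\<Sum>t\<le>n. (if t = r then w $ t else 0) + (if t = j then (if r = i then a * w $ t else 0) else 0))"
   by (rule sum.cong[OF refl]) (use r j in \<open>auto simp: addrow_mat_def algebra_simps\<close>)
  also have "\<dots> = w $ r + (if r = i then a * w $ j else 0)" using r j by (simp add: sum.distrib)
  finally show "(?B a *\<^sub>v w) $ r = (w + (a * w $ j) \<cdot>\<^sub>v unit_vec (Suc n) i) $ r" using r w i by (auto simp: unit_vec_def)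
 qed (simp add: addrow_mat_def)
 have BB: "grad n f v \<bullet> (?B 1 *\<^sub>v w) = grad n g v \<bullet> w" if v: "v \<in> carr n" and w: "w \<in> carr n" for v w
 proof -
  have "grad n f v \<bullet> (w + (1 * w $ j) \<cdot>\<^sub>v unit_vec (Suc n) i) = grad n f v \<bullet> w + grad n f v \<bullet> ((1 * w $ j) \<cdot>\<^sub>v unit_vec (Suc n) i)"
   by (rule scalar_prod_add_distrib[OF grad_carr w]) simp
  also have "grad n f v \<bullet> ((1 * w $ j) \<cdot>\<^sub>v unit_vec (Suc n) i) = w $ j * c i" using i by (simp add: c)
  finally show ?thesis unfolding B[OF w] gg[OF v w] by (simp add: mult.commute)
 qed
 have "nonsingular n g" unfolding nonsingular_def
 proof (intro ballI impI exI conjI)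
  fix v assume v: "v \<in> carr n - {zvec n}"
  show "i \<le> n" by (rule i)
  have "grad n g v \<bullet> unit_vec (Suc n) i = grad n f v \<bullet> unit_vec (Suc n) i" using gg[of v "unit_vec (Suc n) i"] v j i by simp
  then show "ev (poly_partial i g) v \<noteq> 0" using i by (simp add: c)
 qed
 then have G: "smooth_form n 1 g" using F.n g by unfold_locales auto
 have ca: "?B a \<in> carrier_mat (Suc n) (Suc n)" for a by (simp add: addrow_mat_def)
 have ij: "i < Suc n" "j < Suc n" using i j by auto
 have "log_sheaf_iso n (proj_zeros n g) (proj_zeros n f)"
  using addrow_mat_inv[OF ij j(2)[symmetric], of 1] addrow_mat_inv[OF ij j(2)[symmetric], of "- 1"]
  by (intro sheaf_iso_of_linear_gradient[OF G f ca[of 1] ca[of "- 1"] _ _ BB]) simp_all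
 moreover have "smooth_divisor n (proj_zeros n g)"
  unfolding smooth_divisor_def smooth_divisor_of_def using G unfolding smooth_form_def by blast
 moreover have "proj_zeros n g \<noteq> proj_zeros n f"
 proof -
  define v where "v = vec (Suc n) (\<lambda>t. if t = j then c i else if t = i then - c j else 0)"
  have v: "v \<in> carr n" by (simp add: v_def)
  have vj: "v $ j = c i" using j by (simp add: v_def)
  have "v \<noteq> zvec n"
  proof
   assume "v = zvec n"
   then have "v $ j = 0" using j by simp
   then show False using vj i by simp
  qed
  moreover have "ev f v = 0"
  proof -
   have "ev f v = (\<Sum>t\<le>n. (if t = j then c i * c t else 0) - (if t = i then c j * c t else 0))"
    unfolding fv[OF v] by (rule sum.cong[OF refl]) (use j in \<open>auto simp: v_def\<close>)
   also have "\<dots> = 0" using i j by (simp add: sum_subtractf)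
   finally show ?thesis .
  qed
  moreover from this have "ev g v \<noteq> 0" unfolding gv vj using i by simp
  ultimately show ?thesis using proj_zeros_iff[OF F.hom v] proj_zeros_iff[OF g v] by blast
 qed
 ultimately show ?thesis unfolding torelli_def by blast
qed

lemma sebastiani_thom_not_torelli:
 assumes f: "smooth_form n k f" and st: "sebastiani_thom n f"
 shows "\<not> torelli n (proj_zeros n f)"
proof (cases "k = 1")
 case True
 then show ?thesis using hyperplane_not_torelli f by simp
next
 case False
 interpret F: smooth_form n k f by (rule f)
 obtain P Q l where l: "coordinates n P Q" "l < n" "coordinates.splits n P Q f {..l}"
  by (rule sebastiani_thom_splits[OF st F.hom F.k])
 show ?thesis
  by (rule coordinates.splits_not_torelli[OF l(1) f _ l(3), of 0 n]) (use False F.k l(2) in auto)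
qed

section \<open>The Hessian form\<close>

definition hess :: "nat \<Rightarrow> cpoly \<Rightarrow> complex vec \<Rightarrow> complex vec \<Rightarrow> complex vec \<Rightarrow> complex" where
 "hess n f v x y = (\<Sum>i\<le>n. x $ i * (\<Sum>j\<le>n. y $ j * ev (poly_partial i (poly_partial j f)) v))"

lemma hess_commute: "hess n f v x y = hess n f v y x"
proof -
 have "hess n f v x y = (\<Sum>i\<le>n. \<Sum>j\<le>n. x $ i * (y $ j * ev (poly_partial i (poly_partial j f)) v))"
  unfolding hess_def sum_distrib_left ..
 also have "\<dots> = (\<Sum>j\<le>n. \<Sum>i\<le>n. x $ i * (y $ j * ev (poly_partial i (poly_partial j f)) v))" by (rule sum.swap)
 also have "\<dots> = hess n f v y x" unfolding hess_def sum_distrib_left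
  by (rule sum.cong[OF refl], rule sum.cong[OF refl]) (simp only: mult.left_commute poly_partial_commute)
 finally show ?thesis .
qed

lemma hess_smult_left: "x \<in> carr n \<Longrightarrow> hess n f v (c \<cdot>\<^sub>v x) y = c * hess n f v x y"
 unfolding hess_def sum_distrib_left by (rule sum.cong[OF refl]) (simp add: sum_distrib_left mult.assoc)

lemma hess_smult_right: "x \<in> carr n \<Longrightarrow> hess n f v y (c \<cdot>\<^sub>v x) = c * hess n f v y x"
 using hess_smult_left[of x n f v c y] by (simp only: hess_commute[of n f v y])

text \<open>The Hessian form is the derivative of the gradient. Facts about gradients of two polynomials are compared
 through it.\<close>

lemma gradient_line_derivative:
 assumes f: "f \<in> polys n" and c: "v \<in> carr n" "w \<in> carr n" "u \<in> carr n"
 shows "((\<lambda>t. grad n f (v + t \<cdot>\<^sub>v u) \<bullet> w) has_field_derivative hess n f (v + s \<cdot>\<^sub>v u) w u) (at s)"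
proof -
 have "((\<lambda>t. \<Sum>i\<le>n. w $ i * ev (poly_partial i f) (v + t \<cdot>\<^sub>v u)) has_field_derivative
   (\<Sum>i\<le>n. w $ i * (grad n (poly_partial i f) (v + s \<cdot>\<^sub>v u) \<bullet> u))) (at s)"
  by (intro DERIV_sum DERIV_cmult directional_derivative polys_partial f c)
 moreover have "(\<Sum>i\<le>n. w $ i * (grad n (poly_partial i f) (v + s \<cdot>\<^sub>v u) \<bullet> u)) = hess n f (v + s \<cdot>\<^sub>v u) w u"
  unfolding hess_def grad_dot[OF c(3)] by (simp only: poly_partial_commute)
 ultimately show ?thesis unfolding grad_dot[OF c(2)] by simp
qed

lemma constant_of_derivative_0:
 assumes "\<And>t. (\<phi> has_field_derivative 0) (at t)" shows "\<phi> t = \<phi> (0 :: complex)"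
proof -
 have d: "((\<lambda>s. \<phi> (of_real s * t)) has_derivative (\<lambda>h. 0)) (at s)" for s :: real
 proof -
  have "((\<lambda>s. of_real s * t) has_derivative (\<lambda>h. of_real h * t)) (at s)"
   by (auto intro!: derivative_eq_intros)
  moreover have "(\<phi> has_derivative (\<lambda>h. 0)) (at (of_real s * t))"
   using assms[of "of_real s * t"] unfolding has_field_derivative_def mult_zero_left .
  ultimately show ?thesis by (rule has_derivative_compose)
 qed
 have "\<forall>s. ((\<lambda>s. Re (\<phi> (of_real s * t))) has_real_derivative 0) (at s)"
  "\<forall>s. ((\<lambda>s. Im (\<phi> (of_real s * t))) has_real_derivative 0) (at s)"
  using has_derivative_Re[OF d] has_derivative_Im[OF d] unfolding has_field_derivative_def mult_zero_left by simp_all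
 from DERIV_isconst_all[OF this(1), of 1 0] DERIV_isconst_all[OF this(2), of 1 0]
 show ?thesis by (simp add: complex_eq_iff)
qed

lemma gradient_constant_along:
 assumes f: "f \<in> polys n" and c: "v \<in> carr n" "w \<in> carr n" "u \<in> carr n"
  and z: "\<And>v. v \<in> carr n \<Longrightarrow> hess n f v w u = 0"
 shows "grad n f (v + t \<cdot>\<^sub>v u) \<bullet> w = grad n f v \<bullet> w"
proof -
 have "((\<lambda>t. grad n f (v + t \<cdot>\<^sub>v u) \<bullet> w) has_field_derivative 0) (at s)" for s
  using gradient_line_derivative[OF f c, of s] z[of "v + s \<cdot>\<^sub>v u"] c by simp
 from constant_of_derivative_0[OF this, of t] show ?thesis using c by simp
qed

lemma line_add_1: "v \<in> carr n \<Longrightarrow> w \<in> carr n \<Longrightarrow> v + 1 \<cdot>\<^sub>v w = v + (w :: complex vec)"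
 by (intro eq_vecI) auto

text \<open>The mixed derivative of \<open>f(s x + t y)\<close> vanishes, so this function is a sum of a function of \<open>s\<close> and one
 of \<open>t\<close>.\<close>

lemma additive_if_hess_orthogonal:
 assumes f: "f \<in> polys n" and f0: "ev f (zvec n) = 0" and c: "x \<in> carr n" "y \<in> carr n"
  and z: "\<And>v. v \<in> carr n \<Longrightarrow> hess n f v y x = 0"
 shows "ev f (x + y) = ev f x + ev f y"
proof -
 let ?o = "zvec n :: complex vec"
 have o: "?o \<in> carr n" by simp
 have ty: "?o + t \<cdot>\<^sub>v y \<in> carr n" for t using c by simp
 have eq: "grad n f (x + t \<cdot>\<^sub>v y) \<bullet> y = grad n f (?o + t \<cdot>\<^sub>v y) \<bullet> y" for t
 proof -
  have "x + t \<cdot>\<^sub>v y = (?o + t \<cdot>\<^sub>v y) + 1 \<cdot>\<^sub>v x" using c by (intro eq_vecI) auto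
  then show ?thesis using gradient_constant_along[OF f ty c(2) c(1) z, of t 1] by simp
 qed
 have "((\<lambda>t. ev f (x + t \<cdot>\<^sub>v y) - ev f (?o + t \<cdot>\<^sub>v y)) has_field_derivative 0) (at s)" for s
  using DERIV_diff[OF directional_derivative[OF f c, of s] directional_derivative[OF f o c(2), of s]] unfolding eq by simp
 from constant_of_derivative_0[OF this, of 1]
 have "ev f (x + 1 \<cdot>\<^sub>v y) - ev f (?o + 1 \<cdot>\<^sub>v y) = ev f x" using c f0 line_0[OF o c(2)] by simp
 then show ?thesis unfolding line_add_1[OF c] line_add_1[OF o c(2)] using c by (simp add: diff_eq_eq)
qed

text \<open>The polynomial is affine along \<open>w\<close>, so homogeneity gives \<open>f(w + t x) = t\<^sup>k f(x) + t\<^sup>k\<^sup>-\<^sup>1 \<nabla>f(x) \<bullet> w\<close>. For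
 \<open>k \<ge> 3\<close> both terms have vanishing derivative at \<open>t = 0\<close>.\<close>

lemma singular_if_hess_isotropic:
 assumes f: "homogeneous n k f" and k: "k \<ge> 3" and w: "w \<in> carr n"
  and z: "\<And>v. v \<in> carr n \<Longrightarrow> hess n f v w w = 0" and x: "x \<in> carr n"
 shows "grad n f w \<bullet> x = 0"
proof -
 have fp: "f \<in> polys n" by (rule homogeneous_polys[OF f])
 have aff: "ev f (v + t \<cdot>\<^sub>v w) = ev f v + t * (grad n f v \<bullet> w)" if v: "v \<in> carr n" for v t
 proof -
  have gc: "grad n f (v + s \<cdot>\<^sub>v w) \<bullet> w = grad n f v \<bullet> w" for s
   by (rule gradient_constant_along[OF fp v w w z])
  have "((\<lambda>t. ev f (v + t \<cdot>\<^sub>v w) - t * (grad n f v \<bullet> w)) has_field_derivative 0) (at s)" for s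
  proof -
   have "((\<lambda>t. t * (grad n f v \<bullet> w)) has_field_derivative grad n f v \<bullet> w) (at s)"
    by (auto intro!: derivative_eq_intros)
   from DERIV_diff[OF directional_derivative[OF fp v w, of s] this] show ?thesis
    unfolding gc by simp
  qed
  from constant_of_derivative_0[OF this, of t] show ?thesis using v w by (simp add: algebra_simps)
 qed
 have hg: "grad n f (t \<cdot>\<^sub>v x) \<bullet> w = t ^ (k - 1) * (grad n f x \<bullet> w)" for t
  unfolding grad_dot[OF w] homogeneous_eval[OF homogeneous_poly_partial[OF f] x] sum_distrib_left
  by (rule sum.cong[OF refl]) (simp only: mult.left_commute)
 have eq: "ev f (w + t \<cdot>\<^sub>v x) = t ^ k * ev f x + t ^ (k - 1) * (grad n f x \<bullet> w)" for t
 proof -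
  have "w + t \<cdot>\<^sub>v x = t \<cdot>\<^sub>v x + 1 \<cdot>\<^sub>v w" using x w by (intro eq_vecI) auto
  then show ?thesis using aff[of "t \<cdot>\<^sub>v x" 1] x homogeneous_eval[OF f x, of t] hg[of t] by simp
 qed
 have k1: "k - 1 - 1 \<noteq> 0" "k - 1 \<noteq> 0" using k by auto
 show ?thesis
 proof (rule gradient_eqI[OF fp w x])
  show "((\<lambda>t. ev f (w + t \<cdot>\<^sub>v x)) has_field_derivative 0) (at 0)"
   unfolding eq by (rule derivative_eq_intros refl)+ (use k1 in \<open>simp add: power_0_left\<close>)
 qed
qed

section \<open>Matrices that are self-adjoint for the Hessian\<close>

definition self_adjoint :: "nat \<Rightarrow> cpoly \<Rightarrow> complex mat \<Rightarrow> bool" where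
 "self_adjoint n f U \<longleftrightarrow> (\<forall>v\<in>carr n. \<forall>x\<in>carr n. \<forall>y\<in>carr n. hess n f v (U *\<^sub>v x) y = hess n f v x (U *\<^sub>v y))"

text \<open>The shape of a Jordan matrix, without its block structure: entries above the diagonal occur only between equal
 diagonal entries.\<close>

lemma jordan_matrix_bidiagonal:
 assumes "i < sum_list (map fst n_as)" "j < sum_list (map fst n_as)" "jordan_matrix n_as $$ (i, j) \<noteq> (0 :: complex)"
 shows "i = j \<or> (j = Suc i \<and> jordan_matrix n_as $$ (i, i) = jordan_matrix n_as $$ (j, j))"
 using assms
proof (induction n_as arbitrary: i j)
 case (Cons p n_as)
 obtain m a where p: "p = (m, a)" by (cases p)
 let ?J = "jordan_matrix n_as" and ?s = "sum_list (map fst n_as)"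
 have J: "jordan_matrix (p # n_as) = four_block_mat (jordan_block m a) (0\<^sub>m m ?s) (0\<^sub>m ?s m) ?J"
  unfolding jordan_matrix_def p by (simp add: Let_def jordan_matrix_def[symmetric])
 have ent: "jordan_matrix (p # n_as) $$ (r, t) = (if r < m then (if t < m then jordan_block m a $$ (r, t) else 0)
   else (if t < m then 0 else ?J $$ (r - m, t - m)))" if "r < m + ?s" "t < m + ?s" for r t
  using that unfolding J by (subst index_mat_four_block) auto
 have i: "i < m + ?s" and j: "j < m + ?s" using Cons.prems(1,2) by (simp_all add: p)
 show ?case
 proof (cases "i < m")
  case True
  then have jm: "j < m" using Cons.prems(3) unfolding ent[OF i j] by (auto split: if_splits)
  then show ?thesis using Cons.prems(3) True unfolding ent[OF i j] ent[OF i i] ent[OF j j] by (auto split: if_splits)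
 next
  case False
  then have jm: "\<not> j < m" and nz: "?J $$ (i - m, j - m) \<noteq> 0" using Cons.prems(3) unfolding ent[OF i j] by (auto split: if_splits)
  have "i - m = j - m \<or> (j - m = Suc (i - m) \<and> ?J $$ (i - m, i - m) = ?J $$ (j - m, j - m))"
   by (rule Cons.IH[OF _ _ nz]) (use i j False jm in auto)
  then show ?thesis using False jm unfolding ent[OF i i] ent[OF j j] by auto
 qed
qed simp

text \<open>The Jordan basis, together with the fact that every eigenvalue occurs on the diagonal.\<close>

lemma jordan_coordinates:
 assumes U: "U \<in> carrier_mat (Suc n) (Suc n)"
 obtains P Q J where "coordinates n P Q" "J \<in> carrier_mat (Suc n) (Suc n)" "U = P * J * Q"
  "\<And>i j. i \<le> n \<Longrightarrow> j \<le> n \<Longrightarrow> J $$ (i, j) \<noteq> 0 \<Longrightarrow> i = j \<or> (j = Suc i \<and> J $$ (i, i) = J $$ (j, j))"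
  "\<And>x c. x \<in> carr n \<Longrightarrow> x \<noteq> zvec n \<Longrightarrow> U *\<^sub>v x = c \<cdot>\<^sub>v x \<Longrightarrow> \<exists>a\<le>n. J $$ (a, a) = c"
proof -
 obtain as where "char_poly U = (\<Prod>a\<leftarrow>as. [:- a, 1:])" using char_poly_factorized[OF U] by blast
 from jordan_nf_exists[OF U this] obtain n_as where "similar_mat U (jordan_matrix n_as)" unfolding jordan_nf_def by blast
 define J where "J = jordan_matrix n_as"
 have sim: "similar_mat U J" unfolding J_def by fact
 from similar_matD[OF sim] obtain N P Q where carr: "{U, J, P, Q} \<subseteq> carrier_mat N N"
  and PQ: "P * Q = 1\<^sub>m N" "Q * P = 1\<^sub>m N" and UJ: "U = P * J * Q" by blast
 have N: "N = Suc n" using carr U by auto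
 have co: "coordinates n P Q" using carr PQ unfolding N by unfold_locales auto
 have J: "J \<in> carrier_mat (Suc n) (Suc n)" using carr unfolding N by simp
 have s: "sum_list (map fst n_as) = Suc n" using J unfolding J_def carrier_mat_def by simp
 show ?thesis
 proof (rule that[OF co J UJ])
  show bi: "i = j \<or> (j = Suc i \<and> J $$ (i, i) = J $$ (j, j))" if "i \<le> n" "j \<le> n" "J $$ (i, j) \<noteq> 0" for i j
   using jordan_matrix_bidiagonal[of i n_as j] that unfolding s J_def by simp
  fix x c assume x: "x \<in> carr n" "x \<noteq> zvec n" "U *\<^sub>v x = c \<cdot>\<^sub>v x"
  have "eigenvalue U c" unfolding eigenvalue_def eigenvector_def using x U by auto
  then have "poly (char_poly J) c = 0"
   unfolding eigenvalue_root_char_poly[OF U] char_poly_similar[OF sim] .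
  moreover have "upper_triangular J" 
  proof (rule upper_triangularI, rule ccontr)
   fix i j assume ij: "j < i" "i < dim_row J" "J $$ (i, j) \<noteq> 0"
   then have "i \<le> n" "j \<le> n" using J by auto
   from bi[OF this ij(3)] ij(1) show False by simp
  qed
  ultimately have "poly (\<Prod>a\<leftarrow>diag_mat J. [:- a, 1:]) c = 0" using char_poly_upper_triangular[OF J] by simp
  then have "c \<in> set (diag_mat J)" by (induction "diag_mat J" rule: list.induct) (auto simp: poly_prod_list prod_list_zero_iff)
  then obtain a where a: "a < dim_row J" "c = J $$ (a, a)" unfolding diag_mat_def by auto
  then show "\<exists>a\<le>n. J $$ (a, a) = c" using J by (intro exI[of _ a]) auto
 qed
qed

context coordinates begin

abbreviation basis :: "nat \<Rightarrow> complex vec" where "basis a \<equiv> P *\<^sub>v unit_vec (Suc n) a"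

lemma basis_carr [simp]: "basis a \<in> carr n" by (rule mult_mat_vec_carrier[OF P]) simp

text \<open>Linear functionals are determined by the basis vectors.\<close>

lemma linear_expansion:
 assumes z: "z \<in> carr n"
 shows "(\<Sum>i\<le>n. (P *\<^sub>v z) $ i * c i) = (\<Sum>a\<le>n. z $ a * (\<Sum>i\<le>n. basis a $ i * c i))"
proof -
 have ent: "(P *\<^sub>v u) $ i = (\<Sum>a\<le>n. P $$ (i, a) * u $ a)" if u: "u \<in> carr n" and i: "i \<le> n" for u i
 proof -
  have "(P *\<^sub>v u) $ i = row P i \<bullet> u" using P i by simp
  also have "\<dots> = (\<Sum>a\<le>n. row P i $ a * u $ a)" by (rule dot_sum[OF u])
  also have "\<dots> = (\<Sum>a\<le>n. P $$ (i, a) * u $ a)" by (rule sum.cong[OF refl]) (use i carrier_matD[OF P] in simp)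
  finally show ?thesis .
 qed
 have b: "basis a $ i = P $$ (i, a)" if "a \<le> n" "i \<le> n" for a i
 proof -
  have "basis a $ i = (\<Sum>t\<le>n. P $$ (i, t) * unit_vec (Suc n) a $ t)" by (rule ent) (use that in auto)
  also have "\<dots> = (\<Sum>t\<le>n. (if t = a then P $$ (i, t) else 0))" by (rule sum.cong[OF refl]) (use that in \<open>auto simp: unit_vec_def\<close>)
  finally show ?thesis using that by simp
 qed
 have "(\<Sum>i\<le>n. (P *\<^sub>v z) $ i * c i) = (\<Sum>i\<le>n. \<Sum>a\<le>n. z $ a * (basis a $ i * c i))"
  by (rule sum.cong[OF refl]) (simp add: ent[OF z] b sum_distrib_left sum_distrib_right ac_simps)
 also have "\<dots> = (\<Sum>a\<le>n. \<Sum>i\<le>n. z $ a * (basis a $ i * c i))" by (rule sum.swap)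
 finally show ?thesis by (simp only: sum_distrib_left)
qed

lemma hess_expansion:
 assumes "z \<in> carr n" shows "hess n f v (P *\<^sub>v z) y = (\<Sum>a\<le>n. z $ a * hess n f v (basis a) y)"
 unfolding hess_def by (rule linear_expansion[OF assms])

lemma jordan_step:
 assumes J: "J \<in> carrier_mat (Suc n) (Suc n)" and U: "U = P * J * Q"
  and bi: "\<And>i j. i \<le> n \<Longrightarrow> j \<le> n \<Longrightarrow> J $$ (i, j) \<noteq> 0 \<Longrightarrow> i = j \<or> (j = Suc i \<and> J $$ (i, i) = J $$ (j, j))"
  and a: "a \<le> n"
 shows "hess n f v (U *\<^sub>v basis a) y = J $$ (a, a) * hess n f v (basis a) y +
  (if a = 0 then 0 else J $$ (a - 1, a) * hess n f v (basis (a - 1)) y)"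
proof -
 have e: "unit_vec (Suc n) a \<in> carr n" by simp
 have c: "col J a \<in> carr n" using J by (intro carrier_vecI) simp
 have Je: "J *\<^sub>v unit_vec (Suc n) a = col J a" using J a by (intro eq_vecI) auto
 have "U *\<^sub>v basis a = P *\<^sub>v (J *\<^sub>v (Q *\<^sub>v basis a))"
  unfolding U using assoc_mult_mat_vec[OF mult_carrier_mat[OF P J] Q basis_carr] assoc_mult_mat_vec[OF P J mult_mat_vec_carrier[OF Q basis_carr]] by simp
 also have "\<dots> = P *\<^sub>v col J a" unfolding QP_vec[OF e] Je ..
 finally have "hess n f v (U *\<^sub>v basis a) y = (\<Sum>t\<le>n. col J a $ t * hess n f v (basis t) y)"
  using hess_expansion[OF c] by simp
 also have "\<dots> = J $$ (a, a) * hess n f v (basis a) y + (if a = 0 then 0 else J $$ (a - 1, a) * hess n f v (basis (a - 1)) y)"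
 proof -
  have co: "col J a $ t = J $$ (t, a)" if "t \<le> n" for t using J that a by simp
  have zero: "J $$ (t, a) = 0" if "t \<le> n" "t \<noteq> a" "a \<noteq> Suc t" for t using bi[OF that(1) a] that(2,3) by blast
  show ?thesis
  proof (cases a)
   case 0
   have "(\<Sum>t\<le>n. col J a $ t * hess n f v (basis t) y) = (\<Sum>t\<le>n. if t = a then J $$ (a, a) * hess n f v (basis a) y else 0)"
    by (rule sum.cong[OF refl]) (use 0 zero co in auto)
   then show ?thesis using 0 by simp
  next
   case (Suc c)
   have "(\<Sum>t\<le>n. col J a $ t * hess n f v (basis t) y) =
     (\<Sum>t\<le>n. (if t = a then J $$ (a, a) * hess n f v (basis a) y else 0) + (if t = c then J $$ (c, a) * hess n f v (basis c) y else 0))"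
   proof (rule sum.cong[OF refl])
    fix t assume "t \<in> {..n}"
    then have t: "t \<le> n" by simp
    have ac: "a \<noteq> c" using Suc by simp
    show "col J a $ t * hess n f v (basis t) y =
     (if t = a then J $$ (a, a) * hess n f v (basis a) y else 0) + (if t = c then J $$ (c, a) * hess n f v (basis c) y else 0)"
    proof (cases "t = a \<or> t = c")
     case True
     then show ?thesis unfolding co[OF t] using ac by auto
    next
     case False
     then have "J $$ (t, a) = 0" using Suc by (intro zero[OF t]) auto
     then show ?thesis unfolding co[OF t] using False by simp
    qed
   qed
   also have "\<dots> = J $$ (a, a) * hess n f v (basis a) y + J $$ (c, a) * hess n f v (basis c) y"
    using a Suc by (simp add: sum.distrib)
   finally show ?thesis using Suc by simp
  qed
 qed
 finally show ?thesis .
qed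

text \<open>Write \<open>H\<^sub>a\<^sub>b\<close> for the Hessian form on the Jordan basis and \<open>\<epsilon>\<close> for the entries above the diagonal.
 Self-adjointness reads \<open>(\<lambda>\<^sub>a - \<lambda>\<^sub>b) H\<^sub>a\<^sub>b = \<epsilon>\<^sub>b H\<^sub>a\<^sub>,\<^sub>b\<^sub>-\<^sub>1 - \<epsilon>\<^sub>a H\<^sub>a\<^sub>-\<^sub>1\<^sub>,\<^sub>b\<close>. The right side
 vanishes by induction on \<open>a + b\<close>, because moving to a predecessor with non-zero \<open>\<epsilon>\<close> keeps the eigenvalue.\<close>

lemma hess_jordan_orthogonal:
 assumes J: "J \<in> carrier_mat (Suc n) (Suc n)" and U: "U = P * J * Q"
  and bi: "\<And>i j. i \<le> n \<Longrightarrow> j \<le> n \<Longrightarrow> J $$ (i, j) \<noteq> 0 \<Longrightarrow> i = j \<or> (j = Suc i \<and> J $$ (i, i) = J $$ (j, j))"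
  and sa: "self_adjoint n f U" and v: "v \<in> carr n"
 shows "a \<le> n \<Longrightarrow> b \<le> n \<Longrightarrow> J $$ (a, a) \<noteq> J $$ (b, b) \<Longrightarrow> hess n f v (basis a) (basis b) = 0"
proof (induction "a + b" arbitrary: a b rule: less_induct)
 case less
 note a = less.prems(1) and b = less.prems(2)
 let ?H = "\<lambda>a b. hess n f v (basis a) (basis b)"
 have "hess n f v (U *\<^sub>v basis a) (basis b) = hess n f v (basis a) (U *\<^sub>v basis b)"
  using sa v unfolding self_adjoint_def by simp
 also have "\<dots> = hess n f v (U *\<^sub>v basis b) (basis a)" by (rule hess_commute)
 finally have sym: "hess n f v (U *\<^sub>v basis a) (basis b) = hess n f v (U *\<^sub>v basis b) (basis a)" .
 have step: "hess n f v (U *\<^sub>v basis c) y = J $$ (c, c) * hess n f v (basis c) y +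
  (if c = 0 then 0 else J $$ (c - 1, c) * hess n f v (basis (c - 1)) y)" if "c \<le> n" for c y
  by (rule jordan_step[OF J U bi that])
 from sym have eq: "J $$ (a, a) * ?H a b + (if a = 0 then 0 else J $$ (a - 1, a) * ?H (a - 1) b) =
   J $$ (b, b) * ?H b a + (if b = 0 then 0 else J $$ (b - 1, b) * ?H (b - 1) a)"
  unfolding step[OF a] step[OF b] .
 have za: "(if a = 0 then 0 else J $$ (a - 1, a) * ?H (a - 1) b) = 0"
 proof (cases "a = 0 \<or> J $$ (a - 1, a) = 0")
  case False
  have "a - 1 \<le> n" "a - 1 \<noteq> a" using a False by auto
  then have "J $$ (a - 1, a - 1) = J $$ (a, a)" using bi[of "a - 1" a] a False by blast
  then have "?H (a - 1) b = 0" using False less.prems by (intro less.hyps) auto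
  then show ?thesis by simp
 qed auto
 have zb: "(if b = 0 then 0 else J $$ (b - 1, b) * ?H (b - 1) a) = 0"
 proof (cases "b = 0 \<or> J $$ (b - 1, b) = 0")
  case False
  have "b - 1 \<le> n" "b - 1 \<noteq> b" using b False by auto
  then have "J $$ (b - 1, b - 1) = J $$ (b, b)" using bi[of "b - 1" b] b False by blast
  then have "?H a (b - 1) = 0" using False less.prems by (intro less.hyps) auto
  then show ?thesis by (simp add: hess_commute[of n f v "basis (b - Suc 0)" "basis a"])
 qed auto
 have "J $$ (a, a) * ?H a b = J $$ (b, b) * ?H b a" using eq unfolding za zb add_0_right .
 then have "(J $$ (a, a) - J $$ (b, b)) * ?H a b = 0"
  unfolding hess_commute[of n f v "basis b" "basis a"] left_diff_distrib by (simp only: diff_self)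
 then show ?case using less.prems(3) by simp
qed

lemma hess_orthogonal_splits:
 assumes f: "f \<in> polys n" and f0: "ev f (zvec n) = 0"
  and z: "\<And>v a b. v \<in> carr n \<Longrightarrow> a \<le> n \<Longrightarrow> b \<le> n \<Longrightarrow> a \<in> S \<Longrightarrow> b \<notin> S \<Longrightarrow> hess n f v (basis a) (basis b) = 0"
 shows "splits f S"
 unfolding splits_def
proof
 fix v :: "complex vec" assume v: "v \<in> carr n"
 let ?z = "\<lambda>R. vec (Suc n) (\<lambda>i. indicator R i * (Q *\<^sub>v v) $ i)"
 have h: "hess n f u (part (- S) *\<^sub>v v) (part S *\<^sub>v v) = 0" if u: "u \<in> carr n" for u
 proof -
  have "hess n f u (basis b) (part S *\<^sub>v v) = 0" if b: "b \<le> n" "b \<notin> S" for b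
  proof -
   have "hess n f u (part S *\<^sub>v v) (basis b) = (\<Sum>a\<le>n. ?z S $ a * hess n f u (basis a) (basis b))"
    unfolding scaling_vec[OF v] by (rule hess_expansion) simp
   also have "\<dots> = 0" by (rule sum.neutral) (use z[OF u _ b(1) _ b(2)] in \<open>auto simp: indicator_def\<close>)
   finally show ?thesis by (simp only: hess_commute[of n f u "basis b"])
  qed
  moreover have "hess n f u (part (- S) *\<^sub>v v) (part S *\<^sub>v v) = (\<Sum>b\<le>n. ?z (- S) $ b * hess n f u (basis b) (part S *\<^sub>v v))"
   unfolding scaling_vec[OF v, of "indicator (- S)"] by (rule hess_expansion) simp
  ultimately show ?thesis by (auto simp: indicator_def intro!: sum.neutral)
 qed
 show "ev f v = ev f (part S *\<^sub>v v) + ev f (part (- S) *\<^sub>v v)"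
  using additive_if_hess_orthogonal[OF f f0 scaling_vec_carr[OF v] scaling_vec_carr[OF v] h] part_add[OF v, of S] by simp
qed

end

section \<open>From a second divisor to a splitting\<close>

text \<open>The index set of the splitting consists of the basis vectors that belong to one eigenvalue.\<close>

lemma split_of_distinct_eigenvalues:
 assumes f: "smooth_form n k f" and co: "coordinates n P Q"
  and J: "J \<in> carrier_mat (Suc n) (Suc n)" and U: "U = P * J * Q"
  and bi: "\<And>i j. i \<le> n \<Longrightarrow> j \<le> n \<Longrightarrow> J $$ (i, j) \<noteq> 0 \<Longrightarrow> i = j \<or> (j = Suc i \<and> J $$ (i, i) = J $$ (j, j))"
  and sa: "self_adjoint n f U" and ab: "a \<le> n" "b \<le> n" "J $$ (a, a) \<noteq> J $$ (b, b)"
 shows "sebastiani_thom n f"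
proof -
 interpret F: smooth_form n k f by (rule f)
 interpret coordinates n P Q by (rule co)
 let ?S = "{i. J $$ (i, i) = J $$ (a, a)}"
 have z: "zvec n \<in> carr n" by simp
 have "0 \<cdot>\<^sub>v zvec n = (zvec n :: complex vec)" by (intro eq_vecI) auto
 then have f0: "ev f (zvec n) = 0" using homogeneous_eval[OF F.hom z, of 0] F.k by (simp add: power_0_left)
 have "splits f ?S"
 proof (rule hess_orthogonal_splits[OF F.fp f0])
  fix v i j assume v: "v \<in> carr n" and ij: "i \<le> n" "j \<le> n" "i \<in> ?S" "j \<notin> ?S"
  show "hess n f v (basis i) (basis j) = 0"
   by (rule hess_jordan_orthogonal[OF J U bi sa v ij(1,2)]) (use ij in auto)
 qed
 then show ?thesis by (rule splits_imp_sebastiani_thom[OF F.fp _ ab(1) _ ab(2)]) (use ab in auto)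
qed

text \<open>The matrix \<open>x \<mapsto> (y \<bullet> x) w\<close> is self-adjoint for the Hessian forms by assumption, and it has the distinct
 eigenvalues \<open>y \<bullet> w\<close> and \<open>0\<close>.\<close>

lemma sebastiani_thom_if_rank_one:
 assumes f: "smooth_form n k f" and w: "w \<in> carr n" and y: "y \<in> carr n" and yw: "y \<bullet> w \<noteq> 0"
  and h: "\<And>v z. v \<in> carr n \<Longrightarrow> z \<in> carr n \<Longrightarrow> hess n f v w z = \<kappa> * (y \<bullet> z)"
 shows "sebastiani_thom n f"
proof -
 interpret F: smooth_form n k f by (rule f)
 define U where "U = mat (Suc n) (Suc n) (\<lambda>(i, j). w $ i * y $ j)"
 have U: "U \<in> carrier_mat (Suc n) (Suc n)" by (simp add: U_def)
 have Ux: "U *\<^sub>v x = (y \<bullet> x) \<cdot>\<^sub>v w" if x: "x \<in> carr n" for x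
 proof (rule eq_vecI)
  fix i assume "i < dim_vec ((y \<bullet> x) \<cdot>\<^sub>v w)"
  then have i: "i \<le> n" using w by simp
  have "(U *\<^sub>v x) $ i = row U i \<bullet> x" using i by (simp add: U_def)
  also have "\<dots> = (\<Sum>j\<le>n. row U i $ j * x $ j)" by (rule dot_sum[OF x])
  also have "\<dots> = (\<Sum>j\<le>n. y $ j * x $ j * w $ i)" by (rule sum.cong[OF refl]) (use i in \<open>simp add: U_def\<close>)
  also have "\<dots> = (y \<bullet> x) * w $ i" unfolding dot_sum[OF x] sum_distrib_right ..
  finally show "(U *\<^sub>v x) $ i = ((y \<bullet> x) \<cdot>\<^sub>v w) $ i" using i w by simp
 qed (use w in \<open>simp add: U_def\<close>)
 have "self_adjoint n f U" unfolding self_adjoint_def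
 proof (intro ballI)
  fix v x z :: "complex vec" assume c: "v \<in> carr n" "x \<in> carr n" "z \<in> carr n"
  have "hess n f v (U *\<^sub>v x) z = (y \<bullet> x) * (\<kappa> * (y \<bullet> z))"
   unfolding Ux[OF c(2)] hess_smult_left[OF w] h[OF c(1,3)] ..
  moreover have "hess n f v x (U *\<^sub>v z) = (y \<bullet> z) * (\<kappa> * (y \<bullet> x))"
   unfolding Ux[OF c(3)] hess_smult_right[OF w] hess_commute[of n f v x w] h[OF c(1,2)] ..
  ultimately show "hess n f v (U *\<^sub>v x) z = hess n f v x (U *\<^sub>v z)" by simp
 qed
 note sa = this
 have w0: "w \<noteq> zvec n" using yw y by auto
 obtain x where x: "x \<in> carr n" "x \<noteq> zvec n" "y \<bullet> x = 0"
 proof (cases "y $ 0 = 0")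
  case True
  have "y \<bullet> unit_vec (Suc n) 0 = 0" using y True by simp
  then show ?thesis using that[of "unit_vec (Suc n) 0"] by simp
 next
  case False
  define x where "x = vec (Suc n) (\<lambda>i. if i = 0 then y $ 1 else if i = 1 then - y $ 0 else 0)"
  have x: "x \<in> carr n" by (simp add: x_def)
  have "x $ 1 = - y $ 0" using F.n by (simp add: x_def)
  then have "x \<noteq> zvec n" using False F.n by auto
  moreover have "y \<bullet> x = (\<Sum>i\<le>n. (if i = 0 then y $ 0 * y $ 1 else 0) - (if i = 1 then y $ 1 * y $ 0 else 0))"
   unfolding dot_sum[OF x] by (rule sum.cong[OF refl]) (auto simp: x_def)
  moreover have "\<dots> = 0" using F.n by (simp add: sum_subtractf)
  ultimately show ?thesis using that[of x] x by simp
 qed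
 obtain P Q J where co: "coordinates n P Q" "J \<in> carrier_mat (Suc n) (Suc n)" "U = P * J * Q"
  and bi: "\<And>i j. i \<le> n \<Longrightarrow> j \<le> n \<Longrightarrow> J $$ (i, j) \<noteq> 0 \<Longrightarrow> i = j \<or> (j = Suc i \<and> J $$ (i, i) = J $$ (j, j))"
  and ev: "\<And>x c. x \<in> carr n \<Longrightarrow> x \<noteq> zvec n \<Longrightarrow> U *\<^sub>v x = c \<cdot>\<^sub>v x \<Longrightarrow> \<exists>a\<le>n. J $$ (a, a) = c"
  by (rule jordan_coordinates[OF U]) blast
 obtain a where a: "a \<le> n" "J $$ (a, a) = y \<bullet> w" using ev[OF w w0 Ux[OF w]] by blast
 have "U *\<^sub>v x = 0 \<cdot>\<^sub>v x" unfolding Ux[OF x(1)] x(3) using w x(1) by (intro eq_vecI) auto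
 then obtain b where b: "b \<le> n" "J $$ (b, b) = 0" using ev[OF x(1,2)] by blast
 have "J $$ (a, a) \<noteq> J $$ (b, b)" using a(2) b(2) yw by simp
 from split_of_distinct_eigenvalues[OF f co bi sa a(1) b(1) this] show ?thesis .
qed

text \<open>In degree one the Hessian vanishes. In degree two it is a constant bilinear form \<open>H\<close>, and one takes a vector
 \<open>w\<close> with \<open>H(w, w) = 2 f(w) \<noteq> 0\<close> and \<open>y = \<nabla>f(w)\<close>.\<close>

lemma sebastiani_thom_low_degree:
 assumes f: "smooth_form n k f" and k: "k \<le> 2" shows "sebastiani_thom n f"
proof -
 interpret F: smooth_form n k f by (rule f)
 have e0: "unit_vec (Suc n) 0 \<in> carr n" by simp
 show ?thesis
 proof (cases "k = 1")
  case True
  have "poly_partial i (poly_partial j f) = 0" for i j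
  proof -
   have "homogeneous n 0 (poly_partial j f)" using homogeneous_poly_partial[OF F.hom, of j] True by simp
   then obtain c where "poly_partial j f = Const c" by (rule homogeneous_0_const)
   then show ?thesis by (auto simp: poly_partial_def)
  qed
  then have "hess n f v x y = 0" for v x y unfolding hess_def by simp
  then show ?thesis by (intro sebastiani_thom_if_rank_one[OF f e0 e0, where \<kappa> = 0]) auto
 next
  case False
  then have k2: "k = 2" using k F.k by simp
  have const: "ev (poly_partial i (poly_partial j f)) v = ev (poly_partial i (poly_partial j f)) u" for i j u v
  proof -
   have "homogeneous n 0 (poly_partial i (poly_partial j f))"
    using homogeneous_poly_partial[OF homogeneous_poly_partial[OF F.hom], of i j] k2 by simp
   then obtain c where "poly_partial i (poly_partial j f) = Const c" by (rule homogeneous_0_const)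
   then show ?thesis by simp
  qed
  obtain w where w: "w \<in> carr n" "ev f w \<noteq> 0" by (rule nonsingular_nonzero[OF F.ns F.fp])
  have "hess n f v w z = 1 * (grad n f w \<bullet> z)" if z: "z \<in> carr n" for v z
  proof -
   have "hess n f v w z = (\<Sum>i\<le>n. z $ i * (\<Sum>j\<le>n. w $ j * ev (poly_partial j (poly_partial i f)) w))"
    unfolding hess_commute[of n f v w z] unfolding hess_def
    by (simp only: const[of _ _ v w] poly_partial_commute)
   also have "\<dots> = (\<Sum>i\<le>n. z $ i * ev (poly_partial i f) w)"
   proof (rule sum.cong[OF refl])
    fix i
    have "grad n (poly_partial i f) w \<bullet> w = of_nat (k - 1) * ev (poly_partial i f) w"
     by (rule euler_identity[OF homogeneous_poly_partial[OF F.hom] w(1)])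
    then show "z $ i * (\<Sum>j\<le>n. w $ j * ev (poly_partial j (poly_partial i f)) w) = z $ i * ev (poly_partial i f) w"
     unfolding grad_dot[OF w(1)] by (simp add: k2)
   qed
   also have "\<dots> = 1 * (grad n f w \<bullet> z)" unfolding grad_dot[OF z] by simp
   finally show ?thesis .
  qed
  moreover have "grad n f w \<bullet> w \<noteq> 0" unfolding euler_identity[OF F.hom w(1)] using w(2) k2 by simp
  ultimately show ?thesis by (intro sebastiani_thom_if_rank_one[OF f w(1) grad_carr, where \<kappa> = 1])
 qed
qed

lemma proj_zeros_cong:
 assumes "\<And>v. v \<in> carr n \<Longrightarrow> ev f v = 0 \<longleftrightarrow> ev g v = 0"
 shows "proj_zeros n f = proj_zeros n g"
proof -
 have "v \<in> carr n" if "p \<in> proj_space n" "v \<in> p" for p v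
  using that unfolding proj_space_def proj_point_def by auto
 then show ?thesis unfolding proj_zeros_def using assms by blast
qed

text \<open>The relation between the gradients makes \<open>U\<close> self-adjoint for the Hessian forms of \<open>f\<close>, because its composite
 with the Hessian of \<open>f\<close> is a multiple of the Hessian of \<open>f'\<close>. Without a splitting all eigenvalues agree, and smoothness
 excludes entries above the diagonal of the Jordan form. So \<open>U\<close> is scalar and the gradients are proportional.\<close>

lemma zeros_determined_by_sheaf:
 assumes n: "n \<ge> 2" and f: "smooth_form n k f" and f': "smooth_form n k' f'"
  and iso: "log_sheaf_iso n (proj_zeros n f') (proj_zeros n f)" and nst: "\<not> sebastiani_thom n f"
 shows "proj_zeros n f' = proj_zeros n f"
proof -
 interpret F: smooth_form n k f by (rule f)
 interpret F': smooth_form n k' f' by (rule f')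
 have k: "k \<ge> 3" using sebastiani_thom_low_degree[OF f] nst by (cases "k \<le> 2") auto
 obtain \<Phi> where "field_iso n f' f \<Phi>" by (rule field_isoI_of_sheaf_iso[OF f' f iso])
 then have ip: "iso_pair n k' f' k f \<Phi>" using n by unfold_locales
 have "k \<ge> 2" using k by simp
 then obtain A c where c: "c \<noteq> 0"
  and A: "\<And>v l. l \<le> n \<Longrightarrow> (\<Sum>m\<le>n. A l m * ev (poly_partial m f) v) = c * ev (poly_partial l f') v"
  by (rule iso_pair.gradients_linearly_related[OF ip]) blast
 define U where "U = mat (Suc n) (Suc n) (\<lambda>(m, l). A l m)"
 have U: "U \<in> carrier_mat (Suc n) (Suc n)" by (simp add: U_def)
 have gr: "grad n f v \<bullet> (U *\<^sub>v x) = c * (grad n f' v \<bullet> x)" if x: "x \<in> carr n" for v x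
 proof -
  have Ux: "U *\<^sub>v x \<in> carr n" by (rule mult_mat_vec_carrier[OF U x])
  have e: "(U *\<^sub>v x) $ m = (\<Sum>l\<le>n. A l m * x $ l)" if m: "m \<le> n" for m
  proof -
   have "(U *\<^sub>v x) $ m = row U m \<bullet> x" using m by (simp add: U_def)
   also have "\<dots> = (\<Sum>l\<le>n. row U m $ l * x $ l)" by (rule dot_sum[OF x])
   also have "\<dots> = (\<Sum>l\<le>n. A l m * x $ l)" by (rule sum.cong[OF refl]) (use m in \<open>simp add: U_def\<close>)
   finally show ?thesis .
  qed
  have "grad n f v \<bullet> (U *\<^sub>v x) = (\<Sum>m\<le>n. \<Sum>l\<le>n. A l m * x $ l * ev (poly_partial m f) v)"
   unfolding grad_dot[OF Ux] by (rule sum.cong[OF refl]) (simp add: e sum_distrib_right)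
  also have "\<dots> = (\<Sum>l\<le>n. \<Sum>m\<le>n. A l m * x $ l * ev (poly_partial m f) v)" by (rule sum.swap)
  also have "\<dots> = (\<Sum>l\<le>n. x $ l * (\<Sum>m\<le>n. A l m * ev (poly_partial m f) v))"
   unfolding sum_distrib_left by (rule sum.cong[OF refl], rule sum.cong[OF refl]) simp
  also have "\<dots> = (\<Sum>l\<le>n. c * (x $ l * ev (poly_partial l f') v))"
   by (rule sum.cong[OF refl]) (simp add: A)
  finally show ?thesis unfolding grad_dot[OF x] sum_distrib_left .
 qed
 have hs: "hess n f v (U *\<^sub>v x) y = c * hess n f' v x y" if v: "v \<in> carr n" and x: "x \<in> carr n" and y: "y \<in> carr n" for v x y
 proof -
  note d = gradient_line_derivative[OF F.fp v mult_mat_vec_carrier[OF U x] y, of 0]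
  have "hess n f (v + 0 \<cdot>\<^sub>v y) (U *\<^sub>v x) y = c * hess n f' (v + 0 \<cdot>\<^sub>v y) x y"
   using DERIV_unique[OF d[unfolded gr[OF x]] DERIV_cmult[OF gradient_line_derivative[OF F'.fp v x y, of 0]]] .
  then show ?thesis unfolding line_0[OF v y] .
 qed
 have sa: "self_adjoint n f U" unfolding self_adjoint_def
 proof (intro ballI)
  fix v x y :: "complex vec" assume a: "v \<in> carr n" "x \<in> carr n" "y \<in> carr n"
  show "hess n f v (U *\<^sub>v x) y = hess n f v x (U *\<^sub>v y)"
   unfolding hess_commute[of n f v x "U *\<^sub>v y"] hs[OF a(1,2,3)] hs[OF a(1,3,2)] hess_commute[of n f' v y x] ..
 qed
 obtain P Q J where co: "coordinates n P Q" "J \<in> carrier_mat (Suc n) (Suc n)" "U = P * J * Q"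
  and bi: "\<And>i j. i \<le> n \<Longrightarrow> j \<le> n \<Longrightarrow> J $$ (i, j) \<noteq> 0 \<Longrightarrow> i = j \<or> (j = Suc i \<and> J $$ (i, i) = J $$ (j, j))"
  by (rule jordan_coordinates[OF U]) blast
 interpret coordinates n P Q by (rule co(1))
 define \<nu> where "\<nu> = J $$ (0, 0)"
 have eig: "J $$ (a, a) = \<nu>" if "a \<le> n" for a
  using split_of_distinct_eigenvalues[OF f co bi sa that le0] nst unfolding \<nu>_def by blast
 have step: "hess n f v (U *\<^sub>v basis a) y = J $$ (a, a) * hess n f v (basis a) y +
  (if a = 0 then 0 else J $$ (a - 1, a) * hess n f v (basis (a - 1)) y)" if "a \<le> n" for a v y
  by (rule jordan_step[OF co(2,3) bi that])
 \<comment> \<open>The vector preceding the first non-zero entry would be isotropic for all Hessian forms.\<close>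
 have off: "J $$ (a, Suc a) = 0" if "Suc a \<le> n" for a
  using that
 proof (induction a rule: less_induct)
  case (less a)
  show ?case
  proof (rule ccontr)
   assume e: "J $$ (a, Suc a) \<noteq> 0"
   have an: "a \<le> n" using less.prems by simp
   have "(if a = 0 then 0 else J $$ (a - 1, a) * X) = 0" for X
    using less.IH[of "a - 1"] an by (cases a) auto
   then have st1: "hess n f v (U *\<^sub>v basis a) y = \<nu> * hess n f v (basis a) y" for v y
    unfolding step[OF an] eig[OF an] by simp
   have st2: "hess n f v (U *\<^sub>v basis (Suc a)) y = \<nu> * hess n f v (basis (Suc a)) y + J $$ (a, Suc a) * hess n f v (basis a) y" for v y
    unfolding step[OF less.prems] eig[OF less.prems] by simp
   have iso0: "hess n f v (basis a) (basis a) = 0" if v: "v \<in> carr n" for v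
   proof -
    have "hess n f v (U *\<^sub>v basis (Suc a)) (basis a) = hess n f v (basis (Suc a)) (U *\<^sub>v basis a)"
     using sa v unfolding self_adjoint_def by simp
    also have "\<dots> = \<nu> * hess n f v (basis a) (basis (Suc a))"
     unfolding hess_commute[of n f v "basis (Suc a)" "U *\<^sub>v basis a"] by (rule st1)
    finally have "J $$ (a, Suc a) * hess n f v (basis a) (basis a) = 0"
     unfolding st2 hess_commute[of n f v "basis (Suc a)" "basis a"] by simp
    then show ?thesis using e by simp
   qed
   obtain j where j: "j \<le> n" "ev (poly_partial j f) (basis a) \<noteq> 0"
    by (rule F.gradient_nonzero[OF basis_carr frame_vec_nonzero[OF an]])
   have "grad n f (basis a) \<bullet> unit_vec (Suc n) j = 0"
    by (rule singular_if_hess_isotropic[OF F.hom k basis_carr iso0]) simp_all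
   then show False using j by simp
  qed
 qed
 have "J = mat_diag (Suc n) (\<lambda>i. \<nu> * 1)"
 proof (rule eq_matI)
  fix i j assume "i < dim_row (mat_diag (Suc n) (\<lambda>i. \<nu> * 1))" "j < dim_col (mat_diag (Suc n) (\<lambda>i. \<nu> * 1))"
  then have ij: "i \<le> n" "j \<le> n" by (auto simp: mat_diag_def)
  show "J $$ (i, j) = mat_diag (Suc n) (\<lambda>i. \<nu> * 1) $$ (i, j)"
  proof (cases "i = j")
   case True
   then show ?thesis using ij eig by (simp add: mat_diag_def)
  next
   case False
   then have "J $$ (i, j) = 0" using bi[OF ij] off[of i] ij by (cases "j = Suc i") auto
   then show ?thesis using False ij by (simp add: mat_diag_def)
  qed
 qed (use co(2) in \<open>auto simp: mat_diag_def\<close>)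
 then have "U = scaling (\<lambda>i. \<nu> * 1)"
  unfolding co(3) scaling_def by (simp add: assoc_mult_mat[OF P mat_diag_dim Q])
 then have Ux: "U *\<^sub>v x = \<nu> \<cdot>\<^sub>v x" if "x \<in> carr n" for x
  using scaling_smult[OF that, of \<nu> "\<lambda>i. 1"] scaling_one[of "\<lambda>i. 1"] that by simp
 have proportional: "\<nu> * (of_nat k * ev f v) = c * (of_nat k' * ev f' v)" if v: "v \<in> carr n" for v
 proof -
  have "grad n f v \<bullet> (\<nu> \<cdot>\<^sub>v v) = \<nu> * (grad n f v \<bullet> v)" using v by (intro scalar_prod_smult_right) simp
  then show ?thesis using gr[OF v, of v] unfolding Ux[OF v] euler_identity[OF F.hom v] euler_identity[OF F'.hom v] by simp
 qed
 have kk: "of_nat k \<noteq> (0 :: complex)" "of_nat k' \<noteq> (0 :: complex)" using F.k F'.k by auto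
 obtain u where u: "u \<in> carr n" "ev f' u \<noteq> 0" by (rule nonsingular_nonzero[OF F'.ns F'.fp])
 then have "\<nu> \<noteq> 0" using proportional[OF u(1)] c kk by auto
 then have "ev f' v = 0 \<longleftrightarrow> ev f v = 0" if "v \<in> carr n" for v
  using proportional[OF that] c kk by auto
 then show ?thesis by (rule proj_zeros_cong)
qed

theorem theorem1:
 fixes n :: nat and D :: "ppoint set" and f :: cpoly
 assumes "n \<ge> 2"
  and "smooth_divisor_of n D f"
 shows "torelli n D \<longleftrightarrow> \<not> sebastiani_thom n f"
proof -
 obtain k where k: "k \<ge> 1" "homogeneous n k f" "nonsingular n f" and D: "D = proj_zeros n f"
  using assms(2) unfolding smooth_divisor_of_def by blast
 have f: "smooth_form n k f" using assms(1) k by unfold_locales auto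
 show ?thesis
 proof
  assume "torelli n D"
  then show "\<not> sebastiani_thom n f" using sebastiani_thom_not_torelli[OF f] unfolding D by blast
 next
  assume nst: "\<not> sebastiani_thom n f"
  show "torelli n D" unfolding torelli_def
  proof (intro allI impI, elim conjE)
   fix D' assume "smooth_divisor n D'" and iso: "log_sheaf_iso n D' D"
   then obtain f' k' where k': "k' \<ge> 1" "homogeneous n k' f'" "nonsingular n f'" and D': "D' = proj_zeros n f'"
    unfolding smooth_divisor_def smooth_divisor_of_def by blast
   have "smooth_form n k' f'" using assms(1) k' by unfold_locales auto
   from zeros_determined_by_sheaf[OF assms(1) f this iso[unfolded D D'] nst] show "D' = D" unfolding D D' .
  qed
 qed
qed

end
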